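(* Assume that $m(A)>0$ implies $R1_A(x)>0$ for $m$-a.e. $x$ (for every $A\in\mathcal B(E)$). Let $\mu\in\mathcal M(E)$ and let $N_\mu$ be a $\tau$-neighborhood of $\mu$. Then there exists an $m$-thin set $N$ such that for every $x\notin N$, $$\liminf_{t\to\infty}\frac1t\log P^x(L_t\in N_\mu)\ge-I(\mu).$$ Furthermore, if a capacity is given as described in the context and satisfies the capacity condition there, then $N$ has capacity $0$.
   Context: Setting. $E$ is a topological Lusin space (Hausdorff, continuous bijective image of a Polish space); $\mathcal B(E)$ its Borel $\sigma$-algebra, assumed generated by the continuous real functions. $m$ is a $\sigma$-finite measure on $E$ with $m(E)>0$. $B_b(E)$ ($B_b^+(E)$): bounded (bounded nonnegative) measurable functions; $\mathcal M(E)$: probability measures on $E$. $p_t(x,\cdot)$, $t\ge0$, is a transition probability function (probability measures, jointly measurable in $(t,x)$, $p_0(x,A)=1_A(x)$); $p_tf(x)=\int f\,dp_t(x,\cdot)$. There is a strongly continuous semigroup $(T_t)$ on $L_2(m)$ with $p_tf$ a representative of $T_tf$ for every bounded measurable $f$ with $\int f^2dm<\infty$. Process: there is a Polish space $\tilde E$ with $E\in\mathcal B(\tilde E)$; $\tilde\Omega$ is the Skorokhod space of right-continuous paths with left limits in $\tilde E$; there is a Markov process $(\tilde\Omega,\tilde{\mathcal F}^o_t,\tilde X_t,\tilde P^x)_{x\in\tilde E}$ (coordinate process) with transition function $\tilde p_t(x,A)=p_t(x,A\cap E)$ for $x\in E$ and $\tilde p_t(x,\{x\})=1$ for $x\notin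 E$, $\tilde P^x(\tilde X_0=x)=1$, infinite lifetime; and there is a Borel $\Omega\subset\tilde\Omega$ such that $\tilde X_t(\omega)\in E$ for all $t$ when $\omega\in\Omega$, and $\tilde P^x(\Omega)=1$ for $x\in E$. $P^x$ denotes $\tilde P^x$ for $x\in E$ and $X_t=\tilde X_t$. Definitions. $D=\{u\in B_b^+(E):\int u\,dm<\infty\}$. $D_1$: functions $v=\frac1t\int_0^tp_s\tilde u\,ds$, $\tilde u=p_\eta u$, $u\in D$, $t>0$, $\eta\ge0$, with $\hat Lv=\frac1t(p_t\tilde u-\tilde u)$. $\hat I(\mu)=-\inf\{\int\frac{\hat Lv}{v+\varepsilon}d\mu:v\in D_1,\varepsilon>0\}$; $I(\mu)=\hat I(\mu)$ if $\mu\ll m$, $I(\mu)=+\infty$ otherwise. $L_t(\omega,A)=\frac1t\int_0^t1_A(X_s(\omega))ds$. A $\tau$-neighborhood of $\mu$ is $\{\nu\in\mathcal M(E):|\int f_jd\nu-\int f_jd\mu|<\varepsilon,1\le j\le r\}$, $\varepsilon>0$, $f_j\in B_b(E)$. $Rf(x)=\int_0^\infty e^{-t}p_tf(x)dt$. $N\in\mathcal B(E)$ is $m$-thin if there is $B$ with $m(B)=0$ and $N\subset\{x:R1_B(x)>0\}$. Capacity: a monotone set function on $\mathcal B(E)$ such that countable unions of sets of capacity $0$ have capacity $0$. Capacity condition: if $f=0$ $m$-a.e. and $t>0$, then $p_tf=0$ except on a set of capacity $0$. *)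

theory Defs
  imports "HOL-Probability.Probability"
begin

definition borel_sets_of :: "'a topology \<Rightarrow> 'a set set" where
  "borel_sets_of T = sigma_sets (topspace T) {U. openin T U}"

definition lusin_space :: "'a topology \<Rightarrow> 'p topology \<Rightarrow> ('p \<Rightarrow> 'a) \<Rightarrow> bool" where
  "lusin_space T P g \<longleftrightarrow> Hausdorff_space T \<and> completely_metrizable_space P \<and> separable_space P
     \<and> continuous_map P T g \<and> bij_betw g (topspace P) (topspace T)"

section \<open>Functions and measures on E (E = space M, B(E) = sets M)\<close>

definition bmeas :: "'a measure \<Rightarrow> ('a \<Rightarrow> real) \<Rightarrow> bool" where
  "bmeas M f \<longleftrightarrow> f \<in> borel_measurable M \<and> (\<exists>C. \<forall>x\<in>space M. \<bar>f x\<bar> \<le> C)"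

definition prob_measures :: "'a measure \<Rightarrow> 'a measure set" where
  "prob_measures M = {\<mu>. prob_space \<mu> \<and> sets \<mu> = sets M}"

definition tau_nbhd :: "'a measure \<Rightarrow> 'a measure \<Rightarrow> real \<Rightarrow> ('a \<Rightarrow> real) list \<Rightarrow> 'a measure set" where
  "tau_nbhd M \<mu> \<epsilon> fs = {\<nu> \<in> prob_measures M.
      \<forall>f\<in>set fs. \<bar>(\<integral>x. f x \<partial>\<nu>) - (\<integral>x. f x \<partial>\<mu>)\<bar> < \<epsilon>}"

definition transition_function :: "'a measure \<Rightarrow> (real \<Rightarrow> 'a \<Rightarrow> 'a measure) \<Rightarrow> bool" where
  "transition_function M p \<longleftrightarrow>
     (\<forall>t\<ge>0. \<forall>x\<in>space M. prob_space (p t x) \<and> sets (p t x) = sets M) \<and>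
     (\<forall>A\<in>sets M. (\<lambda>(t,x). measure (p t x) A) \<in> borel_measurable (restrict_space borel {0..} \<Otimes>\<^sub>M M)) \<and>
     (\<forall>x\<in>space M. \<forall>A\<in>sets M. measure (p 0 x) A = indicator A x) \<and>
     (\<forall>s\<ge>0. \<forall>t\<ge>0. \<forall>x\<in>space M. \<forall>A\<in>sets M.
        measure (p (s + t) x) A = (\<integral>y. measure (p t y) A \<partial>(p s x)))"

definition pf :: "(real \<Rightarrow> 'a \<Rightarrow> 'a measure) \<Rightarrow> real \<Rightarrow> ('a \<Rightarrow> real) \<Rightarrow> 'a \<Rightarrow> real" where
  "pf p t f x = (\<integral>y. f y \<partial>(p t x))"

definition L2 :: "'a measure \<Rightarrow> ('a \<Rightarrow> real) \<Rightarrow> bool" where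
  "L2 M f \<longleftrightarrow> f \<in> borel_measurable M \<and> integrable M (\<lambda>x. (f x)\<^sup>2)"

text \<open>A strongly continuous semigroup of bounded linear operators on L_2(M), acting on
  representatives (well defined on M-a.e. classes).\<close>
definition strongly_cont_L2_semigroup ::
    "'a measure \<Rightarrow> (real \<Rightarrow> ('a \<Rightarrow> real) \<Rightarrow> ('a \<Rightarrow> real)) \<Rightarrow> bool" where
  "strongly_cont_L2_semigroup M T \<longleftrightarrow>
     (\<forall>t\<ge>0. \<forall>f. L2 M f \<longrightarrow> L2 M (T t f)) \<and>
     (\<forall>t\<ge>0. \<forall>f g. L2 M f \<longrightarrow> L2 M g \<longrightarrow> (AE x in M. f x = g x) \<longrightarrow> (AE x in M. T t f x = T t g x)) \<and>
     (\<forall>t\<ge>0. \<forall>f g a b. L2 M f \<longrightarrow> L2 M g \<longrightarrow>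
        (AE x in M. T t (\<lambda>y. a * f y + b * g y) x = a * T t f x + b * T t g x)) \<and>
     (\<forall>t\<ge>0. \<exists>C. \<forall>f. L2 M f \<longrightarrow> (\<integral>x. (T t f x)\<^sup>2 \<partial>M) \<le> C * (\<integral>x. (f x)\<^sup>2 \<partial>M)) \<and>
     (\<forall>f. L2 M f \<longrightarrow> (AE x in M. T 0 f x = f x)) \<and>
     (\<forall>s\<ge>0. \<forall>t\<ge>0. \<forall>f. L2 M f \<longrightarrow> (AE x in M. T (s + t) f x = T s (T t f) x)) \<and>
     (\<forall>f. L2 M f \<longrightarrow> (\<forall>s\<ge>0. ((\<lambda>t. \<integral>x. (T t f x - T s f x)\<^sup>2 \<partial>M) \<longlongrightarrow> 0) (at s within {0..})))"

section \<open>The process on the Skorokhod space of the Polish space 'a (= E tilde)\<close>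

text \<open>Right-continuous paths with left limits on [0,oo); for definiteness paths are extended
  constantly (omega t = omega 0) to negative times.\<close>
definition cadlag_paths :: "(real \<Rightarrow> 'a::topological_space) set" where
  "cadlag_paths = {\<omega>. (\<forall>t<0. \<omega> t = \<omega> 0) \<and> (\<forall>t\<ge>0. continuous (at_right t) \<omega>)
                    \<and> (\<forall>t>0. \<exists>l. (\<omega> \<longlongrightarrow> l) (at_left t))}"

definition coord_sets :: "real \<Rightarrow> (real \<Rightarrow> 'a::topological_space) set set" where
  "coord_sets s = sigma_sets cadlag_paths
     {{\<omega> \<in> cadlag_paths. \<omega> r \<in> A} | r A. 0 \<le> r \<and> r \<le> s \<and> A \<in> sets borel}"

text \<open>Sigma-algebra generated by the coordinates (= Borel sets of the Skorokhod space).\<close>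
definition path_sets :: "(real \<Rightarrow> 'a::topological_space) set set" where
  "path_sets = sigma_sets cadlag_paths
     {{\<omega> \<in> cadlag_paths. \<omega> r \<in> A} | r A. 0 \<le> r \<and> A \<in> sets borel}"

definition ext_trans :: "'a set \<Rightarrow> (real \<Rightarrow> 'a \<Rightarrow> 'a measure) \<Rightarrow> real \<Rightarrow> 'a \<Rightarrow> 'a set \<Rightarrow> real" where
  "ext_trans E p t x A = (if x \<in> E then measure (p t x) (A \<inter> E) else indicator A x)"

definition markov_process ::
    "'a::topological_space set \<Rightarrow> (real \<Rightarrow> 'a \<Rightarrow> 'a measure) \<Rightarrow> ('a \<Rightarrow> (real \<Rightarrow> 'a) measure) \<Rightarrow> bool" where
  "markov_process E p PX \<longleftrightarrow>
     (\<forall>x. prob_space (PX x) \<and> space (PX x) = cadlag_paths \<and> sets (PX x) = path_sets) \<and>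
     (\<forall>x. measure (PX x) {\<omega> \<in> cadlag_paths. \<omega> 0 = x} = 1) \<and>
     (\<forall>x. \<forall>s\<ge>0. \<forall>t\<ge>0. \<forall>A\<in>sets borel. \<forall>F\<in>coord_sets s.
        measure (PX x) (F \<inter> {\<omega> \<in> cadlag_paths. \<omega> (s + t) \<in> A})
          = (\<integral>\<omega>. indicator F \<omega> * ext_trans E p t (\<omega> s) A \<partial>(PX x)))"

definition occ :: "'a measure \<Rightarrow> real \<Rightarrow> (real \<Rightarrow> 'a) \<Rightarrow> 'a measure" where
  "occ M t \<omega> = measure_of (space M) (sets M)
      (\<lambda>A. ennreal ((1 / t) * (LBINT s=0..t. indicator A (\<omega> s))))"

definition Dset :: "'a measure \<Rightarrow> ('a \<Rightarrow> real) set" where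
  "Dset M = {u. u \<in> borel_measurable M \<and> (\<forall>x\<in>space M. 0 \<le> u x) \<and> (\<exists>C. \<forall>x\<in>space M. u x \<le> C)
               \<and> (\<integral>\<^sup>+x. ennreal (u x) \<partial>M) < \<infinity>}"

text \<open>D_1 as pairs (v, hat L v).\<close>
definition D1 :: "'a measure \<Rightarrow> (real \<Rightarrow> 'a \<Rightarrow> 'a measure) \<Rightarrow> (('a \<Rightarrow> real) \<times> ('a \<Rightarrow> real)) set" where
  "D1 M p = {((\<lambda>x. (1 / t) * (LBINT s=0..t. pf p s (pf p \<eta> u) x)),
              (\<lambda>x. (1 / t) * (pf p t (pf p \<eta> u) x - pf p \<eta> u x))) | u t \<eta>.
             u \<in> Dset M \<and> t > 0 \<and> \<eta> \<ge> 0}"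

definition Ihat :: "'a measure \<Rightarrow> (real \<Rightarrow> 'a \<Rightarrow> 'a measure) \<Rightarrow> 'a measure \<Rightarrow> ereal" where
  "Ihat M p \<mu> = - (INF vL\<in>D1 M p. INF \<epsilon>\<in>{0::real<..}.
                     ereal (\<integral>x. snd vL x / (fst vL x + \<epsilon>) \<partial>\<mu>))"

definition Irate :: "'a measure \<Rightarrow> (real \<Rightarrow> 'a \<Rightarrow> 'a measure) \<Rightarrow> 'a measure \<Rightarrow> ereal" where
  "Irate M p \<mu> = (if absolutely_continuous M \<mu> then Ihat M p \<mu> else \<infinity>)"

definition Rres :: "(real \<Rightarrow> 'a \<Rightarrow> 'a measure) \<Rightarrow> ('a \<Rightarrow> real) \<Rightarrow> 'a \<Rightarrow> real" where
  "Rres p f x = (LBINT t:{0..}. exp (- t) * pf p t f x)"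

definition m_thin :: "'a measure \<Rightarrow> (real \<Rightarrow> 'a \<Rightarrow> 'a measure) \<Rightarrow> 'a set \<Rightarrow> bool" where
  "m_thin M p N \<longleftrightarrow> N \<in> sets M \<and>
     (\<exists>B\<in>sets M. emeasure M B = 0 \<and> N \<subseteq> {x \<in> space M. Rres p (indicator B) x > 0})"

definition capacity :: "'a measure \<Rightarrow> ('a set \<Rightarrow> ennreal) \<Rightarrow> bool" where
  "capacity M Cap \<longleftrightarrow>
     (\<forall>A\<in>sets M. \<forall>B\<in>sets M. A \<subseteq> B \<longrightarrow> Cap A \<le> Cap B) \<and>
     (\<forall>F::nat \<Rightarrow> 'a set. range F \<subseteq> sets M \<longrightarrow> (\<forall>n. Cap (F n) = 0) \<longrightarrow> Cap (\<Union>(range F)) = 0)"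

definition capacity_condition ::
    "'a measure \<Rightarrow> (real \<Rightarrow> 'a \<Rightarrow> 'a measure) \<Rightarrow> ('a set \<Rightarrow> ennreal) \<Rightarrow> bool" where
  "capacity_condition M p Cap \<longleftrightarrow>
     (\<forall>f t. bmeas M f \<longrightarrow> (AE x in M. f x = 0) \<longrightarrow> t > 0 \<longrightarrow>
        (\<exists>Z\<in>sets M. Cap Z = 0 \<and> (\<forall>x\<in>space M - Z. pf p t f x = 0)))"

definition elog :: "real \<Rightarrow> ereal" where
  "elog r = (if r > 0 then ereal (ln r) else - \<infinity>)"

end

theory Submission
  imports Defs
begin

text \<open>
  If \<open>I(\<mu>) < \<infinity>\<close> then \<open>\<mu>\<close> is absolutely continuous with respect to \<open>m\<close>, and the inequalities defining
  \<open>I\<close> give \<open>\<integral> ln (P\<^sub>h w / w) d\<mu> \<ge> - h I(\<mu>)\<close> for bounded \<open>w\<close> bounded away from \<open>0\<close>. Splitting \<open>[0,1]\<close> into small steps, the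
  Feynman-Kac semigroup with potential \<open>V\<close> satisfies \<open>\<integral> ln (P\<^sub>1 u / u) d\<mu> \<ge> \<integral> V d\<mu> - I(\<mu>)\<close>. No ergodic theorem is needed
  to exploit this: an argument in the style of Garsia yields, for \<open>a < \<integral> V d\<mu> - I(\<mu>)\<close>, a set of positive
  \<open>\<mu>\<close>-measure on which \<open>P\<^sub>n 1 \<ge> exp (a n)\<close> for all \<open>n\<close>.

  To localise \<open>S\<^sub>T = \<integral>\<^sub>0\<^sup>T F(X\<^sub>s) ds\<close>, where \<open>F\<^sub>j = f\<^sub>j - \<integral> f\<^sub>j d\<mu>\<close>, split \<open>[0,T]\<close> into a fixed number of blocks and estimate
  the expectation of \<open>exp (- q |S\<^sub>T|\<^sup>2)\<close> with \<open>q\<close> of order \<open>1/T\<close>. On one block the quadratic potential is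
  linearised at the sum accumulated so far, which gives an exponential moment of a linear functional
  with \<open>\<mu>\<close>-mean \<open>0\<close>; finitely many directions suffice. Irreducibility joins the sets of good starting points
  of successive blocks. The result is \<open>P\<^sup>x(|S\<^sub>T| < \<epsilon> T) \<ge> \<kappa> exp (- (I(\<mu>) + c) T)\<close> on a set \<open>H\<^sub>c\<close> of positive \<open>\<mu>\<close>-measure,
  and hence, up to the constants, at each \<open>x\<close> from which \<open>H\<^sub>c\<close> is reached, i.e. with \<open>R 1\<^sub>H(x) > 0\<close>. With \<open>c = 1/n\<close>,
  the exceptional set \<open>N = \<Union>\<^sub>n {x. R 1\<^sub>H(x) = 0}\<close> is \<open>m\<close>-null by irreducibility, and absorbing. From a point of \<open>N\<close> the process
  stays in \<open>N\<close>, so \<open>R 1\<^sub>N = 1\<close> and \<open>p\<^sub>1 1\<^sub>N = 1\<close> on \<open>N\<close>: the null set \<open>N\<close> is \<open>m\<close>-thin and has capacity \<open>0\<close>.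
\<close>

section \<open>Path space and time integrals\<close>

text \<open>The entropy inequality bounds exponential moments from below, one potential at a time.
  This alone puts no mass near \<open>S\<^sub>T = 0\<close>: every linear exponential moment can be
  large because of paths far from the origin. The quadratic penalty cures this because its
  linearisation steers back. With sum \<open>s\<close> so far and increment \<open>D\<close> in the
  next block, the exponent changes by \<open>- 2 q s D - q |D|\<^sup>2\<close>. Since the
  \<open>F\<^sub>j\<close> have mean \<open>0\<close>, the potential in direction
  \<open>- 2 q s\<close> has mean \<open>0\<close> whatever \<open>s\<close> is, so each block costs
  a rate of about \<open>I(\<mu>)\<close> only. With \<open>q = A / (2 T)\<close> and
  \<open>|s|\<close> of order \<open>T\<close>, the directions stay in a fixed box, so one finite
  grid serves for all \<open>T\<close>. On a block of length \<open>T / M\<close> the second-order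
  term is of order \<open>T / M\<^sup>2\<close>, hence of order \<open>T / M\<close> over all
  blocks: a fixed \<open>M\<close> suffices, and the constant factors lost when blocks are joined do
  not grow with \<open>T\<close>. \<open>A\<close> is so large that paths outside the
  \<open>\<epsilon> T\<close>-ball contribute at most \<open>exp (- (I(\<mu>) + c + 1) T)\<close>;
  what exceeds this comes from the paths wanted.\<close>

definition path_space :: "(real \<Rightarrow> 'a::topological_space) measure" where
  "path_space = sigma cadlag_paths {{\<omega> \<in> cadlag_paths. \<omega> r \<in> A} | r A. 0 \<le> r \<and> A \<in> sets borel}"

definition coord_space :: "real \<Rightarrow> (real \<Rightarrow> 'a::topological_space) measure" where
  "coord_space s = sigma cadlag_paths
     {{\<omega> \<in> cadlag_paths. \<omega> r \<in> A} | r A. 0 \<le> r \<and> r \<le> s \<and> A \<in> sets borel}"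

text \<open>Paths are constant on negative times, hence the truncation at \<open>0\<close>.\<close>
definition path_shift :: "real \<Rightarrow> (real \<Rightarrow> 'a) \<Rightarrow> real \<Rightarrow> 'a" where
  "path_shift s \<omega> = (\<lambda>t. \<omega> (s + max 0 t))"

definition Sint :: "('a \<Rightarrow> real) \<Rightarrow> real \<Rightarrow> (real \<Rightarrow> 'a) \<Rightarrow> real" where
  "Sint f t \<omega> = (LBINT r:{0..t}. f (\<omega> r))"

lemma space_path_space [simp]: "space path_space = cadlag_paths"
  unfolding path_space_def by (rule space_measure_of) auto

lemma space_coord_space [simp]: "space (coord_space s) = cadlag_paths"
  unfolding coord_space_def by (rule space_measure_of) auto

lemma sets_path_space: "sets path_space = path_sets"
  unfolding path_space_def path_sets_def by (rule sets_measure_of) auto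

lemma sets_coord_space: "sets (coord_space s) = coord_sets s"
  unfolding coord_space_def coord_sets_def by (rule sets_measure_of) auto

lemma sets_coord_space_mono: "s \<le> t \<Longrightarrow> sets (coord_space s) \<subseteq> sets (coord_space t)"
  unfolding sets_coord_space coord_sets_def
  by (rule sigma_sets_mono') fastforce

lemma sets_coord_space_path_space: "sets (coord_space s) \<subseteq> sets path_space"
  unfolding sets_coord_space sets_path_space coord_sets_def path_sets_def
  by (rule sigma_sets_mono') fastforce

lemma measurable_coord_path:
  "f \<in> coord_space s \<rightarrow>\<^sub>M N \<Longrightarrow> f \<in> path_space \<rightarrow>\<^sub>M N"
  using measurable_mono[of N N "coord_space s" path_space] sets_coord_space_path_space[of s] by auto

lemma measurable_eval_coord:
  assumes "0 \<le> r" "r \<le> s" shows "(\<lambda>\<omega>. \<omega> r) \<in> coord_space s \<rightarrow>\<^sub>M borel"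
proof (rule measurableI)
  fix A :: "'a set" assume "A \<in> sets borel"
  then have "{\<omega> \<in> cadlag_paths. \<omega> r \<in> A} \<in> coord_sets s"
    unfolding coord_sets_def using assms by (intro sigma_sets.Basic) auto
  then show "(\<lambda>\<omega>. \<omega> r) -` A \<inter> space (coord_space s) \<in> sets (coord_space s)"
    unfolding sets_coord_space by (simp add: vimage_def Int_def conj_commute)
qed simp

lemma cadlag_neg: "\<omega> \<in> cadlag_paths \<Longrightarrow> t < 0 \<Longrightarrow> \<omega> t = \<omega> 0"
  by (auto simp: cadlag_paths_def)

lemma measurable_eval: "(\<lambda>\<omega>. \<omega> r) \<in> path_space \<rightarrow>\<^sub>M borel"
proof (cases "0 \<le> r")
  case True
  show ?thesis by (rule measurable_coord_path[OF measurable_eval_coord[OF True order_refl]])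
next
  case False
  have "(\<lambda>\<omega>. \<omega> 0) \<in> path_space \<rightarrow>\<^sub>M (borel :: 'a measure)"
    by (rule measurable_coord_path[OF measurable_eval_coord[OF order_refl order_refl]])
  then show ?thesis
    by (rule measurable_cong[THEN iffD1, rotated]) (use False in \<open>auto simp: not_le intro: cadlag_neg[symmetric]\<close>)
qed

lemma cadlag_right_limit:
  fixes \<omega> :: "real \<Rightarrow> 'a::metric_space"
  assumes \<omega>: "\<omega> \<in> cadlag_paths" and "0 \<le> a" "\<And>n. a \<le> x n" "x \<longlonglongrightarrow> a"
  shows "(\<lambda>n. \<omega> (x n)) \<longlonglongrightarrow> \<omega> a"
proof (rule tendstoI)
  fix e :: real assume "e > 0"
  have "continuous (at_right a) \<omega>" using \<omega> assms(2) by (auto simp: cadlag_paths_def)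
  then have "(\<omega> \<longlongrightarrow> \<omega> a) (at_right a)" by (simp add: continuous_within)
  from tendstoD[OF this \<open>e > 0\<close>] obtain b where b: "b > a" "\<And>y. a < y \<Longrightarrow> y < b \<Longrightarrow> dist (\<omega> y) (\<omega> a) < e"
    unfolding eventually_at_right_field by blast
  have "eventually (\<lambda>n. x n < b) sequentially"
    using order_tendstoD(2)[OF assms(4) b(1)] .
  then show "eventually (\<lambda>n. dist (\<omega> (x n)) (\<omega> a) < e) sequentially"
  proof eventually_elim
    case (elim n)
    then show ?case using b(2)[of "x n"] assms(3)[of n] \<open>e > 0\<close> by (cases "x n = a") auto
  qed
qed

text \<open>Progressive measurability. Time is rounded up to a grid and clipped to
  \<open>[0,s]\<close>, so each approximation reads only coordinates up to \<open>s\<close>; the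
  grid points approach from the right, so right continuity gives convergence.\<close>

lemma measurable_eval_joint:
  "(\<lambda>(\<omega>, t). \<omega> (max 0 (min t s)))
     \<in> (coord_space s \<Otimes>\<^sub>M borel) \<rightarrow>\<^sub>M (borel :: 'a::polish_space measure)" if "0 \<le> s" for s :: real
proof -
  define q where "q n t = (real_of_int \<lfloor>real (Suc n) * t\<rfloor> + 1) / real (Suc n)" for n t
  define f where "f n = (\<lambda>(\<omega> :: real \<Rightarrow> 'a, t). \<omega> (max 0 (min (q n t) s)))" for n
  have q_gt: "t \<le> q n t" for n t
    unfolding q_def by (subst pos_le_divide_eq) (auto simp: mult.commute intro: less_imp_le)
  have q_le: "q n t \<le> t + 1 / real (Suc n)" for n t
  proof -
    have "real_of_int \<lfloor>real (Suc n) * t\<rfloor> \<le> real (Suc n) * t" by (rule of_int_floor_le)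
    then have "q n t \<le> (real (Suc n) * t + 1) / real (Suc n)"
      unfolding q_def by (intro divide_right_mono) auto
    also have "\<dots> = t + 1 / real (Suc n)" by (simp add: add_divide_distrib)
    finally show ?thesis .
  qed
  have q_lim: "(\<lambda>n. q n t) \<longlonglongrightarrow> t" for t
  proof (rule tendsto_sandwich)
    show "eventually (\<lambda>n. t \<le> q n t) sequentially" using q_gt by auto
    show "eventually (\<lambda>n. q n t \<le> t + 1 / real (Suc n)) sequentially" by (intro always_eventually allI q_le)
    show "(\<lambda>n. t) \<longlonglongrightarrow> t" by simp
    have "(\<lambda>n. t + 1 / real (Suc n)) \<longlonglongrightarrow> t + 0"
      by (intro tendsto_add tendsto_const LIMSEQ_Suc[OF lim_1_over_n])
    then show "(\<lambda>n. t + 1 / real (Suc n)) \<longlonglongrightarrow> t" by simp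
  qed
  show ?thesis
  proof (rule borel_measurable_LIMSEQ_metric)
    fix n
    have "(\<lambda>x. fst x (max 0 (min ((real_of_int (\<lfloor>real (Suc n) * snd x\<rfloor>) + 1) / real (Suc n)) s)))
       \<in> coord_space s \<Otimes>\<^sub>M borel \<rightarrow>\<^sub>M (borel :: 'a measure)"
    proof (rule measurable_compose_countable[where g = "\<lambda>x. \<lfloor>real (Suc n) * snd x\<rfloor>" 
          and f = "\<lambda>i x. fst x (max 0 (min ((real_of_int i + 1) / real (Suc n)) s))"])
      fix i :: int
      show "(\<lambda>x. fst x (max 0 (min ((real_of_int i + 1) / real (Suc n)) s)))
        \<in> coord_space s \<Otimes>\<^sub>M borel \<rightarrow>\<^sub>M (borel :: 'a measure)"
        by (rule measurable_compose[OF measurable_fst measurable_eval_coord]) (use that in auto)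
    next
      show "(\<lambda>x. \<lfloor>real (Suc n) * snd x\<rfloor>) \<in> coord_space s \<Otimes>\<^sub>M borel \<rightarrow>\<^sub>M count_space UNIV"
        by measurable
    qed
    then show "f n \<in> coord_space s \<Otimes>\<^sub>M borel \<rightarrow>\<^sub>M borel"
      by (simp add: f_def q_def case_prod_beta')
  next
    fix x :: "(real \<Rightarrow> 'a) \<times> real" assume "x \<in> space (coord_space s \<Otimes>\<^sub>M borel)"
    then have \<omega>: "fst x \<in> cadlag_paths" by (auto simp: space_pair_measure)
    have "(\<lambda>n. max 0 (min (q n (snd x)) s)) \<longlonglongrightarrow> max 0 (min (snd x) s)"
      by (intro tendsto_max tendsto_min tendsto_const q_lim)
    then have "(\<lambda>n. fst x (max 0 (min (q n (snd x)) s))) \<longlonglongrightarrow> fst x (max 0 (min (snd x) s))"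
    proof (rule cadlag_right_limit[OF \<omega>, rotated 2])
      fix n show "max 0 (min (snd x) s) \<le> max 0 (min (q n (snd x)) s)"
        using q_gt[of "snd x" n] by (auto simp: max_def min_def)
    qed auto
    then show "(\<lambda>n. f n x) \<longlonglongrightarrow> (case x of (\<omega>, t) \<Rightarrow> \<omega> (max 0 (min t s)))"
      by (simp add: f_def case_prod_beta')
  qed
qed

lemma cadlag_measurable:
  fixes \<omega> :: "real \<Rightarrow> 'a::polish_space"
  assumes "\<omega> \<in> cadlag_paths" shows "(\<lambda>r. \<omega> (max 0 (min r s))) \<in> borel_measurable borel"
proof (cases "0 \<le> s")
  case True
  from measurable_Pair2[OF measurable_eval_joint[OF True], of \<omega>] assms show ?thesis by simp
next
  case False
  then have "max 0 (min r s) = 0" for r by auto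
  then show ?thesis by simp
qed

lemma cadlag_borel:
  fixes \<omega> :: "real \<Rightarrow> 'a::polish_space"
  assumes \<omega>: "\<omega> \<in> cadlag_paths" shows "\<omega> \<in> borel_measurable borel"
proof (rule borel_measurable_LIMSEQ_metric)
  fix i :: nat
  show "(\<lambda>r. \<omega> (max 0 (min r (real i)))) \<in> borel_measurable borel"
    by (rule cadlag_measurable[OF \<omega>])
next
  fix r :: real
  obtain n :: nat where n: "r \<le> real n" using real_arch_simple by blast
  have "eventually (\<lambda>i. \<omega> (max 0 (min r (real i))) = \<omega> r) sequentially"
    using eventually_ge_at_top[of n]
  proof eventually_elim
    case (elim i)
    then show ?case using n cadlag_neg[OF \<omega>, of r] by (cases "r < 0") (auto simp: max_def min_def)
  qed
  then show "(\<lambda>i. \<omega> (max 0 (min r (real i)))) \<longlonglongrightarrow> \<omega> r" by (rule tendsto_eventually)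
qed

lemma set_integrable_bounded_Icc:
  fixes g :: "real \<Rightarrow> real"
  assumes "g \<in> borel_measurable borel" "\<And>r. \<bar>g r\<bar> \<le> C"
  shows "set_integrable lborel {a..b} g"
  unfolding set_integrable_def
proof (rule Bochner_Integration.integrable_bound[where f = "\<lambda>x. indicator {a..b} x *\<^sub>R C"])
  show "integrable lborel (\<lambda>x. indicator {a..b} x *\<^sub>R C)"
    using borel_integrable_compact[of "{a..b}" "\<lambda>_. C"] by simp
  show "(\<lambda>x. indicator {a..b} x *\<^sub>R g x) \<in> borel_measurable lborel" using assms(1) by simp
  show "AE x in lborel. norm (indicator {a..b} x *\<^sub>R g x) \<le> norm (indicator {a..b} x *\<^sub>R C)"
    using assms(2) by (auto intro!: AE_I2 split: split_indicator) (meson abs_ge_self order_trans)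
qed

lemma set_integral_abs_le_Icc:
  fixes g :: "real \<Rightarrow> real"
  assumes "g \<in> borel_measurable borel" "\<And>r. \<bar>g r\<bar> \<le> C" "a \<le> b"
  shows "\<bar>LBINT r:{a..b}. g r\<bar> \<le> C * (b - a)"
proof -
  have C: "0 \<le> C" using assms(2)[of 0] by linarith
  have "\<bar>LBINT r:{a..b}. g r\<bar> \<le> (LBINT r:{a..b}. \<bar>g r\<bar>)"
    unfolding set_lebesgue_integral_def
    using integral_abs_bound[of lborel "\<lambda>x. indicator {a..b} x *\<^sub>R g x"] by (simp add: abs_mult)
  also have "\<dots> \<le> (LBINT r:{a..b}. C)"
    by (rule set_integral_mono) (use assms in \<open>auto intro!: set_integrable_bounded_Icc[of _ C] simp: C\<close>)
  also have "\<dots> = C * (b - a)" using assms(3) by (simp add: set_lebesgue_integral_def)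
  finally show ?thesis .
qed

lemma Sint_measurable_coord:
  fixes f :: "'a::polish_space \<Rightarrow> real"
  assumes [measurable]: "f \<in> borel_measurable borel" and "0 \<le> s"
  shows "Sint f s \<in> borel_measurable (coord_space s)"
proof -
  note measurable_eval_joint[OF assms(2), measurable]
  have "(\<lambda>\<omega>. \<integral>r. indicator {0..s} r * f ((\<lambda>(\<omega>, t). \<omega> (max 0 (min t s))) (\<omega>, r)) \<partial>lborel)
      \<in> borel_measurable (coord_space s)"
    by measurable
  also have "(\<lambda>\<omega>. \<integral>r. indicator {0..s} r * f ((\<lambda>(\<omega>, t). \<omega> (max 0 (min t s))) (\<omega>, r)) \<partial>lborel) = Sint f s"
    unfolding Sint_def set_lebesgue_integral_def
    by (intro ext Bochner_Integration.integral_cong) (auto split: split_indicator)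
  finally show ?thesis .
qed

lemma Sint_measurable:
  fixes f :: "'a::polish_space \<Rightarrow> real"
  assumes "f \<in> borel_measurable borel"
  shows "Sint f s \<in> borel_measurable path_space"
proof (cases "0 \<le> s")
  case True
  then show ?thesis by (intro measurable_coord_path[OF Sint_measurable_coord] assms)
next
  case False
  then have "Sint f s = (\<lambda>_. 0)" by (auto simp: Sint_def set_lebesgue_integral_def)
  then show ?thesis by simp
qed

lemma shift_cadlag:
  assumes \<omega>: "\<omega> \<in> cadlag_paths" and s: "0 \<le> s" shows "path_shift s \<omega> \<in> cadlag_paths"
proof -
  have 1: "path_shift s \<omega> t = path_shift s \<omega> 0" if "t < 0" for t using that by (simp add: path_shift_def)
  have 2: "continuous (at_right t) (path_shift s \<omega>)" if "0 \<le> t" for t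
  proof -
    have "continuous (at_right (s + t)) \<omega>" using \<omega> s that by (auto simp: cadlag_paths_def)
    then have "(\<omega> \<longlongrightarrow> \<omega> (s + t)) (at_right (s + t))" by (simp add: continuous_within)
    moreover have "filterlim (\<lambda>r. s + r) (at_right (s + t)) (at_right t)"
      unfolding filterlim_at by (auto simp: eventually_at_right_field intro!: tendsto_intros exI[of _ "t + 1"])
    ultimately have "((\<lambda>r. \<omega> (s + r)) \<longlongrightarrow> \<omega> (s + t)) (at_right t)"
      by (rule filterlim_compose)
    moreover have "eventually (\<lambda>r. \<omega> (s + r) = path_shift s \<omega> r) (at_right t)"
      using that by (auto simp: eventually_at_right_field path_shift_def intro!: exI[of _ "t + 1"])
    ultimately have "(path_shift s \<omega> \<longlongrightarrow> \<omega> (s + t)) (at_right t)"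
      using tendsto_cong by force
    then show ?thesis using that by (simp add: continuous_within path_shift_def)
  qed
  have 3: "\<exists>l. (path_shift s \<omega> \<longlongrightarrow> l) (at_left t)" if "0 < t" for t
  proof -
    have "0 < s + t" using s that by simp
    then obtain l where "(\<omega> \<longlongrightarrow> l) (at_left (s + t))" using \<omega> unfolding cadlag_paths_def by blast
    moreover have "filterlim (\<lambda>r. s + r) (at_left (s + t)) (at_left t)"
      unfolding filterlim_at by (auto simp: eventually_at_left_field intro!: tendsto_intros exI[of _ "t - 1"])
    ultimately have "((\<lambda>r. \<omega> (s + r)) \<longlongrightarrow> l) (at_left t)"
      by (rule filterlim_compose)
    moreover have "eventually (\<lambda>r. \<omega> (s + r) = path_shift s \<omega> r) (at_left t)"
      using that by (auto simp: eventually_at_left_field path_shift_def intro!: exI[of _ 0])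
    ultimately have "(path_shift s \<omega> \<longlongrightarrow> l) (at_left t)"
      using tendsto_cong by force
    then show ?thesis ..
  qed
  show ?thesis unfolding cadlag_paths_def using 1 2 3 by blast
qed

lemma measurable_shift:
  assumes s: "0 \<le> s" shows "path_shift s \<in> path_space \<rightarrow>\<^sub>M path_space"
  unfolding path_space_def[where 'a='a]
proof (rule measurable_measure_of)
  show "path_shift s \<in> space (sigma cadlag_paths {{\<omega> \<in> cadlag_paths. \<omega> r \<in> A} | r A. 0 \<le> r \<and> A \<in> sets borel}) \<rightarrow> cadlag_paths"
    using shift_cadlag[OF _ s] by (fold path_space_def) auto
next
  fix y :: "(real \<Rightarrow> 'a) set" assume "y \<in> {{\<omega> \<in> cadlag_paths. \<omega> r \<in> A} |r A. 0 \<le> r \<and> A \<in> sets borel}"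
  then obtain r A where y: "y = {\<omega> \<in> cadlag_paths. \<omega> r \<in> A}" "0 \<le> r" "A \<in> sets borel" by auto
  have "(\<lambda>\<omega>. \<omega> (s + r)) -` A \<inter> space path_space \<in> sets path_space"
    by (rule measurable_sets[OF measurable_eval y(3)])
  also have "(\<lambda>\<omega>. \<omega> (s + r)) -` A \<inter> space path_space = path_shift s -` y \<inter> space path_space"
    using y shift_cadlag[OF _ s] by (auto simp: path_shift_def)
  finally show "path_shift s -` y \<inter> space (sigma cadlag_paths {{\<omega> \<in> cadlag_paths. \<omega> r \<in> A} |r A. 0 \<le> r \<and> A \<in> sets borel})
       \<in> sets (sigma cadlag_paths {{\<omega> \<in> cadlag_paths. \<omega> r \<in> A} |r A. 0 \<le> r \<and> A \<in> sets borel})"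
    by (fold path_space_def)
qed auto

lemma set_integral_split_Icc:
  fixes g :: "real \<Rightarrow> real"
  assumes "\<And>u v. set_integrable lborel {u..v} g" "a \<le> b" "b \<le> c"
  shows "(LBINT r:{a..c}. g r) = (LBINT r:{a..b}. g r) + (LBINT r:{b..c}. g r)"
proof -
  have "AE r in lborel. indicator {a..c} r *\<^sub>R g r
      = indicator {a..b} r *\<^sub>R g r + indicator {b..c} r *\<^sub>R g r"
    using AE_lborel_singleton[of b] by eventually_elim (use assms(2,3) in \<open>auto split: split_indicator\<close>)
  then have "(LBINT r:{a..c}. g r) = (LBINT r. indicator {a..b} r *\<^sub>R g r + indicator {b..c} r *\<^sub>R g r)"
    unfolding set_lebesgue_integral_def
    by (rule integral_cong_AE[rotated 2])
       (use assms(1) in \<open>auto simp: set_integrable_def intro!: borel_measurable_integrable Bochner_Integration.integrable_add\<close>)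
  then show ?thesis
    using assms(1) by (simp add: set_lebesgue_integral_def set_integrable_def)
qed

lemma Sint_add:
  fixes f :: "'a::polish_space \<Rightarrow> real"
  assumes f: "f \<in> borel_measurable borel" "\<And>x. \<bar>f x\<bar> \<le> C" and \<omega>: "\<omega> \<in> cadlag_paths" and st: "0 \<le> s" "0 \<le> t"
  shows "Sint f (s + t) \<omega> = Sint f s \<omega> + Sint f t (path_shift s \<omega>)"
proof -
  note [measurable] = cadlag_borel[OF \<omega>] f(1)
  have int: "set_integrable lborel {u..v} (\<lambda>r. f (\<omega> r))" for u v
    by (rule set_integrable_bounded_Icc) (use f in auto)
  have "(LBINT r:{s..s+t}. f (\<omega> r)) = (\<integral>r. indicator {s..s+t} (s + 1 * r) *\<^sub>R f (\<omega> (s + 1 * r)) \<partial>lborel)"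
    unfolding set_lebesgue_integral_def
    by (subst lborel_integral_real_affine[where c = 1 and t = s]) auto
  also have "\<dots> = Sint f t (path_shift s \<omega>)"
    unfolding Sint_def set_lebesgue_integral_def
    by (intro Bochner_Integration.integral_cong) (auto simp: path_shift_def split: split_indicator)
  finally show ?thesis
    unfolding Sint_def using set_integral_split_Icc[OF int, of 0 s "s + t"] st by (simp add: Sint_def)
qed

lemma Sint_bound:
  fixes f :: "'a::polish_space \<Rightarrow> real"
  assumes f: "f \<in> borel_measurable borel" "\<And>x. \<bar>f x\<bar> \<le> C" and \<omega>: "\<omega> \<in> cadlag_paths" and "0 \<le> t"
  shows "\<bar>Sint f t \<omega>\<bar> \<le> C * t"
  unfolding Sint_def
  using set_integral_abs_le_Icc[of "\<lambda>r. f (\<omega> r)" C 0 t] cadlag_borel[OF \<omega>] f assms(4) by simp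

section \<open>The Markov property for path functionals\<close>

definition cyl :: "real set \<Rightarrow> (real \<Rightarrow> 'a set) \<Rightarrow> (real \<Rightarrow> 'a::topological_space) set" where
  "cyl J A = {\<omega> \<in> cadlag_paths. \<forall>t\<in>J. \<omega> t \<in> A t}"

definition cyls :: "(real \<Rightarrow> 'a::topological_space) set set" where
  "cyls = {cyl J A | J A. finite J \<and> J \<subseteq> {0..} \<and> (\<forall>t. A t \<in> sets borel)}"

lemma Int_stable_cyls: "Int_stable cyls"
proof (rule Int_stableI)
  fix a b :: "(real \<Rightarrow> 'a) set" assume "a \<in> cyls" "b \<in> cyls"
  then obtain J A J' A' where a: "a = cyl J A" "finite J" "J \<subseteq> {0..}" "\<And>t. A t \<in> sets borel"
    and b: "b = cyl J' A'" "finite J'" "J' \<subseteq> {0..}" "\<And>t. A' t \<in> sets borel"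
    unfolding cyls_def by blast
  have "a \<inter> b = cyl (J \<union> J') (\<lambda>t. (if t \<in> J then A t else UNIV) \<inter> (if t \<in> J' then A' t else UNIV))"
    unfolding a(1) b(1) cyl_def by auto
  moreover have "(if t \<in> J then A t else UNIV) \<inter> (if t \<in> J' then A' t else UNIV) \<in> sets borel" for t
    using a(4)[of t] b(4)[of t] by auto
  ultimately show "a \<inter> b \<in> cyls"
    unfolding cyls_def using a b by blast
qed

lemma cyls_subset: "cyls \<subseteq> Pow cadlag_paths"
  by (auto simp: cyls_def cyl_def)

lemma cyl_sets:
  fixes A :: "real \<Rightarrow> ('a::topological_space) set"
  assumes "finite J" "\<And>t. A t \<in> sets borel" shows "cyl J A \<in> sets path_space"
proof -
  have "cyl J A = cadlag_paths \<inter> (\<Inter>t\<in>J. (\<lambda>\<omega>. \<omega> t) -` A t \<inter> space path_space)"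
    unfolding cyl_def by auto
  also have "\<dots> \<in> sets path_space"
  proof (cases "J = {}")
    case True
    then show ?thesis using sets.top[of "path_space :: (real \<Rightarrow> 'a) measure"] by simp
  next
    case False
    then have "(\<Inter>t\<in>J. (\<lambda>\<omega>. \<omega> t) -` A t \<inter> space path_space) \<in> sets path_space"
      using assms by (intro sets.finite_INT measurable_sets[OF measurable_eval]) auto
    then show ?thesis using sets.Int[OF sets.top[of "path_space :: (real \<Rightarrow> 'a) measure"]] by simp
  qed
  finally show ?thesis .
qed

lemma sets_path_space_cyls:
  "sets (path_space :: (real \<Rightarrow> 'a::topological_space) measure) = sigma_sets cadlag_paths cyls"
proof (rule antisym)
  show "sets (path_space :: (real \<Rightarrow> 'a) measure) \<subseteq> sigma_sets cadlag_paths cyls"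
    unfolding sets_path_space path_sets_def
  proof (rule sigma_sets_mono', rule subsetI)
    fix y :: "(real \<Rightarrow> 'a) set" assume "y \<in> {{\<omega> \<in> cadlag_paths. \<omega> r \<in> A} | r A. 0 \<le> r \<and> A \<in> sets borel}"
    then obtain r A where "y = cyl {r} (\<lambda>_. A)" "0 \<le> r" "A \<in> sets borel" by (auto simp: cyl_def)
    then show "y \<in> cyls" unfolding cyls_def by (auto intro!: exI[of _ "{r}"])
  qed
  have "cyls \<subseteq> sets (path_space :: (real \<Rightarrow> 'a) measure)" unfolding cyls_def using cyl_sets by blast
  then show "sigma_sets cadlag_paths cyls \<subseteq> sets (path_space :: (real \<Rightarrow> 'a) measure)"
    using sets.sigma_sets_subset[of cyls path_space] by simp
qed

text \<open>Every point of the Polish space, also outside \<open>E\<close>, carries a path law.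
  \<open>\<kappa>\<close> is measurable in space for each fixed time; joint measurability in space
  and time is recovered from the right-continuous paths (\<open>Pt_joint_measurable\<close>),
  measurability of \<open>PX\<close> in the starting point from the Markov property
  (\<open>PX_kernel\<close>).\<close>

locale markov_family =
  fixes PX :: "'a::polish_space \<Rightarrow> (real \<Rightarrow> 'a) measure" and \<kappa> :: "real \<Rightarrow> 'a \<Rightarrow> 'a measure"
  assumes PX_prob: "prob_space (PX x)" and PX_sets: "sets (PX x) = sets path_space"
    and start: "AE \<omega> in PX x. \<omega> 0 = x"
    and \<kappa>: "0 \<le> t \<Longrightarrow> \<kappa> t \<in> borel \<rightarrow>\<^sub>M prob_algebra borel"
    and markov: "0 \<le> s \<Longrightarrow> 0 \<le> t \<Longrightarrow> A \<in> sets borel \<Longrightarrow> F \<in> sets (coord_space s) \<Longrightarrow>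
      emeasure (PX x) (F \<inter> {\<omega> \<in> cadlag_paths. \<omega> (s + t) \<in> A})
        = (\<integral>\<^sup>+\<omega>. indicator F \<omega> * emeasure (\<kappa> t (\<omega> s)) A \<partial>PX x)"
begin

lemma PX_space [simp]: "space (PX x) = cadlag_paths"
  using sets_eq_imp_space_eq[OF PX_sets] by simp

lemma PX_measurable [simp]: "PX x \<rightarrow>\<^sub>M N = path_space \<rightarrow>\<^sub>M N"
  by (rule measurable_cong_sets[OF PX_sets refl])

lemma \<kappa>_sets: "0 \<le> t \<Longrightarrow> sets (\<kappa> t x) = sets borel"
  using measurable_space[OF \<kappa>, of t x] by (auto simp: space_prob_algebra)

lemma \<kappa>_nn_measurable:
  assumes "0 \<le> t" "f \<in> borel_measurable borel"
  shows "(\<lambda>x. \<integral>\<^sup>+y. f y \<partial>\<kappa> t x) \<in> borel_measurable borel"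
  using measurable_compose[OF measurable_prob_algebraD[OF \<kappa>[OF assms(1)]]
      nn_integral_measurable_subprob_algebra[OF assms(2)]] .

lemma markov_nn:
  fixes f :: "'a \<Rightarrow> ennreal"
  assumes st: "0 \<le> s" "0 \<le> t" and f: "f \<in> borel_measurable borel" and F: "F \<in> sets (coord_space s)"
  shows "(\<integral>\<^sup>+\<omega>. indicator F \<omega> * f (\<omega> (s + t)) \<partial>PX x)
       = (\<integral>\<^sup>+\<omega>. indicator F \<omega> * (\<integral>\<^sup>+y. f y \<partial>\<kappa> t (\<omega> s)) \<partial>PX x)"
proof -
  have F'[measurable]: "F \<in> sets path_space" using F sets_coord_space_path_space by blast
  note ev [measurable] = measurable_eval
  note \<kappa>_nn_measurable[OF st(2), measurable]
  show ?thesis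
    using f
  proof (induction rule: borel_measurable_induct)
    case (cong f g)
    then have "f = g" by auto
    then show ?case using cong by simp
  next
    case (set A)
    have "(\<integral>\<^sup>+\<omega>. indicator F \<omega> * indicator A (\<omega> (s + t)) \<partial>PX x)
        = (\<integral>\<^sup>+\<omega>. indicator (F \<inter> {\<omega> \<in> cadlag_paths. \<omega> (s + t) \<in> A}) \<omega> \<partial>PX x)"
      by (intro nn_integral_cong) (auto split: split_indicator)
    also have "\<dots> = emeasure (PX x) (F \<inter> {\<omega> \<in> cadlag_paths. \<omega> (s + t) \<in> A})"
    proof (intro nn_integral_indicator sets.Int F'[folded PX_sets[of x]])
      show "{\<omega> \<in> cadlag_paths. \<omega> (s + t) \<in> A} \<in> sets (PX x)"
        using measurable_sets[OF ev set, of "s + t"] by (simp add: vimage_def Int_def conj_commute PX_sets)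
    qed
    also have "\<dots> = (\<integral>\<^sup>+\<omega>. indicator F \<omega> * emeasure (\<kappa> t (\<omega> s)) A \<partial>PX x)"
      by (rule markov[OF st set F])
    also have "\<dots> = (\<integral>\<^sup>+\<omega>. indicator F \<omega> * (\<integral>\<^sup>+y. indicator A y \<partial>\<kappa> t (\<omega> s)) \<partial>PX x)"
      using set \<kappa>_sets[OF st(2)] by (intro nn_integral_cong) (simp add: nn_integral_indicator)
    finally show ?case .
  next
    case (mult u c)
    have *: "(\<integral>\<^sup>+y. c * u y \<partial>\<kappa> t z) = c * (\<integral>\<^sup>+y. u y \<partial>\<kappa> t z)" for z
      using mult(2) \<kappa>_sets[OF st(2), of z] by (intro nn_integral_cmult) (simp cong: measurable_cong_sets)
    have "(\<integral>\<^sup>+\<omega>. c * (indicator F \<omega> * u (\<omega> (s + t))) \<partial>PX x)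
        = (\<integral>\<^sup>+\<omega>. c * (indicator F \<omega> * (\<integral>\<^sup>+y. u y \<partial>\<kappa> t (\<omega> s))) \<partial>PX x)"
      using mult F' by (subst (1 2) nn_integral_cmult) auto
    then show ?case unfolding * by (simp add: mult.left_commute)
  next
    case (add u v)
    have *: "(\<integral>\<^sup>+y. v y + u y \<partial>\<kappa> t z) = (\<integral>\<^sup>+y. v y \<partial>\<kappa> t z) + (\<integral>\<^sup>+y. u y \<partial>\<kappa> t z)" for z
      using add \<kappa>_sets[OF st(2), of z] by (intro nn_integral_add) (simp_all cong: measurable_cong_sets)
    show ?case unfolding * distrib_left
      using add F' by (subst (1 2) nn_integral_add) auto
  next
    case (seq U)
    have *: "(\<integral>\<^sup>+y. (SUP i. U i y) \<partial>\<kappa> t z) = (SUP i. \<integral>\<^sup>+y. U i y \<partial>\<kappa> t z)" for z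
      using seq \<kappa>_sets[OF st(2), of z]
      by (intro nn_integral_monotone_convergence_SUP) (simp_all cong: measurable_cong_sets)
    have "(\<integral>\<^sup>+\<omega>. indicator F \<omega> * (SUP i. U i (\<omega> (s + t))) \<partial>PX x)
        = (SUP i. \<integral>\<^sup>+\<omega>. indicator F \<omega> * U i (\<omega> (s + t)) \<partial>PX x)"
      unfolding SUP_mult_left_ennreal using seq F'
      by (intro nn_integral_monotone_convergence_SUP)
         (auto simp: incseq_def le_fun_def intro!: mult_left_mono)
    also have "\<dots> = (SUP i. \<integral>\<^sup>+\<omega>. indicator F \<omega> * (\<integral>\<^sup>+y. U i y \<partial>\<kappa> t (\<omega> s)) \<partial>PX x)"
      using seq by simp
    also have "\<dots> = (\<integral>\<^sup>+\<omega>. indicator F \<omega> * (SUP i. \<integral>\<^sup>+y. U i y \<partial>\<kappa> t (\<omega> s)) \<partial>PX x)"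
      unfolding SUP_mult_left_ennreal using seq F'
      by (intro nn_integral_monotone_convergence_SUP[symmetric])
         (auto simp: incseq_def le_fun_def intro!: mult_left_mono nn_integral_mono)
    finally show ?case unfolding * image_comp SUP_apply .
  qed
qed

text \<open>Induction that strips off the smallest time \<open>b\<close> of \<open>J\<close>: the
  later times are handled with offset \<open>b\<close>, then one kernel step over
  \<open>b - u\<close> brings the conditioning back to \<open>s + u\<close>. The order of the
  quantifiers matters: one \<open>Q\<close> serves all \<open>s\<close>, \<open>F\<close> and
  \<open>x\<close>, so a special choice of these identifies it.\<close>

lemma markov_finite_dim:
  fixes A :: "real \<Rightarrow> 'a set"
  assumes "finite J" and A: "\<And>t. A t \<in> sets borel"
  shows "\<forall>u\<ge>0. (\<forall>t\<in>J. u \<le> t) \<longrightarrow> (\<exists>Q\<in>borel_measurable borel. \<forall>s\<ge>0. \<forall>F\<in>sets (coord_space (s + u)). \<forall>x.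
     (\<integral>\<^sup>+\<omega>. indicator F \<omega> * indicator {\<omega>. \<forall>t\<in>J. \<omega> (s + t) \<in> A t} \<omega> \<partial>PX x)
       = (\<integral>\<^sup>+\<omega>. indicator F \<omega> * Q (\<omega> (s + u)) \<partial>PX x :: ennreal))"
  using assms(1)
proof (induction rule: finite_linorder_min_induct)
  case empty
  show ?case by (auto intro!: bexI[of _ "\<lambda>_. 1"])
next
  case (insert b J)
  show ?case
  proof (intro allI impI)
    fix u :: real assume u: "0 \<le> u" "\<forall>t\<in>insert b J. u \<le> t"
    then have b: "0 \<le> b" "u \<le> b" "\<forall>t\<in>J. b \<le> t" using insert(2) by auto
    with insert(3) obtain Q where Q: "Q \<in> borel_measurable borel"
      and Q': "\<And>s F x. 0 \<le> s \<Longrightarrow> F \<in> sets (coord_space (s + b)) \<Longrightarrow>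
       (\<integral>\<^sup>+\<omega>. indicator F \<omega> * indicator {\<omega>. \<forall>t\<in>J. \<omega> (s + t) \<in> A t} \<omega> \<partial>PX x)
       = (\<integral>\<^sup>+\<omega>. indicator F \<omega> * Q (\<omega> (s + b)) \<partial>PX x :: ennreal)" by meson
    have AQ: "(\<lambda>y. indicator (A b) y * Q y) \<in> borel_measurable borel" using Q A[of b] by simp
    show "\<exists>Q\<in>borel_measurable borel. \<forall>s\<ge>0. \<forall>F\<in>sets (coord_space (s + u)). \<forall>x.
     (\<integral>\<^sup>+\<omega>. indicator F \<omega> * indicator {\<omega>. \<forall>t\<in>insert b J. \<omega> (s + t) \<in> A t} \<omega> \<partial>PX x)
       = (\<integral>\<^sup>+\<omega>. indicator F \<omega> * Q (\<omega> (s + u)) \<partial>PX x :: ennreal)"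
    proof (intro bexI[of _ "\<lambda>x. \<integral>\<^sup>+y. indicator (A b) y * Q y \<partial>\<kappa> (b - u) x"] allI impI ballI)
      show "(\<lambda>x. \<integral>\<^sup>+ y. indicator (A b) y * Q y \<partial>\<kappa> (b - u) x) \<in> borel_measurable borel"
        by (rule \<kappa>_nn_measurable[OF _ AQ]) (use b in simp)
      fix s :: real and F :: "(real \<Rightarrow> 'a) set" and x assume s: "0 \<le> s" and F: "F \<in> sets (coord_space (s + u))"
      let ?F = "F \<inter> ((\<lambda>\<omega>. \<omega> (s + b)) -` A b \<inter> space (coord_space (s + b)))"
      have "?F \<in> sets (coord_space (s + b))"
        using sets_coord_space_mono[of "s + u" "s + b"] F b s
        by (intro sets.Int measurable_sets[OF measurable_eval_coord A]) auto
      note Q'[OF s this, of x]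
      moreover have "(\<integral>\<^sup>+\<omega>. indicator F \<omega> * indicator {\<omega>. \<forall>t\<in>insert b J. \<omega> (s + t) \<in> A t} \<omega> \<partial>PX x)
         = (\<integral>\<^sup>+\<omega>. indicator ?F \<omega> * indicator {\<omega>. \<forall>t\<in>J. \<omega> (s + t) \<in> A t} \<omega> \<partial>PX x :: ennreal)"
        by (intro nn_integral_cong) (auto split: split_indicator)
      moreover have "(\<integral>\<^sup>+\<omega>. indicator ?F \<omega> * Q (\<omega> (s + b)) \<partial>PX x)
          = (\<integral>\<^sup>+\<omega>. indicator F \<omega> * (indicator (A b) (\<omega> ((s + u) + (b - u))) * Q (\<omega> ((s + u) + (b - u)))) \<partial>PX x)"
        by (intro nn_integral_cong) (auto split: split_indicator)
      ultimately show "(\<integral>\<^sup>+\<omega>. indicator F \<omega> * indicator {\<omega>. \<forall>t\<in>insert b J. \<omega> (s + t) \<in> A t} \<omega> \<partial>PX x)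
       = (\<integral>\<^sup>+\<omega>. indicator F \<omega> * (\<integral>\<^sup>+y. indicator (A b) y * Q y \<partial>\<kappa> (b - u) (\<omega> (s + u))) \<partial>PX x :: ennreal)"
        using markov_nn[OF _ _ AQ F, of "b - u" x] s u b by simp
    qed
  qed
qed

text \<open>The case \<open>s = 0\<close> with \<open>F\<close> the whole space and start in
  \<open>x\<close> identifies \<open>Q x\<close> of \<open>markov_finite_dim\<close> as the
  probability of the cylinder. Measurability in the starting point follows, and the same
  \<open>Q\<close> at time \<open>s\<close> becomes the Markov property.\<close>

lemma markov_cyl:
  fixes A :: "real \<Rightarrow> 'a set"
  assumes "finite J" "J \<subseteq> {0..}" and A: "\<And>t. A t \<in> sets borel"
  shows "(\<lambda>x. emeasure (PX x) (cyl J A)) \<in> borel_measurable borel"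
    and "0 \<le> s \<Longrightarrow> F \<in> sets (coord_space s) \<Longrightarrow>
      emeasure (PX x) (F \<inter> (path_shift s -` cyl J A \<inter> cadlag_paths))
       = (\<integral>\<^sup>+\<omega>. indicator F \<omega> * emeasure (PX (\<omega> s)) (cyl J A) \<partial>PX x)"
proof -
  have "\<exists>Q\<in>borel_measurable borel. \<forall>s\<ge>0. \<forall>F\<in>sets (coord_space s). \<forall>x.
     (\<integral>\<^sup>+\<omega>. indicator F \<omega> * indicator {\<omega>. \<forall>t\<in>J. \<omega> (s + t) \<in> A t} \<omega> \<partial>PX x)
       = (\<integral>\<^sup>+\<omega>. indicator F \<omega> * Q (\<omega> s) \<partial>PX x :: ennreal)"
    using markov_finite_dim[OF assms(1), of A, OF A, rule_format, of 0] assms(2) by auto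
  then obtain Q where Q: "Q \<in> borel_measurable borel"
      and Q': "\<And>s F x. 0 \<le> s \<Longrightarrow> F \<in> sets (coord_space s) \<Longrightarrow>
       (\<integral>\<^sup>+\<omega>. indicator F \<omega> * indicator {\<omega>. \<forall>t\<in>J. \<omega> (s + t) \<in> A t} \<omega> \<partial>PX x)
       = (\<integral>\<^sup>+\<omega>. indicator F \<omega> * Q (\<omega> s) \<partial>PX x :: ennreal)"
    by blast
  have cyl_path: "cyl J A \<in> sets (PX x)" for x using cyl_sets[of J A] assms PX_sets by auto
  have QP: "emeasure (PX x) (cyl J A) = Q x" for x
  proof -
    interpret prob_space "PX x" by (rule PX_prob)
    have "emeasure (PX x) (cyl J A) = (\<integral>\<^sup>+\<omega>. indicator (cyl J A) \<omega> \<partial>PX x)"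
      using cyl_path by simp
    also have "\<dots> = (\<integral>\<^sup>+\<omega>. indicator (space (coord_space 0)) \<omega> * indicator {\<omega>. \<forall>t\<in>J. \<omega> (0 + t) \<in> A t} \<omega> \<partial>PX x)"
      by (intro nn_integral_cong) (auto simp: cyl_def split: split_indicator)
    also have "\<dots> = (\<integral>\<^sup>+\<omega>. indicator (space (coord_space 0)) \<omega> * Q (\<omega> 0) \<partial>PX x)"
      by (rule Q') (use sets.top[of "coord_space 0"] in auto)
    also have "\<dots> = (\<integral>\<^sup>+\<omega>. Q x \<partial>PX x)"
    proof (rule nn_integral_cong_AE)
      show "AE \<omega> in PX x. indicator (space (coord_space 0)) \<omega> * Q (\<omega> 0) = Q x"
        using start[of x] AE_space[of "PX x"] by eventually_elim simp
    qed
    also have "\<dots> = Q x" using emeasure_space_1 by simp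
    finally show ?thesis .
  qed
  then show "(\<lambda>x. emeasure (PX x) (cyl J A)) \<in> borel_measurable borel" using Q by simp
  assume s: "0 \<le> s" and F: "F \<in> sets (coord_space s)"
  have F'[measurable]: "F \<in> sets path_space" using F sets_coord_space_path_space by blast
  have C: "path_shift s -` cyl J A \<inter> cadlag_paths \<in> sets (PX x)"
    using measurable_sets[OF measurable_shift[OF s] cyl_sets[OF assms(1) A]] by (simp add: PX_sets)
  have "emeasure (PX x) (F \<inter> (path_shift s -` cyl J A \<inter> cadlag_paths))
     = (\<integral>\<^sup>+\<omega>. indicator (F \<inter> (path_shift s -` cyl J A \<inter> cadlag_paths)) \<omega> \<partial>PX x)"
    using F' C by (intro nn_integral_indicator[symmetric]) (auto simp: PX_sets)
  also have "\<dots> = (\<integral>\<^sup>+\<omega>. indicator F \<omega> * indicator {\<omega>. \<forall>t\<in>J. \<omega> (s + t) \<in> A t} \<omega> \<partial>PX x)"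
    using assms(2) shift_cadlag[OF _ s]
    by (intro nn_integral_cong) (force simp: cyl_def path_shift_def max_def split: split_indicator)
  also have "\<dots> = (\<integral>\<^sup>+\<omega>. indicator F \<omega> * emeasure (PX (\<omega> s)) (cyl J A) \<partial>PX x)"
    unfolding QP by (rule Q'[OF s F])
  finally show "emeasure (PX x) (F \<inter> (path_shift s -` cyl J A \<inter> cadlag_paths))
       = (\<integral>\<^sup>+\<omega>. indicator F \<omega> * emeasure (PX (\<omega> s)) (cyl J A) \<partial>PX x)" .
qed

lemma PX_kernel: "PX \<in> borel \<rightarrow>\<^sub>M prob_algebra path_space"
proof (rule measurable_prob_algebra_generated[OF sets_path_space_cyls Int_stable_cyls cyls_subset])
  fix A :: "(real \<Rightarrow> 'a) set" assume "A \<in> cyls"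
  then show "(\<lambda>a. emeasure (PX a) A) \<in> borel_measurable borel"
    unfolding cyls_def using markov_cyl(1) by blast
qed (auto simp: PX_prob PX_sets)

lemma PX_kernel_eval: "(\<lambda>\<omega>. PX (\<omega> s)) \<in> path_space \<rightarrow>\<^sub>M prob_algebra path_space"
  by (rule measurable_compose[OF measurable_eval PX_kernel])

text \<open>As functions of \<open>B\<close> both sides are finite measures: the law of the shifted
  path on the event \<open>F\<close>, and the mixture of the laws \<open>PX (\<omega> s)\<close>
  over \<open>F\<close>. They agree on the intersection-stable cylinders by
  \<open>markov_cyl\<close>.\<close>

lemma markov_sets:
  assumes s: "0 \<le> s" and F: "F \<in> sets (coord_space s)" and B: "B \<in> sets path_space"
  shows "emeasure (PX x) (F \<inter> (path_shift s -` B \<inter> cadlag_paths))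
       = (\<integral>\<^sup>+\<omega>. indicator F \<omega> * emeasure (PX (\<omega> s)) B \<partial>PX x)"
proof -
  interpret prob_space "PX x" by (rule PX_prob)
  have F'[measurable]: "F \<in> sets path_space" using F sets_coord_space_path_space by blast
  let ?D = "density (PX x) (indicator F)"
  have sh: "path_shift s \<in> ?D \<rightarrow>\<^sub>M path_space" using measurable_shift[OF s] by simp
  have K: "(\<lambda>\<omega>. PX (\<omega> s)) \<in> ?D \<rightarrow>\<^sub>M subprob_algebra path_space"
    using measurable_prob_algebraD[OF PX_kernel_eval] by simp
  have ne: "space ?D \<noteq> {}" using not_empty by simp
  have e1: "emeasure (distr ?D path_space (path_shift s)) B = emeasure (PX x) (F \<inter> (path_shift s -` B \<inter> cadlag_paths))"
    if B: "B \<in> sets path_space" for B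
  proof -
    have C: "path_shift s -` B \<inter> cadlag_paths \<in> sets (PX x)"
      using measurable_sets[OF measurable_shift[OF s] B] by (simp add: PX_sets)
    have "emeasure (distr ?D path_space (path_shift s)) B = emeasure ?D (path_shift s -` B \<inter> cadlag_paths)"
      by (simp add: emeasure_distr[OF sh B])
    also have "\<dots> = (\<integral>\<^sup>+\<omega>. indicator (F \<inter> (path_shift s -` B \<inter> cadlag_paths)) \<omega> \<partial>PX x)"
      using C unfolding indicator_inter_arith[of F] by (intro emeasure_density) (auto simp: PX_sets)
    also have "\<dots> = emeasure (PX x) (F \<inter> (path_shift s -` B \<inter> cadlag_paths))"
      using F' C by (intro nn_integral_indicator) (auto simp: PX_sets)
    finally show ?thesis .
  qed
  have e2: "emeasure (?D \<bind> (\<lambda>\<omega>. PX (\<omega> s))) B = (\<integral>\<^sup>+\<omega>. indicator F \<omega> * emeasure (PX (\<omega> s)) B \<partial>PX x)"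
    if B: "B \<in> sets path_space" for B
    unfolding emeasure_bind[OF ne K B]
    using F' measurable_emeasure_kernel[OF K B] by (subst nn_integral_density) auto
  have "distr ?D path_space (path_shift s) = ?D \<bind> (\<lambda>\<omega>. PX (\<omega> s))"
  proof (rule measure_eqI_generator_eq[OF Int_stable_cyls cyls_subset, where A = "\<lambda>_. cyl {} (\<lambda>_. UNIV)"])
    fix X :: "(real \<Rightarrow> 'a) set" assume X: "X \<in> cyls"
    then have "X \<in> sets path_space" unfolding cyls_def using cyl_sets by blast
    with X show "emeasure (distr ?D path_space (path_shift s)) X = emeasure (?D \<bind> (\<lambda>\<omega>. PX (\<omega> s))) X"
      using markov_cyl(2)[OF _ _ _ s F, of _ _ x] by (auto simp: e1 e2 cyls_def)
  next
    show "sets (distr ?D path_space (path_shift s)) = sigma_sets cadlag_paths cyls"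
      by (simp add: sets_path_space_cyls)
    show "sets (?D \<bind> (\<lambda>\<omega>. PX (\<omega> s))) = sigma_sets cadlag_paths cyls"
      using sets_bind[OF sets_kernel[OF K] ne] by (simp add: sets_path_space_cyls)
    show "range (\<lambda>_. cyl {} (\<lambda>_. UNIV)) \<subseteq> cyls" unfolding cyls_def by fastforce
    show "(\<Union>i. cyl {} (\<lambda>_. UNIV)) = cadlag_paths" by (simp add: cyl_def)
    fix i :: nat
    have "cyl {} (\<lambda>_. UNIV) \<in> sets (path_space :: (real \<Rightarrow> 'a) measure)" by (rule cyl_sets) auto
    then have "emeasure (distr ?D path_space (path_shift s)) (cyl {} (\<lambda>_. UNIV)) \<le> 1"
      by (simp add: e1 emeasure_le_1)
    then show "emeasure (distr ?D path_space (path_shift s)) (cyl {} (\<lambda>_. UNIV)) \<noteq> \<infinity>" by (auto simp: top_unique)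
  qed
  then show ?thesis using e1[OF B] e2[OF B] by simp
qed

text \<open>A functional may depend on past and future together. The joint law of the path and its
  shift is compared with the law obtained by attaching to \<open>\<omega>\<close> a fresh path
  started at \<open>\<omega> s\<close>; on rectangles this is \<open>markov_sets\<close>. The factor
  \<open>coord_space s\<close> restricts the first argument to the past.\<close>

lemma markov_shift_nn:
  fixes h :: "(real \<Rightarrow> 'a) \<times> (real \<Rightarrow> 'a) \<Rightarrow> ennreal"
  assumes s: "0 \<le> s" and h: "h \<in> borel_measurable (coord_space s \<Otimes>\<^sub>M path_space)"
  shows "(\<integral>\<^sup>+\<omega>. h (\<omega>, path_shift s \<omega>) \<partial>PX x) = (\<integral>\<^sup>+\<omega>. \<integral>\<^sup>+\<omega>'. h (\<omega>, \<omega>') \<partial>PX (\<omega> s) \<partial>PX x)"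
proof -
  interpret prob_space "PX x" by (rule PX_prob)
  let ?N = "coord_space s \<Otimes>\<^sub>M path_space :: ((real \<Rightarrow> 'a) \<times> (real \<Rightarrow> 'a)) measure"
  let ?K = "\<lambda>\<omega>. distr (PX (\<omega> s)) ?N (\<lambda>\<omega>'. (\<omega>, \<omega>'))"
  have id: "(\<lambda>\<omega>. \<omega>) \<in> PX x \<rightarrow>\<^sub>M coord_space s"
    using measurable_coord_path[of "\<lambda>\<omega>. \<omega>" s "coord_space s"] by simp
  have map: "(\<lambda>\<omega>. (\<omega>, path_shift s \<omega>)) \<in> PX x \<rightarrow>\<^sub>M ?N"
    using measurable_shift[OF s] by (intro measurable_Pair id) simp
  have K: "?K \<in> PX x \<rightarrow>\<^sub>M subprob_algebra ?N"
  proof (rule measurable_distr2[where M = path_space])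
    have "(\<lambda>(\<omega>, \<omega>'). (\<omega>, \<omega>')) \<in> coord_space s \<Otimes>\<^sub>M path_space \<rightarrow>\<^sub>M ?N" by simp
    moreover have "(\<lambda>x. (fst x, snd x)) \<in> PX x \<Otimes>\<^sub>M path_space \<rightarrow>\<^sub>M ?N"
      by (intro measurable_Pair measurable_compose[OF measurable_fst id] measurable_snd)
    ultimately show "(\<lambda>(\<omega>, y). (\<omega>, y)) \<in> PX x \<Otimes>\<^sub>M path_space \<rightarrow>\<^sub>M ?N" by (simp add: case_prod_beta')
    show "(\<lambda>\<omega>. PX (\<omega> s)) \<in> PX x \<rightarrow>\<^sub>M subprob_algebra path_space"
      using measurable_prob_algebraD[OF PX_kernel_eval] by simp
  qed
  have ne: "space (PX x) \<noteq> {}" by (rule not_empty)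
  have pair: "(\<lambda>\<omega>'. (\<omega>, \<omega>')) \<in> PX z \<rightarrow>\<^sub>M ?N" if "\<omega> \<in> cadlag_paths" for \<omega> z
    using that measurable_Pair1'[of \<omega> "coord_space s" path_space] by simp
  have "distr (PX x) ?N (\<lambda>\<omega>. (\<omega>, path_shift s \<omega>)) = PX x \<bind> ?K"
  proof (rule measure_eqI_generator_eq[OF Int_stable_pair_measure_generator[of "coord_space s" path_space],
        where A = "\<lambda>_. cadlag_paths \<times> cadlag_paths"])
    show "{a \<times> b |a b. a \<in> sets (coord_space s) \<and> b \<in> sets path_space}
       \<subseteq> Pow (cadlag_paths \<times> (cadlag_paths :: (real \<Rightarrow> 'a) set))"
      using pair_measure_closed[of "coord_space s" path_space] by simp
    fix X :: "((real \<Rightarrow> 'a) \<times> (real \<Rightarrow> 'a)) set"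
    assume "X \<in> {a \<times> b |a b. a \<in> sets (coord_space s) \<and> b \<in> sets path_space}"
    then obtain F B where X: "X = F \<times> B" and F: "F \<in> sets (coord_space s)" and B: "B \<in> sets path_space" by auto
    have X': "X \<in> sets ?N" using F B X by auto
    have "emeasure (distr (PX x) ?N (\<lambda>\<omega>. (\<omega>, path_shift s \<omega>))) X = emeasure (PX x) (F \<inter> (path_shift s -` B \<inter> cadlag_paths))"
      unfolding emeasure_distr[OF map X'] by (intro arg_cong[where f = "emeasure (PX x)"]) (auto simp: X)
    also have "\<dots> = (\<integral>\<^sup>+\<omega>. indicator F \<omega> * emeasure (PX (\<omega> s)) B \<partial>PX x)" by (rule markov_sets[OF s F B])
    also have "\<dots> = (\<integral>\<^sup>+\<omega>. emeasure (?K \<omega>) X \<partial>PX x)"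
    proof (intro nn_integral_cong)
      fix \<omega> assume "\<omega> \<in> space (PX x)"
      then have "emeasure (?K \<omega>) X = emeasure (PX (\<omega> s)) ((\<lambda>\<omega>'. (\<omega>, \<omega>')) -` X \<inter> space (PX (\<omega> s)))"
        by (intro emeasure_distr pair X') simp
      also have "(\<lambda>\<omega>'. (\<omega>, \<omega>')) -` X \<inter> space (PX (\<omega> s)) = (if \<omega> \<in> F then B else {})"
        using sets.sets_into_space[OF B] by (auto simp: X)
      finally show "indicator F \<omega> * emeasure (PX (\<omega> s)) B = emeasure (?K \<omega>) X" by simp
    qed
    also have "\<dots> = emeasure (PX x \<bind> ?K) X" by (rule emeasure_bind[OF ne K X', symmetric])
    finally show "emeasure (distr (PX x) ?N (\<lambda>\<omega>. (\<omega>, path_shift s \<omega>))) X = emeasure (PX x \<bind> ?K) X" .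
  next
    show "sets (distr (PX x) ?N (\<lambda>\<omega>. (\<omega>, path_shift s \<omega>))) =
      sigma_sets (cadlag_paths \<times> cadlag_paths) {a \<times> b |a b. a \<in> sets (coord_space s) \<and> b \<in> sets path_space}"
      by (simp add: sets_pair_measure)
    show "sets (PX x \<bind> ?K) =
      sigma_sets (cadlag_paths \<times> cadlag_paths) {a \<times> b |a b. a \<in> sets (coord_space s) \<and> b \<in> sets path_space}"
      using sets_bind[OF sets_kernel[OF K] ne] by (simp add: sets_pair_measure)
    show "range (\<lambda>_. cadlag_paths \<times> cadlag_paths) \<subseteq> {a \<times> b |a b. a \<in> sets (coord_space s) \<and> b \<in> sets (path_space :: (real \<Rightarrow> 'a) measure)}"
      using sets.top[of "coord_space s"] sets.top[of "path_space"] by fastforce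
    show "(\<Union>i. cadlag_paths \<times> cadlag_paths) = cadlag_paths \<times> cadlag_paths" by simp
    fix i :: nat
    show "emeasure (distr (PX x) ?N (\<lambda>\<omega>. (\<omega>, path_shift s \<omega>))) (cadlag_paths \<times> cadlag_paths) \<noteq> \<infinity>"
      using finite_measure.emeasure_finite[OF prob_space.finite_measure[OF prob_space_distr[OF map]]] by simp
  qed
  then have "(\<integral>\<^sup>+z. h z \<partial>distr (PX x) ?N (\<lambda>\<omega>. (\<omega>, path_shift s \<omega>))) = (\<integral>\<^sup>+z. h z \<partial>(PX x \<bind> ?K))" by simp
  then show ?thesis
    unfolding nn_integral_bind[OF h K]
    using nn_integral_distr[OF pair, of _ h] nn_integral_distr[OF map, of h] h
    by (auto intro!: nn_integral_cong)
qed

lemma markov_shift: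
  fixes h :: "(real \<Rightarrow> 'a) \<times> (real \<Rightarrow> 'a) \<Rightarrow> real"
  assumes s: "0 \<le> s" and h: "h \<in> borel_measurable (coord_space s \<Otimes>\<^sub>M path_space)"
    and bd: "\<And>\<omega> \<omega>'. \<omega> \<in> cadlag_paths \<Longrightarrow> \<omega>' \<in> cadlag_paths \<Longrightarrow> 0 \<le> h (\<omega>, \<omega>') \<and> h (\<omega>, \<omega>') \<le> C"
  shows "(\<integral>\<omega>. h (\<omega>, path_shift s \<omega>) \<partial>PX x) = (\<integral>\<omega>. \<integral>\<omega>'. h (\<omega>, \<omega>') \<partial>PX (\<omega> s) \<partial>PX x)"
    and "(\<lambda>\<omega>. \<integral>\<omega>'. h (\<omega>, \<omega>') \<partial>PX (\<omega> s)) \<in> borel_measurable path_space"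
proof -
  have id: "(\<lambda>\<omega>. \<omega>) \<in> path_space \<rightarrow>\<^sub>M coord_space s"
    using measurable_coord_path[of "\<lambda>\<omega>. \<omega>" s "coord_space s"] by simp
  have h1: "(\<lambda>\<omega>. h (\<omega>, path_shift s \<omega>)) \<in> borel_measurable path_space"
    by (rule measurable_compose[OF _ h]) (intro measurable_Pair id measurable_shift s)
  have "(\<lambda>x. (fst x, snd x)) \<in> path_space \<Otimes>\<^sub>M path_space \<rightarrow>\<^sub>M coord_space s \<Otimes>\<^sub>M (path_space :: (real \<Rightarrow> 'a) measure)"
    by (intro measurable_Pair measurable_compose[OF measurable_fst id] measurable_snd)
  from measurable_compose[OF this h]
  have hm: "(\<lambda>(\<omega>, \<omega>'). h (\<omega>, \<omega>')) \<in> borel_measurable (path_space \<Otimes>\<^sub>M path_space)"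
    by (simp add: case_prod_beta')
  have h2: "(\<lambda>\<omega>'. h (\<omega>, \<omega>')) \<in> borel_measurable path_space" if "\<omega> \<in> cadlag_paths" for \<omega>
    using measurable_Pair2[OF h, of \<omega>] that by simp
  have "(\<lambda>(\<omega>, \<omega>'). ennreal (h (\<omega>, \<omega>'))) \<in> borel_measurable (path_space \<Otimes>\<^sub>M path_space)"
    using hm by (simp add: case_prod_beta')
  note nn_integral_measurable_subprob_algebra2[OF this measurable_prob_algebraD[OF PX_kernel_eval]]
  then have "(\<lambda>\<omega>. enn2real (\<integral>\<^sup>+\<omega>'. ennreal (h (\<omega>, \<omega>')) \<partial>PX (\<omega> s))) \<in> borel_measurable path_space"
    by measurable
  then show m: "(\<lambda>\<omega>. \<integral>\<omega>'. h (\<omega>, \<omega>') \<partial>PX (\<omega> s)) \<in> borel_measurable path_space"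
    by (rule measurable_cong[THEN iffD1, rotated])
       (auto intro!: integral_eq_nn_integral[symmetric] h2 AE_I2 simp: bd)
  have int: "integrable (PX z) f" if "f \<in> borel_measurable path_space"
    "\<And>\<omega>. \<omega> \<in> cadlag_paths \<Longrightarrow> 0 \<le> f \<omega> \<and> f \<omega> \<le> C" for f z
  proof -
    interpret prob_space "PX z" by (rule PX_prob)
    show ?thesis by (rule integrable_const_bound[where B = C]) (use that in auto)
  qed
  have b: "0 \<le> (\<integral>\<omega>'. h (\<omega>, \<omega>') \<partial>PX z)" "(\<integral>\<omega>'. h (\<omega>, \<omega>') \<partial>PX z) \<le> C" if "\<omega> \<in> cadlag_paths" for \<omega> z
  proof -
    interpret prob_space "PX z" by (rule PX_prob)
    show "0 \<le> (\<integral>\<omega>'. h (\<omega>, \<omega>') \<partial>PX z)"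
      by (rule Bochner_Integration.integral_nonneg_AE) (use bd[OF that] in auto)
    show "(\<integral>\<omega>'. h (\<omega>, \<omega>') \<partial>PX z) \<le> C"
      by (rule integral_le_const[OF int[OF h2[OF that]]]) (use bd[OF that] in auto)
  qed
  have "ennreal (\<integral>\<omega>. h (\<omega>, path_shift s \<omega>) \<partial>PX x) = (\<integral>\<^sup>+\<omega>. ennreal (h (\<omega>, path_shift s \<omega>)) \<partial>PX x)"
    using bd shift_cadlag[OF _ s] by (intro nn_integral_eq_integral[symmetric] int h1) auto
  also have "\<dots> = (\<integral>\<^sup>+\<omega>. \<integral>\<^sup>+\<omega>'. ennreal (h (\<omega>, \<omega>')) \<partial>PX (\<omega> s) \<partial>PX x)"
    by (rule markov_shift_nn[OF s]) (use h in simp)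
  also have "\<dots> = (\<integral>\<^sup>+\<omega>. ennreal (\<integral>\<omega>'. h (\<omega>, \<omega>') \<partial>PX (\<omega> s)) \<partial>PX x)"
    by (intro nn_integral_cong nn_integral_eq_integral int h2) (use bd in auto)
  also have "\<dots> = ennreal (\<integral>\<omega>. \<integral>\<omega>'. h (\<omega>, \<omega>') \<partial>PX (\<omega> s) \<partial>PX x)"
    using b by (intro nn_integral_eq_integral int m) auto
  finally show "(\<integral>\<omega>. h (\<omega>, path_shift s \<omega>) \<partial>PX x) = (\<integral>\<omega>. \<integral>\<omega>'. h (\<omega>, \<omega>') \<partial>PX (\<omega> s) \<partial>PX x)"
    by (subst (asm) ennreal_inj)
       (auto intro!: Bochner_Integration.integral_nonneg_AE AE_I2 simp: b bd shift_cadlag[OF _ s])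
qed

end

section \<open>Feynman-Kac operators\<close>

lemma fubini_Icc:
  fixes g :: "'b \<times> real \<Rightarrow> real"
  assumes M: "prob_space M" and g [measurable]: "g \<in> borel_measurable (M \<Otimes>\<^sub>M borel)"
    and bd: "\<And>x r. x \<in> space M \<Longrightarrow> \<bar>g (x, r)\<bar> \<le> C"
  shows "(\<integral>x. (LBINT r:{a..b}. g (x, r)) \<partial>M) = (LBINT r:{a..b}. \<integral>x. g (x, r) \<partial>M)"
    and "integrable M (\<lambda>x. LBINT r:{a..b}. g (x, r))"
    and "(\<lambda>r. \<integral>x. g (x, r) \<partial>M) \<in> borel_measurable borel"
proof -
  interpret prob_space M by (rule M)
  interpret pair_sigma_finite M lborel ..
  have [measurable]: "g \<in> borel_measurable (M \<Otimes>\<^sub>M lborel)" using g by simp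
  let ?f = "\<lambda>x r. indicator {a..b} r *\<^sub>R g (x, r)"
  have int: "integrable (M \<Otimes>\<^sub>M lborel) (case_prod ?f)"
  proof (rule integrableI_bounded_set[where A = "space M \<times> {a..b}" and B = C])
    show "emeasure (M \<Otimes>\<^sub>M lborel) (space M \<times> {a..b}) < \<infinity>"
      by (subst lborel.emeasure_pair_measure_Times) (auto simp: emeasure_space_1 emeasure_lborel_Icc_eq)
    show "AE x in M \<Otimes>\<^sub>M lborel. x \<in> space M \<times> {a..b} \<longrightarrow> norm (case x of (x, r) \<Rightarrow> ?f x r) \<le> C"
      by (rule AE_I2) (auto simp: space_pair_measure bd)
    show "(\<lambda>(x, r). ?f x r) \<in> borel_measurable (M \<Otimes>\<^sub>M lborel)" by measurable
    show "AE x in M \<Otimes>\<^sub>M lborel. x \<notin> space M \<times> {a..b} \<longrightarrow> (case x of (x, r) \<Rightarrow> ?f x r) = 0"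
      by (rule AE_I2) (auto simp: space_pair_measure indicator_def split: if_splits)
  qed auto
  from Fubini_integral[OF int]
  show "(\<integral>x. (LBINT r:{a..b}. g (x, r)) \<partial>M) = (LBINT r:{a..b}. \<integral>x. g (x, r) \<partial>M)"
    by (simp add: set_lebesgue_integral_def)
  show "integrable M (\<lambda>x. LBINT r:{a..b}. g (x, r))"
    using integrable_fst[OF int] by (simp add: set_lebesgue_integral_def)
  have "(\<lambda>r. \<integral>x. g (x, r) \<partial>M) \<in> borel_measurable lborel" by measurable
  then show "(\<lambda>r. \<integral>x. g (x, r) \<partial>M) \<in> borel_measurable borel" by simp
qed

lemma measurable_eval_joint_path:
  assumes "0 \<le> s"
  shows "(\<lambda>x. fst x (max 0 (min (snd x) s))) \<in> path_space \<Otimes>\<^sub>M borel \<rightarrow>\<^sub>M (borel :: 'a::polish_space measure)"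
proof -
  have id: "(\<lambda>\<omega>. \<omega>) \<in> path_space \<rightarrow>\<^sub>M (coord_space s :: (real \<Rightarrow> 'a) measure)"
    using measurable_coord_path[of "\<lambda>\<omega>. \<omega>" s "coord_space s"] by simp
  have "(\<lambda>x. (fst x, snd x)) \<in> path_space \<Otimes>\<^sub>M borel \<rightarrow>\<^sub>M (coord_space s :: (real \<Rightarrow> 'a) measure) \<Otimes>\<^sub>M (borel :: real measure)"
    by (intro measurable_Pair measurable_compose[OF measurable_fst id] measurable_snd)
  from measurable_compose[OF this measurable_eval_joint[OF assms]] show ?thesis
    by (simp add: case_prod_beta')
qed

lemma abs_exp_minus_one_le:
  fixes z :: real assumes "\<bar>z\<bar> \<le> 1" shows "\<bar>exp z - 1 - z\<bar> \<le> z\<^sup>2"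
proof (cases "0 \<le> z")
  case True
  then show ?thesis using exp_bound[of z] exp_ge_add_one_self[of z] assms by linarith
next
  case False
  have "exp (-z) \<ge> 1 - z" using exp_ge_add_one_self[of "-z"] by simp
  then have "inverse (exp (-z)) \<le> inverse (1 - z)" using False by (intro le_imp_inverse_le) auto
  then have "exp z \<le> inverse (1 - z)" by (simp add: exp_minus)
  also have "\<dots> \<le> 1 + z + z\<^sup>2"
  proof -
    have "1 \<le> (1 + z + z\<^sup>2) * (1 - z)"
    proof -
      have "(1 + z + z\<^sup>2) * (1 - z) = 1 - z^3" by (simp add: algebra_simps power2_eq_square power3_eq_cube)
      moreover have "z ^ 3 \<le> 0" using False by (simp add: power_le_zero_eq)
      ultimately show ?thesis by linarith
    qed
    then show ?thesis using False by (simp add: inverse_eq_divide divide_le_eq)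
  qed
  finally show ?thesis using exp_ge_add_one_self[of z] by linarith
qed

lemma ln_diff_ge:
  fixes A B :: real
  assumes "0 < \<kappa>" "\<kappa> \<le> A" "\<kappa> \<le> B" shows "ln B - \<bar>A - B\<bar> / \<kappa> \<le> ln A"
proof -
  have "ln (B / A) \<le> B / A - 1" using assms by (intro ln_le_minus_one) auto
  then have "ln B - ln A \<le> (B - A) / A" using assms by (simp add: ln_div field_simps)
  also have "\<dots> \<le> \<bar>A - B\<bar> / A" using assms by (intro divide_right_mono) auto
  also have "\<dots> \<le> \<bar>A - B\<bar> / \<kappa>" using assms by (intro divide_left_mono) auto
  finally show ?thesis by linarith
qed

context markov_family
begin

definition FK :: "('a \<Rightarrow> real) \<Rightarrow> real \<Rightarrow> ('a \<Rightarrow> real) \<Rightarrow> 'a \<Rightarrow> real" where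
  "FK V t f x = (\<integral>\<omega>. exp (Sint V t \<omega>) * f (\<omega> t) \<partial>PX x)"

text \<open>Defined through the path law, hence meaningful at every point of the Polish space; on
  \<open>E\<close> it coincides with \<open>pf\<close> (\<open>Pt_eq_pf\<close>).\<close>

definition Pt :: "real \<Rightarrow> ('a \<Rightarrow> real) \<Rightarrow> 'a \<Rightarrow> real" where
  "Pt t f x = (\<integral>\<omega>. f (\<omega> t) \<partial>PX x)"

lemma Ex_measurable:
  fixes g :: "(real \<Rightarrow> 'a) \<Rightarrow> real"
  assumes "g \<in> borel_measurable path_space" shows "(\<lambda>x. \<integral>\<omega>. g \<omega> \<partial>PX x) \<in> borel_measurable borel"
  using measurable_compose[OF measurable_prob_algebraD[OF PX_kernel]
      integral_measurable_subprob_algebra[OF assms]] .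

lemma Ex_integrable:
  fixes g :: "(real \<Rightarrow> 'a) \<Rightarrow> real"
  assumes "g \<in> borel_measurable path_space" "\<And>\<omega>. \<omega> \<in> cadlag_paths \<Longrightarrow> \<bar>g \<omega>\<bar> \<le> C"
  shows "integrable (PX x) g"
proof -
  interpret prob_space "PX x" by (rule PX_prob)
  show ?thesis by (rule integrable_const_bound[where B = C]) (use assms in auto)
qed

lemma Ex_mono:
  fixes f g :: "(real \<Rightarrow> 'a) \<Rightarrow> real"
  assumes "g \<in> borel_measurable path_space" "\<And>\<omega>. \<omega> \<in> cadlag_paths \<Longrightarrow> \<bar>g \<omega>\<bar> \<le> C"
    "f \<in> borel_measurable path_space" "\<And>\<omega>. \<omega> \<in> cadlag_paths \<Longrightarrow> \<bar>f \<omega>\<bar> \<le> C'"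
    "\<And>\<omega>. \<omega> \<in> cadlag_paths \<Longrightarrow> f \<omega> \<le> g \<omega>"
  shows "(\<integral>\<omega>. f \<omega> \<partial>PX x) \<le> (\<integral>\<omega>. g \<omega> \<partial>PX x)"
  by (rule Bochner_Integration.integral_mono[OF Ex_integrable[OF assms(3,4)] Ex_integrable[OF assms(1,2)]])
     (use assms(5) in auto)

lemma Ex_bounds:
  fixes g :: "(real \<Rightarrow> 'a) \<Rightarrow> real"
  assumes "g \<in> borel_measurable path_space" "\<And>\<omega>. \<omega> \<in> cadlag_paths \<Longrightarrow> c \<le> g \<omega> \<and> g \<omega> \<le> C"
  shows "c \<le> (\<integral>\<omega>. g \<omega> \<partial>PX x)" "(\<integral>\<omega>. g \<omega> \<partial>PX x) \<le> C"
proof -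
  interpret prob_space "PX x" by (rule PX_prob)
  have "integrable (PX x) g"
  proof (rule Ex_integrable[OF assms(1)])
    show "\<bar>g \<omega>\<bar> \<le> max \<bar>c\<bar> \<bar>C\<bar>" if "\<omega> \<in> cadlag_paths" for \<omega> using assms(2)[OF that] by linarith
  qed
  then show "c \<le> (\<integral>\<omega>. g \<omega> \<partial>PX x)" "(\<integral>\<omega>. g \<omega> \<partial>PX x) \<le> C"
    using assms(2) by (auto intro!: integral_ge_const integral_le_const AE_I2)
qed

lemma measurable_comp_eval:
  "f \<in> borel_measurable borel \<Longrightarrow> (\<lambda>\<omega>. f (\<omega> t)) \<in> borel_measurable path_space"
  by (rule measurable_compose[OF measurable_eval])

lemma FK_integrand_measurable:
  fixes V :: "'a \<Rightarrow> real"
  assumes "V \<in> borel_measurable borel" "f \<in> borel_measurable borel"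
  shows "(\<lambda>\<omega>. exp (Sint V t \<omega>) * f (\<omega> t)) \<in> borel_measurable path_space"
  by (intro borel_measurable_times measurable_compose[OF Sint_measurable[OF assms(1)] borel_measurable_exp]
      measurable_comp_eval assms(2))

lemma FK_measurable:
  assumes "V \<in> borel_measurable borel" "f \<in> borel_measurable borel"
  shows "FK V t f \<in> borel_measurable borel"
  unfolding FK_def[abs_def] by (intro Ex_measurable FK_integrand_measurable assms)

lemma Pt_measurable:
  assumes "f \<in> borel_measurable borel" shows "Pt t f \<in> borel_measurable borel"
  unfolding Pt_def[abs_def] by (intro Ex_measurable measurable_comp_eval assms)

lemma exp_Sint_bounds:
  fixes V :: "'a \<Rightarrow> real"
  assumes "V \<in> borel_measurable borel" "\<And>x. \<bar>V x\<bar> \<le> K" "0 \<le> t" "\<omega> \<in> cadlag_paths"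
  shows "exp (- K * t) \<le> exp (Sint V t \<omega>)" "exp (Sint V t \<omega>) \<le> exp (K * t)"
  using Sint_bound[OF assms(1,2,4,3)] by (auto simp: abs_le_iff)

lemma FK_bounds:
  assumes "V \<in> borel_measurable borel" "\<And>x. \<bar>V x\<bar> \<le> K" "0 \<le> t"
    and "f \<in> borel_measurable borel" "\<And>x. c \<le> f x \<and> f x \<le> C" "0 \<le> c"
  shows "c * exp (- K * t) \<le> FK V t f x" "FK V t f x \<le> C * exp (K * t)"
proof -
  have "c * exp (- K * t) \<le> exp (Sint V t \<omega>) * f (\<omega> t) \<and> exp (Sint V t \<omega>) * f (\<omega> t) \<le> C * exp (K * t)"
    if "\<omega> \<in> cadlag_paths" for \<omega>
  proof -
    note e = exp_Sint_bounds[OF assms(1,2,3) that]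
    have "c * exp (- K * t) \<le> f (\<omega> t) * exp (Sint V t \<omega>)"
      using e(1) assms(5)[of "\<omega> t"] assms(6) by (intro mult_mono) auto
    moreover have "f (\<omega> t) * exp (Sint V t \<omega>) \<le> C * exp (K * t)"
      using e(2) assms(5)[of "\<omega> t"] assms(6) by (intro mult_mono) auto
    ultimately show ?thesis by (simp add: mult.commute)
  qed
  note b = Ex_bounds[OF FK_integrand_measurable[OF assms(1,4)] this]
  show "c * exp (- K * t) \<le> FK V t f x" unfolding FK_def by (rule b(1))
  show "FK V t f x \<le> C * exp (K * t)" unfolding FK_def by (rule b(2))
qed

lemma Pt_bounds:
  assumes "f \<in> borel_measurable borel" "\<And>x. c \<le> f x \<and> f x \<le> C"
  shows "c \<le> Pt t f x" "Pt t f x \<le> C"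
  unfolding Pt_def by (rule Ex_bounds[OF measurable_comp_eval[OF assms(1)]], rule assms(2))+

lemma FK_add:
  assumes V: "V \<in> borel_measurable borel" "\<And>x. \<bar>V x\<bar> \<le> K" and st: "0 \<le> s" "0 \<le> t"
    and f: "f \<in> borel_measurable borel" "\<And>x. 0 \<le> f x \<and> f x \<le> C"
  shows "FK V (s + t) f x = FK V s (FK V t f) x"
proof -
  define h where "h = (\<lambda>(\<omega>, \<omega>'). exp (Sint V s \<omega>) * (exp (Sint V t \<omega>') * f (\<omega>' t)))"
  have [measurable]: "h \<in> borel_measurable (coord_space s \<Otimes>\<^sub>M path_space)"
    unfolding h_def case_prod_beta'
    by (intro borel_measurable_times
        measurable_compose[OF measurable_compose[OF measurable_fst Sint_measurable_coord[OF V(1) st(1)]] borel_measurable_exp]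
        measurable_compose[OF measurable_compose[OF measurable_snd Sint_measurable[OF V(1)]] borel_measurable_exp]
        measurable_compose[OF measurable_snd measurable_comp_eval[OF f(1)]])
  have bd: "0 \<le> h (\<omega>, \<omega>') \<and> h (\<omega>, \<omega>') \<le> exp (K * s) * (exp (K * t) * C)"
    if "\<omega> \<in> cadlag_paths" "\<omega>' \<in> cadlag_paths" for \<omega> \<omega>'
    using exp_Sint_bounds(2)[OF V st(1) that(1)] exp_Sint_bounds(2)[OF V st(2) that(2)] f(2)[of "\<omega>' t"]
    unfolding h_def by (auto intro!: mult_mono)
  have "FK V (s + t) f x = (\<integral>\<omega>. h (\<omega>, path_shift s \<omega>) \<partial>PX x)"
    unfolding FK_def h_def
    by (intro Bochner_Integration.integral_cong refl)
       (use st in \<open>simp add: Sint_add[OF V _ st] exp_add path_shift_def\<close>)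
  also have "\<dots> = (\<integral>\<omega>. \<integral>\<omega>'. h (\<omega>, \<omega>') \<partial>PX (\<omega> s) \<partial>PX x)"
    by (rule markov_shift(1)[OF st(1), where C = "exp (K * s) * (exp (K * t) * C)"]) (measurable, rule bd)
  also have "\<dots> = FK V s (FK V t f) x" by (simp add: h_def FK_def)
  finally show ?thesis .
qed

lemma FK_0:
  assumes f: "f \<in> borel_measurable borel" shows "FK V 0 f x = f x"
proof -
  interpret prob_space "PX x" by (rule PX_prob)
  have "Sint V 0 \<omega> = 0" for \<omega>
  proof -
    have "AE r in lborel. indicator {0..0::real} r *\<^sub>R V (\<omega> r) = 0"
      using AE_lborel_singleton[of "0::real"] by eventually_elim auto
    then show ?thesis unfolding Sint_def set_lebesgue_integral_def by (simp add: integral_eq_zero_AE)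
  qed
  then have "FK V 0 f x = (\<integral>\<omega>. f (\<omega> 0) \<partial>PX x)" by (simp add: FK_def)
  also have "\<dots> = (\<integral>\<omega>. f x \<partial>PX x)"
    by (rule integral_cong_AE) (use start[of x] f in \<open>auto simp: measurable_comp_eval\<close>)
  finally show ?thesis using prob_space by simp
qed

end

section \<open>The entropy inequality\<close>

text \<open>Interface between the probabilistic part and the rate function. \<open>I\<close> takes
  the place of a finite I(\<mu>). \<open>Pt_continuous\<close> is what strong continuity on L2(m)
  leaves after passing to \<open>\<mu>\<close>. \<open>entropy_step\<close> is the integrated rate
  inequality: formally the derivative of \<open>ln (Pt h w)\<close> in \<open>h\<close> is
  \<open>L v / v\<close> with \<open>v = Pt h w\<close>, whose \<open>\<mu>\<close>-integral is at
  least \<open>- I\<close>.\<close>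

locale donsker_varadhan = markov_family PX \<kappa>
  for PX :: "'a::polish_space \<Rightarrow> (real \<Rightarrow> 'a) measure" and \<kappa> :: "real \<Rightarrow> 'a \<Rightarrow> 'a measure" +
  fixes \<mu> :: "'a measure" and I :: real
  assumes \<mu>_prob: "prob_space \<mu>" and \<mu>_sets: "sets \<mu> = sets borel"
    and I_nonneg: "0 \<le> I"
    and Pt_continuous: "f \<in> borel_measurable borel \<Longrightarrow> (\<And>x. \<bar>f x\<bar> \<le> C) \<Longrightarrow>
      ((\<lambda>s. \<integral>x. \<bar>Pt s f x - f x\<bar> \<partial>\<mu>) \<longlongrightarrow> 0) (at_right 0)"
    and entropy_step: "0 \<le> h \<Longrightarrow> w \<in> borel_measurable borel \<Longrightarrow> 0 < c \<Longrightarrow> (\<And>x. c \<le> w x \<and> w x \<le> C) \<Longrightarrow>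
      - I * h \<le> (\<integral>x. ln (Pt h w x) - ln (w x) \<partial>\<mu>)"
begin

lemma \<mu>_measurable [simp]: "\<mu> \<rightarrow>\<^sub>M N = borel \<rightarrow>\<^sub>M N"
  by (rule measurable_cong_sets[OF \<mu>_sets refl])

lemma \<mu>_integrable:
  fixes g :: "'a \<Rightarrow> real"
  assumes "g \<in> borel_measurable borel" "\<And>x. \<bar>g x\<bar> \<le> C" shows "integrable \<mu> g"
proof -
  interpret prob_space \<mu> by (rule \<mu>_prob)
  show ?thesis by (rule integrable_const_bound[where B = C]) (use assms in auto)
qed

definition \<nu> :: "(real \<Rightarrow> 'a) measure" where "\<nu> = \<mu> \<bind> PX"

lemma PX_kernel_\<mu>: "PX \<in> \<mu> \<rightarrow>\<^sub>M subprob_algebra path_space"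
  using measurable_prob_algebraD[OF PX_kernel] by simp

lemma \<nu>_sets: "sets \<nu> = sets path_space"
proof -
  interpret prob_space \<mu> by (rule \<mu>_prob)
  show ?thesis unfolding \<nu>_def using sets_bind[OF PX_sets not_empty] by simp
qed

lemma \<nu>_space [simp]: "space \<nu> = cadlag_paths"
  using sets_eq_imp_space_eq[OF \<nu>_sets] by simp

lemma \<nu>_measurable [simp]: "\<nu> \<rightarrow>\<^sub>M N = path_space \<rightarrow>\<^sub>M N"
  by (rule measurable_cong_sets[OF \<nu>_sets refl])

lemma \<nu>_prob: "prob_space \<nu>"
proof -
  interpret prob_space \<mu> by (rule \<mu>_prob)
  show ?thesis unfolding \<nu>_def by (rule prob_space_bind[OF _ PX_kernel_\<mu>]) (auto simp: PX_prob)
qed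

lemma \<nu>_integral:
  fixes g :: "(real \<Rightarrow> 'a) \<Rightarrow> real"
  assumes "g \<in> borel_measurable path_space" "\<And>\<omega>. \<omega> \<in> cadlag_paths \<Longrightarrow> \<bar>g \<omega>\<bar> \<le> C"
  shows "(\<integral>\<omega>. g \<omega> \<partial>\<nu>) = (\<integral>x. \<integral>\<omega>. g \<omega> \<partial>PX x \<partial>\<mu>)" "integrable \<nu> g"
proof -
  interpret prob_space \<mu> by (rule \<mu>_prob)
  have *: "AE x in \<mu>. emeasure (PX x) (space (PX x)) \<le> ennreal 1"
    using prob_space.emeasure_space_1[OF PX_prob] by simp
  show "(\<integral>\<omega>. g \<omega> \<partial>\<nu>) = (\<integral>x. \<integral>\<omega>. g \<omega> \<partial>PX x \<partial>\<mu>)" "integrable \<nu> g"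
    unfolding \<nu>_def
    using integral_bind[OF assms(1) _ PX_kernel_\<mu> finite_measure_axioms *] assms(2)
      integrable_bind[OF assms(1) _ PX_kernel_\<mu> finite_measure_axioms *] by auto
qed

text \<open>\<open>V\<close> is merely measurable, so continuity of paths is of no help, but the
  mean square is computable: \<open>sq\<close> expresses it by \<open>Pt r\<close> of
  \<open>V\<close> and of its square, and \<open>Pt_continuous\<close> applies to both. The
  inequality \<open>*\<close> passes from squares to absolute values.\<close>

lemma Pt_displacement:
  fixes V :: "'a \<Rightarrow> real"
  assumes V: "V \<in> borel_measurable borel" "\<And>x. \<bar>V x\<bar> \<le> K" and \<epsilon>: "0 < \<epsilon>"
  shows "\<exists>\<delta>>0. \<forall>r\<in>{0<..\<delta>}. (\<integral>\<omega>. \<bar>V (\<omega> r) - V (\<omega> 0)\<bar> \<partial>\<nu>) \<le> \<epsilon>"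
proof -
  have K: "0 \<le> K" using V(2)[of undefined] by linarith
  note [measurable] = V(1) measurable_eval
  have V2: "(\<lambda>x. (V x)\<^sup>2) \<in> borel_measurable borel" "\<bar>(V x)\<^sup>2\<bar> \<le> K\<^sup>2" for x
    using power_mono[OF V(2)[of x], of 2] by simp_all
  let ?a = "\<lambda>r. \<integral>x. \<bar>Pt r (\<lambda>x. (V x)\<^sup>2) x - (V x)\<^sup>2\<bar> \<partial>\<mu>" and ?b = "\<lambda>r. \<integral>x. \<bar>Pt r V x - V x\<bar> \<partial>\<mu>"
  have "((\<lambda>r. ?a r + 2 * K * ?b r) \<longlongrightarrow> 0 + 2 * K * 0) (at_right 0)"
    by (intro tendsto_intros Pt_continuous[OF V2] Pt_continuous[OF V])
  then have "((\<lambda>r. ?a r + 2 * K * ?b r) \<longlongrightarrow> 0) (at_right 0)" by simp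
  from order_tendstoD(2)[OF this, of "\<epsilon>\<^sup>2"] \<epsilon>
  obtain \<delta> where \<delta>: "0 < \<delta>" "\<And>r. 0 < r \<Longrightarrow> r < \<delta> \<Longrightarrow> ?a r + 2 * K * ?b r < \<epsilon>\<^sup>2"
    unfolding eventually_at_right_field by auto
  have main: "(\<integral>\<omega>. \<bar>V (\<omega> r) - V (\<omega> 0)\<bar> \<partial>\<nu>) \<le> \<epsilon>" if r: "0 < r" "r < \<delta>" for r
  proof -
    have bd: "\<bar>V (\<omega> r) - V (\<omega> 0)\<bar> \<le> 2 * K" for \<omega>
      using V(2)[of "\<omega> r"] V(2)[of "\<omega> 0"] by linarith
    have bd2: "(V (\<omega> r) - V (\<omega> 0))\<^sup>2 \<le> (2 * K)\<^sup>2" for \<omega>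
      using power_mono[OF bd, of \<omega> 2] by simp
    have *: "\<bar>V (\<omega> r) - V (\<omega> 0)\<bar> \<le> \<epsilon> / 2 + (V (\<omega> r) - V (\<omega> 0))\<^sup>2 / (2 * \<epsilon>)" for \<omega>
    proof -
      have "0 \<le> (\<bar>V (\<omega> r) - V (\<omega> 0)\<bar> - \<epsilon>)\<^sup>2" by simp
      also have "\<dots> = (V (\<omega> r) - V (\<omega> 0))\<^sup>2 - 2 * \<epsilon> * \<bar>V (\<omega> r) - V (\<omega> 0)\<bar> + \<epsilon>\<^sup>2"
        by (simp add: power2_diff)
      finally show ?thesis using \<epsilon> by (simp add: field_simps power2_eq_square)
    qed
    interpret N: prob_space \<nu> by (rule \<nu>_prob)
    have sq: "(\<integral>\<omega>. (V (\<omega> r) - V (\<omega> 0))\<^sup>2 \<partial>PX x)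
        = (Pt r (\<lambda>x. (V x)\<^sup>2) x - (V x)\<^sup>2) - 2 * V x * (Pt r V x - V x)" for x
    proof -
      interpret prob_space "PX x" by (rule PX_prob)
      have i: "integrable (PX x) (\<lambda>\<omega>. V (\<omega> r))" "integrable (PX x) (\<lambda>\<omega>. (V (\<omega> r))\<^sup>2)"
        by (rule Ex_integrable[of _ K], simp, rule V(2)) (rule Ex_integrable[of _ "K\<^sup>2"], simp, rule V2(2))
      have "(\<integral>\<omega>. (V (\<omega> r) - V (\<omega> 0))\<^sup>2 \<partial>PX x) = (\<integral>\<omega>. (V (\<omega> r))\<^sup>2 - 2 * V x * V (\<omega> r) + (V x)\<^sup>2 \<partial>PX x)"
      proof (rule integral_cong_AE)
        show "AE \<omega> in PX x. (V (\<omega> r) - V (\<omega> 0))\<^sup>2 = (V (\<omega> r))\<^sup>2 - 2 * V x * V (\<omega> r) + (V x)\<^sup>2"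
          using start[of x] by eventually_elim (simp add: power2_diff)
      qed auto
      also have "\<dots> = Pt r (\<lambda>x. (V x)\<^sup>2) x - 2 * V x * Pt r V x + (V x)\<^sup>2"
        unfolding Pt_def using i prob_space by simp
      finally show ?thesis by (simp add: algebra_simps power2_eq_square)
    qed
    have Ptb: "\<bar>Pt r V x\<bar> \<le> K" "\<bar>Pt r (\<lambda>x. (V x)\<^sup>2) x\<bar> \<le> K\<^sup>2" for x
    proof -
      have "- K \<le> V x \<and> V x \<le> K" for x using V(2)[of x] by linarith
      from Pt_bounds[OF V(1) this, of r x] show "\<bar>Pt r V x\<bar> \<le> K" by linarith
      have "0 \<le> (V x)\<^sup>2 \<and> (V x)\<^sup>2 \<le> K\<^sup>2" for x using V2(2)[of x] by simp
      from Pt_bounds[OF V2(1) this, of r x] show "\<bar>Pt r (\<lambda>x. (V x)\<^sup>2) x\<bar> \<le> K\<^sup>2" by linarith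
    qed
    have ia: "integrable \<mu> (\<lambda>x. \<bar>Pt r (\<lambda>x. (V x)\<^sup>2) x - (V x)\<^sup>2\<bar>)"
    proof (rule \<mu>_integrable[where C = "2 * K\<^sup>2"])
      show "\<bar>\<bar>Pt r (\<lambda>x. (V x)\<^sup>2) x - (V x)\<^sup>2\<bar>\<bar> \<le> 2 * K\<^sup>2" for x
        using Ptb(2)[of x] V2(2)[of x] by linarith
    qed (use Pt_measurable[OF V2(1)] in simp)
    have ib: "integrable \<mu> (\<lambda>x. \<bar>Pt r V x - V x\<bar>)"
    proof (rule \<mu>_integrable[where C = "2 * K"])
      show "\<bar>\<bar>Pt r V x - V x\<bar>\<bar> \<le> 2 * K" for x
        using Ptb(1)[of x] V(2)[of x] by linarith
    qed (use Pt_measurable[OF V(1)] in simp)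
    have "(\<integral>\<omega>. (V (\<omega> r) - V (\<omega> 0))\<^sup>2 \<partial>\<nu>) = (\<integral>x. \<integral>\<omega>. (V (\<omega> r) - V (\<omega> 0))\<^sup>2 \<partial>PX x \<partial>\<mu>)"
      by (rule \<nu>_integral[where C = "(2 * K)\<^sup>2"]) (use bd2 in auto)
    also have "\<dots> \<le> (\<integral>x. \<bar>Pt r (\<lambda>x. (V x)\<^sup>2) x - (V x)\<^sup>2\<bar> + 2 * K * \<bar>Pt r V x - V x\<bar> \<partial>\<mu>)"
    proof (rule Bochner_Integration.integral_mono)
      show "integrable \<mu> (\<lambda>x. \<integral>\<omega>. (V (\<omega> r) - V (\<omega> 0))\<^sup>2 \<partial>PX x)"
      proof (rule \<mu>_integrable[where C = "(2 * K)\<^sup>2"])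
        show "\<bar>\<integral>\<omega>. (V (\<omega> r) - V (\<omega> 0))\<^sup>2 \<partial>PX x\<bar> \<le> (2 * K)\<^sup>2" for x
          using Ex_bounds[of "\<lambda>\<omega>. (V (\<omega> r) - V (\<omega> 0))\<^sup>2" 0 "(2 * K)\<^sup>2" x] bd2 by (auto simp: abs_le_iff)
      qed (auto intro!: Ex_measurable)
      show "integrable \<mu> (\<lambda>x. \<bar>Pt r (\<lambda>x. (V x)\<^sup>2) x - (V x)\<^sup>2\<bar> + 2 * K * \<bar>Pt r V x - V x\<bar>)"
        using ia ib by simp
      fix x
      have "- 2 * V x * (Pt r V x - V x) \<le> \<bar>2 * V x * (Pt r V x - V x)\<bar>" by linarith
      also have "\<dots> = 2 * \<bar>V x\<bar> * \<bar>Pt r V x - V x\<bar>" by (simp add: abs_mult)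
      also have "\<dots> \<le> 2 * K * \<bar>Pt r V x - V x\<bar>" using V(2)[of x] by (intro mult_right_mono) auto
      finally show "(\<integral>\<omega>. (V (\<omega> r) - V (\<omega> 0))\<^sup>2 \<partial>PX x)
         \<le> \<bar>Pt r (\<lambda>x. (V x)\<^sup>2) x - (V x)\<^sup>2\<bar> + 2 * K * \<bar>Pt r V x - V x\<bar>"
        unfolding sq by linarith
    qed
    also have "\<dots> = ?a r + 2 * K * ?b r" using ia ib by simp
    also have "\<dots> \<le> \<epsilon>\<^sup>2" using \<delta>(2)[OF r] by simp
    finally have sqb: "(\<integral>\<omega>. (V (\<omega> r) - V (\<omega> 0))\<^sup>2 \<partial>\<nu>) \<le> \<epsilon>\<^sup>2" .
    have i1: "integrable \<nu> (\<lambda>\<omega>. (V (\<omega> r) - V (\<omega> 0))\<^sup>2)"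
      by (rule \<nu>_integral[where C = "(2 * K)\<^sup>2"]) (use bd2 in auto)
    have "(\<integral>\<omega>. \<bar>V (\<omega> r) - V (\<omega> 0)\<bar> \<partial>\<nu>) \<le> (\<integral>\<omega>. \<epsilon> / 2 + (V (\<omega> r) - V (\<omega> 0))\<^sup>2 / (2 * \<epsilon>) \<partial>\<nu>)"
    proof (rule Bochner_Integration.integral_mono)
      show "integrable \<nu> (\<lambda>\<omega>. \<bar>V (\<omega> r) - V (\<omega> 0)\<bar>)"
        by (rule \<nu>_integral[where C = "2 * K"]) (use bd in auto)
    qed (use i1 * in auto)
    also have "\<dots> = \<epsilon> / 2 + (\<integral>\<omega>. (V (\<omega> r) - V (\<omega> 0))\<^sup>2 \<partial>\<nu>) / (2 * \<epsilon>)"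
      using i1 N.prob_space by simp
    also have "\<dots> \<le> \<epsilon> / 2 + \<epsilon>\<^sup>2 / (2 * \<epsilon>)"
      using sqb \<epsilon> by (intro add_left_mono divide_right_mono) auto
    also have "\<dots> = \<epsilon>" using \<epsilon> by (simp add: power2_eq_square)
    finally show ?thesis .
  qed
  show ?thesis by (rule exI[of _ "\<delta> / 2"]) (use \<delta>(1) main in auto)
qed

text \<open>Error of the first-order expansion of the Feynman-Kac weight at the starting point. Its
  mean under \<open>\<nu>\<close> is o(h) by \<open>disp_small\<close>.\<close>

definition disp :: "('a \<Rightarrow> real) \<Rightarrow> real \<Rightarrow> (real \<Rightarrow> 'a) \<Rightarrow> real" where
  "disp V h \<omega> = \<bar>exp (Sint V h \<omega>) - 1 - h * V (\<omega> 0)\<bar>"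

lemma disp_measurable: "V \<in> borel_measurable borel \<Longrightarrow> disp V h \<in> borel_measurable path_space"
  unfolding disp_def[abs_def]
  by (intro borel_measurable_abs borel_measurable_diff borel_measurable_times
      measurable_compose[OF Sint_measurable borel_measurable_exp] measurable_comp_eval) auto

lemma disp_bound:
  assumes V: "V \<in> borel_measurable borel" "\<And>x. \<bar>V x\<bar> \<le> K" and h: "0 \<le> h" "K * h \<le> 1" and \<omega>: "\<omega> \<in> cadlag_paths"
  shows "disp V h \<omega> \<le> (LBINT r:{0..h}. \<bar>V (\<omega> r) - V (\<omega> 0)\<bar>) + (K * h)\<^sup>2" "disp V h \<omega> \<le> 3"
proof -
  have S: "\<bar>Sint V h \<omega>\<bar> \<le> K * h" by (rule Sint_bound[OF V \<omega> h(1)])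
  have e: "\<bar>exp (Sint V h \<omega>) - 1 - Sint V h \<omega>\<bar> \<le> (Sint V h \<omega>)\<^sup>2"
    by (rule abs_exp_minus_one_le) (use S h in linarith)
  have S2: "(Sint V h \<omega>)\<^sup>2 \<le> (K * h)\<^sup>2" using power_mono[OF S, of 2] by simp
  have m: "(\<lambda>r. V (\<omega> r)) \<in> borel_measurable borel"
    by (rule measurable_compose[OF cadlag_borel[OF \<omega>] V(1)])
  have i: "set_integrable lborel {0..h} (\<lambda>r. V (\<omega> r))"
    by (rule set_integrable_bounded_Icc[OF m, of K]) (rule V(2))
  have "h * V (\<omega> 0) = (LBINT r:{0..h}. V (\<omega> 0))" using h by (simp add: set_lebesgue_integral_def)
  then have "Sint V h \<omega> - h * V (\<omega> 0) = (LBINT r:{0..h}. V (\<omega> r)) - (LBINT r:{0..h}. V (\<omega> 0))"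
    by (simp add: Sint_def)
  also have "\<dots> = (LBINT r:{0..h}. V (\<omega> r) - V (\<omega> 0))"
    by (rule set_integral_diff(2)[symmetric, OF i]) (auto intro!: set_integrable_bounded_Icc[of _ "\<bar>V (\<omega> 0)\<bar>"])
  finally have "\<bar>Sint V h \<omega> - h * V (\<omega> 0)\<bar> \<le> (LBINT r:{0..h}. \<bar>V (\<omega> r) - V (\<omega> 0)\<bar>)"
    unfolding set_lebesgue_integral_def
    using integral_abs_bound[of lborel "\<lambda>x. indicator {0..h} x *\<^sub>R (V (\<omega> x) - V (\<omega> 0))"] by (simp add: abs_mult)
  then show "disp V h \<omega> \<le> (LBINT r:{0..h}. \<bar>V (\<omega> r) - V (\<omega> 0)\<bar>) + (K * h)\<^sup>2"
    using e S2 unfolding disp_def by linarith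
  have "\<bar>h * V (\<omega> 0)\<bar> \<le> K * h" using mult_left_mono[OF V(2)[of "\<omega> 0"] h(1)] h(1) by (simp add: abs_mult mult.commute)
  moreover have "(K * h)\<^sup>2 \<le> 1" using S h by (intro power_le_one) auto
  ultimately show "disp V h \<omega> \<le> 3" using e S2 S h unfolding disp_def by linarith
qed

text \<open>The error splits into the time integral of the displacement, small in mean by Fubini and
  \<open>Pt_displacement\<close>, and the remainder of the exponential series, which is quadratic in
  \<open>h\<close>.\<close>

lemma disp_small:
  assumes V: "V \<in> borel_measurable borel" "\<And>x. \<bar>V x\<bar> \<le> K" and \<epsilon>: "0 < \<epsilon>"
  shows "\<exists>\<delta>>0. \<forall>h\<in>{0<..\<delta>}. (\<integral>\<omega>. disp V h \<omega> \<partial>\<nu>) \<le> \<epsilon> * h"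
proof -
  have K: "0 \<le> K" using V(2)[of undefined] by linarith
  obtain \<delta> where \<delta>: "0 < \<delta>" "\<And>r. 0 < r \<Longrightarrow> r \<le> \<delta> \<Longrightarrow> (\<integral>\<omega>. \<bar>V (\<omega> r) - V (\<omega> 0)\<bar> \<partial>\<nu>) \<le> \<epsilon> / 2"
    using Pt_displacement[OF V, of "\<epsilon> / 2"] \<epsilon> by auto
  \<comment> \<open>The three bounds make the displacement small, give \<open>K * h \<le> 1\<close>
    as \<open>disp_bound\<close> demands, and keep the quadratic remainder below
    \<open>\<epsilon> / 2 * h\<close>; \<open>K + 1\<close> avoids a zero denominator.\<close>
  define \<delta>' where "\<delta>' = min \<delta> (min (1 / (K + 1)) (\<epsilon> / (2 * (K + 1)\<^sup>2)))"
  have pos: "0 < \<delta>'" using \<delta> K \<epsilon> by (simp add: \<delta>'_def)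
  interpret N: prob_space \<nu> by (rule \<nu>_prob)
  have main: "(\<integral>\<omega>. disp V h \<omega> \<partial>\<nu>) \<le> \<epsilon> * h" if h: "0 < h" "h \<le> \<delta>'" for h
  proof -
    have h0: "h \<le> \<delta>" "h \<le> 1 / (K + 1)" "h \<le> \<epsilon> / (2 * (K + 1)\<^sup>2)" using h(2) unfolding \<delta>'_def by auto
    have h1: "(K + 1) * h \<le> 1" using h0(2) K by (simp add: pos_le_divide_eq mult.commute)
    then have h2: "K * h \<le> 1" using h by (simp add: algebra_simps)
    have h3: "(K + 1)\<^sup>2 * h \<le> \<epsilon> / 2" using h0(3) K by (simp add: pos_le_divide_eq mult_ac)
    let ?g = "\<lambda>(\<omega>, r). \<bar>V (\<omega> (max 0 (min r h))) - V (\<omega> 0)\<bar>"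
    have j [measurable]: "(\<lambda>x. fst x (max 0 (min (snd x) h))) \<in> path_space \<Otimes>\<^sub>M borel \<rightarrow>\<^sub>M (borel :: 'a measure)"
      by (rule measurable_eval_joint_path) (use h in simp)
    note V(1)[measurable] measurable_eval[measurable]
    have "?g \<in> borel_measurable (path_space \<Otimes>\<^sub>M borel)"
      unfolding case_prod_beta' by measurable
    then have g: "?g \<in> borel_measurable (\<nu> \<Otimes>\<^sub>M borel)"
      using measurable_cong_sets[OF sets_pair_measure_cong[OF \<nu>_sets refl] refl] by blast
    have bd: "\<bar>?g (\<omega>, r)\<bar> \<le> 2 * K" for \<omega> r
      using V(2)[of "\<omega> (max 0 (min r h))"] V(2)[of "\<omega> 0"] by simp
    note F = fubini_Icc(1)[OF \<nu>_prob g bd, of 0 h] fubini_Icc(2)[OF \<nu>_prob g bd, of 0 h]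
      fubini_Icc(3)[OF \<nu>_prob g bd]
    have eq: "(LBINT r:{0..h}. \<bar>V (\<omega> r) - V (\<omega> 0)\<bar>) = (LBINT r:{0..h}. ?g (\<omega>, r))" for \<omega>
      unfolding set_lebesgue_integral_def
      by (intro Bochner_Integration.integral_cong) (auto split: split_indicator)
    have "(\<integral>\<omega>. disp V h \<omega> \<partial>\<nu>) \<le> (\<integral>\<omega>. (LBINT r:{0..h}. ?g (\<omega>, r)) + (K * h)\<^sup>2 \<partial>\<nu>)"
    proof (rule Bochner_Integration.integral_mono)
      show "integrable \<nu> (disp V h)"
        by (rule \<nu>_integral(2)[OF disp_measurable[OF V(1)], where C = 3])
           (use disp_bound(2)[OF V _ h2] h in \<open>auto simp: disp_def\<close>)
      show "integrable \<nu> (\<lambda>\<omega>. (LBINT r:{0..h}. ?g (\<omega>, r)) + (K * h)\<^sup>2)" using F(2) by simp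
      fix \<omega> assume "\<omega> \<in> space \<nu>"
      then show "disp V h \<omega> \<le> (LBINT r:{0..h}. ?g (\<omega>, r)) + (K * h)\<^sup>2"
        using disp_bound(1)[OF V _ h2, of \<omega>] h unfolding eq by simp
    qed
    also have "\<dots> = (\<integral>\<omega>. (LBINT r:{0..h}. ?g (\<omega>, r)) \<partial>\<nu>) + (K * h)\<^sup>2"
      using F(2) N.prob_space by simp
    also have "(\<integral>\<omega>. (LBINT r:{0..h}. ?g (\<omega>, r)) \<partial>\<nu>) = (LBINT r:{0..h}. \<integral>\<omega>. ?g (\<omega>, r) \<partial>\<nu>)" by (rule F(1))
    also have "\<dots> \<le> (LBINT r:{0..h}. \<epsilon> / 2)"
    proof (rule set_integral_mono)
      have b0: "\<bar>\<integral>\<omega>. ?g (\<omega>, r) \<partial>\<nu>\<bar> \<le> 2 * K" for r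
      proof -
        have m: "(\<lambda>\<omega>. ?g (\<omega>, r)) \<in> borel_measurable \<nu>" by simp
        have "\<bar>\<integral>\<omega>. ?g (\<omega>, r) \<partial>\<nu>\<bar> \<le> (\<integral>\<omega>. \<bar>?g (\<omega>, r)\<bar> \<partial>\<nu>)" by (rule integral_abs_bound)
        also have "\<dots> \<le> 2 * K"
        proof (rule N.integral_le_const)
          show "integrable \<nu> (\<lambda>\<omega>. \<bar>?g (\<omega>, r)\<bar>)"
            by (rule N.integrable_const_bound[where B = "2 * K"]) (use m bd in auto)
        qed (use bd in auto)
        finally show ?thesis .
      qed
      show "set_integrable lborel {0..h} (\<lambda>r. \<integral>\<omega>. ?g (\<omega>, r) \<partial>\<nu>)"
        by (rule set_integrable_bounded_Icc[OF F(3) b0])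
      show "set_integrable lborel {0..h} (\<lambda>r. \<epsilon> / 2)"
        by (rule set_integrable_bounded_Icc[where C = "\<bar>\<epsilon> / 2\<bar>"]) auto
      fix r assume r: "r \<in> {0..h}"
      then show "(\<integral>\<omega>. ?g (\<omega>, r) \<partial>\<nu>) \<le> \<epsilon> / 2"
        using \<delta>(2)[of r] h0 \<epsilon> by (cases "r = 0") auto
    qed
    also have "(LBINT r:{0..h}. \<epsilon> / 2) = \<epsilon> / 2 * h" using h by (simp add: set_lebesgue_integral_def)
    also have "(K * h)\<^sup>2 \<le> (K + 1)\<^sup>2 * h * h"
      using K by (simp add: power2_eq_square algebra_simps)
    also have "(K + 1)\<^sup>2 * h * h \<le> \<epsilon> / 2 * h" using h3 h by (intro mult_right_mono) auto
    finally show ?thesis by simp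
  qed
  show ?thesis using pos main by auto
qed

end

context markov_family
begin

lemma FK_mono:
  assumes V: "V \<in> borel_measurable borel" "\<And>x. \<bar>V x\<bar> \<le> K" and t: "0 \<le> t"
    and f: "f \<in> borel_measurable borel" "\<And>x. 0 \<le> f x"
    and g: "g \<in> borel_measurable borel" "\<And>x. f x \<le> g x" "\<And>x. g x \<le> C"
  shows "FK V t f x \<le> FK V t g x"
  unfolding FK_def
proof (rule Ex_mono[OF FK_integrand_measurable[OF V(1) g(1)] _ FK_integrand_measurable[OF V(1) f(1)]])
  fix \<omega> :: "real \<Rightarrow> 'a" assume \<omega>: "\<omega> \<in> cadlag_paths"
  note e = exp_Sint_bounds[OF V t \<omega>]
  have f0: "0 \<le> f (\<omega> t)" "f (\<omega> t) \<le> g (\<omega> t)" "g (\<omega> t) \<le> C" using f(2) g(2,3) by auto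
  have "exp (Sint V t \<omega>) * g (\<omega> t) \<le> exp (K * t) * C"
    using e f0 by (intro mult_mono) auto
  then show "\<bar>exp (Sint V t \<omega>) * g (\<omega> t)\<bar> \<le> exp (K * t) * C" using f0 by (simp add: abs_mult)
  have "exp (Sint V t \<omega>) * f (\<omega> t) \<le> exp (K * t) * C"
    using e f0 by (intro mult_mono) auto
  then show "\<bar>exp (Sint V t \<omega>) * f (\<omega> t)\<bar> \<le> exp (K * t) * C" using f0 by (simp add: abs_mult)
  show "exp (Sint V t \<omega>) * f (\<omega> t) \<le> exp (Sint V t \<omega>) * g (\<omega> t)" using f0 by simp
qed

end

context donsker_varadhan
begin

text \<open>The step is compared with \<open>(1 + h * V x) * Pt h w x\<close>; the difference is at
  most \<open>C\<close> times the mean of \<open>disp\<close>. As \<open>K * h \<le> 1 / 2\<close>,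
  both quantities are at least \<open>c / 2\<close>, where \<open>ln\<close> has Lipschitz constant
  \<open>2 / c\<close>, and \<open>ln (1 + y) \<ge> y - 2 * y\<^sup>2\<close> treats the first
  factor.\<close>

lemma FK_step:
  assumes V: "V \<in> borel_measurable borel" "\<And>x. \<bar>V x\<bar> \<le> K" and h: "0 < h" "K * h \<le> 1 / 2"
    and w: "w \<in> borel_measurable borel" "\<And>x. c \<le> w x \<and> w x \<le> C" and c: "0 < c"
  shows "ln (Pt h w x) + h * V x - 2 * (K * h)\<^sup>2 - 2 * C / c * (\<integral>\<omega>. disp V h \<omega> \<partial>PX x) \<le> ln (FK V h w x)"
proof -
  have Kh: "\<bar>h * V x\<bar> \<le> K * h" using mult_left_mono[OF V(2)[of x], of h] h(1) by (simp add: abs_mult mult.commute)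
  have C: "0 < C" using w(2)[of x] c by linarith
  define A where "A = FK V h w x"
  define B where "B = Pt h w x"
  define B' where "B' = (1 + h * V x) * B"
  have B: "c \<le> B" "B \<le> C" unfolding B_def using Pt_bounds[OF w, of h x] by auto
  have "c * (1 / 2) \<le> c * exp (- K * h)"
  proof (intro mult_left_mono)
    show "1 / 2 \<le> exp (- K * h)" using exp_ge_add_one_self[of "- K * h"] h(2) by simp
  qed (use c in simp)
  also have "\<dots> \<le> A" unfolding A_def by (rule FK_bounds(1)[OF V _ w]) (use h c in auto)
  finally have A: "c / 2 \<le> A" by simp
  have "(1 / 2) * c \<le> (1 + h * V x) * B"
    using Kh h(2) B c by (intro mult_mono) auto
  then have B': "c / 2 \<le> B'" by (simp add: B'_def)
  have m1: "(\<lambda>\<omega>. exp (Sint V h \<omega>) * w (\<omega> h)) \<in> borel_measurable path_space"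
    by (rule FK_integrand_measurable[OF V(1) w(1)])
  have i1: "integrable (PX x) (\<lambda>\<omega>. exp (Sint V h \<omega>) * w (\<omega> h))"
  proof (rule Ex_integrable[OF m1])
    fix \<omega> :: "real \<Rightarrow> 'a" assume \<omega>: "\<omega> \<in> cadlag_paths"
    have "exp (Sint V h \<omega>) * w (\<omega> h) \<le> exp (K * h) * C"
      using exp_Sint_bounds(2)[OF V _ \<omega>, of h] h w(2)[of "\<omega> h"] c by (intro mult_mono) auto
    then show "\<bar>exp (Sint V h \<omega>) * w (\<omega> h)\<bar> \<le> exp (K * h) * C" using w(2)[of "\<omega> h"] c by (simp add: abs_mult)
  qed
  have i2: "integrable (PX x) (\<lambda>\<omega>. w (\<omega> h))"
    by (rule Ex_integrable[OF measurable_comp_eval[OF w(1)], where C = C]) (use w(2) c in \<open>smt (verit)\<close>)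
  have i3: "integrable (PX x) (disp V h)"
    by (rule Ex_integrable[OF disp_measurable[OF V(1)], where C = 3])
       (use disp_bound(2)[OF V _ _] h in \<open>auto simp: disp_def\<close>)
  have "A - B' = (\<integral>\<omega>. exp (Sint V h \<omega>) * w (\<omega> h) - (1 + h * V x) * w (\<omega> h) \<partial>PX x)"
    using i1 i2 by (simp add: A_def B_def B'_def FK_def Pt_def)
  also have "\<bar>\<dots>\<bar> \<le> (\<integral>\<omega>. \<bar>exp (Sint V h \<omega>) * w (\<omega> h) - (1 + h * V x) * w (\<omega> h)\<bar> \<partial>PX x)"
    by (rule integral_abs_bound)
  also have "\<dots> \<le> (\<integral>\<omega>. disp V h \<omega> * C \<partial>PX x)"
  proof (rule integral_mono_AE)
    show "AE \<omega> in PX x. \<bar>exp (Sint V h \<omega>) * w (\<omega> h) - (1 + h * V x) * w (\<omega> h)\<bar> \<le> disp V h \<omega> * C"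
      using start[of x]
    proof eventually_elim
      case (elim \<omega>)
      have "exp (Sint V h \<omega>) * w (\<omega> h) - (1 + h * V x) * w (\<omega> h) = (exp (Sint V h \<omega>) - 1 - h * V x) * w (\<omega> h)"
        by (simp add: algebra_simps)
      then have "\<bar>exp (Sint V h \<omega>) * w (\<omega> h) - (1 + h * V x) * w (\<omega> h)\<bar> = disp V h \<omega> * \<bar>w (\<omega> h)\<bar>"
        by (simp add: abs_mult disp_def elim)
      also have "\<dots> \<le> disp V h \<omega> * C" using w(2)[of "\<omega> h"] c by (intro mult_left_mono) (auto simp: disp_def)
      finally show ?case .
    qed
  qed (use i1 i2 i3 in auto)
  finally have AB: "\<bar>A - B'\<bar> \<le> C * (\<integral>\<omega>. disp V h \<omega> \<partial>PX x)" using i3 by (simp add: mult.commute)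
  have "ln B' - \<bar>A - B'\<bar> / (c / 2) \<le> ln A" by (rule ln_diff_ge) (use c A B' in auto)
  moreover have "\<bar>A - B'\<bar> / (c / 2) \<le> 2 * C / c * (\<integral>\<omega>. disp V h \<omega> \<partial>PX x)"
    using divide_right_mono[OF AB, of "c / 2"] c by (simp add: field_simps)
  moreover have "ln B' = ln (1 + h * V x) + ln B"
    unfolding B'_def using B c Kh h by (intro ln_mult_pos) auto
  moreover have "\<bar>ln (1 + h * V x) - h * V x\<bar> \<le> 2 * (h * V x)\<^sup>2"
    by (rule abs_ln_one_plus_x_minus_x_bound) (use Kh h in linarith)
  moreover have "(h * V x)\<^sup>2 \<le> (K * h)\<^sup>2" using power_mono[OF Kh, of 2] by simp
  ultimately show ?thesis unfolding A_def B_def by linarith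
qed

lemma ln_integrable:
  fixes f :: "'a \<Rightarrow> real"
  assumes "f \<in> borel_measurable borel" "\<And>x. c \<le> f x \<and> f x \<le> C" "0 < c"
  shows "integrable \<mu> (\<lambda>x. ln (f x))"
proof (rule \<mu>_integrable)
  show "(\<lambda>x. ln (f x)) \<in> borel_measurable borel" using assms(1) by simp
  show "\<bar>ln (f x)\<bar> \<le> \<bar>ln c\<bar> + \<bar>ln C\<bar>" for x
    using assms(2)[of x] assms(3) ln_mono[of c "f x"] ln_mono[of "f x" C] by linarith
qed

lemma FK_entropy_step:
  assumes V: "V \<in> borel_measurable borel" "\<And>x. \<bar>V x\<bar> \<le> K" and h: "0 < h" "K * h \<le> 1 / 2"
    and w: "w \<in> borel_measurable borel" "\<And>x. c \<le> w x \<and> w x \<le> C" and c: "0 < c"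
  shows "h * (\<integral>x. V x \<partial>\<mu>) - I * h - 2 * (K * h)\<^sup>2 - 2 * C / c * (\<integral>\<omega>. disp V h \<omega> \<partial>\<nu>)
    \<le> (\<integral>x. ln (FK V h w x) - ln (w x) \<partial>\<mu>)"
proof -
  interpret M: prob_space \<mu> by (rule \<mu>_prob)
  have K: "0 \<le> K" using V(2)[of undefined] by linarith
  have b: "c * exp (- K * h) \<le> FK V h w x \<and> FK V h w x \<le> C * exp (K * h)" for x
    using FK_bounds[OF V _ w, of h x] h c by auto
  have i1: "integrable \<mu> (\<lambda>x. ln (FK V h w x))"
    by (rule ln_integrable[OF FK_measurable[OF V(1) w(1)] b]) (use c in simp)
  have i2: "integrable \<mu> (\<lambda>x. ln (w x))" by (rule ln_integrable[OF w c])
  have i3: "integrable \<mu> (\<lambda>x. ln (Pt h w x))"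
    by (rule ln_integrable[OF Pt_measurable[OF w(1)] _ c, of _ C]) (use Pt_bounds[OF w] in auto)
  have i4: "integrable \<mu> V" by (rule \<mu>_integrable[OF V])
  have d: "0 \<le> disp V h \<omega> \<and> disp V h \<omega> \<le> 3" if "\<omega> \<in> cadlag_paths" for \<omega>
    using disp_bound(2)[OF V _ _ that, of h] h by (auto simp: disp_def)
  have i5: "integrable \<mu> (\<lambda>x. \<integral>\<omega>. disp V h \<omega> \<partial>PX x)"
  proof (rule \<mu>_integrable[OF Ex_measurable[OF disp_measurable[OF V(1)]], where C = 3])
    show "\<bar>\<integral>\<omega>. disp V h \<omega> \<partial>PX x\<bar> \<le> 3" for x
      using Ex_bounds[OF disp_measurable[OF V(1)] d, of x] by linarith
  qed
  have n: "(\<integral>\<omega>. disp V h \<omega> \<partial>\<nu>) = (\<integral>x. \<integral>\<omega>. disp V h \<omega> \<partial>PX x \<partial>\<mu>)"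
    by (rule \<nu>_integral(1)[OF disp_measurable[OF V(1)], where C = 3]) (use d in auto)
  have "- I * h \<le> (\<integral>x. ln (Pt h w x) - ln (w x) \<partial>\<mu>)"
    by (rule entropy_step[OF _ w(1) c w(2)]) (use h in simp)
  then have "h * (\<integral>x. V x \<partial>\<mu>) - I * h - 2 * (K * h)\<^sup>2 - 2 * C / c * (\<integral>\<omega>. disp V h \<omega> \<partial>\<nu>)
     \<le> (\<integral>x. ln (Pt h w x) + h * V x - 2 * (K * h)\<^sup>2 - 2 * C / c * (\<integral>\<omega>. disp V h \<omega> \<partial>PX x) - ln (w x) \<partial>\<mu>)"
    using i2 i3 i4 i5 M.prob_space unfolding n by simp
  also have "\<dots> \<le> (\<integral>x. ln (FK V h w x) - ln (w x) \<partial>\<mu>)"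
  proof (rule Bochner_Integration.integral_mono)
    fix x
    show "ln (Pt h w x) + h * V x - 2 * (K * h)\<^sup>2 - 2 * C / c * (\<integral>\<omega>. disp V h \<omega> \<partial>PX x) - ln (w x)
        \<le> ln (FK V h w x) - ln (w x)"
      using FK_step[OF V h w c, of x] by linarith
  qed (use i1 i2 i3 i4 i5 in auto)
  finally show ?thesis .
qed

text \<open>Telescoping over \<open>n\<close> steps of length \<open>h = 1 / n\<close>: each step
  gains \<open>h\<close> times the left-hand side up to o(h), so the total error can be made smaller
  than any \<open>e\<close>. The intermediate functions \<open>w k\<close> share their positive
  bounds because the total time is at most \<open>1\<close>.\<close>

proposition FK_entropy:
  assumes V: "V \<in> borel_measurable borel" "\<And>x. \<bar>V x\<bar> \<le> K"
    and u: "u \<in> borel_measurable borel" "\<And>x. c \<le> u x \<and> u x \<le> C" and c: "0 < c"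
  shows "(\<integral>x. V x \<partial>\<mu>) - I \<le> (\<integral>x. ln (FK V 1 u x) - ln (u x) \<partial>\<mu>)"
proof (rule field_le_epsilon)
  fix e :: real assume e: "0 < e"
  have K: "0 \<le> K" using V(2)[of undefined] by linarith
  have C: "0 < C" using u(2)[of undefined] c by linarith
  define c' where "c' = c * exp (- K)"
  define C' where "C' = C * exp K"
  have c': "0 < c'" "0 < C'" using c C by (auto simp: c'_def C'_def)
  \<comment> \<open>Collects the error of one step in units of \<open>\<eta> * h\<close>: the
    quadratic part, the part from \<open>disp\<close>, and \<open>1\<close> for a positive divisor
    of \<open>e\<close>.\<close>
  define M where "M = 2 * K\<^sup>2 + 2 * C' / c' + 1"
  have M: "0 < M" using c' by (simp add: M_def add_nonneg_pos)
  define \<eta> where "\<eta> = e / M"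
  have \<eta>: "0 < \<eta>" using e M by (simp add: \<eta>_def)
  obtain \<delta> where \<delta>: "0 < \<delta>" "\<And>h. 0 < h \<Longrightarrow> h \<le> \<delta> \<Longrightarrow> (\<integral>\<omega>. disp V h \<omega> \<partial>\<nu>) \<le> \<eta> * h"
    using disp_small[OF V \<eta>] by auto
  obtain n :: nat where n: "max (1 / \<delta>) (max (2 * K) (1 / \<eta>)) < real n" using reals_Archimedean2 by blast
  then have n0: "0 < real n" using \<delta>(1) by (smt (verit) divide_pos_pos max.cobounded1)
  define h where "h = 1 / real n"
  have h: "0 < h" "h \<le> \<delta>" "K * h \<le> 1 / 2" "h \<le> \<eta>" "real n * h = 1"
    using n n0 \<delta>(1) \<eta> by (auto simp: h_def field_simps)
  define w where "w k = FK V (real k * h) u" for k :: nat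
  have wm: "w k \<in> borel_measurable borel" for k unfolding w_def by (rule FK_measurable[OF V(1) u(1)])
  have wb: "c' \<le> w k x \<and> w k x \<le> C'" if "k \<le> n" for k x
  proof -
    have kh: "0 \<le> real k * h" "real k * h \<le> 1"
      using h mult_right_mono[of "real k" "real n" h] that by auto
    have "c' \<le> c * exp (- K * (real k * h))"
      unfolding c'_def using mult_left_mono[OF kh(2) K] c by (intro mult_left_mono) auto
    also have "\<dots> \<le> w k x" unfolding w_def by (rule FK_bounds(1)[OF V kh(1) u]) (use c in simp)
    finally have 1: "c' \<le> w k x" .
    have "w k x \<le> C * exp (K * (real k * h))" unfolding w_def by (rule FK_bounds(2)[OF V kh(1) u]) (use c in simp)
    also have "\<dots> \<le> C'" unfolding C'_def using mult_left_mono[OF kh(2) K] C by (intro mult_left_mono) auto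
    finally show ?thesis using 1 by simp
  qed
  have lw: "integrable \<mu> (\<lambda>x. ln (w k x))" if "k \<le> n" for k
    by (rule ln_integrable[OF wm wb[OF that] c'(1)])
  have u0: "0 \<le> u x \<and> u x \<le> C" for x using u(2)[of x] c by linarith
  have wS: "w (Suc k) x = FK V h (w k) x" for k x
  proof -
    have "w (Suc k) x = FK V (h + real k * h) u x" by (simp add: w_def algebra_simps)
    also have "\<dots> = FK V h (FK V (real k * h) u) x"
      by (rule FK_add[OF V _ _ u(1), of _ _ C]) (use h u0 in auto)
    finally show ?thesis by (simp add: w_def)
  qed
  define D where "D = h * (\<integral>x. V x \<partial>\<mu>) - I * h - M * \<eta> * h"
  have step: "D \<le> (\<integral>x. ln (w (Suc k) x) \<partial>\<mu>) - (\<integral>x. ln (w k x) \<partial>\<mu>)" if k: "Suc k \<le> n" for k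
  proof -
    have "h * (\<integral>x. V x \<partial>\<mu>) - I * h - 2 * (K * h)\<^sup>2 - 2 * C' / c' * (\<integral>\<omega>. disp V h \<omega> \<partial>\<nu>)
       \<le> (\<integral>x. ln (FK V h (w k) x) - ln (w k x) \<partial>\<mu>)"
      by (rule FK_entropy_step[OF V h(1,3) wm wb c'(1)]) (use k in simp)
    also have "\<dots> = (\<integral>x. ln (w (Suc k) x) \<partial>\<mu>) - (\<integral>x. ln (w k x) \<partial>\<mu>)"
      using lw[of "Suc k"] lw[of k] k by (simp add: wS[abs_def])
    finally have 1: "h * (\<integral>x. V x \<partial>\<mu>) - I * h - 2 * (K * h)\<^sup>2 - 2 * C' / c' * (\<integral>\<omega>. disp V h \<omega> \<partial>\<nu>)
       \<le> (\<integral>x. ln (w (Suc k) x) \<partial>\<mu>) - (\<integral>x. ln (w k x) \<partial>\<mu>)" .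
    have 2: "2 * C' / c' * (\<integral>\<omega>. disp V h \<omega> \<partial>\<nu>) \<le> 2 * C' / c' * (\<eta> * h)"
      using \<delta>(2)[OF h(1,2)] c' by (intro mult_left_mono) auto
    have "2 * (K * h)\<^sup>2 = 2 * K\<^sup>2 * h * h" by (simp add: power2_eq_square)
    also have "\<dots> \<le> 2 * K\<^sup>2 * \<eta> * h" using h by (intro mult_right_mono mult_left_mono) auto
    finally have 3: "2 * (K * h)\<^sup>2 \<le> 2 * K\<^sup>2 * \<eta> * h" .
    have "2 * K\<^sup>2 * \<eta> * h + 2 * C' / c' * (\<eta> * h) + \<eta> * h = M * \<eta> * h"
      by (simp add: M_def algebra_simps)
    moreover have "0 \<le> \<eta> * h" using \<eta> h by simp
    ultimately show ?thesis using 1 2 3 unfolding D_def by linarith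
  qed
  have "real k * D \<le> (\<integral>x. ln (w k x) \<partial>\<mu>) - (\<integral>x. ln (w 0 x) \<partial>\<mu>)" if "k \<le> n" for k
    using that
  proof (induction k)
    case (Suc k)
    then show ?case using step[of k] by (simp add: algebra_simps)
  qed simp
  from this[of n] have "real n * D \<le> (\<integral>x. ln (w n x) \<partial>\<mu>) - (\<integral>x. ln (w 0 x) \<partial>\<mu>)" by simp
  also have "\<dots> = (\<integral>x. ln (FK V 1 u x) - ln (u x) \<partial>\<mu>)"
    using lw[of n] lw[of 0] h(5) by (simp add: w_def FK_0[OF u(1)])
  also have "real n * D = (real n * h) * ((\<integral>x. V x \<partial>\<mu>) - I - M * \<eta>)" by (simp add: D_def algebra_simps)
  also have "\<dots> = (\<integral>x. V x \<partial>\<mu>) - I - e" using h(5) M by (simp add: \<eta>_def)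
  finally show "(\<integral>x. V x \<partial>\<mu>) - I \<le> (\<integral>x. ln (FK V 1 u x) - ln (u x) \<partial>\<mu>) + e" by simp
qed

text \<open>A multiplicative form of Garsia's argument for the maximal ergodic theorem: with
  \<open>u = min\<^sub>k\<^sub>\<le>\<^sub>N e\<^sup>-\<^sup>a\<^sup>k P\<^sub>k 1\<close> one has \<open>P\<^sub>1 u \<le> e\<^sup>a u\<close> wherever the minimum is below \<open>1\<close>.\<close>
proposition exponential_growth_set:
  assumes V: "V \<in> borel_measurable borel" "\<And>x. \<bar>V x\<bar> \<le> K" and a: "a < (\<integral>x. V x \<partial>\<mu>) - I"
  defines "G \<equiv> {x. \<forall>n::nat. exp (a * real n) \<le> FK V (real n) (\<lambda>_. 1) x}"
  shows "G \<in> sets borel" "0 < measure \<mu> G"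
proof -
  interpret M: prob_space \<mu> by (rule \<mu>_prob)
  have K: "0 \<le> K" using V(2)[of undefined] by linarith
  define \<phi> where "\<phi> n x = exp (- a * real n) * FK V (real n) (\<lambda>_. 1) x" for n :: nat and x
  have \<phi>m [measurable]: "\<phi> n \<in> borel_measurable borel" for n
    unfolding \<phi>_def[abs_def] by (intro borel_measurable_times FK_measurable V borel_measurable_const)
  have \<phi>b: "0 < \<phi> n x" "\<phi> n x \<le> exp ((\<bar>a\<bar> + K) * real n)" "exp (- (\<bar>a\<bar> + K) * real n) \<le> \<phi> n x" for n x
  proof -
    note b = FK_bounds[OF V, of "real n" "\<lambda>_. 1" 1 1 x]
    have e: "exp (- \<bar>a\<bar> * real n) \<le> exp (- a * real n)" "exp (- a * real n) \<le> exp (\<bar>a\<bar> * real n)"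
      unfolding exp_le_cancel_iff by (intro mult_right_mono; simp)+
    have "exp (- \<bar>a\<bar> * real n) * exp (- K * real n) \<le> \<phi> n x"
      unfolding \<phi>_def using b(1) e by (intro mult_mono) auto
    then show 1: "exp (- (\<bar>a\<bar> + K) * real n) \<le> \<phi> n x" by (simp add: exp_add[symmetric] algebra_simps)
    then show "0 < \<phi> n x" by (rule less_le_trans[OF exp_gt_zero])
    have "exp (- K * real n) \<le> FK V (real n) (\<lambda>_. 1) x" using b(1) by simp
    then have "0 \<le> FK V (real n) (\<lambda>_. 1) x" by (rule order_trans[OF exp_ge_zero])
    then have "\<phi> n x \<le> exp (\<bar>a\<bar> * real n) * exp (K * real n)"
      unfolding \<phi>_def using b(2) e by (intro mult_mono) auto
    then show "\<phi> n x \<le> exp ((\<bar>a\<bar> + K) * real n)" by (simp only: exp_add[symmetric] distrib_right)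
  qed
  have \<phi>0: "\<phi> 0 x = 1" for x by (simp add: \<phi>_def FK_0)
  have G: "x \<in> G \<longleftrightarrow> (\<forall>n. 1 \<le> \<phi> n x)" for x
    unfolding G_def \<phi>_def by (auto simp: exp_minus field_simps)
  \<comment> \<open>The points where the minimum up to index \<open>N\<close> is already below
    \<open>1\<close>. These sets increase to the complement of \<open>G\<close>.\<close>
  define B where "B N = {x. \<exists>k\<le>N. \<phi> k x < 1}" for N
  have Bm: "B N \<in> sets borel" for N
  proof -
    have "B N = (\<Union>k\<in>{..N}. {x\<in>space borel. \<phi> k x < 1})" by (auto simp: B_def)
    also have "\<dots> \<in> sets borel" by (intro sets.finite_UN) auto
    finally show ?thesis .
  qed
  have UB: "(\<Union>N. B N) = - G" proof (rule set_eqI)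
    fix x
    have "x \<in> (\<Union>N. B N) \<longleftrightarrow> (\<exists>k. \<phi> k x < 1)" unfolding B_def by blast
    then show "x \<in> (\<Union>N. B N) \<longleftrightarrow> x \<in> - G" using G by (simp add: not_le)
  qed
  then show Gm: "G \<in> sets borel" proof -
    assume "(\<Union>N. B N) = - G"
    then have "G = UNIV - (\<Union>N. B N)" by blast
    moreover have "(\<Union>N. B N) \<in> sets borel" using Bm by (intro sets.countable_UN) auto
    ultimately show ?thesis using borel_comp[of "\<Union>N. B N"] by (simp only: Compl_eq_Diff_UNIV)
  qed
  define u where "u N x = Min ((\<lambda>k. \<phi> k x) ` {..N})" for N x
  have um: "u N \<in> borel_measurable borel" for N
  proof (induction N)
    case 0
    have "u 0 = \<phi> 0" by (simp add: u_def[abs_def])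
    then show ?case by simp
  next
    case (Suc N)
    have "u (Suc N) = (\<lambda>x. min (\<phi> (Suc N) x) (u N x))" by (simp add: u_def[abs_def] atMost_Suc)
    then show ?case using Suc by simp
  qed
  have u_le: "u N x \<le> \<phi> k x" if "k \<le> N" for N x k unfolding u_def using that by (intro Min_le) auto
  have u_in: "\<exists>k\<le>N. u N x = \<phi> k x" for N x
  proof -
    have "u N x \<in> (\<lambda>k. \<phi> k x) ` {..N}" unfolding u_def by (rule Min_in) auto
    then show ?thesis by auto
  qed
  have ub: "exp (- (\<bar>a\<bar> + K) * real N) \<le> u N x \<and> u N x \<le> 1" for N x
  proof -
    obtain k where k: "k \<le> N" "u N x = \<phi> k x" using u_in by blast
    have "exp (- (\<bar>a\<bar> + K) * real N) \<le> exp (- (\<bar>a\<bar> + K) * real k)"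
      unfolding exp_le_cancel_iff using k(1) K by (intro mult_left_mono_neg) auto
    also have "\<dots> \<le> u N x" using \<phi>b(3)[of k x] k(2) by simp
    finally show ?thesis using u_le[of 0 N x] \<phi>0[of x] by simp
  qed
  have pos: "0 < u N x" for N x
    using ub[of N x] exp_gt_zero[of "- (\<bar>a\<bar> + K) * real N"] by linarith
  have F1: "FK V 1 (\<phi> k) x = exp a * \<phi> (Suc k) x" for k x
  proof -
    have "FK V 1 (\<phi> k) x = exp (- a * real k) * FK V 1 (FK V (real k) (\<lambda>_. 1)) x"
    proof -
      have "FK V 1 (\<phi> k) x = (\<integral>\<omega>. exp (- a * real k) * (exp (Sint V 1 \<omega>) * FK V (real k) (\<lambda>_. 1) (\<omega> 1)) \<partial>PX x)"
        unfolding FK_def[of V 1] \<phi>_def by (simp only: mult.left_commute)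
      then show ?thesis unfolding FK_def[of V 1] by (simp only: integral_mult_right_zero)
    qed
    also have "FK V 1 (FK V (real k) (\<lambda>_. 1)) x = FK V (1 + real k) (\<lambda>_. 1) x"
      by (rule FK_add[OF V, symmetric, of _ _ _ 1]) auto
    also have "exp (- a * real k) = exp a * exp (- a * real (Suc k))"
      unfolding exp_add[symmetric] by (simp add: algebra_simps)
    finally show ?thesis by (simp add: \<phi>_def[of "Suc k"])
  qed
  have Fu: "FK V 1 (u N) x \<le> exp a * \<phi> (Suc k) x" if "k \<le> N" for N k x
    unfolding F1[symmetric]
    by (rule FK_mono[OF V _ um _ \<phi>m u_le[OF that] \<phi>b(2)]) (use pos in \<open>auto simp: less_imp_le\<close>)
  have posF: "0 < FK V 1 (u N) x" for N x
  proof -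
    have "0 < exp (- (\<bar>a\<bar> + K) * real N) * exp (- K * 1)" by simp
    also have "\<dots> \<le> FK V 1 (u N) x" by (rule FK_bounds(1)[OF V _ um ub]) auto
    finally show ?thesis .
  qed
  \<comment> \<open>On \<open>B N\<close> the minimum is not attained at index \<open>0\<close>,
    where the value is \<open>1\<close>. If it is attained at \<open>Suc k\<close>, then \<open>FK V
    1 (u N) \<le> FK V 1 (\<phi> k) = exp a * \<phi> (Suc k) = exp a * u N\<close>. Off
    \<open>B N\<close> the minimum equals \<open>1\<close>, and the growth in unit time is at most
    \<open>exp K\<close>.\<close>
  have pt: "ln (FK V 1 (u N) x) - ln (u N x) \<le> a + (K + \<bar>a\<bar>) * indicator (- B N) x" for N x
  proof (cases "x \<in> B N")
    case True
    then obtain i where i: "i \<le> N" "\<phi> i x < 1" by (auto simp: B_def)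
    obtain j where j: "j \<le> N" "u N x = \<phi> j x" using u_in by blast
    have "j \<noteq> 0" using j u_le[OF i(1), of x] i(2) \<phi>0[of x] by (intro notI) auto
    then obtain k where k: "j = Suc k" by (cases j) auto
    have "FK V 1 (u N) x \<le> exp a * u N x" using Fu[of k N x] j k by simp
    then have "ln (FK V 1 (u N) x) \<le> ln (exp a * u N x)" using posF by (intro ln_mono) auto
    also have "\<dots> = a + ln (u N x)" using pos[of N x] by (simp add: ln_mult)
    finally show ?thesis using True by simp
  next
    case False
    then have "u N x = 1" using u_in[of N x] ub[of N x] by (auto simp: B_def not_less)
    moreover have "FK V 1 (u N) x \<le> 1 * exp (K * 1)"
      by (rule FK_bounds(2)[OF V _ um ub]) auto
    then have "ln (FK V 1 (u N) x) \<le> ln (exp K)" using posF by (intro ln_mono) auto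
    ultimately show ?thesis using False by simp
  qed
  have main: "(\<integral>x. V x \<partial>\<mu>) - I \<le> a + (K + \<bar>a\<bar>) * (1 - measure \<mu> (B N))" for N
  proof -
    have Bs: "B N \<in> sets \<mu>" "- B N \<in> sets \<mu>" using Bm \<mu>_sets by auto
    have sp: "space \<mu> = UNIV" using sets_eq_imp_space_eq[OF \<mu>_sets] by simp
    have "(\<integral>x. V x \<partial>\<mu>) - I \<le> (\<integral>x. ln (FK V 1 (u N) x) - ln (u N x) \<partial>\<mu>)"
      by (rule FK_entropy[OF V um ub]) simp
    also have "\<dots> \<le> (\<integral>x. a + (K + \<bar>a\<bar>) * indicator (- B N) x \<partial>\<mu>)"
    proof (rule Bochner_Integration.integral_mono)
      have b1: "exp (- (\<bar>a\<bar> + K) * real N) * exp (- K * 1) \<le> FK V 1 (u N) x \<and> FK V 1 (u N) x \<le> 1 * exp (K * 1)" for x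
        using FK_bounds[OF V _ um ub, of 1 N x] by auto
      have "integrable \<mu> (\<lambda>x. ln (FK V 1 (u N) x))"
        by (rule ln_integrable[OF FK_measurable[OF V(1) um] b1]) simp
      moreover have "integrable \<mu> (\<lambda>x. ln (u N x))" by (rule ln_integrable[OF um ub]) simp
      ultimately show "integrable \<mu> (\<lambda>x. ln (FK V 1 (u N) x) - ln (u N x))" by simp
      show "integrable \<mu> (\<lambda>x. a + (K + \<bar>a\<bar>) * indicator (- B N) x)"
        using Bs by (auto simp: M.emeasure_eq_measure)
    qed (rule pt)
    also have "\<dots> = a + (K + \<bar>a\<bar>) * measure \<mu> (- B N)" 
      using Bs M.prob_space sp by (simp add: M.emeasure_eq_measure)
    also have "measure \<mu> (- B N) = 1 - measure \<mu> (B N)"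
      using M.prob_compl[OF Bs(1)] sp by (simp add: Compl_eq_Diff_UNIV)
    finally show ?thesis .
  qed
  \<comment> \<open>If \<open>G\<close> were null, \<open>measure \<mu> (B N)\<close> would tend to
    \<open>1\<close>, and \<open>main\<close> would give in the limit that the integral of
    \<open>V\<close> minus \<open>I\<close> is at most \<open>a\<close>, against the choice of
    \<open>a\<close>.\<close>
  show "0 < measure \<mu> G"
  proof (rule ccontr)
    assume "\<not> 0 < measure \<mu> G"
    then have "measure \<mu> G = 0" using measure_nonneg[of \<mu> G] by linarith
    then have "measure \<mu> (\<Union>N. B N) = 1"
      using M.prob_compl[of G] Gm \<mu>_sets sets_eq_imp_space_eq[OF \<mu>_sets] unfolding UB
      by (simp add: Compl_eq_Diff_UNIV)
    moreover have "(\<lambda>N. measure \<mu> (B N)) \<longlonglongrightarrow> measure \<mu> (\<Union>N. B N)"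
    proof (rule M.finite_Lim_measure_incseq)
      show "range B \<subseteq> M.events" using Bm \<mu>_sets by auto
      show "incseq B" unfolding incseq_def B_def using le_trans by blast
    qed
    ultimately have "(\<lambda>N. a + (K + \<bar>a\<bar>) * (1 - measure \<mu> (B N))) \<longlonglongrightarrow> a + (K + \<bar>a\<bar>) * (1 - 1)"
      by (intro tendsto_intros) simp
    from LIMSEQ_le_const[OF this, of "(\<integral>x. V x \<partial>\<mu>) - I"] main a show False by auto
  qed
qed

section \<open>Growth on paths that land in a large set\<close>

lemma \<mu>_space: "space \<mu> = UNIV"
  using sets_eq_imp_space_eq[OF \<mu>_sets] by simp

text \<open>Penalising the time spent outside \<open>H\<close> turns the growth of \<open>E\<^sup>y exp(\<integral>W)\<close> into growth on
  paths that are in \<open>H\<close> at a suitable time close to \<open>t\<close>.\<close>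
proposition landing:
  assumes \<delta>: "0 < \<delta>" "\<delta> \<le> 1" and L: "0 \<le> L"
  shows "\<exists>\<eta>>0. \<forall>H\<in>sets borel. measure \<mu> (- H) \<le> \<eta> \<longrightarrow>
    (\<forall>W\<in>borel_measurable borel. (\<forall>x. \<bar>W x\<bar> \<le> L) \<longrightarrow> (\<integral>x. W x \<partial>\<mu>) = 0 \<longrightarrow>
      (\<exists>G\<in>sets borel. 0 < measure \<mu> G \<and> (\<exists>t0. \<forall>y\<in>G. \<forall>t\<ge>t0. \<exists>s\<in>{(1 - \<delta>) * t..t}. 0 \<le> s \<and>
         exp (- (I + \<delta>) * t) \<le> FK W s (indicator H) y)))"
proof -
  interpret M: prob_space \<mu> by (rule \<mu>_prob)
  \<comment> \<open>\<open>2 * \<theta>\<close> is the fraction of time taken by the final window in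
    which the landing time is sought. Smallness against \<open>\<delta>\<close> keeps the window
    late enough; smallness against \<open>\<delta> / L\<close> makes the potential on the window
    worth at most \<open>\<delta> / 4\<close> per unit of total time.\<close>
  define \<theta> where "\<theta> = \<delta> / (8 * (L + 1))"
  have \<theta>: "0 < \<theta>" using \<delta> L by (simp add: \<theta>_def)
  have \<theta>1: "\<theta> \<le> \<delta> / 8" using \<delta> L by (simp add: \<theta>_def field_simps)
  have \<theta>2: "L * \<theta> \<le> \<delta> / 8" using \<delta> L by (simp add: \<theta>_def field_simps)
  \<comment> \<open>The penalty rate: a time \<open>\<theta> * n\<close> spent outside
    \<open>H\<close> costs \<open>(L + I + \<delta> + 1) * n\<close>, while \<open>W\<close> gains
    at most \<open>L * n\<close>, so such paths carry weight at most
    \<open>exp (- (I + \<delta> + 1) * n)\<close>.\<close>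
  define C' where "C' = (L + I + \<delta> + 1) / \<theta>"
  have C': "0 < C'" "C' * \<theta> = L + I + \<delta> + 1" using L I_nonneg \<delta> \<theta> by (simp_all add: C'_def)
  \<comment> \<open>With this bound on the measure of the complement of \<open>H\<close>, the
    penalty lowers the mean of the potential by at most \<open>\<delta> / 4\<close>, which fits into
    the slack \<open>\<delta> / 2\<close>.\<close>
  define \<eta> where "\<eta> = \<delta> / (4 * C')"
  have \<eta>: "0 < \<eta>" "C' * \<eta> = \<delta> / 4" using \<delta> C' by (simp_all add: \<eta>_def)
  show ?thesis
  proof (intro exI[of _ \<eta>] conjI \<eta>(1) ballI impI)
    fix H :: "'a set" and W :: "'a \<Rightarrow> real"
    assume H [measurable]: "H \<in> sets borel" and mH: "measure \<mu> (- H) \<le> \<eta>"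
      and W [measurable]: "W \<in> borel_measurable borel" and WL: "\<forall>x. \<bar>W x\<bar> \<le> L" and W0: "(\<integral>x. W x \<partial>\<mu>) = 0"
    define V where "V x = W x - C' * indicator (- H) x" for x
    have Hc: "- H \<in> sets borel" using H by auto
    have V: "V \<in> borel_measurable borel" "\<bar>V x\<bar> \<le> L + C'" for x
      using WL[rule_format, of x] C'(1) Hc unfolding V_def[abs_def] by (auto split: split_indicator)
    have "(\<integral>x. V x \<partial>\<mu>) = (\<integral>x. W x \<partial>\<mu>) - C' * measure \<mu> (- H)"
    proof -
      have "integrable \<mu> W" by (rule \<mu>_integrable[OF W]) (use WL in auto)
      moreover have "integrable \<mu> (indicator (- H) :: 'a \<Rightarrow> real)" 
        by (rule \<mu>_integrable[where C = 1]) (use Hc in \<open>auto split: split_indicator\<close>)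
      ultimately show ?thesis unfolding V_def using \<mu>_space by simp
    qed
    also have "\<dots> \<ge> - \<delta> / 4" using W0 mult_left_mono[OF mH, of C'] C'(1) \<eta>(2) by simp
    finally have "- (I + \<delta> / 2) < (\<integral>x. V x \<partial>\<mu>) - I" using \<delta> by simp
    note G = exponential_growth_set[OF V this]
    define G where "G = {x. \<forall>n::nat. exp (- (I + \<delta> / 2) * real n) \<le> FK V (real n) (\<lambda>_. 1) x}"
    show "\<exists>G\<in>sets borel. 0 < measure \<mu> G \<and> (\<exists>t0. \<forall>y\<in>G. \<forall>t\<ge>t0. \<exists>s\<in>{(1 - \<delta>) * t..t}. 0 \<le> s \<and>
         exp (- (I + \<delta>) * t) \<le> FK W s (indicator H) y)"
    proof (intro bexI[of _ G] conjI exI[of _ "12 / \<delta>"] ballI allI impI)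
      show "G \<in> sets borel" "0 < measure \<mu> G" using G unfolding G_def by auto
    next
      fix y t assume y: "y \<in> G" and t: "12 / \<delta> \<le> t"
      interpret P: prob_space "PX y" by (rule PX_prob)
      \<comment> \<open>\<open>exponential_growth_set\<close> controls integer times only.\<close>
      define n :: real where "n = real (nat \<lfloor>t\<rfloor>)"
      \<comment> \<open>\<open>\<delta> * t \<ge> 12\<close> leaves a margin
        \<open>\<delta> * t / 4 \<ge> 3\<close> in the exponent, which pays for the factor
        \<open>8 \<le> exp 3\<close> below, and it covers the loss from rounding \<open>t\<close>
        down.\<close>
      have t12: "12 \<le> \<delta> * t" "12 \<le> t"
      proof -
        have "0 \<le> 12 / \<delta>" using \<delta> by simp
        then have t0: "0 \<le> t" using t by linarith
        show *: "12 \<le> \<delta> * t" using t \<delta> by (simp add: field_simps)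
        also have "\<dots> \<le> 1 * t" using \<delta> t0 by (intro mult_right_mono) auto
        finally show "12 \<le> t" by simp
      qed
      have n: "n \<le> t" "t - 1 \<le> n" "1 \<le> n" using t12 unfolding n_def by linarith+
      define \<beta> where "\<beta> = exp (- (I + \<delta> / 2) * n)"
      have ybd: "\<beta> \<le> FK V n (\<lambda>_. 1) y" using y unfolding G_def \<beta>_def n_def by blast
      define w where "w = (1 - 2 * \<theta>) * n"
      have th: "2 * \<theta> < 1" using \<theta>1 \<delta> by linarith
      have w: "0 \<le> w" "w \<le> n" "n - w = 2 * \<theta> * n" using th n \<theta> by (auto simp: w_def algebra_simps)
      let ?g = "\<lambda>(\<omega>, r). exp (Sint W n \<omega>) * indicator H (\<omega> (max 0 (min r n)))"
      have n0: "0 \<le> n" using n by simp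
      note j [measurable] = measurable_eval_joint_path[OF n0, where 'a = 'a]
      have SW [measurable]: "Sint W n \<in> borel_measurable path_space" by (rule Sint_measurable[OF W])
      have "?g \<in> borel_measurable (path_space \<Otimes>\<^sub>M borel)" unfolding case_prod_beta' by measurable
      then have g: "?g \<in> borel_measurable (PX y \<Otimes>\<^sub>M borel)"
        using measurable_cong_sets[OF sets_pair_measure_cong[OF PX_sets refl] refl] by blast
      have gb: "\<bar>?g (\<omega>, r)\<bar> \<le> exp (L * n)" if "\<omega> \<in> space (PX y)" for \<omega> r
        using exp_Sint_bounds(2)[OF W _ n0, of L \<omega>] WL that by (auto split: split_indicator)
      note F = fubini_Icc(1)[OF P.prob_space_axioms g gb, of w n] fubini_Icc(2)[OF P.prob_space_axioms g gb, of w n]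
      define \<Phi> where "\<Phi> r = (\<integral>\<omega>. ?g (\<omega>, r) \<partial>PX y)" for r
      have \<Phi>m: "\<Phi> \<in> borel_measurable borel" unfolding \<Phi>_def[abs_def] by (rule fubini_Icc(3)[OF P.prob_space_axioms g gb])
      \<comment> \<open>An alternative for each path. Either it spends at least
        \<open>\<theta> * n\<close> outside \<open>H\<close>, and the penalty makes its weight
        negligible; or the window of length \<open>2 * \<theta> * n\<close> contains at least
        \<open>\<theta> * n\<close> of time in \<open>H\<close>, so the integral over the window
        dominates the weight.\<close>
      have path: "exp (Sint V n \<omega>) \<le> exp (- (I + \<delta> + 1) * n) + (LBINT r:{w..n}. ?g (\<omega>, r)) / (\<theta> * n)"
        if \<omega>: "\<omega> \<in> cadlag_paths" for \<omega>
      proof -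
        note wm = cadlag_borel[OF \<omega>, measurable]
        have i1: "set_integrable lborel {u..v} (\<lambda>r. W (\<omega> r))" for u v
          by (rule set_integrable_bounded_Icc[where C = L]) (use WL in auto)
        have i2: "set_integrable lborel {u..v} (\<lambda>r. indicator (- H) (\<omega> r) :: real)" for u v
          by (rule set_integrable_bounded_Icc[where C = 1]) (use Hc in \<open>auto split: split_indicator\<close>)
        define occ where "occ = (LBINT r:{0..n}. indicator (- H) (\<omega> r) :: real)"
        have S: "Sint V n \<omega> = Sint W n \<omega> - C' * occ"
          unfolding Sint_def V_def occ_def using set_integral_diff(2)[OF i1 set_integrable_mult_right[OF i2]] by simp
        have nn: "0 \<le> (LBINT r:{u..v}. ?g (\<omega>, r))" for u v
          unfolding set_lebesgue_integral_def by (rule Bochner_Integration.integral_nonneg) auto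
        show ?thesis
        proof (cases "\<theta> * n \<le> occ")
          case True
          have "Sint W n \<omega> \<le> L * n" using Sint_bound[OF W _ \<omega> n0, of L] WL by (simp add: abs_le_iff)
          moreover have "C' * (\<theta> * n) \<le> C' * occ" using True C'(1) by (intro mult_left_mono) auto
          moreover have "C' * (\<theta> * n) = (L + I + \<delta> + 1) * n" using C'(2) by (simp add: mult.assoc[symmetric])
          ultimately have "Sint V n \<omega> \<le> - (I + \<delta> + 1) * n" unfolding S by (simp add: algebra_simps)
          then have "exp (Sint V n \<omega>) \<le> exp (- (I + \<delta> + 1) * n)" by simp
          moreover have "0 \<le> (LBINT r:{w..n}. ?g (\<omega>, r)) / (\<theta> * n)" using nn \<theta> n0 by simp
          ultimately show ?thesis by linarith
        next
          case False
          have sp: "occ = (LBINT r:{0..w}. indicator (- H) (\<omega> r) :: real) + (LBINT r:{w..n}. indicator (- H) (\<omega> r) :: real)"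
            unfolding occ_def by (rule set_integral_split_Icc[OF i2 w(1,2)])
          have "0 \<le> (LBINT r:{0..w}. indicator (- H) (\<omega> r) :: real)"
            unfolding set_lebesgue_integral_def by (rule Bochner_Integration.integral_nonneg) auto
          with sp False have o: "(LBINT r:{w..n}. indicator (- H) (\<omega> r) :: real) \<le> \<theta> * n" by linarith
          have "(LBINT r:{w..n}. ?g (\<omega>, r)) = (LBINT r:{w..n}. exp (Sint W n \<omega>) * (1 - indicator (- H) (\<omega> r)))"
            unfolding set_lebesgue_integral_def using w
            by (intro Bochner_Integration.integral_cong) (auto split: split_indicator simp: max_def min_def)
          also have "\<dots> = exp (Sint W n \<omega>) * ((n - w) - (LBINT r:{w..n}. indicator (- H) (\<omega> r)))"
          proof -
            have "(LBINT r:{w..n}. 1 - indicator (- H) (\<omega> r) :: real) = (LBINT r:{w..n}. 1) - (LBINT r:{w..n}. indicator (- H) (\<omega> r))"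
              by (rule set_integral_diff(2)[OF set_integrable_bounded_Icc[where C = 1] i2]) auto
            also have "(LBINT r:{w..n}. 1 :: real) = n - w" using w by (simp add: set_lebesgue_integral_def)
            finally show ?thesis by simp
          qed
          also have "\<dots> \<ge> exp (Sint W n \<omega>) * (\<theta> * n)"
            using o w(3) by (intro mult_left_mono) auto
          finally have "exp (Sint W n \<omega>) \<le> (LBINT r:{w..n}. ?g (\<omega>, r)) / (\<theta> * n)"
            using \<theta> n by (simp add: pos_le_divide_eq)
          moreover have "exp (Sint V n \<omega>) \<le> exp (Sint W n \<omega>)"
          proof -
            have "0 \<le> occ" unfolding occ_def set_lebesgue_integral_def by (rule Bochner_Integration.integral_nonneg) auto
            then show ?thesis unfolding S using C'(1) by simp
          qed
          moreover have "0 \<le> exp (- (I + \<delta> + 1) * n)" by simp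
          ultimately show ?thesis by linarith
        qed
      qed
      have "\<beta> \<le> (\<integral>\<omega>. exp (Sint V n \<omega>) \<partial>PX y)" using ybd by (simp add: FK_def)
      also have "\<dots> \<le> (\<integral>\<omega>. exp (- (I + \<delta> + 1) * n) + (LBINT r:{w..n}. ?g (\<omega>, r)) / (\<theta> * n) \<partial>PX y)"
      proof (rule Bochner_Integration.integral_mono)
        show "integrable (PX y) (\<lambda>\<omega>. exp (Sint V n \<omega>))"
          using exp_Sint_bounds(2)[OF V n0] FK_integrand_measurable[OF V(1), of "\<lambda>_. 1" n]
          by (intro Ex_integrable[where C = "exp ((L + C') * n)"]) auto
        show "integrable (PX y) (\<lambda>\<omega>. exp (- (I + \<delta> + 1) * n) + (LBINT r:{w..n}. ?g (\<omega>, r)) / (\<theta> * n))"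
          using F(2) by auto
      qed (use path in simp)
      also have "\<dots> = exp (- (I + \<delta> + 1) * n) + (LBINT r:{w..n}. \<Phi> r) / (\<theta> * n)"
        using F P.prob_space unfolding \<Phi>_def by simp
      finally have b1: "\<beta> \<le> exp (- (I + \<delta> + 1) * n) + (LBINT r:{w..n}. \<Phi> r) / (\<theta> * n)" .
      have "exp (- (I + \<delta> + 1) * n) \<le> exp (- (I + \<delta> / 2) * n + (- 1))"
      proof -
        have "0 \<le> \<delta> * n" using \<delta> n0 by simp
        then show ?thesis using n by (simp add: algebra_simps)
      qed
      also have "\<dots> = \<beta> * exp (- 1)" by (simp add: \<beta>_def exp_add[symmetric])
      also have "\<dots> \<le> \<beta> * (1 / 2)"
      proof (rule mult_left_mono)
        have "2 \<le> exp (1::real)" using exp_ge_add_one_self[of "1::real"] by simp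
        then show "exp (- 1) \<le> (1 / 2 :: real)" by (simp add: exp_minus field_simps)
      qed (simp add: \<beta>_def)
      finally have b2: "\<beta> / 2 \<le> (LBINT r:{w..n}. \<Phi> r) / (\<theta> * n)" using b1 by linarith
      \<comment> \<open>Were \<open>\<Phi>\<close> below \<open>\<beta> / 8\<close> throughout a
        window of length \<open>2 * \<theta> * n\<close>, the right-hand side of \<open>b2\<close>
        would be at most \<open>\<beta> / 4\<close>.\<close>
      have "\<exists>s\<in>{w..n}. \<beta> / 8 \<le> \<Phi> s"
      proof (rule ccontr)
        assume "\<not> ?thesis"
        then have less: "\<Phi> s \<le> \<beta> / 8" if "s \<in> {w..n}" for s using that by force
        have \<Phi>b: "\<bar>\<Phi> r\<bar> \<le> exp (L * n)" for r
        proof -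
          have m: "(\<lambda>\<omega>. ?g (\<omega>, r)) \<in> borel_measurable path_space"
            using measurable_comp_eval[of "indicator H :: 'a \<Rightarrow> real" "max 0 (min r n)"] by simp
          have "0 \<le> ?g (\<omega>, r) \<and> ?g (\<omega>, r) \<le> exp (L * n)" if "\<omega> \<in> cadlag_paths" for \<omega>
            using gb[of \<omega> r] that by (simp split: split_indicator)
          from Ex_bounds[OF m this, of y] show ?thesis unfolding \<Phi>_def by linarith
        qed
        have "(LBINT r:{w..n}. \<Phi> r) \<le> (LBINT r:{w..n}. \<beta> / 8)"
          by (rule set_integral_mono[OF set_integrable_bounded_Icc[OF \<Phi>m \<Phi>b] set_integrable_bounded_Icc[where C = "\<bar>\<beta> / 8\<bar>"]])
             (use less in auto)
        also have "\<dots> = \<beta> / 8 * (n - w)" using w by (simp add: set_lebesgue_integral_def)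
        finally have "(LBINT r:{w..n}. \<Phi> r) / (\<theta> * n) \<le> (\<beta> / 8 * (n - w)) / (\<theta> * n)"
          using \<theta> n0 by (intro divide_right_mono) auto
        also have "\<dots> = \<beta> / 4" using w(3) \<theta> n by simp
        finally have "\<beta> / 2 \<le> \<beta> / 4" using b2 by linarith
        moreover have "0 < \<beta>" by (simp add: \<beta>_def)
        ultimately show False by simp
      qed
      then obtain s where s: "w \<le> s" "s \<le> n" "\<beta> / 8 \<le> \<Phi> s" by auto
      have s0: "0 \<le> s" using s w by simp
      \<comment> \<open>Stopping the weight at \<open>s\<close> instead of \<open>n\<close> changes
        the exponent by at most \<open>L * (n - s) \<le> 2 * \<theta> * L * n\<close>.\<close>
      have "\<Phi> s \<le> (\<integral>\<omega>. exp (2 * \<theta> * L * n) * (exp (Sint W s \<omega>) * indicator H (\<omega> s)) \<partial>PX y)"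
        unfolding \<Phi>_def
      proof (rule Ex_mono)
        show "(\<lambda>\<omega>. exp (2 * \<theta> * L * n) * (exp (Sint W s \<omega>) * indicator H (\<omega> s))) \<in> borel_measurable path_space"
          using FK_integrand_measurable[OF W, of "indicator H" s] by simp
        show "(\<lambda>\<omega>. ?g (\<omega>, s)) \<in> borel_measurable path_space"
          using measurable_comp_eval[of "indicator H :: 'a \<Rightarrow> real" "max 0 (min s n)"] by simp
        fix \<omega> :: "real \<Rightarrow> 'a" assume \<omega>: "\<omega> \<in> cadlag_paths"
        show "\<bar>?g (\<omega>, s)\<bar> \<le> exp (L * n)" using gb[of \<omega> s] \<omega> by simp
        show "\<bar>exp (2 * \<theta> * L * n) * (exp (Sint W s \<omega>) * indicator H (\<omega> s))\<bar> \<le> exp (2 * \<theta> * L * n) * exp (L * s)"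
          using exp_Sint_bounds(2)[OF W _ s0 \<omega>, of L] WL by (auto split: split_indicator)
        have "Sint W n \<omega> = Sint W s \<omega> + Sint W (n - s) (path_shift s \<omega>)"
          using Sint_add[OF W _ \<omega> s0, of L "n - s"] WL s by simp
        also have "Sint W (n - s) (path_shift s \<omega>) \<le> L * (n - s)"
          using Sint_bound[OF W _ shift_cadlag[OF \<omega> s0], of L "n - s"] WL s by (simp add: abs_le_iff)
        also have "L * (n - s) \<le> L * (2 * \<theta> * n)" using w s L by (intro mult_left_mono) auto
        finally have "exp (Sint W n \<omega>) \<le> exp (2 * \<theta> * L * n + Sint W s \<omega>)" by (simp add: mult_ac)
        then show "?g (\<omega>, s) \<le> exp (2 * \<theta> * L * n) * (exp (Sint W s \<omega>) * indicator H (\<omega> s))"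
          using s s0 by (auto split: split_indicator simp: exp_add max_def min_def)
      qed
      also have "\<dots> = exp (2 * \<theta> * L * n) * FK W s (indicator H) y" by (simp add: FK_def)
      finally have b3: "\<beta> / 8 \<le> exp (2 * \<theta> * L * n) * FK W s (indicator H) y" using s(3) by linarith
      have "exp (- (I + \<delta>) * t) \<le> exp (- (I + 3 * \<delta> / 4) * n - 3)"
      proof -
        have "(I + 3 * \<delta> / 4) * n \<le> (I + 3 * \<delta> / 4) * t" using n I_nonneg \<delta> by (intro mult_left_mono) auto
        moreover have "(I + 3 * \<delta> / 4) * t + 3 \<le> (I + \<delta>) * t" using t12(1) by (simp add: algebra_simps)
        ultimately show ?thesis unfolding exp_le_cancel_iff mult_minus_left by linarith
      qed
      also have "\<dots> = exp (- (I + 3 * \<delta> / 4) * n) * exp (- 3)" by (simp add: exp_add[symmetric])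
      also have "\<dots> \<le> exp (- (I + 3 * \<delta> / 4) * n) * (1 / 8)"
      proof (rule mult_left_mono)
        have "2 \<le> exp (1::real)" using exp_ge_add_one_self[of "1::real"] by simp
        then have "2 ^ 3 \<le> exp (1::real) ^ 3" by (intro power_mono) auto
        then have "8 \<le> exp (3::real)" by (simp add: exp_of_nat_mult[symmetric])
        then show "exp (- 3) \<le> (1 / 8 :: real)" by (simp add: exp_minus field_simps)
      qed simp
      also have "\<dots> \<le> (\<beta> * exp (- (2 * \<theta> * L * n))) * (1 / 8)"
      proof (rule mult_right_mono)
        have "2 * \<theta> * L * n \<le> \<delta> / 4 * n" using \<theta>2 n0 by (intro mult_right_mono) (auto simp: mult_ac)
        then show "exp (- (I + 3 * \<delta> / 4) * n) \<le> \<beta> * exp (- (2 * \<theta> * L * n))"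
          unfolding \<beta>_def exp_add[symmetric] by (simp add: algebra_simps)
      qed simp
      also have "\<dots> \<le> FK W s (indicator H) y"
        using b3 by (simp add: exp_minus field_simps)
      finally have fin: "exp (- (I + \<delta>) * t) \<le> FK W s (indicator H) y" .
      have "(1 - \<delta>) * t \<le> w"
      proof -
        have e1: "(1 - \<delta>) * t = t - \<delta> * t" by (simp add: algebra_simps)
        have e2: "(1 - \<delta> / 4) * (t - 1) = t - 1 - \<delta> * t / 4 + \<delta> / 4" by (simp add: field_simps)
        have "(1 - \<delta>) * t \<le> (1 - \<delta> / 4) * (t - 1)" unfolding e1 e2 using t12 \<delta> by linarith
        also have "\<dots> \<le> (1 - \<delta> / 4) * n" using n \<delta> by (intro mult_left_mono) auto
        also have "\<dots> \<le> w" unfolding w_def using \<theta>1 n0 by (intro mult_right_mono) auto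
        finally show ?thesis .
      qed
      then show "\<exists>s\<in>{(1 - \<delta>) * t..t}. 0 \<le> s \<and> exp (- (I + \<delta>) * t) \<le> FK W s (indicator H) y"
        using s n fin s0 by (intro bexI[of _ s]) auto
    qed
  qed
qed

end

section \<open>Quadratic potentials\<close>

lemma Sint_lipschitz:
  fixes f :: "'a::polish_space \<Rightarrow> real"
  assumes f: "f \<in> borel_measurable borel" "\<And>x. \<bar>f x\<bar> \<le> C" and \<omega>: "\<omega> \<in> cadlag_paths" and st: "0 \<le> s" "0 \<le> t"
  shows "\<bar>Sint f t \<omega> - Sint f s \<omega>\<bar> \<le> C * \<bar>t - s\<bar>"
proof -
  have *: "\<bar>Sint f v \<omega> - Sint f u \<omega>\<bar> \<le> C * (v - u)" if "0 \<le> u" "u \<le> v" for u v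
    using Sint_add[OF f \<omega> that(1), of "v - u"] Sint_bound[OF f shift_cadlag[OF \<omega> that(1)], of "v - u"] that by simp
  show ?thesis
  proof (cases "s \<le> t")
    case True
    then show ?thesis using *[OF st(1) True] by simp
  next
    case False
    then show ?thesis using *[OF st(2), of s] by (simp add: abs_minus_commute)
  qed
qed

definition sqsum :: "nat \<Rightarrow> (nat \<Rightarrow> real) \<Rightarrow> real" where
  "sqsum r s = (\<Sum>j<r. (s j)\<^sup>2)"

lemma sqsum_nonneg: "0 \<le> sqsum r s"
  by (simp add: sqsum_def sum_nonneg)

lemma sqsum_le:
  assumes "\<And>j. j < r \<Longrightarrow> \<bar>s j\<bar> \<le> B" shows "sqsum r s \<le> real r * B\<^sup>2"
proof -
  have "(s j)\<^sup>2 \<le> B\<^sup>2" if "j < r" for j using power_mono[OF assms[OF that], of 2] by simp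
  then have "sqsum r s \<le> (\<Sum>j<r. B\<^sup>2)" unfolding sqsum_def by (intro sum_mono) auto
  then show ?thesis by simp
qed

lemma sqsum_add: "sqsum r (\<lambda>j. s j + u j) = sqsum r s + (\<Sum>j<r. 2 * s j * u j) + sqsum r u"
  unfolding sqsum_def by (simp add: power2_sum sum.distrib)

context markov_family
begin

text \<open>\<open>s\<close> is the sum accumulated before the start. The case \<open>s = 0\<close>
  is the penalised expectation over the whole interval, and what later blocks contribute is the same
  functional at another \<open>s\<close>.\<close>

definition quad :: "(nat \<Rightarrow> 'a \<Rightarrow> real) \<Rightarrow> nat \<Rightarrow> real \<Rightarrow> real \<Rightarrow> (nat \<Rightarrow> real) \<Rightarrow> 'a \<Rightarrow> real" where
  "quad F r q \<tau> s x = (\<integral>\<omega>. exp (- q * sqsum r (\<lambda>j. s j + Sint (F j) \<tau> \<omega>)) \<partial>PX x)"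

lemma quad_integrand_measurable:
  fixes F :: "nat \<Rightarrow> 'a \<Rightarrow> real"
  assumes "\<And>j. F j \<in> borel_measurable borel"
  shows "(\<lambda>\<omega>. exp (- q * sqsum r (\<lambda>j. s j + Sint (F j) \<tau> \<omega>))) \<in> borel_measurable path_space"
  unfolding sqsum_def
  by (intro measurable_compose[OF _ borel_measurable_exp] borel_measurable_times borel_measurable_sum
      borel_measurable_power borel_measurable_add Sint_measurable assms borel_measurable_const)

lemma exp_quad_le_1: "0 \<le> q \<Longrightarrow> exp (- q * sqsum r s) \<le> 1"
  using sqsum_nonneg[of r s] by simp

lemma quad_bounds:
  assumes "\<And>j. F j \<in> borel_measurable borel" "0 \<le> q"
  shows "0 \<le> quad F r q \<tau> s x" "quad F r q \<tau> s x \<le> 1"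
proof -
  have "0 \<le> exp (- q * sqsum r (\<lambda>j. s j + Sint (F j) \<tau> \<omega>)) \<and> exp (- q * sqsum r (\<lambda>j. s j + Sint (F j) \<tau> \<omega>)) \<le> 1" for \<omega>
    using exp_quad_le_1[OF assms(2)] by simp
  note b = Ex_bounds[OF quad_integrand_measurable[OF assms(1)] this]
  show "0 \<le> quad F r q \<tau> s x" unfolding quad_def by (rule b(1))
  show "quad F r q \<tau> s x \<le> 1" unfolding quad_def by (rule b(2))
qed

text \<open>The Markov property at \<open>u\<close>: the integrals over \<open>[0,u]\<close> are
  absorbed into the accumulated sum. This recursion is what the induction over blocks runs
  on.\<close>

lemma quad_add:
  assumes F: "\<And>j. F j \<in> borel_measurable borel" "\<And>j x. \<bar>F j x\<bar> \<le> b" and q: "0 \<le> q" and u: "0 \<le> u" "0 \<le> \<tau>"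
  shows "quad F r q (u + \<tau>) s x = (\<integral>\<omega>. quad F r q \<tau> (\<lambda>j. s j + Sint (F j) u \<omega>) (\<omega> u) \<partial>PX x)"
    and "(\<lambda>\<omega>. quad F r q \<tau> (\<lambda>j. s j + Sint (F j) u \<omega>) (\<omega> u)) \<in> borel_measurable path_space"
proof -
  define h where "h = (\<lambda>(\<omega>, \<omega>'). exp (- q * sqsum r (\<lambda>j. (s j + Sint (F j) u \<omega>) + Sint (F j) \<tau> \<omega>')))"
  have h: "h \<in> borel_measurable (coord_space u \<Otimes>\<^sub>M path_space)"
    unfolding h_def sqsum_def case_prod_beta'
    by (intro measurable_compose[OF _ borel_measurable_exp] borel_measurable_times borel_measurable_sum
      borel_measurable_power borel_measurable_add borel_measurable_const
      measurable_compose[OF measurable_fst Sint_measurable_coord[OF F(1) u(1)]]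
      measurable_compose[OF measurable_snd Sint_measurable[OF F(1)]])
  have bd: "0 \<le> h (\<omega>, \<omega>') \<and> h (\<omega>, \<omega>') \<le> 1" for \<omega> \<omega>'
    unfolding h_def using exp_quad_le_1[OF q] by simp
  have "quad F r q (u + \<tau>) s x = (\<integral>\<omega>. h (\<omega>, path_shift u \<omega>) \<partial>PX x)"
    unfolding quad_def h_def
    by (intro Bochner_Integration.integral_cong refl) (simp add: Sint_add[OF F _ u] add.assoc)
  also have "\<dots> = (\<integral>\<omega>. \<integral>\<omega>'. h (\<omega>, \<omega>') \<partial>PX (\<omega> u) \<partial>PX x)"
    by (rule markov_shift(1)[OF u(1) h]) (rule bd)
  finally show "quad F r q (u + \<tau>) s x = (\<integral>\<omega>. quad F r q \<tau> (\<lambda>j. s j + Sint (F j) u \<omega>) (\<omega> u) \<partial>PX x)"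
    by (simp add: h_def quad_def)
  have "(\<lambda>\<omega>. \<integral>\<omega>'. h (\<omega>, \<omega>') \<partial>PX (\<omega> u)) \<in> borel_measurable path_space"
    by (rule markov_shift(2)[OF u(1) h]) (rule bd)
  then show "(\<lambda>\<omega>. quad F r q \<tau> (\<lambda>j. s j + Sint (F j) u \<omega>) (\<omega> u)) \<in> borel_measurable path_space"
    by (simp add: h_def quad_def)
qed

text \<open>Landing and walking times are known only up to an error, so the horizon has to be
  movable. The exponent changes by a sum of products \<open>(x - y) * (x + y)\<close>, the first
  factor being at most \<open>b * \<bar>\<tau>' - \<tau>\<bar>\<close> and the second at most
  \<open>2 * R + 2 * b * T\<close>; for \<open>q\<close> of order \<open>1 / T\<close> and
  \<open>R\<close> of order \<open>T\<close> the cost is proportional to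
  \<open>\<bar>\<tau>' - \<tau>\<bar>\<close>.\<close>

lemma quad_time:
  assumes F: "\<And>j. F j \<in> borel_measurable borel" "\<And>j x. \<bar>F j x\<bar> \<le> b" and q: "0 \<le> q"
    and \<tau>: "0 \<le> \<tau>" "\<tau> \<le> T" "0 \<le> \<tau>'" "\<tau>' \<le> T" and s: "\<And>j. j < r \<Longrightarrow> \<bar>s j\<bar> \<le> R"
  shows "exp (- (q * real r * (b * \<bar>\<tau>' - \<tau>\<bar>) * (2 * R + 2 * b * T))) * quad F r q \<tau> s x \<le> quad F r q \<tau>' s x"
proof -
  have b: "0 \<le> b" using F(2)[of 0 undefined] by linarith
  let ?e = "exp (- (q * real r * (b * \<bar>\<tau>' - \<tau>\<bar>) * (2 * R + 2 * b * T)))"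
  have pt: "?e * exp (- q * sqsum r (\<lambda>j. s j + Sint (F j) \<tau> \<omega>)) \<le> exp (- q * sqsum r (\<lambda>j. s j + Sint (F j) \<tau>' \<omega>))"
    if \<omega>: "\<omega> \<in> cadlag_paths" for \<omega>
  proof -
    have "sqsum r (\<lambda>j. s j + Sint (F j) \<tau>' \<omega>) - sqsum r (\<lambda>j. s j + Sint (F j) \<tau> \<omega>)
       = (\<Sum>j<r. (Sint (F j) \<tau>' \<omega> - Sint (F j) \<tau> \<omega>) * (2 * s j + Sint (F j) \<tau>' \<omega> + Sint (F j) \<tau> \<omega>))"
      unfolding sqsum_def sum_subtractf[symmetric]
      by (intro sum.cong refl) (simp add: power2_eq_square algebra_simps)
    also have "\<dots> \<le> (\<Sum>j<r. (b * \<bar>\<tau>' - \<tau>\<bar>) * (2 * R + 2 * b * T))"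
    proof (rule sum_mono)
      fix j assume j: "j \<in> {..<r}"
      have 1: "\<bar>Sint (F j) \<tau>' \<omega> - Sint (F j) \<tau> \<omega>\<bar> \<le> b * \<bar>\<tau>' - \<tau>\<bar>"
        by (rule Sint_lipschitz[OF F \<omega> \<tau>(1,3)])
      have "\<bar>Sint (F j) \<tau>' \<omega>\<bar> \<le> b * T" "\<bar>Sint (F j) \<tau> \<omega>\<bar> \<le> b * T"
        using Sint_bound[OF F \<omega> \<tau>(3), of j] Sint_bound[OF F \<omega> \<tau>(1), of j]
          mult_left_mono[OF \<tau>(2) b] mult_left_mono[OF \<tau>(4) b] by linarith+
      then have 2: "\<bar>2 * s j + Sint (F j) \<tau>' \<omega> + Sint (F j) \<tau> \<omega>\<bar> \<le> 2 * R + 2 * b * T"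
        using s[of j] j by auto
      have "(Sint (F j) \<tau>' \<omega> - Sint (F j) \<tau> \<omega>) * (2 * s j + Sint (F j) \<tau>' \<omega> + Sint (F j) \<tau> \<omega>)
        \<le> \<bar>Sint (F j) \<tau>' \<omega> - Sint (F j) \<tau> \<omega>\<bar> * \<bar>2 * s j + Sint (F j) \<tau>' \<omega> + Sint (F j) \<tau> \<omega>\<bar>"
        unfolding abs_mult[symmetric] by (rule abs_ge_self)
      also have "\<dots> \<le> (b * \<bar>\<tau>' - \<tau>\<bar>) * (2 * R + 2 * b * T)"
        using 1 2 b by (intro mult_mono) auto
      finally show "(Sint (F j) \<tau>' \<omega> - Sint (F j) \<tau> \<omega>) * (2 * s j + Sint (F j) \<tau>' \<omega> + Sint (F j) \<tau> \<omega>)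
        \<le> (b * \<bar>\<tau>' - \<tau>\<bar>) * (2 * R + 2 * b * T)" .
    qed
    also have "\<dots> = real r * (b * \<bar>\<tau>' - \<tau>\<bar>) * (2 * R + 2 * b * T)" by simp
    finally have "sqsum r (\<lambda>j. s j + Sint (F j) \<tau>' \<omega>) \<le> sqsum r (\<lambda>j. s j + Sint (F j) \<tau> \<omega>)
       + real r * (b * \<bar>\<tau>' - \<tau>\<bar>) * (2 * R + 2 * b * T)" by linarith
    from mult_left_mono[OF this q]
    have "- (q * real r * (b * \<bar>\<tau>' - \<tau>\<bar>) * (2 * R + 2 * b * T)) + - q * sqsum r (\<lambda>j. s j + Sint (F j) \<tau> \<omega>)
       \<le> - q * sqsum r (\<lambda>j. s j + Sint (F j) \<tau>' \<omega>)"
      by (simp add: distrib_left mult.assoc)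
    then show ?thesis unfolding exp_add[symmetric] by simp
  qed
  have "?e * quad F r q \<tau> s x = (\<integral>\<omega>. ?e * exp (- q * sqsum r (\<lambda>j. s j + Sint (F j) \<tau> \<omega>)) \<partial>PX x)"
    by (simp add: quad_def)
  also have "\<dots> \<le> quad F r q \<tau>' s x"
    unfolding quad_def
  proof (rule Ex_mono[OF quad_integrand_measurable[OF F(1)] _ _ _ pt])
    show "(\<lambda>\<omega>. ?e * exp (- q * sqsum r (\<lambda>j. s j + Sint (F j) \<tau> \<omega>))) \<in> borel_measurable path_space"
      by (intro borel_measurable_times quad_integrand_measurable F(1) borel_measurable_const)
    show "\<bar>exp (- q * sqsum r (\<lambda>j. s j + Sint (F j) \<tau>' \<omega>))\<bar> \<le> 1" for \<omega>
      using exp_quad_le_1[OF q] by simp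
    show "\<bar>?e * exp (- q * sqsum r (\<lambda>j. s j + Sint (F j) \<tau> \<omega>))\<bar> \<le> ?e * 1" for \<omega>
      unfolding abs_mult abs_exp_cancel using exp_quad_le_1[OF q] by (intro mult_left_mono) auto
  qed
  finally show ?thesis .
qed

end

section \<open>Uniform reachability of sets of positive measure\<close>

locale irreducible_donsker_varadhan = donsker_varadhan +
  assumes reach: "G \<in> sets borel \<Longrightarrow> 0 < measure \<mu> G \<Longrightarrow>
    \<exists>\<rho>\<in>borel_measurable borel. (AE x in \<mu>. 0 < \<rho> x) \<and>
      (\<forall>k>0. \<exists>T\<ge>0. \<forall>x. k < (\<rho> x :: real) \<longrightarrow>
        (\<exists>t\<in>{0..T}. k / 2 \<le> measure (PX x) {\<omega> \<in> cadlag_paths. \<omega> t \<in> G}))"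
begin

text \<open>\<open>\<rho>\<close> stands for the resolvent of the indicator of \<open>G\<close>,
  positive almost everywhere by irreducibility. The sets where it exceeds \<open>1 / (n + 1)\<close>
  exhaust the space up to a null set, and on each of them time and probability of being found in
  \<open>G\<close> are controlled uniformly.\<close>

lemma reach_one:
  assumes G: "G \<in> sets borel" "0 < measure \<mu> G" and \<eta>: "0 < \<eta>"
  shows "\<exists>H\<in>sets borel. measure \<mu> (- H) \<le> \<eta> \<and> (\<exists>k>0. \<exists>T\<ge>0. \<forall>x\<in>H. \<exists>t\<in>{0..T}.
     k \<le> measure (PX x) {\<omega> \<in> cadlag_paths. \<omega> t \<in> G})"
proof -
  interpret M: prob_space \<mu> by (rule \<mu>_prob)
  obtain \<rho> :: "'a \<Rightarrow> real" where \<rho>: "\<rho> \<in> borel_measurable borel" "AE x in \<mu>. 0 < \<rho> x"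
    "\<And>k. 0 < k \<Longrightarrow> \<exists>T\<ge>0. \<forall>x. k < \<rho> x \<longrightarrow> (\<exists>t\<in>{0..T}. k / 2 \<le> measure (PX x) {\<omega> \<in> cadlag_paths. \<omega> t \<in> G})"
    using reach[OF G] by blast
  define H where "H n = {x. 1 / real (Suc n) < \<rho> x}" for n
  have Hm: "H n \<in> sets borel" for n
  proof -
    have "{x \<in> space borel. 1 / real (Suc n) < \<rho> x} \<in> sets borel" using \<rho>(1) by measurable
    then show ?thesis by (simp add: H_def)
  qed
  have inc: "incseq H"
  proof (rule incseq_SucI)
    fix n show "H n \<subseteq> H (Suc n)"
    proof
      fix x assume "x \<in> H n"
      moreover have "1 / real (Suc (Suc n)) \<le> 1 / real (Suc n)" by (intro divide_left_mono) auto
      ultimately show "x \<in> H (Suc n)" by (simp add: H_def)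
    qed
  qed
  have U: "(\<Union>n. H n) = {x. 0 < \<rho> x}"
  proof (intro set_eqI iffI)
    fix x assume "x \<in> (\<Union>n. H n)"
    then obtain n where "1 / real (Suc n) < \<rho> x" by (auto simp: H_def)
    moreover have "0 < 1 / real (Suc n)" by simp
    ultimately have "0 < \<rho> x" by linarith
    then show "x \<in> {x. 0 < \<rho> x}" by simp
  next
    fix x assume "x \<in> {x. 0 < \<rho> x}"
    then obtain n where "inverse (real (Suc n)) < \<rho> x" using reals_Archimedean[of "\<rho> x"] by auto
    then show "x \<in> (\<Union>n. H n)" by (auto simp: H_def inverse_eq_divide)
  qed
  have "(\<lambda>n. measure \<mu> (H n)) \<longlonglongrightarrow> measure \<mu> (\<Union>n. H n)"
    by (rule M.finite_Lim_measure_incseq) (use Hm inc \<mu>_sets in auto)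
  moreover have "measure \<mu> (\<Union>n. H n) = 1"
  proof -
    have "(\<Union>n. H n) \<in> M.events" using Hm \<mu>_sets by auto
    then show ?thesis unfolding U using \<rho>(2) by (subst M.prob_eq_1) auto
  qed
  ultimately have "(\<lambda>n. measure \<mu> (H n)) \<longlonglongrightarrow> 1" by simp
  from order_tendstoD(1)[OF this, of "1 - \<eta>"] \<eta> obtain n where n: "1 - \<eta> < measure \<mu> (H n)"
    by (auto simp: eventually_sequentially)
  have "measure \<mu> (- H n) = 1 - measure \<mu> (H n)"
    using M.prob_compl[of "H n"] Hm \<mu>_sets \<mu>_space by (simp add: Compl_eq_Diff_UNIV)
  then have "measure \<mu> (- H n) \<le> \<eta>" using n by simp
  moreover obtain T where "0 \<le> T" "\<And>x. x \<in> H n \<Longrightarrow> \<exists>t\<in>{0..T}. (1 / real (Suc n)) / 2 \<le> measure (PX x) {\<omega> \<in> cadlag_paths. \<omega> t \<in> G}"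
    using \<rho>(3)[of "1 / real (Suc n)"] unfolding H_def by auto
  ultimately show ?thesis
    by (intro bexI[OF _ Hm[of n]] conjI exI[of _ "(1 / real (Suc n)) / 2"] exI[of _ T]) auto
qed

text \<open>The direction needed in a block depends on the accumulated sum and hence on the path, so
  the target sets of all grid directions must be reachable from one and the same
  \<open>H\<close>.\<close>

lemma reach_finite:
  assumes "finite \<Lambda>" and G: "\<And>l. l \<in> \<Lambda> \<Longrightarrow> G l \<in> sets borel \<and> 0 < measure \<mu> (G l)" and "0 < \<eta>"
  shows "\<exists>H\<in>sets borel. measure \<mu> (- H) \<le> \<eta> \<and> (\<exists>k>0. \<exists>T\<ge>0. \<forall>x\<in>H. \<forall>l\<in>\<Lambda>. \<exists>t\<in>{0..T}.
     k \<le> measure (PX x) {\<omega> \<in> cadlag_paths. \<omega> t \<in> G l})"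
  using assms
proof (induction arbitrary: \<eta> rule: finite_induct)
  case empty
  then show ?case by (intro bexI[of _ UNIV] conjI exI[of _ 1] exI[of _ 0]) auto
next
  case (insert l \<Lambda>)
  interpret M: prob_space \<mu> by (rule \<mu>_prob)
  have \<eta>2: "0 < \<eta> / 2" using insert.prems by simp
  obtain H1 k1 T1 where 1: "H1 \<in> sets borel" "measure \<mu> (- H1) \<le> \<eta> / 2" "0 < k1" "0 \<le> T1"
    "\<And>x l. x \<in> H1 \<Longrightarrow> l \<in> \<Lambda> \<Longrightarrow> \<exists>t\<in>{0..T1}. k1 \<le> measure (PX x) {\<omega> \<in> cadlag_paths. \<omega> t \<in> G l}"
    using insert.IH[OF _ \<eta>2] insert.prems(1) by (blast intro: insertI2)
  obtain H2 k2 T2 where 2: "H2 \<in> sets borel" "measure \<mu> (- H2) \<le> \<eta> / 2" "0 < k2" "0 \<le> T2"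
    "\<And>x. x \<in> H2 \<Longrightarrow> \<exists>t\<in>{0..T2}. k2 \<le> measure (PX x) {\<omega> \<in> cadlag_paths. \<omega> t \<in> G l}"
    using reach_one[OF _ _ \<eta>2, of "G l"] insert.prems(1)[OF insertI1] by blast
  have "measure \<mu> (- (H1 \<inter> H2)) \<le> measure \<mu> (- H1) + measure \<mu> (- H2)"
    unfolding Compl_Int using 1(1) 2(1) \<mu>_sets by (intro measure_Un_le) auto
  then have "measure \<mu> (- (H1 \<inter> H2)) \<le> \<eta>" using 1(2) 2(2) by simp
  moreover have "\<exists>t\<in>{0..max T1 T2}. min k1 k2 \<le> measure (PX x) {\<omega> \<in> cadlag_paths. \<omega> t \<in> G l'}"
    if x: "x \<in> H1 \<inter> H2" and l': "l' \<in> insert l \<Lambda>" for x l'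
  proof (cases "l' = l")
    case True
    obtain t where "t \<in> {0..T2}" "k2 \<le> measure (PX x) {\<omega> \<in> cadlag_paths. \<omega> t \<in> G l}" using 2(5)[of x] x by auto
    then show ?thesis using True by (intro bexI[of _ t]) auto
  next
    case False
    obtain t where "t \<in> {0..T1}" "k1 \<le> measure (PX x) {\<omega> \<in> cadlag_paths. \<omega> t \<in> G l'}" using 1(5)[of x l'] x l' False by auto
    then show ?thesis by (intro bexI[of _ t]) auto
  qed
  ultimately show ?case
    using 1 2 by (intro bexI[of _ "H1 \<inter> H2"] conjI exI[of _ "min k1 k2"] exI[of _ "max T1 T2"]) auto
qed

end

section \<open>One block, and the induction over blocks\<close>

lemma Sint_sum:
  fixes F :: "nat \<Rightarrow> 'a::polish_space \<Rightarrow> real"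
  assumes F: "\<And>j. F j \<in> borel_measurable borel" "\<And>j x. \<bar>F j x\<bar> \<le> b" and \<omega>: "\<omega> \<in> cadlag_paths"
  shows "Sint (\<lambda>x. \<Sum>j<r. l j * F j x) t \<omega> = (\<Sum>j<r. l j * Sint (F j) t \<omega>)"
proof -
  have m: "(\<lambda>u. F j (\<omega> u)) \<in> borel_measurable borel" for j
    by (rule measurable_compose[OF cadlag_borel[OF \<omega>] F(1)])
  have i: "integrable lborel (\<lambda>u. indicator {0..t} u * F j (\<omega> u))" for j
    using set_integrable_bounded_Icc[OF m, of j b 0 t] F(2) by (simp add: set_integrable_def)
  have "Sint (\<lambda>x. \<Sum>j<r. l j * F j x) t \<omega> = (\<integral>u. (\<Sum>j<r. l j * (indicator {0..t} u * F j (\<omega> u))) \<partial>lborel)"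
    unfolding Sint_def set_lebesgue_integral_def
    by (intro Bochner_Integration.integral_cong refl) (simp add: sum_distrib_left mult_ac)
  also have "\<dots> = (\<Sum>j<r. l j * (\<integral>u. indicator {0..t} u * F j (\<omega> u) \<partial>lborel))"
    using i by (simp add: Bochner_Integration.integral_sum)
  finally show ?thesis by (simp add: Sint_def set_lebesgue_integral_def)
qed

context irreducible_donsker_varadhan
begin

text \<open>The lower bound for the last \<open>k\<close> of \<open>M\<close> blocks, started at the accumulated value \<open>s\<close>.\<close>
definition level :: "(nat \<Rightarrow> 'a \<Rightarrow> real) \<Rightarrow> nat \<Rightarrow> real \<Rightarrow> real \<Rightarrow> real \<Rightarrow> real \<Rightarrow> real \<Rightarrow> real \<Rightarrow> 'a set \<Rightarrow> real \<Rightarrow> real \<Rightarrow> bool" where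
  "level F r b A M c0 \<eta> k H \<kappa>0 t0 \<longleftrightarrow> H \<in> sets borel \<and> measure \<mu> (- H) \<le> \<eta> \<and> 0 < \<kappa>0 \<and> 0 < t0 \<and>
     (\<forall>t\<ge>t0. \<forall>x\<in>H. \<forall>s. (\<forall>j<r. \<bar>s j\<bar> \<le> 2 * (M - k) * t * b) \<longrightarrow>
        \<kappa>0 * exp (- (A / (2 * M * t)) * sqsum r s - k * (I + c0) * t) \<le> quad F r (A / (2 * M * t)) (k * t) s x)"

text \<open>One block of length about \<open>t\<close>: the quadratic potential is linearised at the accumulated
  value \<open>s\<close>, so that the block is driven by the exponential moment in the direction
  \<open>- 2 q s\<close>, rounded to a finite grid; the second order error is \<open>O(t / M)\<close>.\<close>
lemma level_step:
  fixes F :: "nat \<Rightarrow> 'a \<Rightarrow> real" and b A M \<delta> d \<eta> k :: real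
  assumes F: "\<And>j. F j \<in> borel_measurable borel" "\<And>j x. \<bar>F j x\<bar> \<le> b" and F0: "\<And>j. (\<integral>x. F j x \<partial>\<mu>) = 0"
    and A: "0 < A" and M: "1 \<le> M" and d: "0 < d" "d \<le> 1" and \<delta>: "0 < \<delta>" and \<eta>: "0 < \<eta>"
    and k: "0 \<le> k" "k + 1 \<le> M"
    and land: "\<And>H W. H \<in> sets borel \<Longrightarrow> measure \<mu> (- H) \<le> \<eta> \<Longrightarrow> W \<in> borel_measurable borel \<Longrightarrow>
       (\<forall>x. \<bar>W x\<bar> \<le> real r * ((2 * A * b + 1) * b)) \<Longrightarrow> (\<integral>x. W x \<partial>\<mu>) = 0 \<Longrightarrow>
       \<exists>G\<in>sets borel. 0 < measure \<mu> G \<and> (\<exists>t0. \<forall>y\<in>G. \<forall>t\<ge>t0. \<exists>s\<in>{(1 - \<delta>) * t..t}. 0 \<le> s \<and>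
         exp (- (I + \<delta>) * t) \<le> FK W s (indicator H) y)"
    and c0: "c0 = \<delta> + 3 * A * real r * b\<^sup>2 * \<delta> + d * real r * b + 2 * A * real r * b\<^sup>2 / M"
    and lev: "level F r b A M c0 \<eta> k H \<kappa>0 t0"
  shows "\<exists>H' \<kappa>' t0'. level F r b A M c0 \<eta> (k + 1) H' \<kappa>' t0'"
proof -
  have b: "0 \<le> b" using F(2)[of 0 undefined] by linarith
  have H: "H \<in> sets borel" "measure \<mu> (- H) \<le> \<eta>" "0 < \<kappa>0" "0 < t0"
    and lv: "\<And>t x s. t0 \<le> t \<Longrightarrow> x \<in> H \<Longrightarrow> (\<And>j. j < r \<Longrightarrow> \<bar>s j\<bar> \<le> 2 * (M - k) * t * b) \<Longrightarrow>
      \<kappa>0 * exp (- (A / (2 * M * t)) * sqsum r s - k * (I + c0) * t) \<le> quad F r (A / (2 * M * t)) (k * t) s x"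
    using lev unfolding level_def by auto
  \<comment> \<open>The grid has mesh \<open>d\<close> and covers the box
    \<open>\<bar>l j\<bar> \<le> 2 * A * b\<close>, which contains every direction \<open>l0\<close>
    that can occur below.\<close>
  define N where "N = \<lceil>2 * A * b / d\<rceil>"
  define \<Lambda> where "\<Lambda> = PiE {..<r} (\<lambda>_. (\<lambda>i. d * real_of_int i) ` {-N..N})"
  have fin: "finite \<Lambda>" unfolding \<Lambda>_def by (intro finite_PiE) auto
  define W where "W l x = (\<Sum>j<r. l j * F j x)" for l x
  have lb: "\<bar>l j\<bar> \<le> 2 * A * b + 1" if l: "l \<in> \<Lambda>" and j: "j < r" for l j
  proof -
    obtain i where i: "i \<in> {-N..N}" "l j = d * real_of_int i" using l j unfolding \<Lambda>_def by (auto dest: PiE_mem)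
    have "\<bar>real_of_int i\<bar> \<le> real_of_int N" using i(1) by (simp add: abs_le_iff)
    also have "\<dots> \<le> 2 * A * b / d + 1" unfolding N_def by (rule of_int_ceiling_le_add_one)
    finally have "\<bar>real_of_int i\<bar> * d \<le> (2 * A * b / d + 1) * d" using d by (intro mult_right_mono) auto
    also have "\<dots> = 2 * A * b + d" using d by (simp add: distrib_right)
    finally show ?thesis using i(2) d by (simp add: abs_mult mult.commute)
  qed
  have Wm: "W l \<in> borel_measurable borel" for l
    unfolding W_def[abs_def] by (intro borel_measurable_sum borel_measurable_times borel_measurable_const F(1))
  have Wb: "\<bar>W l x\<bar> \<le> real r * ((2 * A * b + 1) * b)" if l: "l \<in> \<Lambda>" for l x
  proof -
    have "\<bar>W l x\<bar> \<le> (\<Sum>j<r. \<bar>l j * F j x\<bar>)" unfolding W_def by (rule sum_abs)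
    also have "\<dots> \<le> (\<Sum>j<r. (2 * A * b + 1) * b)"
    proof (rule sum_mono)
      fix j assume "j \<in> {..<r}"
      then show "\<bar>l j * F j x\<bar> \<le> (2 * A * b + 1) * b"
        unfolding abs_mult using lb[OF l, of j] F(2)[of j x] A b by (intro mult_mono) auto
    qed
    finally show ?thesis by simp
  qed
  have W0: "(\<integral>x. W l x \<partial>\<mu>) = 0" for l
    unfolding W_def using F0 \<mu>_integrable[OF F] by (simp add: Bochner_Integration.integral_sum)
  define R where "R l G t1 \<longleftrightarrow> (\<forall>y\<in>G. \<forall>t\<ge>t1. \<exists>s\<in>{(1 - \<delta>) * t..t}. 0 \<le> s \<and>
         exp (- (I + \<delta>) * t) \<le> FK (W l) s (indicator H) y)" for l G t1
  have "\<exists>G\<in>sets borel. 0 < measure \<mu> G \<and> (\<exists>t1. R l G t1)" if l: "l \<in> \<Lambda>" for l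
    unfolding R_def by (rule land[OF H(1,2) Wm _ W0]) (rule allI, rule Wb[OF l])
  then have "\<forall>l\<in>\<Lambda>. \<exists>G. G \<in> sets borel \<and> 0 < measure \<mu> G \<and> (\<exists>t1. R l G t1)" by blast
  from bchoice[OF this] obtain G where G: "\<forall>l\<in>\<Lambda>. G l \<in> sets borel \<and> 0 < measure \<mu> (G l) \<and> (\<exists>t1. R l (G l) t1)" ..
  then have "\<forall>l\<in>\<Lambda>. \<exists>t1. R l (G l) t1" by blast
  from bchoice[OF this] obtain t1 where t1R: "\<forall>l\<in>\<Lambda>. R l (G l) (t1 l)" ..
  have t1: "\<exists>s\<in>{(1 - \<delta>) * t..t}. 0 \<le> s \<and> exp (- (I + \<delta>) * t) \<le> FK (W l) s (indicator H) y"
    if "l \<in> \<Lambda>" "y \<in> G l" "t1 l \<le> t" for l y t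
    using t1R[rule_format, OF that(1)] that(2,3) unfolding R_def by blast
  have GG: "G l \<in> sets borel \<and> 0 < measure \<mu> (G l)" if "l \<in> \<Lambda>" for l using G that by blast
  have "\<exists>H\<in>sets borel. measure \<mu> (- H) \<le> \<eta> \<and> (\<exists>k>0. \<exists>T\<ge>0. \<forall>x\<in>H. \<forall>l\<in>\<Lambda>. \<exists>t\<in>{0..T}.
     k \<le> measure (PX x) {\<omega> \<in> cadlag_paths. \<omega> t \<in> G l})"
    by (rule reach_finite[OF fin _ \<eta>]) (rule GG)
  then obtain H' where H': "H' \<in> sets borel" "measure \<mu> (- H') \<le> \<eta>"
    and "\<exists>k>0. \<exists>T\<ge>0. \<forall>x\<in>H'. \<forall>l\<in>\<Lambda>. \<exists>t\<in>{0..T}. k \<le> measure (PX x) {\<omega> \<in> cadlag_paths. \<omega> t \<in> G l}"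
    by (elim bexE conjE) (rule that)
  then obtain k1 rm where "0 < k1" "0 \<le> rm"
    and rm: "\<forall>x\<in>H'. \<forall>l\<in>\<Lambda>. \<exists>t\<in>{0..rm}. k1 \<le> measure (PX x) {\<omega> \<in> cadlag_paths. \<omega> t \<in> G l}"
    by (elim exE conjE) (rule that)
  note H' = H' this
  \<comment> \<open>One threshold for all grid directions, and at least \<open>rm\<close>, so that
    the walk to a set \<open>G l\<close> never takes longer than a block.\<close>
  define t2 where "t2 = t0 + rm + (\<Sum>l\<in>\<Lambda>. \<bar>t1 l\<bar>)"
  have t2: "0 < t2" "t0 \<le> t2" "rm \<le> t2" "\<And>l. l \<in> \<Lambda> \<Longrightarrow> t1 l \<le> t2"
  proof -
    have S: "0 \<le> (\<Sum>l\<in>\<Lambda>. \<bar>t1 l\<bar>)" by (simp add: sum_nonneg)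
    then show "0 < t2" "t0 \<le> t2" "rm \<le> t2" using H(4) H'(4) unfolding t2_def by linarith+
    fix l assume "l \<in> \<Lambda>"
    then have "\<bar>t1 l\<bar> \<le> (\<Sum>l\<in>\<Lambda>. \<bar>t1 l\<bar>)" by (intro member_le_sum fin) auto
    then show "t1 l \<le> t2" using H(4) H'(4) unfolding t2_def by linarith
  qed
  \<comment> \<open>Losses caused by the walk of length at most \<open>rm\<close>: in the linear
    term (\<open>E1\<close>) and in the horizon (\<open>E2\<close>). They are independent of
    \<open>t\<close> and go into the constant \<open>\<kappa>'\<close>.\<close>
  define E1 where "E1 = real r * (2 * A * b * (b * rm))"
  define E2 where "E2 = 4 * A * real r * b\<^sup>2 * rm"
  define \<kappa>' where "\<kappa>' = k1 * \<kappa>0 * exp (- E1 - E2)"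
  have main: "\<kappa>' * exp (- (A / (2 * M * t)) * sqsum r s - (k + 1) * (I + c0) * t) \<le> quad F r (A / (2 * M * t)) ((k + 1) * t) s x"
    if t: "t2 \<le> t" and x: "x \<in> H'" and s: "\<And>j. j < r \<Longrightarrow> \<bar>s j\<bar> \<le> 2 * (M - (k + 1)) * t * b" for t x s
  proof -
    have tpos: "0 < t" "rm \<le> t" "t0 \<le> t" using t t2 by auto
    \<comment> \<open>The relation \<open>q * (2 * M * t) = A\<close> turns the bound
      \<open>2 * M * t * b\<close> on the sum into the bound \<open>2 * A * b\<close> on the
      direction, uniformly in \<open>t\<close>.\<close>
    define q where "q = A / (2 * M * t)"
    have q: "0 < q" "q * (2 * M * t) = A" using A M tpos by (simp_all add: q_def)
    have sM: "\<bar>s j\<bar> \<le> 2 * M * t * b" if "j < r" for j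
    proof -
      have "2 * (M - (k + 1)) * t * b \<le> 2 * M * t * b" using k tpos b by (intro mult_right_mono) auto
      then show ?thesis using s[OF that] by linarith
    qed
    define l0 where "l0 j = - 2 * q * s j" for j
    have l0: "\<bar>l0 j\<bar> \<le> 2 * A * b" if "j < r" for j
    proof -
      have "\<bar>l0 j\<bar> = 2 * q * \<bar>s j\<bar>" using q by (simp add: l0_def abs_mult)
      also have "\<dots> \<le> 2 * q * (2 * M * t * b)" using sM[OF that] q by (intro mult_left_mono) auto
      also have "\<dots> = 2 * A * b" using q(2) by (simp add: mult.assoc[symmetric]) (simp add: mult_ac)
      finally show ?thesis .
    qed
    \<comment> \<open>\<open>l0\<close> rounded down to the grid; \<open>restrict\<close> places it
      in the extensional product \<open>\<Lambda>\<close>.\<close>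
    define l where "l = restrict (\<lambda>j. d * real_of_int \<lfloor>l0 j / d\<rfloor>) {..<r}"
    have l: "l \<in> \<Lambda>"
    proof -
      have "\<lfloor>l0 j / d\<rfloor> \<in> {-N..N}" if "j < r" for j
      proof -
        have "l0 j / d \<le> 2 * A * b / d" "- (2 * A * b / d) \<le> l0 j / d"
          using l0[OF that] d by (auto simp: abs_le_iff field_simps)
        moreover have "2 * A * b / d \<le> real_of_int N" unfolding N_def by (rule le_of_int_ceiling)
        ultimately have "real_of_int (- N) \<le> l0 j / d" "l0 j / d \<le> real_of_int N" by simp_all
        then have "- N \<le> \<lfloor>l0 j / d\<rfloor>" "\<lfloor>l0 j / d\<rfloor> \<le> N"
          unfolding le_floor_iff floor_le_iff by linarith+
        then show ?thesis by simp
      qed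
      then show ?thesis unfolding \<Lambda>_def l_def by auto
    qed
    have ld: "\<bar>l0 j - l j\<bar> \<le> d" if "j < r" for j
    proof -
      have "0 \<le> l0 j / d - real_of_int \<lfloor>l0 j / d\<rfloor>" "l0 j / d - real_of_int \<lfloor>l0 j / d\<rfloor> \<le> 1" by linarith+
      then have "0 * d \<le> (l0 j / d - real_of_int \<lfloor>l0 j / d\<rfloor>) * d" "(l0 j / d - real_of_int \<lfloor>l0 j / d\<rfloor>) * d \<le> 1 * d"
        using d by (intro mult_right_mono; simp)+
      moreover have "(l0 j / d - real_of_int \<lfloor>l0 j / d\<rfloor>) * d = l0 j - l j"
        using d that by (simp add: l_def left_diff_distrib)
      ultimately show ?thesis by simp
    qed
    obtain r1 where r1: "0 \<le> r1" "r1 \<le> rm" "k1 \<le> measure (PX x) {\<omega> \<in> cadlag_paths. \<omega> r1 \<in> G l}"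
      using rm[rule_format, OF x l] by auto
    \<comment> \<open>What the remaining \<open>k\<close> blocks are worth after the landing in
      \<open>H\<close>, apart from the linear weight of the present block: the bound
      \<open>lv\<close> diminished by the inaccuracy of the landing time, the walk
      (\<open>E1\<close>), the rounding of the direction and the second-order term.\<close>
    define B where "B = exp (- (3 * A * real r * b\<^sup>2 * \<delta>) * t) *
       (\<kappa>0 * exp (- q * sqsum r s - k * (I + c0) * t - E1 - (d * real r * b + 2 * A * real r * b\<^sup>2 / M) * t))"
    have B: "0 < B" using H(3) by (simp add: B_def)
    have kt: "0 \<le> k * t" "k * t \<le> M * t" "(k + 1) * t \<le> M * t" "0 \<le> (k + 1) * t" "(k + 1) * t = k * t + t"
    proof -
      show "(k + 1) * t \<le> M * t" using k(2) tpos by (intro mult_right_mono) auto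
      show "(k + 1) * t = k * t + t" by (simp add: distrib_right)
      show "0 \<le> k * t" using k tpos by simp
      then show "0 \<le> (k + 1) * t" using tpos by (simp add: distrib_right)
      show "k * t \<le> M * t" using k tpos by (intro mult_right_mono) auto
    qed
    \<comment> \<open>From a point of \<open>G l\<close> the block runs until it lands in
      \<open>H\<close>, at a time \<open>s1\<close> between \<open>(1 - \<delta>) * t\<close> and
      \<open>t\<close>; from there the bound for \<open>k\<close> blocks takes over.
      \<open>s'\<close> differs from \<open>s\<close> by what the walk to \<open>G l\<close> has
      contributed.\<close>
    have one: "exp (- (I + \<delta>) * t) * B \<le> quad F r q ((k + 1) * t) s' y"
      if y: "y \<in> G l" and s': "\<And>j. j < r \<Longrightarrow> \<bar>s' j - s j\<bar> \<le> b * rm" for y s'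
    proof -
      obtain s1 where s1: "(1 - \<delta>) * t \<le> s1" "s1 \<le> t" "0 \<le> s1" "exp (- (I + \<delta>) * t) \<le> FK (W l) s1 (indicator H) y"
        using t1[OF l y, of t] t2(4)[OF l] t by auto
      define \<tau> where "\<tau> = (k + 1) * t - s1"
      have \<tau>: "0 \<le> \<tau>" "k * t \<le> \<tau>" "\<tau> \<le> M * t" "\<bar>\<tau> - k * t\<bar> \<le> \<delta> * t"
      proof -
        have e: "(1 - \<delta>) * t = t - \<delta> * t" by (simp add: algebra_simps)
        have s1': "t - \<delta> * t \<le> s1" using s1(1) unfolding e .
        show "0 \<le> \<tau>" "k * t \<le> \<tau>" "\<tau> \<le> M * t" using s1(2,3) kt unfolding \<tau>_def by linarith+
        show "\<bar>\<tau> - k * t\<bar> \<le> \<delta> * t" using s1(2) s1' unfolding \<tau>_def kt(5) by linarith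
      qed
      have path: "exp (Sint (W l) s1 \<omega>) * indicator H (\<omega> s1) * B \<le> quad F r q \<tau> (\<lambda>j. s' j + Sint (F j) s1 \<omega>) (\<omega> s1)"
        if \<omega>: "\<omega> \<in> cadlag_paths" for \<omega>
      proof (cases "\<omega> s1 \<in> H")
        case False
        then show ?thesis using quad_bounds(1)[OF F(1)] q by simp
      next
        case True
        \<comment> \<open>The increment since \<open>x\<close>, from the walk and from the block.
          Each part is at most \<open>b * t\<close>, which explains the factor \<open>2\<close> in
          the bound on \<open>s\<close> in \<open>level\<close>.\<close>
        define D where "D j = s' j - s j + Sint (F j) s1 \<omega>" for j
        have Sb: "\<bar>Sint (F j) s1 \<omega>\<bar> \<le> b * t" for j
          using Sint_bound[OF F \<omega> s1(3), of j] mult_left_mono[OF s1(2) b] by linarith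
        have Db: "\<bar>D j\<bar> \<le> 2 * (b * t)" if "j < r" for j
          using Sb[of j] s'[OF that] mult_left_mono[OF tpos(2) b] unfolding D_def by linarith
        have eq: "(\<lambda>j. s' j + Sint (F j) s1 \<omega>) = (\<lambda>j. s j + D j)" by (auto simp: D_def)
        have sD: "\<bar>s j + D j\<bar> \<le> 2 * (M - k) * t * b" if "j < r" for j
        proof -
          have "2 * (M - k) * t * b = 2 * (M - (k + 1)) * t * b + 2 * (b * t)" by (simp add: algebra_simps)
          then show ?thesis using s[OF that] Db[OF that] by linarith
        qed
        \<comment> \<open>The exact linear term has direction \<open>l0\<close> and increment
          \<open>D\<close>, while \<open>landing\<close> was applied to \<open>l\<close> and to the
          block alone. Per coordinate the rounding costs \<open>d * (b * t)\<close> and the walk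
          costs \<open>2 * A * b * (b * rm)\<close>.\<close>
        have lin: "(\<Sum>j<r. l j * Sint (F j) s1 \<omega>) - real r * (d * (b * t)) - E1 \<le> (\<Sum>j<r. l0 j * D j)"
        proof -
          have "l j * Sint (F j) s1 \<omega> - d * (b * t) - 2 * A * b * (b * rm) \<le> l0 j * D j" if j: "j < r" for j
          proof -
            have "l0 j * D j = l j * Sint (F j) s1 \<omega> + (l0 j - l j) * Sint (F j) s1 \<omega> + l0 j * (s' j - s j)"
              by (simp add: D_def algebra_simps)
            moreover have "\<bar>(l0 j - l j) * Sint (F j) s1 \<omega>\<bar> \<le> d * (b * t)"
              unfolding abs_mult using ld[OF j] Sb[of j] d by (intro mult_mono) auto
            moreover have "\<bar>l0 j * (s' j - s j)\<bar> \<le> 2 * A * b * (b * rm)"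
              unfolding abs_mult using l0[OF j] s'[OF j] A b by (intro mult_mono) auto
            ultimately show ?thesis by linarith
          qed
          then have "(\<Sum>j<r. l j * Sint (F j) s1 \<omega> - d * (b * t) - 2 * A * b * (b * rm)) \<le> (\<Sum>j<r. l0 j * D j)"
            by (intro sum_mono) auto
          then show ?thesis by (simp add: sum_subtractf E1_def)
        qed
        have sW: "Sint (W l) s1 \<omega> = (\<Sum>j<r. l j * Sint (F j) s1 \<omega>)"
          unfolding W_def by (rule Sint_sum[OF F \<omega>])
        \<comment> \<open>The second-order term: \<open>D\<close> is of order \<open>t\<close> and
          \<open>q = A / (2 * M * t)\<close>, so it is of order \<open>t / M\<close>.\<close>
        have qD: "q * sqsum r D \<le> 2 * A * real r * b\<^sup>2 / M * t"
        proof -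
          have "q * sqsum r D \<le> q * (real r * (2 * (b * t))\<^sup>2)"
            using sqsum_le[of r D "2 * (b * t)"] Db q by (intro mult_left_mono) auto
          also have "\<dots> = 2 * A * real r * b\<^sup>2 / M * t"
            using M tpos by (simp add: q_def power2_eq_square field_simps)
          finally show ?thesis .
        qed
        have "q * sqsum r (\<lambda>j. s j + D j) = q * sqsum r s - (\<Sum>j<r. l0 j * D j) + q * sqsum r D"
          unfolding sqsum_add by (simp add: distrib_left sum_distrib_left l0_def sum_negf mult_ac)
        then have sq: "- q * sqsum r (\<lambda>j. s j + D j) \<ge> - q * sqsum r s + Sint (W l) s1 \<omega> - E1
             - (d * real r * b + 2 * A * real r * b\<^sup>2 / M) * t"
          using lin qD sW by (simp add: algebra_simps)
        have "q * real r * (b * \<bar>\<tau> - k * t\<bar>) * (2 * (2 * M * t * b) + 2 * b * (M * t))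
            = 3 * (q * (2 * M * t)) * real r * b\<^sup>2 * \<bar>\<tau> - k * t\<bar>"
          by (simp add: power2_eq_square algebra_simps)
        also have "\<dots> \<le> 3 * A * real r * b\<^sup>2 * (\<delta> * t)"
          unfolding q(2) using \<tau>(4) A by (intro mult_left_mono) auto
        finally have te: "q * real r * (b * \<bar>\<tau> - k * t\<bar>) * (2 * (2 * M * t * b) + 2 * b * (M * t)) \<le> 3 * A * real r * b\<^sup>2 * \<delta> * t"
          by (simp add: mult_ac)
        have sD2: "\<bar>s j + D j\<bar> \<le> 2 * M * t * b" if "j < r" for j
        proof -
          have "2 * (M - k) * t * b \<le> 2 * M * t * b" using k tpos b by (intro mult_right_mono) auto
          then show ?thesis using sD[OF that] by linarith
        qed
        define X where "X = - q * sqsum r s - k * (I + c0) * t - E1 - (d * real r * b + 2 * A * real r * b\<^sup>2 / M) * t"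
        have "exp (Sint (W l) s1 \<omega>) * B
           = exp (- (3 * A * real r * b\<^sup>2 * \<delta>) * t) * (\<kappa>0 * exp (Sint (W l) s1 \<omega> + X))"
          unfolding B_def X_def[symmetric] exp_add by (simp only: mult_ac)
        also have "\<dots> \<le> exp (- (q * real r * (b * \<bar>\<tau> - k * t\<bar>) * (2 * (2 * M * t * b) + 2 * b * (M * t)))) *
             (\<kappa>0 * exp (- q * sqsum r (\<lambda>j. s j + D j) - k * (I + c0) * t))"
        proof (intro mult_mono)
          show "exp (- (3 * A * real r * b\<^sup>2 * \<delta>) * t)
             \<le> exp (- (q * real r * (b * \<bar>\<tau> - k * t\<bar>) * (2 * (2 * M * t * b) + 2 * b * (M * t))))"
            unfolding exp_le_cancel_iff mult_minus_left using te by linarith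
          show "exp (Sint (W l) s1 \<omega> + X) \<le> exp (- q * sqsum r (\<lambda>j. s j + D j) - k * (I + c0) * t)"
            unfolding exp_le_cancel_iff X_def using sq by linarith
        qed (use H(3) in auto)
        also have "\<dots> \<le> exp (- (q * real r * (b * \<bar>\<tau> - k * t\<bar>) * (2 * (2 * M * t * b) + 2 * b * (M * t)))) *
             quad F r q (k * t) (\<lambda>j. s j + D j) (\<omega> s1)"
          unfolding q_def by (intro mult_left_mono lv tpos True sD) auto
        also have "\<dots> \<le> quad F r q \<tau> (\<lambda>j. s j + D j) (\<omega> s1)"
          by (rule quad_time[OF F _ kt(1,2) \<tau>(1,3) sD2]) (use q in auto)
        finally show ?thesis using True by (simp add: eq)
      qed
      have "exp (- (I + \<delta>) * t) * B \<le> FK (W l) s1 (indicator H) y * B"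
        using s1(4) B by (intro mult_right_mono) auto
      also have "\<dots> = (\<integral>\<omega>. exp (Sint (W l) s1 \<omega>) * indicator H (\<omega> s1) * B \<partial>PX y)" by (simp add: FK_def)
      also have "\<dots> \<le> (\<integral>\<omega>. quad F r q \<tau> (\<lambda>j. s' j + Sint (F j) s1 \<omega>) (\<omega> s1) \<partial>PX y)"
      proof (rule Ex_mono[OF _ _ _ _ path])
        show "(\<lambda>\<omega>. quad F r q \<tau> (\<lambda>j. s' j + Sint (F j) s1 \<omega>) (\<omega> s1)) \<in> borel_measurable path_space"
          by (rule quad_add(2)[OF F _ s1(3) \<tau>(1)]) (use q in simp)
        show "\<bar>quad F r q \<tau> (\<lambda>j. s' j + Sint (F j) s1 \<omega>) (\<omega> s1)\<bar> \<le> 1" for \<omega>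
          by (simp add: quad_bounds[OF F(1) less_imp_le[OF q(1)]])
        show "(\<lambda>\<omega>. exp (Sint (W l) s1 \<omega>) * indicator H (\<omega> s1) * B) \<in> borel_measurable path_space"
          using FK_integrand_measurable[OF Wm, of "indicator H" l s1] H(1) by simp
        fix \<omega> :: "real \<Rightarrow> 'a" assume \<omega>: "\<omega> \<in> cadlag_paths"
        show "\<bar>exp (Sint (W l) s1 \<omega>) * indicator H (\<omega> s1) * B\<bar> \<le> exp (real r * ((2 * A * b + 1) * b) * s1) * B"
          using exp_Sint_bounds(2)[OF Wm Wb[OF l] s1(3) \<omega>] B by (auto simp: abs_mult split: split_indicator)
      qed
      also have "\<dots> = quad F r q (s1 + \<tau>) s' y"
        by (rule quad_add(1)[OF F _ s1(3) \<tau>(1), symmetric]) (use q in simp)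
      finally show ?thesis by (simp add: \<tau>_def)
    qed
    let ?B = "exp (- (I + \<delta>) * t) * B"
    \<comment> \<open>With probability at least \<open>k1\<close> the process is in
      \<open>G l\<close> at time \<open>r1\<close>; there \<open>one\<close> applies, the sum having
      changed by at most \<open>b * rm\<close> per coordinate. On all other paths the integrand is
      nonnegative.\<close>
    have "k1 * ?B \<le> quad F r q (r1 + (k + 1) * t) s x"
    proof -
      have ev: "{\<omega> \<in> cadlag_paths. \<omega> r1 \<in> G l} \<in> sets (PX x)"
        using measurable_sets[OF measurable_eval, of "G l" r1] G l by (auto simp: PX_sets vimage_def Int_def conj_commute)
      interpret P: prob_space "PX x" by (rule PX_prob)
      have "k1 * ?B \<le> measure (PX x) {\<omega> \<in> cadlag_paths. \<omega> r1 \<in> G l} * ?B"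
        using r1(3) B by (intro mult_right_mono) auto
      also have "\<dots> = (\<integral>\<omega>. indicator {\<omega> \<in> cadlag_paths. \<omega> r1 \<in> G l} \<omega> * ?B \<partial>PX x)"
        using ev by (simp add: P.emeasure_eq_measure Int_absorb2 sets.sets_into_space)
      also have "\<dots> \<le> (\<integral>\<omega>. quad F r q ((k + 1) * t) (\<lambda>j. s j + Sint (F j) r1 \<omega>) (\<omega> r1) \<partial>PX x)"
      proof (rule Ex_mono)
        show "(\<lambda>\<omega>. quad F r q ((k + 1) * t) (\<lambda>j. s j + Sint (F j) r1 \<omega>) (\<omega> r1)) \<in> borel_measurable path_space"
          by (rule quad_add(2)[OF F _ r1(1) kt(4)]) (use q in simp)
        show "\<bar>quad F r q ((k + 1) * t) (\<lambda>j. s j + Sint (F j) r1 \<omega>) (\<omega> r1)\<bar> \<le> 1" for \<omega>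
          by (simp add: quad_bounds[OF F(1) less_imp_le[OF q(1)]])
        show "(\<lambda>\<omega>. indicator {\<omega> \<in> cadlag_paths. \<omega> r1 \<in> G l} \<omega> * ?B) \<in> borel_measurable path_space"
          using ev PX_sets by (intro borel_measurable_times borel_measurable_indicator) auto
        fix \<omega> :: "real \<Rightarrow> 'a" assume \<omega>: "\<omega> \<in> cadlag_paths"
        show "\<bar>indicator {\<omega> \<in> cadlag_paths. \<omega> r1 \<in> G l} \<omega> * ?B\<bar> \<le> ?B" using B by (auto split: split_indicator)
        show "indicator {\<omega> \<in> cadlag_paths. \<omega> r1 \<in> G l} \<omega> * ?B \<le> quad F r q ((k + 1) * t) (\<lambda>j. s j + Sint (F j) r1 \<omega>) (\<omega> r1)"
        proof (cases "\<omega> r1 \<in> G l")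
          case True
          have "\<bar>(s j + Sint (F j) r1 \<omega>) - s j\<bar> \<le> b * rm" for j
            using Sint_bound[OF F \<omega> r1(1), of j] mult_left_mono[OF r1(2) b] by simp
          from one[OF True this] show ?thesis using True \<omega> by simp
        next
          case False
          then show ?thesis using quad_bounds(1)[OF F(1)] q by simp
        qed
      qed
      also have "\<dots> = quad F r q (r1 + (k + 1) * t) s x"
        by (rule quad_add(1)[OF F _ r1(1) kt(4), symmetric]) (use q in simp)
      finally show ?thesis .
    qed
    moreover have "exp (- E2) * quad F r q (r1 + (k + 1) * t) s x \<le> quad F r q ((k + 1) * t) s x"
    proof -
      have Mt: "t \<le> M * t" using mult_right_mono[OF M, of t] tpos by simp
      \<comment> \<open>The horizon including the walk may exceed \<open>M * t\<close>, hence the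
        bound \<open>2 * (M * t)\<close> in this application of \<open>quad_time\<close>.\<close>
      have T: "r1 + (k + 1) * t \<le> 2 * (M * t)" using r1(2) tpos(2) kt(3) Mt by linarith
      have "q * real r * (b * \<bar>(k + 1) * t - (r1 + (k + 1) * t)\<bar>) * (2 * (2 * M * t * b) + 2 * b * (2 * (M * t)))
         = 4 * (q * (2 * M * t)) * real r * b\<^sup>2 * r1"
        using r1(1) by (simp add: power2_eq_square algebra_simps)
      also have "\<dots> \<le> E2" unfolding q(2) E2_def using r1(2) A by (intro mult_left_mono) auto
      finally have "exp (- E2) * quad F r q (r1 + (k + 1) * t) s x
        \<le> exp (- (q * real r * (b * \<bar>(k + 1) * t - (r1 + (k + 1) * t)\<bar>) * (2 * (2 * M * t * b) + 2 * b * (2 * (M * t)))))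
            * quad F r q (r1 + (k + 1) * t) s x"
        using quad_bounds(1)[OF F(1)] q by (intro mult_right_mono) auto
      also have "\<dots> \<le> quad F r q ((k + 1) * t) s x"
        by (rule quad_time[OF F _ _ T _ _ sM]) (use q r1 kt Mt tpos in auto)
      finally show ?thesis .
    qed
    ultimately have "exp (- E2) * (k1 * ?B) \<le> quad F r q ((k + 1) * t) s x"
      by (meson exp_ge_zero mult_left_mono order_trans)
    moreover have "exp (- E2) * (k1 * ?B) = \<kappa>' * exp (- q * sqsum r s - (k + 1) * (I + c0) * t)"
    proof -
      have "exp (- E2) * (k1 * ?B) = k1 * \<kappa>0 * exp (- E2 + (- (I + \<delta>) * t + (- (3 * A * real r * b\<^sup>2 * \<delta>) * t +
         (- q * sqsum r s - k * (I + c0) * t - E1 - (d * real r * b + 2 * A * real r * b\<^sup>2 / M) * t))))"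
        unfolding B_def exp_add by simp
      \<comment> \<open>The losses of this block that are proportional to \<open>t\<close> add up to
        exactly \<open>c0 * t\<close>, so the exponent passes from \<open>k\<close> to
        \<open>k + 1\<close>.\<close>
      also have "- E2 + (- (I + \<delta>) * t + (- (3 * A * real r * b\<^sup>2 * \<delta>) * t +
         (- q * sqsum r s - k * (I + c0) * t - E1 - (d * real r * b + 2 * A * real r * b\<^sup>2 / M) * t)))
         = (- E1 - E2) + (- q * sqsum r s - (k + 1) * (I + c0) * t)"
        unfolding c0 by (simp add: algebra_simps add_divide_distrib)
      finally show ?thesis unfolding \<kappa>'_def exp_add by (simp add: mult.assoc)
    qed
    ultimately show ?thesis unfolding q_def by simp
  qed
  have "level F r b A M c0 \<eta> (k + 1) H' \<kappa>' t2"
    unfolding level_def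
  proof (intro conjI allI ballI impI)
    show "0 < \<kappa>'" using H' H(3) by (simp add: \<kappa>'_def)
    fix t x s assume "t2 \<le> t" "x \<in> H'" "\<forall>j<r. \<bar>s j\<bar> \<le> 2 * (M - (k + 1)) * t * b"
    then show "\<kappa>' * exp (- (A / (2 * M * t)) * sqsum r s - (k + 1) * (I + c0) * t)
      \<le> quad F r (A / (2 * M * t)) ((k + 1) * t) s x" by (intro main) auto
  qed (use H' t2 in auto)
  then show ?thesis by blast
qed

text \<open>All \<open>M\<close> blocks started from sum \<open>0\<close> bound the penalised
  expectation from below by a constant times \<open>exp (- (I + c) * T)\<close>. On the other hand
  it is at most the probability wanted plus \<open>exp (- (I + c + 1) * T)\<close>, because the
  penalty suppresses the paths outside the event.\<close>

proposition exponential_lower_bound: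
  fixes F :: "nat \<Rightarrow> 'a \<Rightarrow> real"
  assumes F: "\<And>j. F j \<in> borel_measurable borel" "\<And>j x. \<bar>F j x\<bar> \<le> b" and F0: "\<And>j. (\<integral>x. F j x \<partial>\<mu>) = 0"
    and \<epsilon>: "0 < \<epsilon>" and c: "0 < c"
  shows "\<exists>H\<in>sets borel. 0 < measure \<mu> H \<and> (\<exists>k>0. \<exists>T0>0. \<forall>T\<ge>T0. \<forall>x\<in>H.
    k * exp (- (I + c) * T) \<le> measure (PX x) {\<omega> \<in> cadlag_paths. \<forall>j<r. \<bar>Sint (F j) T \<omega>\<bar> < \<epsilon> * T})"
proof -
  interpret M: prob_space \<mu> by (rule \<mu>_prob)
  have b: "0 \<le> b" using F(2)[of 0 undefined] by linarith
  \<comment> \<open>With \<open>q = A / (2 * T)\<close> this gives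
    \<open>q * (\<epsilon> * T)\<^sup>2 = (I + c + 1) * T\<close>, the least penalty of a path
    outside the event.\<close>
  define A where "A = 2 * (I + c + 1) / \<epsilon>\<^sup>2"
  have A: "0 < A" using I_nonneg c \<epsilon> by (simp add: A_def)
  define y where "y = A * real r * b\<^sup>2"
  have y: "0 \<le> y" using A by (simp add: y_def)
  \<comment> \<open>\<open>\<delta>\<close>, \<open>d\<close> and \<open>M\<close> are chosen so
    that landing, rounding of the direction and second-order error each take at most
    \<open>c / 4\<close> of the rate; together this gives \<open>c0 \<le> c\<close>.\<close>
  define \<delta> where "\<delta> = min 1 (c / (4 * (1 + 3 * y)))"
  have \<delta>: "0 < \<delta>" "\<delta> \<le> 1" "\<delta> * (1 + 3 * y) \<le> c / 4"
  proof -
    show "0 < \<delta>" "\<delta> \<le> 1" using c y by (auto simp: \<delta>_def)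
    have "\<delta> \<le> c / (4 * (1 + 3 * y))" by (simp add: \<delta>_def)
    then show "\<delta> * (1 + 3 * y) \<le> c / 4" using y by (simp add: pos_le_divide_eq algebra_simps)
  qed
  define d where "d = min 1 (c / (4 * (1 + real r * b)))"
  have rb: "0 \<le> real r * b" using b by simp
  have d: "0 < d" "d \<le> 1" "d * (real r * b) \<le> c / 4"
  proof -
    show "0 < d" "d \<le> 1" using c rb by (auto simp: d_def)
    then have "d * (real r * b) \<le> d * (1 + real r * b)" by (intro mult_left_mono) auto
    also have "\<dots> \<le> c / 4"
    proof -
      have "d \<le> c / (4 * (1 + real r * b))" by (simp add: d_def)
      then show ?thesis using rb by (simp add: pos_le_divide_eq algebra_simps)
    qed
    finally show "d * (real r * b) \<le> c / 4" .
  qed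
  obtain n :: nat where n: "max 1 (8 * y / c) < real n" using reals_Archimedean2 by blast
  define M where "M = real n"
  have M: "1 \<le> M" "2 * y / M \<le> c / 4"
  proof -
    show M1: "1 \<le> M" using n by (simp add: M_def)
    have "8 * y / c < M" using n by (simp add: M_def)
    then have "8 * y < M * c" using c by (simp add: pos_divide_less_eq)
    then have "2 * y \<le> c / 4 * M" by (simp add: mult.commute)
    then show "2 * y / M \<le> c / 4" using M1 by (simp add: pos_divide_le_eq)
  qed
  define c0 where "c0 = \<delta> + 3 * A * real r * b\<^sup>2 * \<delta> + d * real r * b + 2 * A * real r * b\<^sup>2 / M"
  have c0: "c0 \<le> c"
  proof -
    have "c0 = \<delta> * (1 + 3 * y) + d * (real r * b) + 2 * y / M"
      by (simp add: c0_def y_def algebra_simps)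
    then show ?thesis using \<delta>(3) d(3) M(2) c by linarith
  qed
  have L0: "0 \<le> real r * ((2 * A * b + 1) * b)" using A b by simp
  from landing[OF \<delta>(1,2) L0] obtain \<eta>0 where \<eta>0: "0 < \<eta>0" and
   land: "\<forall>H\<in>sets borel. measure \<mu> (- H) \<le> \<eta>0 \<longrightarrow>
    (\<forall>W\<in>borel_measurable borel. (\<forall>x. \<bar>W x\<bar> \<le> real r * ((2 * A * b + 1) * b)) \<longrightarrow> (\<integral>x. W x \<partial>\<mu>) = 0 \<longrightarrow>
      (\<exists>G\<in>sets borel. 0 < measure \<mu> G \<and> (\<exists>t0. \<forall>y\<in>G. \<forall>t\<ge>t0. \<exists>s\<in>{(1 - \<delta>) * t..t}. 0 \<le> s \<and>
         exp (- (I + \<delta>) * t) \<le> FK W s (indicator H) y)))" by (elim exE conjE) (rule that)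
  \<comment> \<open>The bound \<open>1 / 2\<close> ensures that the final \<open>H\<close> has
    positive measure.\<close>
  define \<eta> where "\<eta> = min \<eta>0 (1 / 2)"
  have \<eta>: "0 < \<eta>" "\<eta> \<le> \<eta>0" "\<eta> \<le> 1 / 2" using \<eta>0 by (auto simp: \<eta>_def)
  have lv: "\<exists>H k0 t0. level F r b A M c0 \<eta> (real i) H k0 t0" if "i \<le> n" for i
    using that
  proof (induction i)
    case 0
    have "level F r b A M c0 \<eta> (real 0) UNIV 1 1"
      unfolding level_def
    proof (intro conjI allI impI ballI)
      show "measure \<mu> (- UNIV) \<le> \<eta>" using \<eta>(1) by simp
      fix t x s
      interpret P: prob_space "PX x" by (rule PX_prob)
      have z: "Sint (F j) 0 \<omega> = 0" if "\<omega> \<in> cadlag_paths" for j \<omega>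
        using Sint_bound[OF F that, of 0 j] by simp
      have "quad F r (A / (2 * M * t)) 0 s x = (\<integral>\<omega>. exp (- (A / (2 * M * t)) * sqsum r s) \<partial>PX x)"
        unfolding quad_def by (intro Bochner_Integration.integral_cong refl) (simp add: z)
      also have "\<dots> = exp (- (A / (2 * M * t)) * sqsum r s)" using P.prob_space by simp
      finally show "1 * exp (- (A / (2 * M * t)) * sqsum r s - real 0 * (I + c0) * t)
         \<le> quad F r (A / (2 * M * t)) (real 0 * t) s x" by simp
    qed auto
    then show ?case by blast
  next
    case (Suc i)
    then obtain H k0 t0 where l: "level F r b A M c0 \<eta> (real i) H k0 t0" by auto
    have k: "0 \<le> real i" "real i + 1 \<le> M" using Suc.prems by (auto simp: M_def)
    have "\<exists>H' k' t'. level F r b A M c0 \<eta> (real i + 1) H' k' t'"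
    proof (rule level_step[OF F F0 A M(1) d(1,2) \<delta>(1) \<eta>(1) k _ c0_def l])
      fix H :: "'a set" and W :: "'a \<Rightarrow> real"
      assume a: "H \<in> sets borel" "measure \<mu> (- H) \<le> \<eta>" "W \<in> borel_measurable borel"
       "\<forall>x. \<bar>W x\<bar> \<le> real r * ((2 * A * b + 1) * b)" "(\<integral>x. W x \<partial>\<mu>) = 0"
      have "measure \<mu> (- H) \<le> \<eta>0" using a(2) \<eta>(2) by simp
      from land[rule_format, OF a(1) this a(3) a(4)[rule_format] a(5)]
      show "\<exists>G\<in>sets borel. 0 < measure \<mu> G \<and> (\<exists>t0. \<forall>y\<in>G. \<forall>t\<ge>t0. \<exists>s\<in>{(1 - \<delta>) * t..t}. 0 \<le> s \<and>
         exp (- (I + \<delta>) * t) \<le> FK W s (indicator H) y)" .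
    qed
    then show ?case by (simp add: add.commute)
  qed
  from lv[OF order_refl] obtain H k0 t0 where H: "H \<in> sets borel" "measure \<mu> (- H) \<le> \<eta>" "0 < k0" "0 < t0"
    and lb: "\<forall>t\<ge>t0. \<forall>x\<in>H. \<forall>s. (\<forall>j<r. \<bar>s j\<bar> \<le> 2 * (M - M) * t * b) \<longrightarrow>
        k0 * exp (- (A / (2 * M * t)) * sqsum r s - M * (I + c0) * t) \<le> quad F r (A / (2 * M * t)) (M * t) s x"
    unfolding level_def M_def[symmetric] by (elim exE conjE) (rule that)
  have "measure \<mu> (- H) = 1 - measure \<mu> H"
    using M.prob_compl[of H] H(1) \<mu>_sets \<mu>_space by (simp add: Compl_eq_Diff_UNIV)
  then have mH: "0 < measure \<mu> H" using H(2) \<eta>(3) by linarith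
  \<comment> \<open>The logarithm gives \<open>exp (- T) \<le> k0 / 2\<close>: the paths outside the
    event then account for at most half of the lower bound.\<close>
  define T0 where "T0 = max (M * t0) (ln (2 / k0))"
  have T0: "0 < T0" using H(4) M by (simp add: T0_def less_max_iff_disj)
  have main: "k0 / 2 * exp (- (I + c) * T) \<le> measure (PX x) {\<omega> \<in> cadlag_paths. \<forall>j<r. \<bar>Sint (F j) T \<omega>\<bar> < \<epsilon> * T}"
    if T: "T0 \<le> T" and x: "x \<in> H" for T x
  proof -
    interpret P: prob_space "PX x" by (rule PX_prob)
    have Tp: "0 < T" using T T0 by simp
    define t where "t = T / M"
    have t: "t0 \<le> t" "M * t = T"
    proof -
      have "M * t0 \<le> T" using T by (simp add: T0_def)
      then show "t0 \<le> t" using M(1) by (simp add: t_def pos_le_divide_eq mult.commute)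
      show "M * t = T" using M(1) by (simp add: t_def)
    qed
    define q where "q = A / (2 * T)"
    have q: "0 < q" "A / (2 * M * t) = q" using A Tp t(2) by (auto simp: q_def mult.assoc)
    let ?E = "{\<omega> \<in> cadlag_paths. \<forall>j<r. \<bar>Sint (F j) T \<omega>\<bar> < \<epsilon> * T}"
    have E: "?E \<in> sets (PX x)"
    proof -
      have "?E = cadlag_paths \<inter> (\<Inter>j\<in>{..<r}. {\<omega> \<in> space path_space. \<bar>Sint (F j) T \<omega>\<bar> < \<epsilon> * T})" by auto
      also have "\<dots> \<in> sets path_space"
      proof (cases "r = 0")
        case True
        then show ?thesis using sets.top[of "path_space :: (real \<Rightarrow> 'a) measure"] by simp
      next
        case False
        have "{\<omega> \<in> space path_space. \<bar>Sint (F j) T \<omega>\<bar> < \<epsilon> * T} \<in> sets path_space" for j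
          using borel_measurable_abs[OF Sint_measurable[OF F(1), of j T]]
          by (rule borel_measurable_less[OF _ borel_measurable_const])
        then have "(\<Inter>j\<in>{..<r}. {\<omega> \<in> space path_space. \<bar>Sint (F j) T \<omega>\<bar> < \<epsilon> * T}) \<in> sets path_space"
          using False by (intro sets.finite_INT) auto
        then show ?thesis using sets.Int[OF sets.top[of "path_space :: (real \<Rightarrow> 'a) measure"]] by simp
      qed
      finally show ?thesis unfolding PX_sets .
    qed
    have "k0 * exp (- (A / (2 * M * t)) * sqsum r (\<lambda>_. 0) - M * (I + c0) * t) \<le> quad F r (A / (2 * M * t)) (M * t) (\<lambda>_. 0) x"
      using lb[rule_format, OF t(1) x, of "\<lambda>_. 0"] by simp
    moreover have "M * (I + c0) * t = (I + c0) * T" unfolding t(2)[symmetric] by (simp only: mult_ac)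
    ultimately have l1: "k0 * exp (- ((I + c0) * T)) \<le> quad F r q T (\<lambda>_. 0) x"
      unfolding q(2) t(2) by (simp add: sqsum_def)
    have "quad F r q T (\<lambda>_. 0) x \<le> (\<integral>\<omega>. indicator ?E \<omega> + exp (- (I + c + 1) * T) \<partial>PX x)"
      unfolding quad_def
    proof (rule Ex_mono[OF _ _ quad_integrand_measurable[OF F(1)]])
      show "(\<lambda>\<omega>. indicator ?E \<omega> + exp (- (I + c + 1) * T)) \<in> borel_measurable path_space"
        by (intro borel_measurable_add borel_measurable_indicator E[unfolded PX_sets] borel_measurable_const)
      show "\<bar>indicator ?E \<omega> + exp (- (I + c + 1) * T)\<bar> \<le> 1 + exp (- (I + c + 1) * T)" for \<omega>
        by (simp split: split_indicator)
      show "\<bar>exp (- q * sqsum r (\<lambda>j. 0 + Sint (F j) T \<omega>))\<bar> \<le> 1" for \<omega>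
        using exp_quad_le_1[of q] q by simp
      fix \<omega> :: "real \<Rightarrow> 'a" assume \<omega>: "\<omega> \<in> cadlag_paths"
      show "exp (- q * sqsum r (\<lambda>j. 0 + Sint (F j) T \<omega>)) \<le> indicator ?E \<omega> + exp (- (I + c + 1) * T)"
      proof (cases "\<omega> \<in> ?E")
        case True
        have "exp (- q * sqsum r (\<lambda>j. 0 + Sint (F j) T \<omega>)) \<le> 1" using exp_quad_le_1[of q] q by simp
        also have "1 \<le> indicator ?E \<omega> + exp (- (I + c + 1) * T)" using True by simp
        finally show ?thesis .
      next
        case False
        then obtain j where j: "j < r" "\<epsilon> * T \<le> \<bar>Sint (F j) T \<omega>\<bar>" using \<omega> by (auto simp: not_less)
        have "(\<epsilon> * T)\<^sup>2 \<le> (Sint (F j) T \<omega>)\<^sup>2" using power_mono[OF j(2), of 2] \<epsilon> Tp by simp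
        also have "\<dots> \<le> sqsum r (\<lambda>j. 0 + Sint (F j) T \<omega>)"
          unfolding sqsum_def using j(1) member_le_sum[of j "{..<r}" "\<lambda>j. (0 + Sint (F j) T \<omega>)\<^sup>2"] by simp
        finally have "q * (\<epsilon> * T)\<^sup>2 \<le> q * sqsum r (\<lambda>j. 0 + Sint (F j) T \<omega>)" using q by (intro mult_left_mono) auto
        moreover have "q * (\<epsilon> * T)\<^sup>2 = (I + c + 1) * T"
          using \<epsilon> Tp by (simp add: q_def A_def power2_eq_square)
        ultimately have "exp (- q * sqsum r (\<lambda>j. 0 + Sint (F j) T \<omega>)) \<le> exp (- (I + c + 1) * T)"
          unfolding exp_le_cancel_iff mult_minus_left by linarith
        moreover have "(0::real) \<le> indicator ?E \<omega>" by simp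
        ultimately show ?thesis by linarith
      qed
    qed
    also have "\<dots> = measure (PX x) ?E + exp (- (I + c + 1) * T)"
    proof -
      define E' where "E' = ?E"
      have E': "E' \<in> sets (PX x)" unfolding E'_def by (rule E)
      have "integrable (PX x) (indicator E' :: _ \<Rightarrow> real)" using E' by (simp add: P.emeasure_eq_measure)
      moreover have "(\<integral>\<omega>. indicator E' \<omega> \<partial>PX x) = measure (PX x) E'"
        using E' by (simp add: Int_absorb2 sets.sets_into_space del: PX_space)
      ultimately show ?thesis unfolding E'_def[symmetric] using P.prob_space by simp
    qed
    finally have l2: "quad F r q T (\<lambda>_. 0) x \<le> measure (PX x) ?E + exp (- (I + c + 1) * T)" .
    have "exp (- (I + c + 1) * T) = exp (- T) * exp (- (I + c) * T)"
      unfolding exp_add[symmetric] by (simp add: algebra_simps)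
    also have "\<dots> \<le> k0 / 2 * exp (- (I + c) * T)"
    proof (rule mult_right_mono)
      have "exp (- T) \<le> exp (- ln (2 / k0))" using T by (simp add: T0_def)
      also have "\<dots> = k0 / 2" using H(3) by (simp add: exp_minus)
      finally show "exp (- T) \<le> k0 / 2" .
    qed simp
    finally have l3: "exp (- (I + c + 1) * T) \<le> k0 / 2 * exp (- (I + c) * T)" .
    have l4: "k0 * exp (- (I + c) * T) \<le> k0 * exp (- ((I + c0) * T))"
    proof (rule mult_left_mono)
      have "(I + c0) * T \<le> (I + c) * T" using c0 Tp by (intro mult_right_mono) auto
      then show "exp (- (I + c) * T) \<le> exp (- ((I + c0) * T))"
        unfolding exp_le_cancel_iff mult_minus_left by linarith
    qed (use H(3) in simp)
    have "k0 / 2 * exp (- (I + c) * T) = k0 * exp (- (I + c) * T) - k0 / 2 * exp (- (I + c) * T)" by simp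
    also have "\<dots> \<le> measure (PX x) ?E" using l1 l2 l3 l4 by linarith
    finally show ?thesis .
  qed
  have "\<forall>T\<ge>T0. \<forall>x\<in>H. k0 / 2 * exp (- (I + c) * T) \<le> measure (PX x) {\<omega> \<in> cadlag_paths. \<forall>j<r. \<bar>Sint (F j) T \<omega>\<bar> < \<epsilon> * T}"
    using main by simp
  then have "\<exists>T0>0. \<forall>T\<ge>T0. \<forall>x\<in>H. k0 / 2 * exp (- (I + c) * T) \<le> measure (PX x) {\<omega> \<in> cadlag_paths. \<forall>j<r. \<bar>Sint (F j) T \<omega>\<bar> < \<epsilon> * T}"
    by (intro exI[of _ T0] conjI T0)
  moreover have "0 < k0 / 2" using H(3) by simp
  ultimately have "\<exists>k>0. \<exists>T0>0. \<forall>T\<ge>T0. \<forall>x\<in>H. k * exp (- (I + c) * T)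
      \<le> measure (PX x) {\<omega> \<in> cadlag_paths. \<forall>j<r. \<bar>Sint (F j) T \<omega>\<bar> < \<epsilon> * T}" by blast
  with mH show ?thesis by (intro bexI[OF _ H(1)] conjI)
qed

end

section \<open>From the rate function to the entropy inequality\<close>

text \<open>The density of \<open>\<mu>\<close> need not be square integrable, so convergence in
  L2(m) does not pass to \<open>\<mu>\<close> by Cauchy-Schwarz. A subsequence converges
  \<open>m\<close>-almost everywhere, hence \<open>\<mu>\<close>-almost everywhere, and the uniform
  bound allows dominated convergence; the subsequence principle gives the whole sequence.\<close>

lemma L2_imp_L1_absolutely_continuous:
  fixes g :: "nat \<Rightarrow> 'b \<Rightarrow> real"
  assumes m: "\<And>n. integrable m (\<lambda>x. (g n x)\<^sup>2)" "(\<lambda>n. \<integral>x. (g n x)\<^sup>2 \<partial>m) \<longlonglongrightarrow> 0"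
    and gm: "\<And>n. g n \<in> borel_measurable m" and bd: "\<And>n x. x \<in> space m \<Longrightarrow> \<bar>g n x\<bar> \<le> C"
    and \<mu>: "prob_space \<mu>" "sets \<mu> = sets m" "absolutely_continuous m \<mu>"
  shows "(\<lambda>n. \<integral>x. \<bar>g n x\<bar> \<partial>\<mu>) \<longlonglongrightarrow> 0"
proof (rule ccontr)
  interpret prob_space \<mu> by (rule \<mu>(1))
  have sp: "space \<mu> = space m" using sets_eq_imp_space_eq[OF \<mu>(2)] .
  assume "\<not> ?thesis"
  then obtain e where e: "0 < e" "\<not> eventually (\<lambda>n. dist (\<integral>x. \<bar>g n x\<bar> \<partial>\<mu>) 0 < e) sequentially"
    unfolding tendsto_iff by auto
  define S where "S = {n. e \<le> dist (\<integral>x. \<bar>g n x\<bar> \<partial>\<mu>) 0}"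
  have "infinite S"
    using e(2) unfolding S_def not_eventually not_less cofinite_eq_sequentially[symmetric] frequently_cofinite .
  from infinite_enumerate[OF this] obtain r :: "nat \<Rightarrow> nat" where r: "strict_mono r" "\<And>n. r n \<in> S" by blast
  have "(\<lambda>n. \<integral>x. norm ((g (r n) x)\<^sup>2) \<partial>m) \<longlonglongrightarrow> 0"
    using LIMSEQ_subseq_LIMSEQ[OF m(2) r(1)] by (simp add: o_def)
  from tendsto_L1_AE_subseq[OF _ this] m(1) obtain r' :: "nat \<Rightarrow> nat" where
    "AE x in m. (\<lambda>n. (g (r (r' n)) x)\<^sup>2) \<longlonglongrightarrow> 0" by auto
  from absolutely_continuous_AE[OF \<mu>(2,3) this]
  have ae: "AE x in \<mu>. (\<lambda>n. \<bar>g (r (r' n)) x\<bar>) \<longlonglongrightarrow> 0"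
  proof eventually_elim
    case (elim x)
    from tendsto_real_sqrt[OF this] show ?case by simp
  qed
  have gm': "g n \<in> borel_measurable \<mu>" for n using gm[of n] measurable_cong_sets[OF \<mu>(2) refl] by blast
  have "(\<lambda>n. \<integral>x. \<bar>g (r (r' n)) x\<bar> \<partial>\<mu>) \<longlonglongrightarrow> (\<integral>x. 0 \<partial>\<mu>)"
  proof (rule integral_dominated_convergence[where w = "\<lambda>_. C"])
    show "AE x in \<mu>. norm \<bar>g (r (r' n)) x\<bar> \<le> C" for n using bd by (intro AE_I2) (simp add: sp)
  qed (use gm' ae in auto)
  then have "(\<lambda>n. \<integral>x. \<bar>g (r (r' n)) x\<bar> \<partial>\<mu>) \<longlonglongrightarrow> 0" by simp
  from order_tendstoD(2)[OF this e(1)] obtain n where "(\<integral>x. \<bar>g (r (r' n)) x\<bar> \<partial>\<mu>) < e"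
    by (auto simp: eventually_sequentially)
  moreover have "0 \<le> (\<integral>x. \<bar>g (r (r' n)) x\<bar> \<partial>\<mu>)" by simp
  ultimately show False using r(2)[of "r' n"] by (simp add: S_def)
qed

text \<open>\<open>g\<close> is only measurable, so \<open>\<phi>\<close> is Lipschitz on
  \<open>[0,\<infinity>)\<close> but not differentiable everywhere. Instead of differentiating, the
  defect \<open>H\<close> of the identity is shown to have increments of order
  \<open>(b - a)\<^sup>2\<close>; over \<open>n\<close> equal pieces these sum to order
  \<open>1 / n\<close>.\<close>

lemma integral_log_derivative:
  fixes g \<phi> :: "real \<Rightarrow> real"
  assumes g: "g \<in> borel_measurable borel" "\<And>r. \<bar>g r\<bar> \<le> C"
    and \<phi>: "\<And>a b. 0 \<le> a \<Longrightarrow> a \<le> b \<Longrightarrow> \<phi> b - \<phi> a = (LBINT r:{a..b}. g r)" "\<And>s. 0 \<le> s \<Longrightarrow> \<epsilon> \<le> \<phi> s"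
    and \<epsilon>: "0 < \<epsilon>" and \<phi>m: "\<phi> \<in> borel_measurable borel" and h: "0 \<le> h"
  shows "ln (\<phi> h) - ln (\<phi> 0) = (LBINT r:{0..h}. g r / \<phi> r)"
proof -
  have C: "0 \<le> C" using g(2)[of 0] by linarith
  \<comment> \<open>\<open>max\<close> keeps the denominator away from \<open>0\<close> also at
    negative times, where nothing is known about \<open>\<phi>\<close>.\<close>
  define \<psi> where "\<psi> r = g r / max \<epsilon> (\<phi> r)" for r
  have \<psi>m: "\<psi> \<in> borel_measurable borel" unfolding \<psi>_def[abs_def] using g(1) \<phi>m by simp
  have \<psi>b: "\<bar>\<psi> r\<bar> \<le> C / \<epsilon>" for r
    unfolding \<psi>_def abs_divide using g(2)[of r] \<epsilon> C by (intro frac_le) auto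
  have int: "set_integrable lborel {u..v} \<psi>" for u v by (rule set_integrable_bounded_Icc[OF \<psi>m \<psi>b])
  have lip: "\<bar>\<phi> b - \<phi> a\<bar> \<le> C * (b - a)" if "0 \<le> a" "a \<le> b" for a b
    unfolding \<phi>(1)[OF that] by (rule set_integral_abs_le_Icc[OF g that(2)])
  define H where "H s = ln (\<phi> s) - (LBINT r:{0..s}. \<psi> r)" for s
  define K where "K = 2 * C\<^sup>2 / \<epsilon>\<^sup>2"
  have est: "\<bar>H b - H a\<bar> \<le> K * (b - a)\<^sup>2" if ab: "0 \<le> a" "a \<le> b" for a b
  proof -
    have pa: "\<epsilon> \<le> \<phi> a" "\<epsilon> \<le> \<phi> b" using \<phi>(2) ab by auto
    have Hd: "H b - H a = ln (\<phi> b) - ln (\<phi> a) - (LBINT r:{a..b}. \<psi> r)"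
      unfolding H_def using set_integral_split_Icc[OF int ab] by simp
    have "(LBINT r:{a..b}. \<psi> r) - (\<phi> b - \<phi> a) / \<phi> a = (LBINT r:{a..b}. \<psi> r) - (LBINT r:{a..b}. g r / \<phi> a)"
      unfolding \<phi>(1)[OF ab] by (simp add: set_lebesgue_integral_def)
    also have "\<dots> = (LBINT r:{a..b}. \<psi> r - g r / \<phi> a)"
    proof (rule set_integral_diff(2)[symmetric, OF int])
      show "set_integrable lborel {a..b} (\<lambda>r. g r / \<phi> a)"
        by (rule set_integrable_bounded_Icc[where C = "C / \<phi> a"])
           (use g pa \<epsilon> in \<open>auto simp: abs_divide intro!: divide_right_mono\<close>)
    qed
    also have "\<dots> = (LBINT r:{a..b}. (if r \<in> {a..b} then \<psi> r - g r / \<phi> a else 0))"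
      unfolding set_lebesgue_integral_def by (intro Bochner_Integration.integral_cong) (auto split: split_indicator)
    finally have eq: "(LBINT r:{a..b}. \<psi> r) - (\<phi> b - \<phi> a) / \<phi> a = (LBINT r:{a..b}. (if r \<in> {a..b} then \<psi> r - g r / \<phi> a else 0))" .
    have "\<bar>LBINT r:{a..b}. (if r \<in> {a..b} then \<psi> r - g r / \<phi> a else 0)\<bar> \<le> (C * (C * (b - a)) / \<epsilon>\<^sup>2) * (b - a)"
    proof (rule set_integral_abs_le_Icc[OF _ _ ab(2)])
      show "(\<lambda>r. if r \<in> {a..b} then \<psi> r - g r / \<phi> a else 0) \<in> borel_measurable borel"
        using \<psi>m g(1) by measurable
      fix r
      show "\<bar>if r \<in> {a..b} then \<psi> r - g r / \<phi> a else 0\<bar> \<le> C * (C * (b - a)) / \<epsilon>\<^sup>2"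
      proof (cases "r \<in> {a..b}")
        case True
        then have pr: "\<epsilon> \<le> \<phi> r" using \<phi>(2) ab by auto
        have "\<psi> r - g r / \<phi> a = g r * (\<phi> a - \<phi> r) / (\<phi> r * \<phi> a)"
          using pr pa \<epsilon> by (simp add: \<psi>_def max_def field_simps)
        then have "\<bar>\<psi> r - g r / \<phi> a\<bar> = \<bar>g r\<bar> * \<bar>\<phi> r - \<phi> a\<bar> / (\<phi> r * \<phi> a)"
          using pr pa \<epsilon> by (simp add: abs_mult abs_minus_commute)
        also have "\<dots> \<le> C * (C * (b - a)) / \<epsilon>\<^sup>2"
        proof (rule frac_le)
          have "\<bar>\<phi> r - \<phi> a\<bar> \<le> C * (r - a)" using lip[of a r] True ab by simp
          also have "\<dots> \<le> C * (b - a)" using True C by (intro mult_left_mono) auto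
          finally show "\<bar>g r\<bar> * \<bar>\<phi> r - \<phi> a\<bar> \<le> C * (C * (b - a))" using g(2)[of r] C by (intro mult_mono) auto
          show "\<epsilon>\<^sup>2 \<le> \<phi> r * \<phi> a" unfolding power2_eq_square using pr pa \<epsilon> by (intro mult_mono) auto
        qed (use \<epsilon> C ab in auto)
        finally show ?thesis using True by simp
      qed (use C ab in auto)
    qed
    then have 1: "\<bar>(LBINT r:{a..b}. \<psi> r) - (\<phi> b - \<phi> a) / \<phi> a\<bar> \<le> (C * (C * (b - a)) / \<epsilon>\<^sup>2) * (b - a)"
      unfolding eq .
    have l1: "ln (\<phi> b) - ln (\<phi> a) \<le> (\<phi> b - \<phi> a) / \<phi> a"
    proof -
      have "ln (\<phi> b / \<phi> a) \<le> \<phi> b / \<phi> a - 1" using pa \<epsilon> by (intro ln_le_minus_one) auto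
      then show ?thesis using pa \<epsilon> by (simp add: ln_div diff_divide_distrib)
    qed
    have l2: "(\<phi> b - \<phi> a) / \<phi> b \<le> ln (\<phi> b) - ln (\<phi> a)"
    proof -
      have "ln (\<phi> a / \<phi> b) \<le> \<phi> a / \<phi> b - 1" using pa \<epsilon> by (intro ln_le_minus_one) auto
      then show ?thesis using pa \<epsilon> by (simp add: ln_div diff_divide_distrib)
    qed
    have "(\<phi> b - \<phi> a) / \<phi> a - (\<phi> b - \<phi> a) / \<phi> b = (\<phi> b - \<phi> a)\<^sup>2 / (\<phi> b * \<phi> a)"
      using pa \<epsilon> by (simp add: field_simps power2_eq_square)
    also have "\<dots> \<le> (C * (b - a))\<^sup>2 / \<epsilon>\<^sup>2"
    proof (rule frac_le)
      show "(\<phi> b - \<phi> a)\<^sup>2 \<le> (C * (b - a))\<^sup>2" using power_mono[OF lip[OF ab], of 2] by simp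
      show "\<epsilon>\<^sup>2 \<le> \<phi> b * \<phi> a" unfolding power2_eq_square using pa \<epsilon> by (intro mult_mono) auto
    qed (use \<epsilon> in auto)
    finally have 2: "\<bar>ln (\<phi> b) - ln (\<phi> a) - (\<phi> b - \<phi> a) / \<phi> a\<bar> \<le> (C * (b - a))\<^sup>2 / \<epsilon>\<^sup>2"
      using l1 l2 by linarith
    have "(C * (C * (b - a)) / \<epsilon>\<^sup>2) * (b - a) + (C * (b - a))\<^sup>2 / \<epsilon>\<^sup>2 = K * (b - a)\<^sup>2"
      by (simp add: K_def power2_eq_square add_divide_distrib[symmetric])
    then show ?thesis using 1 2 unfolding Hd by linarith
  qed
  have K0: "0 \<le> K" by (simp add: K_def)
  have step: "\<bar>H h - H 0\<bar> \<le> K * h\<^sup>2 / real (Suc n)" for n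
  proof -
    define d where "d = h / real (Suc n)"
    have d: "0 \<le> d" "real (Suc n) * d = h" using h by (simp_all add: d_def)
    have "\<bar>H (real k * d) - H 0\<bar> \<le> real k * (K * d\<^sup>2)" for k
    proof (induction k)
      case (Suc k)
      have "\<bar>H (real (Suc k) * d) - H (real k * d)\<bar> \<le> K * (real (Suc k) * d - real k * d)\<^sup>2"
        by (rule est) (use d in \<open>auto intro!: mult_right_mono\<close>)
      also have "real (Suc k) * d - real k * d = d" by (simp add: algebra_simps)
      finally show ?case using Suc by (simp add: algebra_simps)
    qed simp
    from this[of "Suc n"] have "\<bar>H h - H 0\<bar> \<le> real (Suc n) * (K * d\<^sup>2)" unfolding d(2) .
    also have "\<dots> = K * h\<^sup>2 / real (Suc n)" by (simp add: d_def power2_eq_square)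
    finally show ?thesis .
  qed
  have "(\<lambda>n. K * h\<^sup>2 / real (Suc n)) \<longlonglongrightarrow> 0"
    using LIMSEQ_Suc[OF lim_const_over_n[of "K * h\<^sup>2"]] by simp
  from LIMSEQ_le_const[OF this] step have "\<bar>H h - H 0\<bar> \<le> 0" by blast
  moreover have "(LBINT r:{0..0}. \<psi> r) = 0"
    using set_integral_abs_le_Icc[OF \<psi>m \<psi>b, of 0 0] by simp
  ultimately have "ln (\<phi> h) - ln (\<phi> 0) = (LBINT r:{0..h}. \<psi> r)" by (simp add: H_def)
  also have "\<dots> = (LBINT r:{0..h}. g r / \<phi> r)"
    unfolding set_lebesgue_integral_def \<psi>_def using \<phi>(2)
    by (intro Bochner_Integration.integral_cong refl) (auto split: split_indicator simp: max_def)
  finally show ?thesis .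
qed

lemma ln_add_lipschitz:
  fixes x y \<epsilon> :: real
  assumes "0 < \<epsilon>" "0 \<le> x" "0 \<le> y" shows "\<bar>ln (x + \<epsilon>) - ln (y + \<epsilon>)\<bar> \<le> \<bar>x - y\<bar> / \<epsilon>"
  using ln_diff_ge[of \<epsilon> "x + \<epsilon>" "y + \<epsilon>"] ln_diff_ge[of \<epsilon> "y + \<epsilon>" "x + \<epsilon>"] assms
  by (simp add: abs_minus_commute abs_le_iff)

context markov_family
begin

lemma Pt_FK: "Pt t f = FK (\<lambda>_. 0) t f"
proof
  fix x
  have "Sint (\<lambda>_. 0) t \<omega> = 0" for \<omega> :: "real \<Rightarrow> 'a" by (simp add: Sint_def set_lebesgue_integral_def)
  then show "Pt t f x = FK (\<lambda>_. 0) t f x" by (simp add: Pt_def FK_def)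
qed

lemma Pt_add:
  assumes "0 \<le> s" "0 \<le> t" "f \<in> borel_measurable borel" "\<And>x. 0 \<le> f x \<and> f x \<le> C"
  shows "Pt (s + t) f x = Pt s (Pt t f) x"
  unfolding Pt_FK by (rule FK_add[of _ 0]) (use assms in auto)

lemma Pt_0: "f \<in> borel_measurable borel \<Longrightarrow> Pt 0 f x = f x"
  unfolding Pt_FK by (rule FK_0)

lemma measurable_eval_all:
  "(\<lambda>x. fst x (max 0 (snd x))) \<in> path_space \<Otimes>\<^sub>M borel \<rightarrow>\<^sub>M (borel :: 'a measure)"
proof (rule borel_measurable_LIMSEQ_metric)
  fix i :: nat
  show "(\<lambda>x. fst x (max 0 (min (snd x) (real i)))) \<in> path_space \<Otimes>\<^sub>M borel \<rightarrow>\<^sub>M (borel :: 'a measure)"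
    by (rule measurable_eval_joint_path) simp
next
  fix x :: "(real \<Rightarrow> 'a) \<times> real"
  obtain n :: nat where n: "snd x \<le> real n" using real_arch_simple by blast
  have "eventually (\<lambda>i. fst x (max 0 (min (snd x) (real i))) = fst x (max 0 (snd x))) sequentially"
    using eventually_ge_at_top[of n]
  proof eventually_elim
    case (elim i)
    then have "min (snd x) (real i) = snd x" using n by (simp add: min_def)
    then show ?case by simp
  qed
  then show "(\<lambda>i. fst x (max 0 (min (snd x) (real i)))) \<longlonglongrightarrow> fst x (max 0 (snd x))" by (rule tendsto_eventually)
qed

text \<open>Evaluation is jointly measurable in path and time, and \<open>PX\<close> is a kernel;
  \<open>max 0\<close> lets the time variable range over all reals.\<close>

lemma Pt_joint_measurable:
  assumes f: "f \<in> borel_measurable borel" "\<And>x. 0 \<le> f x"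
  shows "(\<lambda>z. Pt (max 0 (snd z)) f (fst z)) \<in> borel_measurable (borel \<Otimes>\<^sub>M borel)"
proof -
  have j: "(\<lambda>(z :: 'a \<times> real, \<omega>). ennreal (f (\<omega> (max 0 (snd z))))) \<in> borel_measurable ((borel \<Otimes>\<^sub>M borel) \<Otimes>\<^sub>M path_space)"
  proof -
    have "(\<lambda>x :: ('a \<times> real) \<times> (real \<Rightarrow> 'a). (snd x, snd (fst x))) \<in> (borel \<Otimes>\<^sub>M borel) \<Otimes>\<^sub>M path_space \<rightarrow>\<^sub>M path_space \<Otimes>\<^sub>M borel"
      by (intro measurable_Pair measurable_snd measurable_compose[OF measurable_fst measurable_snd])
    from measurable_compose[OF measurable_compose[OF this measurable_eval_all] f(1)]
    show ?thesis by (simp add: case_prod_beta')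
  qed
  have k: "(\<lambda>z :: 'a \<times> real. PX (fst z)) \<in> borel \<Otimes>\<^sub>M borel \<rightarrow>\<^sub>M subprob_algebra path_space"
    by (rule measurable_compose[OF measurable_fst measurable_prob_algebraD[OF PX_kernel]])
  from nn_integral_measurable_subprob_algebra2[OF j k]
  have "(\<lambda>z. enn2real (\<integral>\<^sup>+\<omega>. ennreal (f (\<omega> (max 0 (snd z)))) \<partial>PX (fst z))) \<in> borel_measurable (borel \<Otimes>\<^sub>M borel)"
    by measurable
  moreover have "enn2real (\<integral>\<^sup>+\<omega>. ennreal (f (\<omega> t)) \<partial>PX x) = Pt t f x" for t x
    unfolding Pt_def
    by (rule integral_eq_nn_integral[symmetric]) (use measurable_comp_eval[OF f(1)] f(2) in auto)
  ultimately show ?thesis by simp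
qed

end

section \<open>The given process as a Markov family on the whole Polish space\<close>

locale process_setting =
  fixes E :: "'a::polish_space set" and m :: "'a measure" and p :: "real \<Rightarrow> 'a \<Rightarrow> 'a measure"
    and PX :: "'a \<Rightarrow> (real \<Rightarrow> 'a) measure"
  assumes E_borel: "E \<in> sets borel" and m_space: "space m = E"
    and m_sets: "sets m = sets (restrict_space borel E)"
    and p_trans: "transition_function m p" and process: "markov_process E p PX"
begin

text \<open>The kernel behind \<open>ext_trans\<close>. For \<open>x \<in> E\<close> the measure
  \<open>p t x\<close> has the sigma-algebra of \<open>E\<close> and is carried to the Borel sets of
  the whole space by the inclusion; points outside \<open>E\<close> do not move.\<close>

definition \<kappa> :: "real \<Rightarrow> 'a \<Rightarrow> 'a measure" where
  "\<kappa> t x = (if x \<in> E then distr (p t x) borel (\<lambda>y. y) else return borel x)"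

lemma m_measurable: "f \<in> borel \<rightarrow>\<^sub>M N \<Longrightarrow> f \<in> m \<rightarrow>\<^sub>M N"
  using measurable_restrict_space1[of f borel N E] measurable_cong_sets[OF m_sets refl] by blast

lemma m_sets_iff: "A \<in> sets m \<longleftrightarrow> A \<in> sets borel \<and> A \<subseteq> E"
  unfolding m_sets sets_restrict_space using E_borel by (auto intro!: image_eqI[where x = A])

lemma m_borel_measurable_iff:
  fixes f :: "'a \<Rightarrow> real"
  shows "f \<in> borel_measurable m \<longleftrightarrow> (\<lambda>x. indicator E x * f x) \<in> borel_measurable borel"
  using borel_measurable_restrict_space_iff[of E borel f] E_borel measurable_cong_sets[OF m_sets refl, of borel] by auto

lemma p_prob: "0 \<le> t \<Longrightarrow> x \<in> E \<Longrightarrow> prob_space (p t x)"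
  and p_sets: "0 \<le> t \<Longrightarrow> x \<in> E \<Longrightarrow> sets (p t x) = sets m"
  using p_trans m_space by (auto simp: transition_function_def)

lemma p_space: "0 \<le> t \<Longrightarrow> x \<in> E \<Longrightarrow> space (p t x) = E"
  using sets_eq_imp_space_eq[OF p_sets] m_space by simp

lemma p_measurable: "0 \<le> t \<Longrightarrow> x \<in> E \<Longrightarrow> f \<in> borel \<rightarrow>\<^sub>M N \<Longrightarrow> f \<in> p t x \<rightarrow>\<^sub>M N"
  using m_measurable measurable_cong_sets[OF p_sets refl] by blast

lemma \<kappa>_emeasure:
  assumes "0 \<le> t" "A \<in> sets borel"
  shows "emeasure (\<kappa> t x) A = ennreal (ext_trans E p t x A)"
proof (cases "x \<in> E")
  case True
  interpret prob_space "p t x" by (rule p_prob[OF assms(1) True])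
  have "emeasure (\<kappa> t x) A = emeasure (p t x) (A \<inter> E)"
    using True assms p_measurable[OF assms(1) True measurable_ident] p_space[OF assms(1) True]
    by (simp add: \<kappa>_def emeasure_distr vimage_def Int_def id_def)
  then show ?thesis using True by (simp add: ext_trans_def emeasure_eq_measure)
next
  case False
  then show ?thesis using assms by (simp add: \<kappa>_def ext_trans_def ennreal_indicator)
qed

lemma \<kappa>_prob: "0 \<le> t \<Longrightarrow> prob_space (\<kappa> t x)"
  using prob_space.prob_space_distr[OF p_prob p_measurable[OF _ _ measurable_ident]]
  by (auto simp: \<kappa>_def id_def intro!: prob_space_return)

lemma \<kappa>_kernel:
  assumes t: "0 \<le> t" shows "\<kappa> t \<in> borel \<rightarrow>\<^sub>M prob_algebra borel"
proof (rule measurable_prob_algebraI[OF \<kappa>_prob[OF t]], rule measurable_subprob_algebra)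
  show "subprob_space (\<kappa> t x)" for x using prob_space_imp_subprob_space[OF \<kappa>_prob[OF t]] .
  show "sets (\<kappa> t x) = sets borel" for x by (simp add: \<kappa>_def)
  fix A :: "'a set" assume A: "A \<in> sets borel"
  have AE: "A \<inter> E \<in> sets m" using A E_borel by (simp add: m_sets_iff)
  then have "(\<lambda>(t,x). measure (p t x) (A \<inter> E)) \<in> borel_measurable (restrict_space borel {0..} \<Otimes>\<^sub>M m)"
    using p_trans unfolding transition_function_def by blast
  from measurable_Pair2[OF this, of t] t
  have "(\<lambda>x. measure (p t x) (A \<inter> E)) \<in> borel_measurable m" by (simp add: space_restrict_space)
  then have "(\<lambda>x. indicator E x * measure (p t x) (A \<inter> E)) \<in> borel_measurable borel"
    by (simp add: m_borel_measurable_iff)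
  then have "(\<lambda>x. indicator E x * measure (p t x) (A \<inter> E) + indicator (A - E) x) \<in> borel_measurable borel"
    using A E_borel by simp
  moreover have "indicator E x * measure (p t x) (A \<inter> E) + indicator (A - E) x = ext_trans E p t x A" for x
    by (auto simp: ext_trans_def split: split_indicator)
  ultimately show "(\<lambda>x. emeasure (\<kappa> t x) A) \<in> borel_measurable borel"
    unfolding \<kappa>_emeasure[OF t A] by simp
qed

lemma process_PX:
  shows "prob_space (PX x)" "sets (PX x) = sets path_space" "AE \<omega> in PX x. \<omega> 0 = x"
proof -
  have P: "prob_space (PX x)" "sets (PX x) = path_sets"
     "measure (PX x) {\<omega> \<in> cadlag_paths. \<omega> 0 = x} = 1"
    using process unfolding markov_process_def by blast+
  show "prob_space (PX x)" by (rule P)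
  show "sets (PX x) = sets path_space" by (simp add: P sets_path_space)
  show "AE \<omega> in PX x. \<omega> 0 = x"
    using prob_space.AE_prob_1[OF P(1,3)] by eventually_elim simp
qed

lemma process_markov:
  assumes st: "0 \<le> s" "0 \<le> t" and A: "A \<in> sets borel" and F: "F \<in> sets (coord_space s)"
  shows "emeasure (PX x) (F \<inter> {\<omega> \<in> cadlag_paths. \<omega> (s + t) \<in> A})
     = (\<integral>\<^sup>+\<omega>. indicator F \<omega> * emeasure (\<kappa> t (\<omega> s)) A \<partial>PX x)"
proof -
  interpret prob_space "PX x" by (rule process_PX(1))
  have Fc: "F \<in> coord_sets s" using F by (simp add: sets_coord_space)
  have F': "F \<in> sets path_space" using F sets_coord_space_path_space by blast
  have m1: "(\<lambda>z. measure (\<kappa> t z) A) \<in> borel_measurable borel"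
    using measurable_compose[OF measurable_prob_algebraD[OF \<kappa>_kernel[OF st(2)]] measurable_measure_subprob_algebra[OF A]] .
  have e: "measure (\<kappa> t z) A = ext_trans E p t z A" for z
    using \<kappa>_emeasure[OF st(2) A, of z] unfolding measure_def by (simp add: ext_trans_def)
  have "(\<lambda>\<omega>. indicator F \<omega> * ext_trans E p t (\<omega> s) A) \<in> borel_measurable path_space"
    using measurable_compose[OF measurable_eval m1, of s] F' unfolding e by simp
  then have m2: "(\<lambda>\<omega>. indicator F \<omega> * ext_trans E p t (\<omega> s) A) \<in> borel_measurable (PX x)"
    using measurable_cong_sets[OF process_PX(2)[of x] refl] by blast
  have b: "0 \<le> ext_trans E p t z A" "ext_trans E p t z A \<le> 1" for z
    unfolding e[symmetric] using prob_space.prob_le_1[OF \<kappa>_prob[OF st(2)]] by auto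
  have "emeasure (PX x) (F \<inter> {\<omega> \<in> cadlag_paths. \<omega> (s + t) \<in> A})
     = ennreal (\<integral>\<omega>. indicator F \<omega> * ext_trans E p t (\<omega> s) A \<partial>PX x)"
    using process st A Fc unfolding emeasure_eq_measure markov_process_def by simp
  also have "\<dots> = (\<integral>\<^sup>+\<omega>. ennreal (indicator F \<omega> * ext_trans E p t (\<omega> s) A) \<partial>PX x)"
  proof (rule nn_integral_eq_integral[symmetric])
    show "integrable (PX x) (\<lambda>\<omega>. indicator F \<omega> * ext_trans E p t (\<omega> s) A)"
      by (rule integrable_const_bound[where B = 1, OF _ m2]) (use b in \<open>auto split: split_indicator\<close>)
  qed (use b in auto)
  also have "\<dots> = (\<integral>\<^sup>+\<omega>. indicator F \<omega> * emeasure (\<kappa> t (\<omega> s)) A \<partial>PX x)"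
    using b by (intro nn_integral_cong) (simp add: \<kappa>_emeasure[OF st(2) A] ennreal_mult ennreal_indicator)
  finally show ?thesis .
qed

sublocale markov_family PX \<kappa>
  by (rule markov_family.intro) (fact process_PX process_markov \<kappa>_kernel)+

lemma distr_eval:
  assumes t: "0 \<le> t" shows "distr (PX x) borel (\<lambda>\<omega>. \<omega> t) = \<kappa> t x"
proof (rule measure_eqI)
  show "sets (distr (PX x) borel (\<lambda>\<omega>. \<omega> t)) = sets (\<kappa> t x)" by (simp add: \<kappa>_def)
  interpret P: prob_space "PX x" by (rule PX_prob)
  fix A assume "A \<in> sets (distr (PX x) borel (\<lambda>\<omega>. \<omega> t))"
  then have A: "A \<in> sets borel" by simp
  have "emeasure (distr (PX x) borel (\<lambda>\<omega>. \<omega> t)) A = emeasure (PX x) (space (coord_space 0) \<inter> {\<omega> \<in> cadlag_paths. \<omega> (0 + t) \<in> A})"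
    using A by (subst emeasure_distr) (auto simp: measurable_eval intro!: arg_cong2[where f = emeasure])
  also have "\<dots> = (\<integral>\<^sup>+\<omega>. indicator (space (coord_space 0)) \<omega> * emeasure (\<kappa> t (\<omega> 0)) A \<partial>PX x)"
    by (rule markov[OF _ t A sets.top]) simp
  also have "\<dots> = (\<integral>\<^sup>+\<omega>. emeasure (\<kappa> t x) A \<partial>PX x)"
  proof (rule nn_integral_cong_AE)
    show "AE \<omega> in PX x. indicator (space (coord_space 0)) \<omega> * emeasure (\<kappa> t (\<omega> 0)) A = emeasure (\<kappa> t x) A"
      using start[of x] AE_space[of "PX x"] by eventually_elim simp
  qed
  also have "\<dots> = emeasure (\<kappa> t x) A" using P.emeasure_space_1 by simp
  finally show "emeasure (distr (PX x) borel (\<lambda>\<omega>. \<omega> t)) A = emeasure (\<kappa> t x) A" .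
qed

lemma Pt_eq_pf:
  assumes t: "0 \<le> t" and x: "x \<in> E" and f: "f \<in> borel_measurable borel"
  shows "Pt t f x = pf p t f x"
proof -
  have "Pt t f x = (\<integral>y. f y \<partial>distr (PX x) borel (\<lambda>\<omega>. \<omega> t))"
    unfolding Pt_def by (rule integral_distr[symmetric]) (use f in \<open>auto simp: measurable_eval\<close>)
  also have "\<dots> = (\<integral>y. f y \<partial>distr (p t x) borel (\<lambda>y. y))" unfolding distr_eval[OF t] using x by (simp add: \<kappa>_def)
  also have "\<dots> = pf p t f x"
    unfolding pf_def using p_measurable[OF t x measurable_ident] f by (intro integral_distr) (auto simp: id_def)
  finally show ?thesis .
qed

lemma pf_cong: "0 \<le> t \<Longrightarrow> x \<in> E \<Longrightarrow> (\<And>y. y \<in> E \<Longrightarrow> f y = g y) \<Longrightarrow> pf p t f x = pf p t g x"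
  unfolding pf_def by (intro Bochner_Integration.integral_cong refl) (simp add: p_space)

lemma AE_eval_E: "0 \<le> t \<Longrightarrow> x \<in> E \<Longrightarrow> AE \<omega> in PX x. \<omega> t \<in> E"
proof -
  assume a: "0 \<le> t" "x \<in> E"
  interpret P: prob_space "p t x" by (rule p_prob[OF a])
  interpret K: prob_space "\<kappa> t x" by (rule \<kappa>_prob[OF a(1)])
  have "measure (\<kappa> t x) E = 1"
    using \<kappa>_emeasure[OF a(1) E_borel, of x] a P.prob_space
    by (simp add: ext_trans_def p_space K.emeasure_eq_measure)
  from K.AE_prob_1[OF this] have "AE y in distr (PX x) borel (\<lambda>\<omega>. \<omega> t). y \<in> E"
    unfolding distr_eval[OF a(1)] .
  then show ?thesis
    using E_borel by (subst (asm) AE_distr_iff) (auto simp: measurable_eval)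
qed

end

section \<open>Finite rate: continuity under \<open>\<mu>\<close> and the integrated rate
  inequality\<close>

locale ld_setting = process_setting E m p PX
  for E :: "'a::polish_space set" and m :: "'a measure" and p :: "real \<Rightarrow> 'a \<Rightarrow> 'a measure"
    and PX :: "'a \<Rightarrow> (real \<Rightarrow> 'a) measure" +
  fixes Tsg :: "real \<Rightarrow> ('a \<Rightarrow> real) \<Rightarrow> ('a \<Rightarrow> real)" and \<mu> :: "'a measure" and I :: real
  assumes m_sigma_finite: "sigma_finite_measure m"
    and semigroup: "strongly_cont_L2_semigroup m Tsg"
    and p_repr: "\<forall>t\<ge>0. \<forall>f. bmeas m f \<and> integrable m (\<lambda>x. (f x)\<^sup>2) \<longrightarrow> (AE x in m. pf p t f x = Tsg t f x)"
    and irred: "\<forall>A\<in>sets m. emeasure m A > 0 \<longrightarrow> (AE x in m. Rres p (indicator A) x > 0)"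
    and \<mu>_prob: "prob_space \<mu>" and \<mu>_sets: "sets \<mu> = sets m" and \<mu>_ac: "absolutely_continuous m \<mu>"
    and I_nonneg: "0 \<le> I"
    and rate: "\<And>v L \<epsilon>. (v, L) \<in> D1 m p \<Longrightarrow> 0 < \<epsilon> \<Longrightarrow> - I \<le> (\<integral>x. L x / (v x + \<epsilon>) \<partial>\<mu>)"
begin

lemma \<mu>_space: "space \<mu> = E"
  using sets_eq_imp_space_eq[OF \<mu>_sets] m_space by simp

lemma \<mu>_measurable: "f \<in> borel \<rightarrow>\<^sub>M N \<Longrightarrow> f \<in> \<mu> \<rightarrow>\<^sub>M N"
  using m_measurable measurable_cong_sets[OF \<mu>_sets refl] by blast

text \<open>\<open>\<mu>\<close> as a Borel measure on the whole Polish space, the form that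
  \<open>donsker_varadhan\<close> requires.\<close>

definition \<mu>b :: "'a measure" where "\<mu>b = distr \<mu> borel (\<lambda>x. x)"

lemma \<mu>b_sets: "sets \<mu>b = sets borel" and \<mu>b_space: "space \<mu>b = UNIV"
  by (simp_all add: \<mu>b_def)

lemma \<mu>b_prob: "prob_space \<mu>b"
  unfolding \<mu>b_def using \<mu>_measurable[OF measurable_ident] by (intro prob_space.prob_space_distr \<mu>_prob) (simp add: id_def)

lemma \<mu>b_integral:
  fixes f :: "'a \<Rightarrow> real"
  assumes "f \<in> borel_measurable borel" shows "(\<integral>x. f x \<partial>\<mu>b) = (\<integral>x. f x \<partial>\<mu>)"
  unfolding \<mu>b_def using \<mu>_measurable[OF measurable_ident] assms by (intro integral_distr) (simp_all add: id_def)

lemma \<mu>b_measurable: "f \<in> borel \<rightarrow>\<^sub>M N \<Longrightarrow> f \<in> \<mu>b \<rightarrow>\<^sub>M N"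
  using measurable_cong_sets[OF \<mu>b_sets refl] by blast

lemma \<mu>b_integrable:
  fixes f :: "'a \<Rightarrow> real"
  assumes "f \<in> borel_measurable borel" "\<And>x. \<bar>f x\<bar> \<le> C" shows "integrable \<mu>b f"
  by (rule finite_measure.integrable_const_bound[OF prob_space.finite_measure[OF \<mu>b_prob], where B = C])
     (use assms \<mu>b_measurable in auto)

lemma Pt_abs_le:
  assumes "f \<in> borel_measurable borel" "\<And>x. \<bar>f x\<bar> \<le> C" shows "\<bar>Pt t f x\<bar> \<le> C"
proof -
  have "- C \<le> f x \<and> f x \<le> C" for x using assms(2)[of x] by linarith
  from Pt_bounds[OF assms(1) this, of t x] show ?thesis by linarith
qed

text \<open>For square integrable \<open>f\<close> the functions \<open>Pt s f\<close> and
  \<open>Tsg s f\<close> agree \<open>m\<close>-almost everywhere, so \<open>Pt\<close> inherits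
  strong continuity at \<open>0\<close>; \<open>L2_imp_L1_absolutely_continuous\<close> carries it
  over to \<open>\<mu>\<close>.\<close>

lemma Pt_continuous_L2:
  assumes f: "f \<in> borel_measurable borel" "\<And>x. \<bar>f x\<bar> \<le> C" and f2: "integrable m (\<lambda>x. (f x)\<^sup>2)"
  shows "((\<lambda>s. \<integral>x. \<bar>Pt s f x - f x\<bar> \<partial>\<mu>) \<longlongrightarrow> 0) (at_right 0)"
proof (rule tendsto_at_right_sequentially[of 0 1])
  fix S :: "nat \<Rightarrow> real" assume S: "\<And>n. 0 < S n" "S \<longlonglongrightarrow> 0"
  have fm: "f \<in> borel_measurable m" by (rule m_measurable[OF f(1)])
  have bm: "bmeas m f" unfolding bmeas_def using fm f(2) by blast
  have L2f: "L2 m f" using fm f2 by (simp add: L2_def)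
  note sg = semigroup[unfolded strongly_cont_L2_semigroup_def]
  have T2: "L2 m (Tsg t f)" if "0 \<le> t" for t by (rule sg[THEN conjunct1, rule_format, OF that L2f])
  have T0: "AE x in m. Tsg 0 f x = f x"
    by (rule sg[THEN conjunct2, THEN conjunct2, THEN conjunct2, THEN conjunct2, THEN conjunct1, rule_format, OF L2f])
  have Tlim: "((\<lambda>t. \<integral>x. (Tsg t f x - Tsg 0 f x)\<^sup>2 \<partial>m) \<longlongrightarrow> 0) (at 0 within {0..})"
    by (rule sg[THEN conjunct2, THEN conjunct2, THEN conjunct2, THEN conjunct2, THEN conjunct2, THEN conjunct2,
          rule_format, OF L2f order_refl])
  have ae: "AE x in m. (Tsg (S n) f x - Tsg 0 f x)\<^sup>2 = (Pt (S n) f x - f x)\<^sup>2" for n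
  proof -
    have "AE x in m. pf p (S n) f x = Tsg (S n) f x" using p_repr[rule_format, OF less_imp_le[OF S(1)], of f n] bm f2 by blast
    with T0 AE_space[of m] show ?thesis
    proof eventually_elim
      case (elim x)
      then show ?case using Pt_eq_pf[OF less_imp_le[OF S(1)] _ f(1), of x n] m_space by simp
    qed
  qed
  have gm: "(\<lambda>x. Pt (S n) f x - f x) \<in> borel_measurable m" for n
    by (rule m_measurable) (intro borel_measurable_diff Pt_measurable f(1))
  have Tm: "Tsg (S n) f \<in> borel_measurable m" "Tsg 0 f \<in> borel_measurable m"
    "integrable m (\<lambda>x. (Tsg (S n) f x)\<^sup>2)" "integrable m (\<lambda>x. (Tsg 0 f x)\<^sup>2)" for n
    using T2[of "S n"] T2[of 0] S(1)[of n] by (simp_all add: L2_def)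
  have Ti: "integrable m (\<lambda>x. (Tsg (S n) f x - Tsg 0 f x)\<^sup>2)" for n
  proof (rule Bochner_Integration.integrable_bound)
    show "integrable m (\<lambda>x. 2 * (Tsg (S n) f x)\<^sup>2 + 2 * (Tsg 0 f x)\<^sup>2)" using Tm by simp
    show "(\<lambda>x. (Tsg (S n) f x - Tsg 0 f x)\<^sup>2) \<in> borel_measurable m" using Tm(1)[of n] Tm(2) by measurable
    have "(a - b)\<^sup>2 \<le> 2 * a\<^sup>2 + 2 * b\<^sup>2" for a b :: real
      using zero_le_power2[of "a + b"] by (simp add: power2_sum power2_diff)
    then show "AE x in m. norm ((Tsg (S n) f x - Tsg 0 f x)\<^sup>2) \<le> norm (2 * (Tsg (S n) f x)\<^sup>2 + 2 * (Tsg 0 f x)\<^sup>2)"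
      by (intro AE_I2) simp
  qed
  have m1: "(\<lambda>x. (Tsg (S n) f x - Tsg 0 f x)\<^sup>2) \<in> borel_measurable m" for n using Tm(1)[of n] Tm(2) by measurable
  have m2: "(\<lambda>x. (Pt (S n) f x - f x)\<^sup>2) \<in> borel_measurable m" for n using gm[of n] by simp
  show "(\<lambda>n. \<integral>x. \<bar>Pt (S n) f x - f x\<bar> \<partial>\<mu>) \<longlonglongrightarrow> 0"
  proof (rule L2_imp_L1_absolutely_continuous[where m = m and C = "2 * C"])
    show "integrable m (\<lambda>x. (Pt (S n) f x - f x)\<^sup>2)" for n
      using iffD1[OF integrable_cong_AE[OF m1[of n] m2[of n] ae[of n]] Ti[of n]] .
    have "S n \<in> {0..} \<and> S n \<noteq> 0" for n using S(1)[of n] by simp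
    then have "filterlim S (at 0 within {0..}) sequentially"
      by (simp add: filterlim_at S(2))
    from filterlim_compose[OF Tlim this]
    show "(\<lambda>n. \<integral>x. (Pt (S n) f x - f x)\<^sup>2 \<partial>m) \<longlonglongrightarrow> 0"
      unfolding integral_cong_AE[OF m1 m2 ae] .
    show "\<bar>Pt (S n) f x - f x\<bar> \<le> 2 * C" for n x
      using Pt_abs_le[OF f, of "S n" x] f(2)[of x] by linarith
  qed (use gm \<mu>_prob \<mu>_sets \<mu>_ac in auto)
qed simp

text \<open>If \<open>m\<close> is infinite, a bounded function need not be in L2(m). It is cut off
  to a set \<open>A k\<close> with finite \<open>m\<close>-measure and \<open>\<mu>\<close>-measure
  close to \<open>1\<close>. The difficulty is the semigroup applied to the part cut off, since
  \<open>\<mu>\<close> is not assumed invariant; it is dominated by \<open>C * (1 - Pt s i)\<close>,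
  and continuity for the indicator \<open>i\<close>, which is in L2(m), handles this.\<close>

lemma Pt_continuous_bounded:
  assumes f: "f \<in> borel_measurable borel" "\<And>x. \<bar>f x\<bar> \<le> C"
  shows "((\<lambda>s. \<integral>x. \<bar>Pt s f x - f x\<bar> \<partial>\<mu>b) \<longlongrightarrow> 0) (at_right 0)"
proof (rule tendstoI)
  interpret S: sigma_finite_measure m by (rule m_sigma_finite)
  interpret M: prob_space \<mu> by (rule \<mu>_prob)
  interpret B: prob_space \<mu>b by (rule \<mu>b_prob)
  fix e :: real assume e: "0 < e"
  have C: "0 \<le> C" using f(2)[of undefined] by linarith
  obtain A :: "nat \<Rightarrow> 'a set" where A: "range A \<subseteq> sets m" "(\<Union>i. A i) = space m"
    "\<And>i. emeasure m (A i) \<noteq> \<infinity>" "incseq A" by (rule S.sigma_finite_incseq) blast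
  have "(\<lambda>k. measure \<mu> (A k)) \<longlonglongrightarrow> measure \<mu> (\<Union>k. A k)"
    by (rule M.finite_Lim_measure_incseq) (use A \<mu>_sets in auto)
  moreover have "measure \<mu> (\<Union>k. A k) = 1" using A(2) M.prob_space \<mu>_space m_space by simp
  ultimately have "(\<lambda>k. measure \<mu> (A k)) \<longlonglongrightarrow> 1" by simp
  \<comment> \<open>With this choice the remainder \<open>2 * C * (1 - measure \<mu> (A k))\<close>
    is at most \<open>e / 3\<close>, while the two continuity terms together stay below
    \<open>e / 2\<close>.\<close>
  from order_tendstoD(1)[OF this, of "1 - e / (6 * (C + 1))"] e C
  obtain k where k: "1 - e / (6 * (C + 1)) < measure \<mu> (A k)" by (auto simp: eventually_sequentially)
  have Ak: "A k \<in> sets m" "A k \<in> sets borel" "A k \<subseteq> E" using A(1) m_sets_iff by blast+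
  define i :: "'a \<Rightarrow> real" where "i = indicator (A k)"
  define f1 where "f1 x = f x * i x" for x
  have im: "i \<in> borel_measurable borel" "\<bar>i x\<bar> \<le> 1" for x using Ak by (auto simp: i_def split: split_indicator)
  have f1m: "f1 \<in> borel_measurable borel" unfolding f1_def[abs_def] using f(1) im(1) by simp
  have f1b: "\<bar>f1 x\<bar> \<le> C" for x using f(2)[of x] C by (auto simp: f1_def i_def split: split_indicator)
  have ii: "integrable m (\<lambda>x. (i x)\<^sup>2)"
  proof -
    have "(\<lambda>x. (i x)\<^sup>2) = i" by (auto simp: i_def split: split_indicator)
    then show ?thesis using Ak A(3)[of k] by (simp add: i_def less_top)
  qed
  have fi: "integrable m (\<lambda>x. (f1 x)\<^sup>2)"
  proof (rule Bochner_Integration.integrable_bound)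
    show "integrable m (\<lambda>x. C\<^sup>2 * (i x)\<^sup>2)" using ii by simp
    show "(\<lambda>x. (f1 x)\<^sup>2) \<in> borel_measurable m" using m_measurable[OF f1m] by simp
    have "(f x)\<^sup>2 \<le> C\<^sup>2" for x using power_mono[OF f(2)[of x], of 2] by simp
    then show "AE x in m. norm ((f1 x)\<^sup>2) \<le> norm (C\<^sup>2 * (i x)\<^sup>2)"
      by (intro AE_I2) (simp add: f1_def power_mult_distrib mult_right_mono)
  qed
  let ?a = "\<lambda>s. \<integral>x. \<bar>Pt s f1 x - f1 x\<bar> \<partial>\<mu>" and ?b = "\<lambda>s. \<integral>x. \<bar>Pt s i x - i x\<bar> \<partial>\<mu>"
  have "((\<lambda>s. ?a s + C * ?b s) \<longlongrightarrow> 0 + C * 0) (at_right 0)"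
    by (intro tendsto_intros Pt_continuous_L2[OF f1m f1b fi] Pt_continuous_L2[OF im ii])
  then have "eventually (\<lambda>s. ?a s + C * ?b s < e / 2) (at_right 0)"
    using e by (intro order_tendstoD(2)) auto
  moreover have "eventually (\<lambda>s. 0 < s) (at_right (0::real))" by (simp add: eventually_at_right_less)
  ultimately show "eventually (\<lambda>s. dist (\<integral>x. \<bar>Pt s f x - f x\<bar> \<partial>\<mu>b) 0 < e) (at_right 0)"
  proof eventually_elim
    case (elim s)
    have pt: "\<bar>Pt s f x - f x\<bar> \<le> \<bar>Pt s f1 x - f1 x\<bar> + C * \<bar>Pt s i x - i x\<bar> + 2 * C * (1 - i x)" for x
    proof -
      interpret P: prob_space "PX x" by (rule PX_prob)
      have i1: "integrable (PX x) (\<lambda>\<omega>. f (\<omega> s))" "integrable (PX x) (\<lambda>\<omega>. f1 (\<omega> s))" "integrable (PX x) (\<lambda>\<omega>. i (\<omega> s))"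
        by (rule Ex_integrable[OF measurable_comp_eval[OF f(1)]], rule f(2),
            rule Ex_integrable[OF measurable_comp_eval[OF f1m]], rule f1b,
            rule Ex_integrable[OF measurable_comp_eval[OF im(1)]], rule im(2))
      have "Pt s f x - Pt s f1 x = (\<integral>\<omega>. f (\<omega> s) - f1 (\<omega> s) \<partial>PX x)" unfolding Pt_def using i1 by simp
      also have "\<bar>\<dots>\<bar> \<le> (\<integral>\<omega>. \<bar>f (\<omega> s) - f1 (\<omega> s)\<bar> \<partial>PX x)" by (rule integral_abs_bound)
      also have "\<dots> \<le> (\<integral>\<omega>. C * (1 - i (\<omega> s)) \<partial>PX x)"
      proof (rule Bochner_Integration.integral_mono)
        show "\<bar>f (\<omega> s) - f1 (\<omega> s)\<bar> \<le> C * (1 - i (\<omega> s))" for \<omega>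
          using f(2)[of "\<omega> s"] by (simp add: f1_def i_def split: split_indicator)
      qed (use i1 in auto)
      also have "\<dots> = C * (1 - Pt s i x)" unfolding Pt_def using i1 P.prob_space by (simp add: right_diff_distrib)
      finally have 1: "\<bar>Pt s f x - Pt s f1 x\<bar> \<le> C * (1 - Pt s i x)" .
      have "C * (1 - Pt s i x) \<le> C * (\<bar>Pt s i x - i x\<bar> + (1 - i x))" using C by (intro mult_left_mono) auto
      then have 2: "C * (1 - Pt s i x) \<le> C * \<bar>Pt s i x - i x\<bar> + C * (1 - i x)" by (simp add: distrib_left)
      have 3: "\<bar>f1 x - f x\<bar> \<le> C * (1 - i x)" using f(2)[of x] by (simp add: f1_def i_def split: split_indicator)
      have 4: "2 * C * (1 - i x) = C * (1 - i x) + C * (1 - i x)" by simp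
      show ?thesis using 1 2 3 unfolding 4 by linarith
    qed
    have mm: "(\<lambda>x. \<bar>Pt s f1 x - f1 x\<bar>) \<in> borel_measurable borel" "(\<lambda>x. \<bar>Pt s i x - i x\<bar>) \<in> borel_measurable borel"
        "(\<lambda>x. \<bar>Pt s f x - f x\<bar>) \<in> borel_measurable borel"
      using Pt_measurable[OF f1m] f1m Pt_measurable[OF im(1)] im(1) Pt_measurable[OF f(1)] f(1) by simp_all
    have ib: "integrable \<mu>b (\<lambda>x. \<bar>Pt s f1 x - f1 x\<bar>)" "integrable \<mu>b (\<lambda>x. \<bar>Pt s i x - i x\<bar>)" "integrable \<mu>b (\<lambda>x. \<bar>Pt s f x - f x\<bar>)" "integrable \<mu>b i"
    proof -
      show "integrable \<mu>b (\<lambda>x. \<bar>Pt s f1 x - f1 x\<bar>)"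
      proof (rule \<mu>b_integrable[OF mm(1), of "2 * C"])
        show "\<bar>\<bar>Pt s f1 x - f1 x\<bar>\<bar> \<le> 2 * C" for x using Pt_abs_le[OF f1m f1b, of s x] f1b[of x] by linarith
      qed
      show "integrable \<mu>b (\<lambda>x. \<bar>Pt s i x - i x\<bar>)"
      proof (rule \<mu>b_integrable[OF mm(2), of 2])
        show "\<bar>\<bar>Pt s i x - i x\<bar>\<bar> \<le> 2" for x using Pt_abs_le[OF im, of s x] im(2)[of x] by linarith
      qed
      show "integrable \<mu>b (\<lambda>x. \<bar>Pt s f x - f x\<bar>)"
      proof (rule \<mu>b_integrable[OF mm(3), of "2 * C"])
        show "\<bar>\<bar>Pt s f x - f x\<bar>\<bar> \<le> 2 * C" for x using Pt_abs_le[OF f, of s x] f(2)[of x] by linarith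
      qed
      show "integrable \<mu>b i" by (rule \<mu>b_integrable[OF im])
    qed
    have "(\<integral>x. \<bar>Pt s f x - f x\<bar> \<partial>\<mu>b)
       \<le> (\<integral>x. \<bar>Pt s f1 x - f1 x\<bar> + C * \<bar>Pt s i x - i x\<bar> + 2 * C * (1 - i x) \<partial>\<mu>b)"
      by (rule Bochner_Integration.integral_mono[OF ib(3) _ pt]) (use ib in simp)
    also have "\<dots> = (\<integral>x. \<bar>Pt s f1 x - f1 x\<bar> \<partial>\<mu>b) + C * (\<integral>x. \<bar>Pt s i x - i x\<bar> \<partial>\<mu>b) + 2 * C * (1 - (\<integral>x. i x \<partial>\<mu>b))"
      using ib B.prob_space by (simp add: right_diff_distrib)
    also have "\<dots> = ?a s + C * ?b s + 2 * C * (1 - measure \<mu> (A k))"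
      unfolding \<mu>b_integral[OF mm(1)] \<mu>b_integral[OF mm(2)] \<mu>b_integral[OF im(1)]
      using Ak(3) by (simp add: i_def \<mu>_space Int_absorb2)
    also have "\<dots> < e"
    proof -
      have "2 * C * (1 - measure \<mu> (A k)) \<le> 2 * (C + 1) * (e / (6 * (C + 1)))"
        using k C M.prob_le_1[of "A k"] by (intro mult_mono) auto
      also have "\<dots> = e / 3" using C by (simp add: field_simps)
      finally show ?thesis using elim(1) e by linarith
    qed
    finally have "(\<integral>x. \<bar>Pt s f x - f x\<bar> \<partial>\<mu>b) < e" .
    moreover have "0 \<le> (\<integral>x. \<bar>Pt s f x - f x\<bar> \<partial>\<mu>b)" by simp
    ultimately show ?case by simp
  qed
qed

lemma measurable_\<mu>b_borel:
  "f \<in> borel_measurable (borel \<Otimes>\<^sub>M borel) \<Longrightarrow> f \<in> borel_measurable (\<mu>b \<Otimes>\<^sub>M borel)"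
  using measurable_cong_sets[OF sets_pair_measure_cong[OF \<mu>b_sets refl] refl] by blast

text \<open>The function \<open>v\<close> of \<open>D1\<close> with \<open>\<eta> = s\<close>,
  written with \<open>Pt\<close> on the whole space; \<open>max 0\<close> gives a formula for every
  real \<open>s\<close>.\<close>

definition avg :: "real \<Rightarrow> ('a \<Rightarrow> real) \<Rightarrow> real \<Rightarrow> 'a \<Rightarrow> real" where
  "avg t u s x = (1 / t) * (LBINT r:{0..t}. Pt (max 0 (s + r)) u x)"

lemma Pt_section_measurable:
  assumes u: "u \<in> borel_measurable borel" "\<And>x. 0 \<le> u x"
  shows "(\<lambda>r. Pt (max 0 r) u x) \<in> borel_measurable borel"
  using measurable_Pair2[OF Pt_joint_measurable[OF u], of x] by simp

lemma rate_avg: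
  assumes u: "u \<in> borel_measurable borel" "\<And>x. 0 \<le> u x \<and> u x \<le> C" "(\<integral>\<^sup>+x. ennreal (u x) \<partial>m) < \<infinity>"
    and t: "0 < t" and s: "0 \<le> s" and \<epsilon>: "0 < \<epsilon>"
  shows "- I \<le> (\<integral>x. ((1 / t) * (Pt (s + t) u x - Pt s u x)) / (avg t u s x + \<epsilon>) \<partial>\<mu>)"
proof -
  have uD: "u \<in> Dset m" unfolding Dset_def using u m_measurable[OF u(1)] by auto
  let ?v = "\<lambda>x. (1 / t) * (LBINT r=0..t. pf p r (pf p s u) x)"
  let ?L = "\<lambda>x. (1 / t) * (pf p t (pf p s u) x - pf p s u x)"
  have "(?v, ?L) \<in> D1 m p" unfolding D1_def using uD t s by blast
  from rate[OF this \<epsilon>] have "- I \<le> (\<integral>x. ?L x / (?v x + \<epsilon>) \<partial>\<mu>)" .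
  also have "\<dots> = (\<integral>x. ((1 / t) * (Pt (s + t) u x - Pt s u x)) / (avg t u s x + \<epsilon>) \<partial>\<mu>)"
  proof (rule Bochner_Integration.integral_cong[OF refl])
    fix x assume "x \<in> space \<mu>"
    then have x: "x \<in> E" by (simp add: \<mu>_space)
    have P: "pf p r (pf p s u) x = Pt (s + r) u x" if r: "0 \<le> r" for r
    proof -
      have "pf p r (pf p s u) x = pf p r (Pt s u) x"
        by (rule pf_cong[OF r x]) (rule Pt_eq_pf[OF s _ u(1), symmetric])
      also have "\<dots> = Pt r (Pt s u) x" by (rule Pt_eq_pf[OF r x Pt_measurable[OF u(1)], symmetric])
      also have "\<dots> = Pt (r + s) u x" by (rule Pt_add[OF r s u(1,2), symmetric])
      finally show ?thesis by (simp add: add.commute)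
    qed
    have "(LBINT r=0..t. pf p r (pf p s u) x) = (LBINT r:{0..t}. pf p r (pf p s u) x)"
      using interval_integral_Icc[of 0 t "\<lambda>r. pf p r (pf p s u) x"] t by (simp add: zero_ereal_def)
    also have "\<dots> = (LBINT r:{0..t}. Pt (max 0 (s + r)) u x)"
      unfolding set_lebesgue_integral_def using s P
      by (intro Bochner_Integration.integral_cong refl) (auto split: split_indicator)
    finally have "?v x = avg t u s x" by (simp add: avg_def)
    moreover have "?L x = (1 / t) * (Pt (s + t) u x - Pt s u x)"
      using P[of t] t Pt_eq_pf[OF s x u(1)] by simp
    ultimately show "?L x / (?v x + \<epsilon>) = ((1 / t) * (Pt (s + t) u x - Pt s u x)) / (avg t u s x + \<epsilon>)" by (simp only:)
  qed
  finally show ?thesis .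
qed

lemma set_integral_shift:
  fixes g :: "real \<Rightarrow> real"
  shows "(LBINT r:{a..b}. g (c + r)) = (LBINT r:{c + a..c + b}. g r)"
proof -
  have "(LBINT r:{c + a..c + b}. g r) = (\<integral>r. indicator {c + a..c + b} (c + 1 * r) *\<^sub>R g (c + 1 * r) \<partial>lborel)"
    unfolding set_lebesgue_integral_def by (subst lborel_integral_real_affine[where c = 1 and t = c]) auto
  also have "\<dots> = (LBINT r:{a..b}. g (c + r))"
    unfolding set_lebesgue_integral_def
    by (intro Bochner_Integration.integral_cong) (auto split: split_indicator)
  finally show ?thesis ..
qed

lemma avg_bounds:
  assumes u: "u \<in> borel_measurable borel" "\<And>x. 0 \<le> u x \<and> u x \<le> C" and t: "0 < t"
  shows "0 \<le> avg t u s x" "avg t u s x \<le> C"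
proof -
  have G: "0 \<le> Pt r u x \<and> Pt r u x \<le> C" for r using Pt_bounds[OF u, of r x] by simp
  have "0 \<le> (LBINT r:{0..t}. Pt (max 0 (s + r)) u x)"
    unfolding set_lebesgue_integral_def by (rule Bochner_Integration.integral_nonneg) (use G in auto)
  then show "0 \<le> avg t u s x" using t by (simp add: avg_def)
  have "\<bar>LBINT r:{0..t}. Pt (max 0 (s + r)) u x\<bar> \<le> C * (t - 0)"
  proof (rule set_integral_abs_le_Icc)
    show "(\<lambda>r. Pt (max 0 (s + r)) u x) \<in> borel_measurable borel"
      by (rule measurable_compose[OF _ Pt_section_measurable]) (use u in auto)
  qed (use G t in auto)
  then show "avg t u s x \<le> C" using t by (simp add: avg_def pos_divide_le_eq)
qed

text \<open>For \<open>v = avg t u s\<close> the associated \<open>hat L v\<close> is the derivative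
  of \<open>v\<close> in \<open>s\<close>, thanks to the time average; so the integrand of the rate
  inequality is the derivative of \<open>ln (v + \<epsilon>)\<close>. Integrating
  \<open>rate_avg\<close> over \<open>s\<close> in \<open>[0,h]\<close> and exchanging the integrals
  gives the claim.\<close>

lemma entropy_avg:
  assumes u: "u \<in> borel_measurable borel" "\<And>x. 0 \<le> u x \<and> u x \<le> C" "(\<integral>\<^sup>+x. ennreal (u x) \<partial>m) < \<infinity>"
    and t: "0 < t" and h: "0 \<le> h" and \<epsilon>: "0 < \<epsilon>"
  shows "- I * h \<le> (\<integral>x. ln (avg t u h x + \<epsilon>) - ln (avg t u 0 x + \<epsilon>) \<partial>\<mu>b)"
proof -
  have u0: "0 \<le> u x" for x using u(2) by simp
  have C: "0 \<le> C" using u(2)[of undefined] by linarith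
  define G where "G x r = Pt (max 0 r) u x" for x r
  have Gb: "0 \<le> G x r \<and> G x r \<le> C" for x r unfolding G_def using Pt_bounds[OF u(1,2)] by auto
  have Gm: "(\<lambda>z. G (fst z) (snd z)) \<in> borel_measurable (borel \<Otimes>\<^sub>M borel)"
    unfolding G_def by (rule Pt_joint_measurable[OF u(1) u0])
  have Gs: "G x \<in> borel_measurable borel" for x unfolding G_def[abs_def] by (rule Pt_section_measurable[OF u(1) u0])
  have Gabs: "\<bar>G x r\<bar> \<le> C" for x r using Gb[of x r] by simp
  have Gi: "set_integrable lborel {a..b} (G x)" for a b x
    by (rule set_integrable_bounded_Icc[OF Gs Gabs])
  define g where "g x r = (1 / t) * (G x (t + r) - G x r)" for x r
  define \<phi> where "\<phi> x s = avg t u s x + \<epsilon>" for x s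
  have avgG: "avg t u s x = (1 / t) * (LBINT r:{s..s + t}. G x r)" for s x
    using set_integral_shift[of 0 t "G x" s] by (simp add: avg_def G_def)
  have gm: "(\<lambda>z. g (fst z) (snd z)) \<in> borel_measurable (borel \<Otimes>\<^sub>M borel)"
  proof -
    have "(\<lambda>z. (fst z, t + snd z)) \<in> borel \<Otimes>\<^sub>M borel \<rightarrow>\<^sub>M (borel :: 'a measure) \<Otimes>\<^sub>M (borel :: real measure)" by measurable
    from measurable_compose[OF this Gm] show ?thesis unfolding g_def using Gm by simp
  qed
  have gb: "\<bar>g x r\<bar> \<le> C / t" for x r
  proof -
    have "\<bar>G x (t + r) - G x r\<bar> \<le> C" using Gb[of x "t + r"] Gb[of x r] by (simp add: abs_le_iff)
    then show ?thesis using t unfolding g_def by (simp add: abs_mult divide_right_mono)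
  qed
  have gs: "g x \<in> borel_measurable borel" for x
    unfolding g_def[abs_def] by (intro borel_measurable_times borel_measurable_const borel_measurable_diff Gs measurable_compose[OF _ Gs]) auto
  have \<phi>m: "(\<lambda>z. \<phi> (fst z) (snd z)) \<in> borel_measurable (borel \<Otimes>\<^sub>M borel)"
  proof -
    have "(\<lambda>y :: ('a \<times> real) \<times> real. (fst (fst y), snd (fst y) + snd y)) \<in> (borel \<Otimes>\<^sub>M borel) \<Otimes>\<^sub>M lborel \<rightarrow>\<^sub>M (borel :: 'a measure) \<Otimes>\<^sub>M (borel :: real measure)"
      by measurable
    from measurable_compose[OF this Gm]
    have "(\<lambda>(z :: 'a \<times> real, r). indicator {0..t} r *\<^sub>R G (fst z) (snd z + r)) \<in> borel_measurable ((borel \<Otimes>\<^sub>M borel) \<Otimes>\<^sub>M lborel)"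
      by (auto simp: case_prod_beta' intro!: borel_measurable_times)
    from lborel.borel_measurable_lebesgue_integral[OF this]
    show ?thesis unfolding \<phi>_def avg_def G_def[symmetric] set_lebesgue_integral_def by simp
  qed
  have \<phi>s: "\<phi> x \<in> borel_measurable borel" for x
    using measurable_Pair2[OF \<phi>m, of x] by simp
  have \<phi>pos: "\<epsilon> \<le> \<phi> x s" for x s unfolding \<phi>_def using avg_bounds(1)[OF u(1,2) t, of s x] by simp
  \<comment> \<open>Both windows \<open>[a, a + t]\<close> and \<open>[b, b + t]\<close> are
    compared with \<open>[a, b + t]\<close>, which works whether or not they overlap.\<close>
  have \<phi>d: "\<phi> x b - \<phi> x a = (LBINT r:{a..b}. g x r)" if ab: "0 \<le> a" "a \<le> b" for x a b
  proof -
    have 1: "(LBINT r:{a..b + t}. G x r) = (LBINT r:{a..b}. G x r) + (LBINT r:{b..b + t}. G x r)"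
      by (rule set_integral_split_Icc[OF Gi]) (use ab t in auto)
    have 2: "(LBINT r:{a..b + t}. G x r) = (LBINT r:{a..a + t}. G x r) + (LBINT r:{a + t..b + t}. G x r)"
      by (rule set_integral_split_Icc[OF Gi]) (use ab t in auto)
    have 3: "(LBINT r:{a + t..b + t}. G x r) = (LBINT r:{a..b}. G x (t + r))"
      using set_integral_shift[of a b "G x" t] by (simp add: add.commute)
    have i4: "set_integrable lborel {a..b} (\<lambda>r. G x (t + r))"
      by (rule set_integrable_bounded_Icc[OF measurable_compose[OF _ Gs] Gabs]) simp
    have "\<phi> x b - \<phi> x a = (1 / t) * ((LBINT r:{b..b + t}. G x r) - (LBINT r:{a..a + t}. G x r))"
      unfolding \<phi>_def avgG by (simp add: right_diff_distrib)
    also have "\<dots> = (1 / t) * ((LBINT r:{a..b}. G x (t + r)) - (LBINT r:{a..b}. G x r))"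
      using 1 2 3 by (intro arg_cong[where f = "\<lambda>y. (1 / t) * y"]) linarith
    also have "\<dots> = (LBINT r:{a..b}. g x r)"
      unfolding g_def using set_integral_diff(2)[OF i4 Gi] by simp
    finally show ?thesis .
  qed
  let ?q = "\<lambda>z :: 'a \<times> real. g (fst z) (snd z) / \<phi> (fst z) (snd z)"
  have qm0: "?q \<in> borel_measurable (borel \<Otimes>\<^sub>M borel)" by (rule borel_measurable_divide[OF gm \<phi>m])
  note qm = measurable_\<mu>b_borel[OF qm0]
  have qb: "\<bar>?q (x, r)\<bar> \<le> C / t / \<epsilon>" for x r
    using gb[of x r] \<phi>pos[of x r] \<epsilon> C t unfolding abs_divide fst_conv snd_conv by (intro frac_le) auto
  have ln: "ln (avg t u h x + \<epsilon>) - ln (avg t u 0 x + \<epsilon>) = (LBINT r:{0..h}. ?q (x, r))" for x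
    using integral_log_derivative[OF gs[of x] gb[of x] \<phi>d[of _ _ x] \<phi>pos[of x] \<epsilon> \<phi>s[of x] h] by (simp add: \<phi>_def)
  have "(\<integral>x. ln (avg t u h x + \<epsilon>) - ln (avg t u 0 x + \<epsilon>) \<partial>\<mu>b) = (LBINT r:{0..h}. \<integral>x. ?q (x, r) \<partial>\<mu>b)"
    unfolding ln by (rule fubini_Icc(1)[OF \<mu>b_prob qm qb])
  also have "\<dots> \<ge> (LBINT r:{0..h}. - I)"
  proof (rule set_integral_mono)
    show "set_integrable lborel {0..h} (\<lambda>r. - I)" by (rule set_integrable_bounded_Icc[where C = "\<bar>I\<bar>"]) auto
    interpret B: prob_space \<mu>b by (rule \<mu>b_prob)
    have "\<bar>\<integral>x. ?q (x, r) \<partial>\<mu>b\<bar> \<le> C / t / \<epsilon>" for r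
    proof -
      have qmr: "(\<lambda>x. ?q (x, r)) \<in> borel_measurable \<mu>b" using measurable_Pair1[OF qm, of r] by simp
      have qi: "integrable \<mu>b (\<lambda>x. ?q (x, r))" by (rule B.integrable_const_bound[OF _ qmr]) (use qb in auto)
      have "\<bar>\<integral>x. ?q (x, r) \<partial>\<mu>b\<bar> \<le> (\<integral>x. \<bar>?q (x, r)\<bar> \<partial>\<mu>b)" by (rule integral_abs_bound)
      also have "\<dots> \<le> C / t / \<epsilon>" by (rule B.integral_le_const[OF integrable_abs[OF qi]]) (use qb in auto)
      finally show ?thesis .
    qed
    then show "set_integrable lborel {0..h} (\<lambda>r. \<integral>x. ?q (x, r) \<partial>\<mu>b)"
      by (rule set_integrable_bounded_Icc[OF fubini_Icc(3)[OF \<mu>b_prob qm qb]])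
    fix r assume r: "r \<in> {0..h}"
    have "(\<integral>x. ?q (x, r) \<partial>\<mu>b) = (\<integral>x. ?q (x, r) \<partial>\<mu>)"
      by (rule \<mu>b_integral) (use measurable_Pair1[OF qm0, of r] in simp)
    also have "\<dots> = (\<integral>x. ((1 / t) * (Pt (r + t) u x - Pt r u x)) / (avg t u r x + \<epsilon>) \<partial>\<mu>)"
      using r t by (simp add: g_def \<phi>_def G_def add.commute)
    also have "\<dots> \<ge> - I" by (rule rate_avg[OF u t _ \<epsilon>]) (use r in simp)
    finally show "- I \<le> (\<integral>x. ?q (x, r) \<partial>\<mu>b)" .
  qed
  also have "(LBINT r:{0..h}. - I) = - I * h" using h by (simp add: set_lebesgue_integral_def)
  finally show ?thesis .
qed

end

section \<open>The resolvent\<close>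

lemma nn_integral_exp_tail:
  "(\<integral>\<^sup>+t. ennreal (exp (- t)) * indicator {a..} t \<partial>lborel) = ennreal (exp (- a :: real))"
proof -
  have "(\<integral>\<^sup>+t. ennreal (exp (- t)) * indicator {a..} t \<partial>lborel) = ennreal (0 - (- exp (- a)))"
  proof (rule nn_integral_FTC_atLeast)
    show "DERIV (\<lambda>x. - exp (- x)) x :> exp (- x)" for x :: real by (auto intro!: derivative_eq_intros)
    have "((\<lambda>x. exp (- x)) \<longlongrightarrow> (0 :: real)) at_top"
      by (rule filterlim_compose[OF exp_at_bot filterlim_uminus_at_bot_at_top])
    from tendsto_minus[OF this] show "((\<lambda>x. - exp (- x)) \<longlongrightarrow> (0 :: real)) at_top" by simp
  qed auto
  then show ?thesis by simp
qed

lemma integral_uniform_Icc: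
  fixes g :: "real \<Rightarrow> real"
  assumes t: "0 < t" and g: "g \<in> borel_measurable borel"
  shows "(\<integral>s. g s \<partial>uniform_measure lborel {0..t}) = (1 / t) * (LBINT s:{0..t}. g s)"
proof -
  have d: "indicator {0..t} x / emeasure lborel {0..t} = ennreal (indicator {0..t} x / t)" for x
    using t divide_ennreal[of 1 t] by (cases "x \<in> {0..t}") simp_all
  have u: "uniform_measure lborel {0..t} = density lborel (\<lambda>x. ennreal (indicator {0..t} x / t))"
    unfolding uniform_measure_def d ..
  have "(\<integral>s. g s \<partial>uniform_measure lborel {0..t}) = (\<integral>s. (indicator {0..t} s / t) *\<^sub>R g s \<partial>lborel)"
    unfolding u by (rule integral_density) (use t g in auto)
  also have "\<dots> = (\<integral>s. (1 / t) * (indicator {0..t} s *\<^sub>R g s) \<partial>lborel)"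
    by (intro Bochner_Integration.integral_cong) auto
  also have "\<dots> = (1 / t) * (LBINT s:{0..t}. g s)"
    unfolding set_lebesgue_integral_def by (rule integral_mult_right_zero)
  finally show ?thesis .
qed

section \<open>Removing the time average and the integrability of the test function; the
  resolvent\<close>

context ld_setting
begin

lemma avg_close:
  assumes f: "f \<in> borel_measurable borel" "\<And>x. 0 \<le> f x \<and> f x \<le> C" and t: "0 < t" and \<delta>: "0 \<le> \<delta>"
    and cl: "\<And>r. 0 < r \<Longrightarrow> r \<le> t \<Longrightarrow> (\<integral>x. \<bar>Pt r f x - f x\<bar> \<partial>\<mu>b) \<le> \<delta>"
  shows "(\<integral>x. \<bar>avg t f 0 x - f x\<bar> \<partial>\<mu>b) \<le> \<delta>" "integrable \<mu>b (avg t f 0)"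
proof -
  interpret B: prob_space \<mu>b by (rule \<mu>b_prob)
  have f0: "0 \<le> f x" for x using f(2) by simp
  have C: "0 \<le> C" using f(2)[of undefined] by linarith
  have Pb: "0 \<le> Pt r f x \<and> Pt r f x \<le> C" for r x using Pt_bounds[OF f, of r x] by simp
  let ?P = "\<lambda>z :: 'a \<times> real. Pt (max 0 (snd z)) f (fst z)"
  have Pm: "?P \<in> borel_measurable (borel \<Otimes>\<^sub>M borel)" by (rule Pt_joint_measurable[OF f(1) f0])
  let ?g = "\<lambda>z :: 'a \<times> real. \<bar>?P z - f (fst z)\<bar>"
  have g0: "?g \<in> borel_measurable (borel \<Otimes>\<^sub>M borel)"
    by (intro borel_measurable_abs borel_measurable_diff Pm measurable_compose[OF measurable_fst f(1)])
  note gm = measurable_\<mu>b_borel[OF g0]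
  have gb: "\<bar>?g (x, r)\<bar> \<le> C" for x r using Pb[of "max 0 r" x] f(2)[of x] by (auto simp: abs_le_iff)
  have Pmb: "?P \<in> borel_measurable (\<mu>b \<Otimes>\<^sub>M borel)" by (rule measurable_\<mu>b_borel[OF Pm])
  have Pbb: "\<bar>?P (x, r)\<bar> \<le> C" for x r using Pb[of "max 0 r" x] by simp
  have "integrable \<mu>b (\<lambda>x. LBINT r:{0..t}. ?P (x, r))" by (rule fubini_Icc(2)[OF \<mu>b_prob Pmb Pbb])
  then have ia: "integrable \<mu>b (\<lambda>x. (1 / t) * (LBINT r:{0..t}. ?P (x, r)))" by simp
  then show iavg: "integrable \<mu>b (avg t f 0)" by (simp add: avg_def[abs_def])
  have le: "\<bar>avg t f 0 x - f x\<bar> \<le> (1 / t) * (LBINT r:{0..t}. ?g (x, r))" for x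
  proof -
    have ms: "(\<lambda>r. Pt (max 0 r) f x) \<in> borel_measurable borel" by (rule Pt_section_measurable[OF f(1) f0])
    have i1: "set_integrable lborel {0..t} (\<lambda>r. Pt (max 0 r) f x)"
      by (rule set_integrable_bounded_Icc[OF ms, of C]) (use Pb in auto)
    have i2: "set_integrable lborel {0..t} (\<lambda>r. f x)" by (rule set_integrable_bounded_Icc[where C = "\<bar>f x\<bar>"]) auto
    have "f x = (1 / t) * (LBINT r:{0..t}. f x)" using t by (simp add: set_lebesgue_integral_def)
    then have "avg t f 0 x - f x = (1 / t) * ((LBINT r:{0..t}. Pt (max 0 r) f x) - (LBINT r:{0..t}. f x))"
      by (simp add: avg_def right_diff_distrib)
    also have "\<dots> = (1 / t) * (LBINT r:{0..t}. Pt (max 0 r) f x - f x)"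
      by (simp add: set_integral_diff(2)[OF i1 i2])
    finally have "\<bar>avg t f 0 x - f x\<bar> = (1 / t) * \<bar>LBINT r:{0..t}. Pt (max 0 r) f x - f x\<bar>"
      using t by (simp add: abs_mult)
    also have "\<dots> \<le> (1 / t) * (LBINT r:{0..t}. ?g (x, r))"
      unfolding set_lebesgue_integral_def
      using integral_abs_bound[of lborel "\<lambda>r. indicator {0..t} r *\<^sub>R (Pt (max 0 r) f x - f x)"] t
      by (intro mult_left_mono) (simp_all add: abs_mult)
    finally show ?thesis .
  qed
  have ig: "integrable \<mu>b (\<lambda>x. (1 / t) * (LBINT r:{0..t}. ?g (x, r)))"
    using fubini_Icc(2)[OF \<mu>b_prob gm gb, of 0 t] by simp
  have "(\<integral>x. \<bar>avg t f 0 x - f x\<bar> \<partial>\<mu>b) \<le> (\<integral>x. (1 / t) * (LBINT r:{0..t}. ?g (x, r)) \<partial>\<mu>b)"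
  proof (rule Bochner_Integration.integral_mono[OF _ ig le])
    have "integrable \<mu>b f" by (rule \<mu>b_integrable[OF f(1), of C]) (use f(2) in auto)
    then show "integrable \<mu>b (\<lambda>x. \<bar>avg t f 0 x - f x\<bar>)" using iavg by simp
  qed
  also have "\<dots> = (1 / t) * (LBINT r:{0..t}. \<integral>x. ?g (x, r) \<partial>\<mu>b)"
    using fubini_Icc(1)[OF \<mu>b_prob gm gb, of 0 t] by simp
  also have "\<dots> \<le> (1 / t) * (LBINT r:{0..t}. \<delta>)"
  proof (intro mult_left_mono set_integral_mono)
    show "set_integrable lborel {0..t} (\<lambda>r. \<delta>)" by (rule set_integrable_bounded_Icc[where C = "\<bar>\<delta>\<bar>"]) auto
    have "\<bar>\<integral>x. ?g (x, r) \<partial>\<mu>b\<bar> \<le> C" for r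
    proof -
      have gr: "(\<lambda>x. ?g (x, r)) \<in> borel_measurable \<mu>b" using measurable_Pair1[OF gm, of r] by simp
      have gi: "integrable \<mu>b (\<lambda>x. ?g (x, r))" by (rule B.integrable_const_bound[OF _ gr, of C]) (use gb in auto)
      have "(\<integral>x. ?g (x, r) \<partial>\<mu>b) \<le> C" by (rule B.integral_le_const[OF gi]) (use gb in auto)
      moreover have "0 \<le> (\<integral>x. ?g (x, r) \<partial>\<mu>b)" by (rule Bochner_Integration.integral_nonneg) auto
      ultimately show ?thesis by linarith
    qed
    then show "set_integrable lborel {0..t} (\<lambda>r. \<integral>x. ?g (x, r) \<partial>\<mu>b)"
      by (rule set_integrable_bounded_Icc[OF fubini_Icc(3)[OF \<mu>b_prob gm gb]])
    fix r assume r: "r \<in> {0..t}"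
    show "(\<integral>x. ?g (x, r) \<partial>\<mu>b) \<le> \<delta>"
    proof (cases "r = 0")
      case True
      then show ?thesis using \<delta> by (simp add: Pt_0[OF f(1)])
    next
      case False
      then show ?thesis using cl[of r] r by simp
    qed
  qed (use t in auto)
  also have "\<dots> = \<delta>" using t by (simp add: set_lebesgue_integral_def)
  finally show "(\<integral>x. \<bar>avg t f 0 x - f x\<bar> \<partial>\<mu>b) \<le> \<delta>" .
qed

lemma ln_add_integrable:
  fixes f :: "'a \<Rightarrow> real"
  assumes f: "f \<in> borel_measurable \<mu>b" "\<And>x. 0 \<le> f x \<and> f x \<le> C" and \<epsilon>: "0 < \<epsilon>"
  shows "integrable \<mu>b (\<lambda>x. ln (f x + \<epsilon>))"
proof (rule finite_measure.integrable_const_bound[OF prob_space.finite_measure[OF \<mu>b_prob], where B = "\<bar>ln \<epsilon>\<bar> + \<bar>ln (C + \<epsilon>)\<bar>"])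
  have "\<bar>ln (f x + \<epsilon>)\<bar> \<le> \<bar>ln \<epsilon>\<bar> + \<bar>ln (C + \<epsilon>)\<bar>" for x
    using f(2)[of x] \<epsilon> ln_mono[of \<epsilon> "f x + \<epsilon>"] ln_mono[of "f x + \<epsilon>" "C + \<epsilon>"] by linarith
  then show "AE x in \<mu>b. norm (ln (f x + \<epsilon>)) \<le> \<bar>ln \<epsilon>\<bar> + \<bar>ln (C + \<epsilon>)\<bar>" by simp
qed (use f(1) in measurable)

text \<open>The averaging time \<open>t\<close> tends to \<open>0\<close> in
  \<open>entropy_avg\<close>. By the semigroup property \<open>avg t u h\<close> is the average of
  \<open>Pt h u\<close> started at time \<open>0\<close>, so \<open>avg_close\<close> applies to
  both terms; the shift by \<open>\<epsilon>\<close> gives \<open>ln\<close> the Lipschitz constant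
  \<open>1 / \<epsilon>\<close>, and \<open>\<delta>\<close> allots \<open>e / 2\<close> to each
  term.\<close>

lemma entropy_D:
  assumes u: "u \<in> borel_measurable borel" "\<And>x. 0 \<le> u x \<and> u x \<le> C" "(\<integral>\<^sup>+x. ennreal (u x) \<partial>m) < \<infinity>"
    and h: "0 \<le> h" and \<epsilon>: "0 < \<epsilon>"
  shows "- I * h \<le> (\<integral>x. ln (Pt h u x + \<epsilon>) - ln (u x + \<epsilon>) \<partial>\<mu>b)"
proof (rule field_le_epsilon)
  fix e :: real assume e: "0 < e"
  interpret B: prob_space \<mu>b by (rule \<mu>b_prob)
  define \<delta> where "\<delta> = e * \<epsilon> / 2"
  have \<delta>: "0 < \<delta>" using e \<epsilon> by (simp add: \<delta>_def)
  define w where "w = Pt h u"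
  have w: "w \<in> borel_measurable borel" "0 \<le> w x \<and> w x \<le> C" for x
    using Pt_measurable[OF u(1)] Pt_bounds[OF u(1,2)] by (simp_all add: w_def)
  have ab: "\<bar>u x\<bar> \<le> C" "\<bar>w x\<bar> \<le> C" for x using u(2)[of x] w(2)[of x] by auto
  have "eventually (\<lambda>s. (\<integral>x. \<bar>Pt s u x - u x\<bar> \<partial>\<mu>b) < \<delta> \<and> (\<integral>x. \<bar>Pt s w x - w x\<bar> \<partial>\<mu>b) < \<delta>) (at_right 0)"
    by (intro eventually_conj order_tendstoD(2)[OF Pt_continuous_bounded[OF u(1) ab(1)]]
        order_tendstoD(2)[OF Pt_continuous_bounded[OF w(1) ab(2)]] \<delta>)
  then obtain b where b: "0 < b" "\<And>s. 0 < s \<Longrightarrow> s < b \<Longrightarrow> (\<integral>x. \<bar>Pt s u x - u x\<bar> \<partial>\<mu>b) < \<delta> \<and> (\<integral>x. \<bar>Pt s w x - w x\<bar> \<partial>\<mu>b) < \<delta>"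
    unfolding eventually_at_right_field by auto
  define t where "t = b / 2"
  have t: "0 < t" "t < b" using b(1) by (auto simp: t_def)
  have c1: "(\<integral>x. \<bar>avg t u 0 x - u x\<bar> \<partial>\<mu>b) \<le> \<delta>" "integrable \<mu>b (avg t u 0)"
    using avg_close[OF u(1,2) t(1), of \<delta>] b(2) t \<delta> by (auto simp: less_imp_le)
  have c2: "(\<integral>x. \<bar>avg t w 0 x - w x\<bar> \<partial>\<mu>b) \<le> \<delta>" "integrable \<mu>b (avg t w 0)"
    using avg_close[OF w t(1), of \<delta>] b(2) t \<delta> by (auto simp: less_imp_le)
  have aw: "avg t u h x = avg t w 0 x" for x
  proof -
    have "(LBINT r:{0..t}. Pt (max 0 (h + r)) u x) = (LBINT r:{0..t}. Pt (max 0 (0 + r)) w x)"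
      unfolding set_lebesgue_integral_def
    proof (intro Bochner_Integration.integral_cong refl)
      fix r :: real
      have "Pt (h + r) u x = Pt r w x" if "0 \<le> r" "r \<le> t"
        using Pt_add[OF that(1) h u(1,2), of x] by (simp add: w_def add.commute)
      then show "indicator {0..t} r *\<^sub>R Pt (max 0 (h + r)) u x = indicator {0..t} r *\<^sub>R Pt (max 0 (0 + r)) w x"
        using h by (auto split: split_indicator)
    qed
    then show ?thesis by (simp add: avg_def)
  qed
  have avb: "0 \<le> avg t u 0 x \<and> avg t u 0 x \<le> C" "0 \<le> avg t w 0 x \<and> avg t w 0 x \<le> C" for x
    using avg_bounds[OF u(1,2) t(1)] avg_bounds[OF w t(1)] by auto
  have iu: "integrable \<mu>b u" "integrable \<mu>b w"
    by (rule \<mu>b_integrable[OF u(1) ab(1)]) (rule \<mu>b_integrable[OF w(1) ab(2)])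
  have l: "integrable \<mu>b (\<lambda>x. ln (u x + \<epsilon>))" "integrable \<mu>b (\<lambda>x. ln (w x + \<epsilon>))"
    "integrable \<mu>b (\<lambda>x. ln (avg t u 0 x + \<epsilon>))" "integrable \<mu>b (\<lambda>x. ln (avg t w 0 x + \<epsilon>))"
    by (rule ln_add_integrable[OF borel_measurable_integrable[OF iu(1)] u(2) \<epsilon>],
        rule ln_add_integrable[OF borel_measurable_integrable[OF iu(2)] w(2) \<epsilon>],
        rule ln_add_integrable[OF borel_measurable_integrable[OF c1(2)] avb(1) \<epsilon>],
        rule ln_add_integrable[OF borel_measurable_integrable[OF c2(2)] avb(2) \<epsilon>])
  have "- I * h \<le> (\<integral>x. ln (avg t w 0 x + \<epsilon>) - ln (avg t u 0 x + \<epsilon>) \<partial>\<mu>b)"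
    using entropy_avg[OF u t(1) h \<epsilon>] by (simp add: aw)
  also have "\<dots> \<le> (\<integral>x. (ln (w x + \<epsilon>) - ln (u x + \<epsilon>)) + (\<bar>avg t w 0 x - w x\<bar> / \<epsilon> + \<bar>avg t u 0 x - u x\<bar> / \<epsilon>) \<partial>\<mu>b)"
  proof (rule Bochner_Integration.integral_mono)
    fix x
    show "ln (avg t w 0 x + \<epsilon>) - ln (avg t u 0 x + \<epsilon>)
      \<le> (ln (w x + \<epsilon>) - ln (u x + \<epsilon>)) + (\<bar>avg t w 0 x - w x\<bar> / \<epsilon> + \<bar>avg t u 0 x - u x\<bar> / \<epsilon>)"
      using ln_add_lipschitz[OF \<epsilon>, of "avg t w 0 x" "w x"] ln_add_lipschitz[OF \<epsilon>, of "avg t u 0 x" "u x"]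
        avb[of x] u(2)[of x] w(2)[of x] by linarith
  qed (use l c1 c2 iu in auto)
  also have "\<dots> = (\<integral>x. ln (w x + \<epsilon>) - ln (u x + \<epsilon>) \<partial>\<mu>b)
      + ((\<integral>x. \<bar>avg t w 0 x - w x\<bar> \<partial>\<mu>b) / \<epsilon> + (\<integral>x. \<bar>avg t u 0 x - u x\<bar> \<partial>\<mu>b) / \<epsilon>)"
    using l c1 c2 iu by simp
  also have "\<dots> \<le> (\<integral>x. ln (w x + \<epsilon>) - ln (u x + \<epsilon>) \<partial>\<mu>b) + (\<delta> / \<epsilon> + \<delta> / \<epsilon>)"
    using c1(1) c2(1) \<epsilon> by (intro add_left_mono add_mono divide_right_mono) auto
  also have "\<delta> / \<epsilon> + \<delta> / \<epsilon> = e" using \<epsilon> by (simp add: \<delta>_def)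
  finally show "- I * h \<le> (\<integral>x. ln (Pt h u x + \<epsilon>) - ln (u x + \<epsilon>) \<partial>\<mu>b) + e" by (simp add: w_def)
qed

lemma AE_\<mu>b_E: "AE x in \<mu>b. x \<in> E"
proof -
  interpret B: prob_space \<mu>b by (rule \<mu>b_prob)
  interpret M: prob_space \<mu> by (rule \<mu>_prob)
  have "measure \<mu>b E = measure \<mu> ((\<lambda>x. x) -` E \<inter> space \<mu>)"
    unfolding \<mu>b_def using \<mu>_measurable[OF measurable_ident] E_borel by (intro measure_distr) (simp_all add: id_def)
  then have "measure \<mu>b E = 1" using M.prob_space \<mu>_space by simp
  from B.AE_prob_1[OF this] show ?thesis .
qed

text \<open>A function bounded away from \<open>0\<close> is not integrable when \<open>m\<close> is
  infinite. Its lower bound \<open>c\<close> takes the role of \<open>\<epsilon>\<close>: in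
  \<open>w = v + c\<close> only \<open>v\<close> is cut off to sets of finite measure, and
  \<open>Pt h v + c = Pt h w\<close> because path laws are probabilities.\<close>

lemma entropy_bounded:
  assumes h: "0 \<le> h" and w: "w \<in> borel_measurable borel" "\<And>x. c \<le> w x \<and> w x \<le> C" and c: "0 < c"
  shows "- I * h \<le> (\<integral>x. ln (Pt h w x) - ln (w x) \<partial>\<mu>b)"
proof -
  interpret S: sigma_finite_measure m by (rule m_sigma_finite)
  obtain A :: "nat \<Rightarrow> 'a set" where A: "range A \<subseteq> sets m" "(\<Union>i. A i) = space m"
    "\<And>i. emeasure m (A i) \<noteq> \<infinity>" "incseq A" by (rule S.sigma_finite_incseq) blast
  have Ab: "A k \<in> sets m" "A k \<in> sets borel" for k using A(1) m_sets_iff by blast+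
  define v where "v x = w x - c" for x
  have v: "v \<in> borel_measurable borel" "0 \<le> v x \<and> v x \<le> C" for x
    using w(1) w(2)[of x] c unfolding v_def[abs_def] by auto
  define u where "u k x = v x * indicator (A k) x" for k x
  have u: "u k \<in> borel_measurable borel" "0 \<le> u k x \<and> u k x \<le> C" for k x
    using v(1) v(2)[of x] Ab(2)[of k] unfolding u_def[abs_def] by (auto split: split_indicator)
  have uf: "(\<integral>\<^sup>+x. ennreal (u k x) \<partial>m) < \<infinity>" for k
  proof -
    have "(\<integral>\<^sup>+x. ennreal (u k x) \<partial>m) \<le> (\<integral>\<^sup>+x. ennreal C * indicator (A k) x \<partial>m)"
      using v(2) by (intro nn_integral_mono) (auto simp: u_def ennreal_leI split: split_indicator)
    also have "\<dots> = ennreal C * emeasure m (A k)" using Ab(1) by (rule nn_integral_cmult_indicator)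
    also have "\<dots> < \<infinity>" using A(3)[of k] by (simp add: ennreal_mult_less_top less_top)
    finally show ?thesis .
  qed
  have ev: "eventually (\<lambda>k. u k x = v x) sequentially" if x: "x \<in> E" for x
  proof -
    obtain k0 where "x \<in> A k0" using x A(2) m_space by blast
    then have "x \<in> A k" if "k0 \<le> k" for k using A(4) that by (auto simp: incseq_def)
    then show ?thesis unfolding eventually_sequentially u_def by (intro exI[of _ k0]) auto
  qed
  have Pl: "(\<lambda>k. Pt h (u k) x) \<longlonglongrightarrow> Pt h v x" if x: "x \<in> E" for x
    unfolding Pt_def
  proof (rule integral_dominated_convergence[where w = "\<lambda>_. C"])
    interpret P: prob_space "PX x" by (rule PX_prob)
    show "integrable (PX x) (\<lambda>_. C)" by simp
    show "AE \<omega> in PX x. (\<lambda>k. u k (\<omega> h)) \<longlonglongrightarrow> v (\<omega> h)"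
      using AE_eval_E[OF h x] by eventually_elim (rule tendsto_eventually[OF ev])
    show "AE \<omega> in PX x. norm (u k (\<omega> h)) \<le> C" for k using u(2) by auto
  qed (use measurable_comp_eval[OF v(1)] measurable_comp_eval[OF u(1)] in auto)
  have Pvb: "0 \<le> Pt h v x \<and> Pt h v x \<le> C" "0 \<le> Pt h (u k) x \<and> Pt h (u k) x \<le> C" for k x
    using Pt_bounds[OF v] Pt_bounds[OF u] by auto
  have "(\<lambda>k. \<integral>x. ln (Pt h (u k) x + c) - ln (u k x + c) \<partial>\<mu>b) \<longlonglongrightarrow> (\<integral>x. ln (Pt h v x + c) - ln (v x + c) \<partial>\<mu>b)"
  proof (rule integral_dominated_convergence[where w = "\<lambda>_. 2 * (\<bar>ln c\<bar> + \<bar>ln (C + c)\<bar>)"])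
    interpret B: prob_space \<mu>b by (rule \<mu>b_prob)
    show "integrable \<mu>b (\<lambda>_. 2 * (\<bar>ln c\<bar> + \<bar>ln (C + c)\<bar>))" by simp
    show "(\<lambda>x. ln (Pt h v x + c) - ln (v x + c)) \<in> borel_measurable \<mu>b"
      by (rule \<mu>b_measurable) (use Pt_measurable[OF v(1)] v(1) in measurable)
    show "(\<lambda>x. ln (Pt h (u k) x + c) - ln (u k x + c)) \<in> borel_measurable \<mu>b" for k
      by (rule \<mu>b_measurable) (use Pt_measurable[OF u(1)] u(1) in measurable)
    have lb: "\<bar>ln (y + c)\<bar> \<le> \<bar>ln c\<bar> + \<bar>ln (C + c)\<bar>" if "0 \<le> y \<and> y \<le> C" for y
      using that c ln_mono[of c "y + c"] ln_mono[of "y + c" "C + c"] by linarith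
    show "AE x in \<mu>b. norm (ln (Pt h (u k) x + c) - ln (u k x + c)) \<le> 2 * (\<bar>ln c\<bar> + \<bar>ln (C + c)\<bar>)" for k
    proof (rule AE_I2)
      fix x
      have "\<bar>ln (Pt h (u k) x + c) - ln (u k x + c)\<bar> \<le> \<bar>ln (Pt h (u k) x + c)\<bar> + \<bar>ln (u k x + c)\<bar>"
        by (rule abs_triangle_ineq4)
      also have "\<dots> \<le> (\<bar>ln c\<bar> + \<bar>ln (C + c)\<bar>) + (\<bar>ln c\<bar> + \<bar>ln (C + c)\<bar>)"
        by (rule add_mono[OF lb[OF Pvb(2)] lb[OF u(2)]])
      finally show "norm (ln (Pt h (u k) x + c) - ln (u k x + c)) \<le> 2 * (\<bar>ln c\<bar> + \<bar>ln (C + c)\<bar>)" by simp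
    qed
    show "AE x in \<mu>b. (\<lambda>k. ln (Pt h (u k) x + c) - ln (u k x + c)) \<longlonglongrightarrow> ln (Pt h v x + c) - ln (v x + c)"
      using AE_\<mu>b_E
    proof eventually_elim
      case (elim x)
      have "Pt h v x + c \<noteq> 0" "v x + c \<noteq> 0" using Pvb(1)[of x] v(2)[of x] c by linarith+
      then show ?case by (intro tendsto_diff tendsto_ln tendsto_add tendsto_const Pl[OF elim] tendsto_eventually[OF ev[OF elim]])
    qed
  qed
  from LIMSEQ_le_const[OF this] entropy_D[OF u uf h c]
  have "- I * h \<le> (\<integral>x. ln (Pt h v x + c) - ln (v x + c) \<partial>\<mu>b)" by blast
  moreover have "Pt h v x + c = Pt h w x" for x
  proof -
    interpret P: prob_space "PX x" by (rule PX_prob)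
    have wb: "\<bar>w (\<omega> h)\<bar> \<le> C" for \<omega> using w(2)[of "\<omega> h"] c by linarith
    have "integrable (PX x) (\<lambda>\<omega>. w (\<omega> h))" by (rule Ex_integrable[OF measurable_comp_eval[OF w(1)] wb])
    then show ?thesis unfolding Pt_def v_def using P.prob_space by simp
  qed
  ultimately show ?thesis by (simp add: v_def)
qed

text \<open>The resolvent \<open>R 1\<^sub>A\<close> on the whole Polish space, computed with the process itself instead of with
  \<open>p\<close>, which carries no information outside \<open>E\<close>.\<close>
definition Rb :: "'a set \<Rightarrow> 'a \<Rightarrow> real" where
  "Rb A x = (\<integral>t. indicator {0..} t *\<^sub>R (exp (- t) * Pt (max 0 t) (indicator A) x) \<partial>lborel)"

lemma Pt_indicator:
  assumes A: "A \<in> sets borel" shows "Pt t (indicator A) x = measure (PX x) {\<omega> \<in> cadlag_paths. \<omega> t \<in> A}"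
    "{\<omega> \<in> cadlag_paths. \<omega> t \<in> A} \<in> sets (PX x)"
proof -
  define S where "S = {\<omega> \<in> cadlag_paths. \<omega> t \<in> A}"
  interpret P: prob_space "PX x" by (rule PX_prob)
  have S: "S \<in> sets (PX x)"
    using measurable_sets[OF measurable_eval A, of t] by (simp add: S_def PX_sets vimage_def Int_def conj_commute)
  then show "{\<omega> \<in> cadlag_paths. \<omega> t \<in> A} \<in> sets (PX x)" by (simp only: S_def)
  have "Pt t (indicator A) x = (\<integral>\<omega>. indicator S \<omega> \<partial>PX x)"
    unfolding Pt_def by (intro Bochner_Integration.integral_cong refl) (auto simp: S_def split: split_indicator)
  also have "\<dots> = measure (PX x) S" using S by (simp add: Int_absorb2 sets.sets_into_space del: PX_space)
  finally show "Pt t (indicator A) x = measure (PX x) {\<omega> \<in> cadlag_paths. \<omega> t \<in> A}" by (simp only: S_def)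
qed

lemma Pt_indicator_bounds:
  assumes A: "A \<in> sets borel" shows "0 \<le> Pt t (indicator A) x" "Pt t (indicator A) x \<le> 1"
  unfolding Pt_indicator(1)[OF A] using prob_space.prob_le_1[OF PX_prob] by auto

lemma Rb_nn:
  assumes A: "A \<in> sets borel"
  shows "ennreal (Rb A x) = (\<integral>\<^sup>+t. ennreal (exp (- t) * Pt (max 0 t) (indicator A) x) * indicator {0..} t \<partial>lborel)"
    and "0 \<le> Rb A x" and "Rb A \<in> borel_measurable borel"
proof -
  let ?f = "\<lambda>t. exp (- t) * Pt (max 0 t) (indicator A) x"
  have im: "(indicator A :: 'a \<Rightarrow> real) \<in> borel_measurable borel" using A by simp
  have ms: "(\<lambda>t. Pt (max 0 t) (indicator A) x) \<in> borel_measurable borel" by (rule Pt_section_measurable[OF im]) simp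
  have fm: "(\<lambda>t. indicator {0..} t *\<^sub>R ?f t) \<in> borel_measurable lborel" using ms by simp
  have eq: "ennreal (indicator {0..} t *\<^sub>R ?f t) = ennreal (?f t) * indicator {0..} t" for t by (auto split: split_indicator)
  have "(\<integral>\<^sup>+t. ennreal (?f t) * indicator {0..} t \<partial>lborel) \<le> (\<integral>\<^sup>+t. ennreal (exp (- t)) * indicator {0..} t \<partial>lborel)"
    by (intro nn_integral_mono mult_right_mono ennreal_leI) (auto simp: Pt_indicator_bounds[OF A] mult_left_le)
  also have "\<dots> < \<infinity>" unfolding nn_integral_exp_tail by simp
  finally have fin: "(\<integral>\<^sup>+t. ennreal (indicator {0..} t *\<^sub>R ?f t) \<partial>lborel) < \<infinity>" unfolding eq .
  have nn: "AE t in lborel. 0 \<le> indicator {0..} t *\<^sub>R ?f t" using Pt_indicator_bounds[OF A] by (intro AE_I2) (auto split: split_indicator)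
  have int: "integrable lborel (\<lambda>t. indicator {0..} t *\<^sub>R ?f t)" by (rule integrableI_nonneg[OF fm nn fin])
  show "ennreal (Rb A x) = (\<integral>\<^sup>+t. ennreal (?f t) * indicator {0..} t \<partial>lborel)"
    unfolding Rb_def nn_integral_eq_integral[OF int nn, symmetric] eq ..
  show "0 \<le> Rb A x" unfolding Rb_def by (rule Bochner_Integration.integral_nonneg_AE[OF nn])
  have "(\<lambda>z :: 'a \<times> real. Pt (max 0 (snd z)) (indicator A) (fst z)) \<in> borel_measurable (borel \<Otimes>\<^sub>M borel)"
    by (rule Pt_joint_measurable[OF im]) simp
  then have "(\<lambda>(x :: 'a, t). indicator {0..} t *\<^sub>R (exp (- t) * Pt (max 0 t) (indicator A) x)) \<in> borel_measurable (borel \<Otimes>\<^sub>M lborel)"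
    by (simp add: case_prod_beta')
  from lborel.borel_measurable_lebesgue_integral[OF this]
  show "Rb A \<in> borel_measurable borel" unfolding Rb_def[abs_def] .
qed

lemma Rres_eq_Rb:
  assumes A: "A \<in> sets borel" and x: "x \<in> E" shows "Rres p (indicator A) x = Rb A x"
  unfolding Rres_def Rb_def set_lebesgue_integral_def
  using A x by (intro Bochner_Integration.integral_cong refl) (auto simp: Pt_eq_pf split: split_indicator)

text \<open>If \<open>Pt t (indicator A) x\<close> were at most \<open>k / 2\<close> up to a time
  \<open>T\<close> with \<open>exp (- T) \<le> k / 2\<close>, the resolvent would be at most
  \<open>k / 2 + exp (- T) \<le> k\<close>.\<close>

lemma Rb_reach:
  assumes A: "A \<in> sets borel" and k: "0 < k" "k < Rb A x"
  shows "\<exists>t\<in>{0..max 0 (ln (2 / k))}. k / 2 \<le> Pt t (indicator A) x"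
proof (rule ccontr)
  define T where "T = max 0 (ln (2 / k))"
  assume "\<not> ?thesis"
  then have less: "Pt t (indicator A) x \<le> k / 2" if "0 \<le> t" "t \<le> T" for t using that unfolding T_def by force
  have "ennreal (Rb A x) \<le> (\<integral>\<^sup>+t. ennreal (k / 2) * (ennreal (exp (- t)) * indicator {0..} t) + ennreal (exp (- t)) * indicator {T..} t \<partial>lborel)"
    unfolding Rb_nn(1)[OF A]
  proof (rule nn_integral_mono)
    fix t :: real
    show "ennreal (exp (- t) * Pt (max 0 t) (indicator A) x) * indicator {0..} t
      \<le> ennreal (k / 2) * (ennreal (exp (- t)) * indicator {0..} t) + ennreal (exp (- t)) * indicator {T..} t"
    proof (cases "0 \<le> t")
      case False
      then show ?thesis by simp
    next
      case True
      show ?thesis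
      proof (cases "t \<le> T")
        case t: True
        have "exp (- t) * Pt t (indicator A) x \<le> k / 2 * exp (- t)" using less[OF True t] by simp
        then have "ennreal (exp (- t) * Pt t (indicator A) x) \<le> ennreal (k / 2) * ennreal (exp (- t))"
          using k(1) by (simp add: ennreal_mult[symmetric] ennreal_leI)
        then show ?thesis using True by (simp add: add_increasing2)
      next
        case t: False
        have "exp (- t) * Pt t (indicator A) x \<le> exp (- t)" using Pt_indicator_bounds[OF A] by (simp add: mult_left_le)
        then have "ennreal (exp (- t) * Pt t (indicator A) x) \<le> ennreal (exp (- t))" by (rule ennreal_leI)
        then show ?thesis using True t by (simp add: add_increasing)
      qed
    qed
  qed
  also have "\<dots> = ennreal (k / 2) * ennreal (exp (- 0)) + ennreal (exp (- T))"
    by (subst nn_integral_add) (auto simp: nn_integral_cmult nn_integral_exp_tail)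
  also have "\<dots> = ennreal (k / 2 + exp (- T))" using k(1) by (simp add: ennreal_plus)
  also have "\<dots> \<le> ennreal k"
  proof (rule ennreal_leI)
    have "exp (- T) \<le> exp (- ln (2 / k))" by (simp add: T_def)
    also have "\<dots> = k / 2" using k(1) by (simp add: exp_minus)
    finally show "k / 2 + exp (- T) \<le> k" by simp
  qed
  finally have "Rb A x \<le> k" using k by (simp add: ennreal_le_iff)
  then show False using k by simp
qed

text \<open>Absolute continuity is used twice: positive \<open>\<mu>\<close>-measure forces positive
  \<open>m\<close>-measure, so that irreducibility applies, and the resulting positivity
  \<open>m\<close>-almost everywhere holds \<open>\<mu>\<close>-almost everywhere.\<close>

lemma Rb_pos_AE:
  assumes A: "A \<in> sets borel" "0 < measure \<mu>b A"
  shows "emeasure m (A \<inter> E) > 0" "AE x in m. 0 < Rb (A \<inter> E) x" "AE x in \<mu>b. 0 < Rb (A \<inter> E) x"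
proof -
  have AE: "A \<inter> E \<in> sets m" "A \<inter> E \<in> sets borel" using A E_borel by (auto simp: m_sets_iff)
  have "measure \<mu>b A = measure \<mu> ((\<lambda>x. x) -` A \<inter> space \<mu>)"
    unfolding \<mu>b_def using \<mu>_measurable[OF measurable_ident] A(1) by (intro measure_distr) (simp_all add: id_def)
  then have "measure \<mu> (A \<inter> E) \<noteq> 0" using A(2) by (simp add: \<mu>_space)
  then have "A \<inter> E \<notin> null_sets \<mu>" by (auto simp: null_sets_def measure_def)
  then have "A \<inter> E \<notin> null_sets m" using \<mu>_ac unfolding absolutely_continuous_def by blast
  then show pos: "emeasure m (A \<inter> E) > 0" using AE(1) by (auto simp: null_sets_def zero_less_iff_neq_zero)
  have "AE x in m. 0 < Rres p (indicator (A \<inter> E)) x" using irred AE(1) pos by blast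
  then show m: "AE x in m. 0 < Rb (A \<inter> E) x"
    using AE_space[of m] by eventually_elim (simp add: Rres_eq_Rb[OF AE(2)] m_space)
  have "AE x in \<mu>. 0 < Rb (A \<inter> E) x" by (rule absolutely_continuous_AE[OF \<mu>_sets \<mu>_ac m])
  moreover have "{x \<in> space borel. 0 < Rb (A \<inter> E) x} \<in> sets borel"
    using Rb_nn(3)[OF AE(2)] by measurable
  ultimately show "AE x in \<mu>b. 0 < Rb (A \<inter> E) x"
    unfolding \<mu>b_def using \<mu>_measurable[OF measurable_ident]
    by (subst AE_distr_iff) (simp_all add: id_def)
qed

lemma reach_\<mu>b:
  assumes G: "G \<in> sets borel" "0 < measure \<mu>b G"
  shows "\<exists>\<rho>\<in>borel_measurable borel. (AE x in \<mu>b. 0 < \<rho> x) \<and>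
      (\<forall>k>0. \<exists>T\<ge>0. \<forall>x. k < (\<rho> x :: real) \<longrightarrow>
        (\<exists>t\<in>{0..T}. k / 2 \<le> measure (PX x) {\<omega> \<in> cadlag_paths. \<omega> t \<in> G}))"
proof (intro bexI[of _ "Rb (G \<inter> E)"] conjI allI impI)
  have AE: "G \<inter> E \<in> sets borel" using G E_borel by auto
  show "Rb (G \<inter> E) \<in> borel_measurable borel" by (rule Rb_nn(3)[OF AE])
  show "AE x in \<mu>b. 0 < Rb (G \<inter> E) x" by (rule Rb_pos_AE(3)[OF G])
  fix k :: real assume k: "0 < k"
  show "\<exists>T\<ge>0. \<forall>x. k < Rb (G \<inter> E) x \<longrightarrow> (\<exists>t\<in>{0..T}. k / 2 \<le> measure (PX x) {\<omega> \<in> cadlag_paths. \<omega> t \<in> G})"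
  proof (intro exI[of _ "max 0 (ln (2 / k))"] conjI allI impI)
    fix x assume "k < Rb (G \<inter> E) x"
    from Rb_reach[OF AE k this] obtain t where t: "t \<in> {0..max 0 (ln (2 / k))}" "k / 2 \<le> Pt t (indicator (G \<inter> E)) x" by blast
    interpret P: prob_space "PX x" by (rule PX_prob)
    have "measure (PX x) {\<omega> \<in> cadlag_paths. \<omega> t \<in> G \<inter> E} \<le> measure (PX x) {\<omega> \<in> cadlag_paths. \<omega> t \<in> G}"
      by (rule P.finite_measure_mono[OF _ Pt_indicator(2)[OF G(1)]]) auto
    then show "\<exists>t\<in>{0..max 0 (ln (2 / k))}. k / 2 \<le> measure (PX x) {\<omega> \<in> cadlag_paths. \<omega> t \<in> G}"
      using t by (intro bexI[of _ t]) (simp_all add: Pt_indicator(1)[OF AE])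
  qed simp
qed

sublocale dv: irreducible_donsker_varadhan PX \<kappa> \<mu>b I
proof (rule irreducible_donsker_varadhan.intro)
  show "donsker_varadhan PX \<kappa> \<mu>b I"
  proof (rule donsker_varadhan.intro[OF markov_family_axioms], rule donsker_varadhan_axioms.intro)
    show "prob_space \<mu>b" "sets \<mu>b = sets borel" "0 \<le> I" by (rule \<mu>b_prob \<mu>b_sets I_nonneg)+
  qed (rule Pt_continuous_bounded entropy_bounded; assumption)+
  show "irreducible_donsker_varadhan_axioms PX \<mu>b"
    by (rule irreducible_donsker_varadhan_axioms.intro) (rule reach_\<mu>b)
qed

end

section \<open>The exceptional set\<close>

context ld_setting
begin

text \<open>\<open>measure_of\<close> returns the intended values only for a countably additive set
  function. Identifying \<open>occ\<close> with the law of the path at a uniform random time in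
  \<open>[0,t]\<close> settles this for paths in \<open>E\<close> and makes integrals
  computable.\<close>

lemma occ_eq_distr:
  assumes \<omega>: "\<omega> \<in> cadlag_paths" "\<And>t. \<omega> t \<in> E" and t: "0 < t"
  shows "occ m t \<omega> = distr (uniform_measure lborel {0..t}) m \<omega>"
    and "prob_space (occ m t \<omega>)" and "sets (occ m t \<omega>) = sets m"
    and "f \<in> borel_measurable m \<Longrightarrow> (\<integral>x. f x \<partial>occ m t \<omega>) = (1 / t) * (LBINT s:{0..t}. (f (\<omega> s) :: real))"
proof -
  let ?U = "uniform_measure lborel {0..t}"
  have U: "prob_space ?U" by (rule prob_space_uniform_measure) (use t in auto)
  have "\<omega> \<in> borel \<rightarrow>\<^sub>M restrict_space borel E"
    by (rule measurable_restrict_space2) (use \<omega> cadlag_borel in auto)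
  then have \<omega>m: "\<omega> \<in> borel \<rightarrow>\<^sub>M m" using measurable_cong_sets[OF refl m_sets] by blast
  then have \<omega>U: "\<omega> \<in> ?U \<rightarrow>\<^sub>M m" by (simp add: measurable_def)
  have N: "prob_space (distr ?U m \<omega>)" by (rule prob_space.prob_space_distr[OF U \<omega>U])
  have int: "(\<integral>x. f x \<partial>distr ?U m \<omega>) = (1 / t) * (LBINT s:{0..t}. f (\<omega> s))"
    if "f \<in> borel_measurable m" for f :: "'a \<Rightarrow> real"
    using integral_distr[OF \<omega>U, of f] integral_uniform_Icc[OF t measurable_compose[OF \<omega>m that]] that by simp
  have e: "emeasure (distr ?U m \<omega>) A = ennreal ((1 / t) * (LBINT s=0..t. indicator A (\<omega> s)))" if A: "A \<in> sets m" for A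
  proof -
    interpret N: prob_space "distr ?U m \<omega>" by (rule N)
    have "measure (distr ?U m \<omega>) A = (\<integral>x. indicator A x \<partial>distr ?U m \<omega>)"
      using A by (simp add: Int_absorb2 sets.sets_into_space)
    also have "\<dots> = (1 / t) * (LBINT s:{0..t}. indicator A (\<omega> s))" by (rule int) (use A in simp)
    also have "(LBINT s:{0..t}. indicator A (\<omega> s) :: real) = (LBINT s=0..t. indicator A (\<omega> s))"
      using interval_integral_Icc[of 0 t "\<lambda>s. indicator A (\<omega> s) :: real"] t by (simp add: zero_ereal_def)
    finally show ?thesis unfolding N.emeasure_eq_measure by simp
  qed
  have "distr ?U m \<omega> = measure_of (space m) (sets m) (emeasure (distr ?U m \<omega>))"
    using measure_of_of_measure[of "distr ?U m \<omega>"] by simp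
  also have "\<dots> = occ m t \<omega>"
    unfolding occ_def by (rule measure_of_eq[OF sets.space_closed]) (simp add: e sets.sigma_sets_eq)
  finally show o: "occ m t \<omega> = distr ?U m \<omega>" ..
  show "prob_space (occ m t \<omega>)" "sets (occ m t \<omega>) = sets m" unfolding o using N by simp_all
  show "f \<in> borel_measurable m \<Longrightarrow> (\<integral>x. f x \<partial>occ m t \<omega>) = (1 / t) * (LBINT s:{0..t}. (f (\<omega> s) :: real))"
    unfolding o by (rule int)
qed

text \<open>The resolvent is 1-excessive: moving the time integral by \<open>s\<close> shows that
  the mean of \<open>Rb A\<close> at time \<open>s\<close> is at most \<open>exp s * Rb A x\<close>.
  If this is \<open>0\<close>, the nonnegative variable \<open>Rb A (\<omega> s)\<close> vanishes
  almost surely.\<close>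

lemma Rb_absorb:
  assumes A: "A \<in> sets borel" and x: "x \<in> E" "Rb A x = 0" and s: "0 \<le> s"
  shows "AE \<omega> in PX x. Rb A (\<omega> s) = 0"
proof -
  interpret P: prob_space "PX x" by (rule PX_prob)
  interpret PL: pair_sigma_finite "PX x" lborel ..
  let ?f = "\<lambda>t y. ennreal (exp (- t) * Pt (max 0 t) (indicator A) y) * indicator {0..} t"
  have im: "(indicator A :: 'a \<Rightarrow> real) \<in> borel_measurable borel" using A by simp
  have jm: "(\<lambda>z. Pt (max 0 (snd z)) (indicator A) (fst z)) \<in> borel_measurable (borel \<Otimes>\<^sub>M borel)"
    by (rule Pt_joint_measurable[OF im]) simp
  have "(\<lambda>z. (fst z s, snd z)) \<in> path_space \<Otimes>\<^sub>M lborel \<rightarrow>\<^sub>M (borel :: 'a measure) \<Otimes>\<^sub>M (borel :: real measure)"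
    using measurable_compose[OF measurable_fst measurable_eval] by (intro measurable_Pair) simp_all
  from measurable_compose[OF this jm]
  have jm': "(\<lambda>z. Pt (max 0 (snd z)) (indicator A) (fst z s)) \<in> borel_measurable (path_space \<Otimes>\<^sub>M lborel)" by simp
  have "(\<lambda>(\<omega>, t). ?f t (\<omega> s)) \<in> borel_measurable (path_space \<Otimes>\<^sub>M lborel)"
    unfolding case_prod_beta' using jm' by measurable
  then have fm: "(\<lambda>(\<omega>, t). ?f t (\<omega> s)) \<in> borel_measurable (PX x \<Otimes>\<^sub>M lborel)"
    using measurable_cong_sets[OF sets_pair_measure_cong[OF PX_sets refl] refl] by blast
  have ms: "(\<lambda>t. ?f t x) \<in> borel_measurable borel"
    using Pt_section_measurable[OF im, of x] by simp
  have "(\<integral>\<^sup>+\<omega>. ennreal (Rb A (\<omega> s)) \<partial>PX x) = (\<integral>\<^sup>+\<omega>. \<integral>\<^sup>+t. ?f t (\<omega> s) \<partial>lborel \<partial>PX x)"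
    unfolding Rb_nn(1)[OF A] ..
  also have "\<dots> = (\<integral>\<^sup>+t. \<integral>\<^sup>+\<omega>. ?f t (\<omega> s) \<partial>PX x \<partial>lborel)"
    using PL.Fubini'[OF fm] by simp
  also have "\<dots> \<le> (\<integral>\<^sup>+t. ennreal (exp s) * ?f (s + 1 * t) x \<partial>lborel)"
  proof (rule nn_integral_mono)
    fix t :: real
    show "(\<integral>\<^sup>+\<omega>. ?f t (\<omega> s) \<partial>PX x) \<le> ennreal (exp s) * ?f (s + 1 * t) x"
    proof (cases "0 \<le> t")
      case False
      then show ?thesis by simp
    next
      case True
      have "(\<integral>\<^sup>+\<omega>. ?f t (\<omega> s) \<partial>PX x) = (\<integral>\<^sup>+\<omega>. ennreal (exp (- t) * Pt t (indicator A) (\<omega> s)) \<partial>PX x)"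
        using True by simp
      also have "\<dots> = ennreal (\<integral>\<omega>. exp (- t) * Pt t (indicator A) (\<omega> s) \<partial>PX x)"
      proof (rule nn_integral_eq_integral)
        have "integrable (PX x) (\<lambda>\<omega>. Pt t (indicator A) (\<omega> s))"
          by (rule Ex_integrable[OF measurable_comp_eval[OF Pt_measurable[OF im]], where C = 1])
             (use Pt_indicator_bounds[OF A] in auto)
        then show "integrable (PX x) (\<lambda>\<omega>. exp (- t) * Pt t (indicator A) (\<omega> s))" by simp
      qed (use Pt_indicator_bounds[OF A] in auto)
      also have "(\<integral>\<omega>. exp (- t) * Pt t (indicator A) (\<omega> s) \<partial>PX x) = exp (- t) * Pt s (Pt t (indicator A)) x"
        by (simp add: Pt_def[of s])
      also have "Pt s (Pt t (indicator A)) x = Pt (s + t) (indicator A) x"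
        by (rule Pt_add[OF s True im, symmetric, of 1]) (auto split: split_indicator)
      also have "ennreal (exp (- t) * Pt (s + t) (indicator A) x)
          = ennreal (exp s * (exp (- (s + t)) * Pt (s + t) (indicator A) x))"
        unfolding mult.assoc[symmetric] exp_add[symmetric] by simp
      also have "\<dots> = ennreal (exp s) * ?f (s + 1 * t) x"
        using s True Pt_indicator_bounds[OF A] by (simp add: ennreal_mult)
      finally show ?thesis by (rule eq_refl)
    qed
  qed
  also have "\<dots> = ennreal (exp s) * (\<integral>\<^sup>+t. ?f (s + 1 * t) x \<partial>lborel)"
    using measurable_compose[OF _ ms, of "\<lambda>t. s + 1 * t"] by (intro nn_integral_cmult) simp
  also have "(\<integral>\<^sup>+t. ?f (s + 1 * t) x \<partial>lborel) = (\<integral>\<^sup>+t. ?f t x \<partial>lborel)"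
    using nn_integral_real_affine[OF ms, of 1 s] by simp
  also have "\<dots> = ennreal (Rb A x)" by (rule Rb_nn(1)[OF A, symmetric])
  finally have "(\<integral>\<^sup>+\<omega>. ennreal (Rb A (\<omega> s)) \<partial>PX x) = 0" using x(2) by simp
  moreover have "(\<lambda>\<omega>. ennreal (Rb A (\<omega> s))) \<in> borel_measurable (PX x)"
    using measurable_comp_eval[OF Rb_nn(3)[OF A], of s] by simp
  ultimately have "AE \<omega> in PX x. ennreal (Rb A (\<omega> s)) = 0" by (simp add: nn_integral_0_iff_AE)
  then show ?thesis
  proof eventually_elim
    case (elim \<omega>)
    then show ?case using Rb_nn(2)[OF A, of "\<omega> s"] by (simp add: ennreal_eq_0_iff)
  qed
qed

lemma absorbing_set:
  fixes H :: "nat \<Rightarrow> 'a set"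
  assumes H: "\<And>n. H n \<in> sets borel" "\<And>n. 0 < measure \<mu>b (H n)"
  defines "N \<equiv> (\<Union>n. {x \<in> E. Rb (H n \<inter> E) x = 0})"
  shows "m_thin m p N" "\<And>Cap. capacity m Cap \<Longrightarrow> capacity_condition m p Cap \<Longrightarrow> Cap N = 0"
proof -
  have A: "H n \<inter> E \<in> sets borel" for n using H(1) E_borel by auto
  have Nb: "N \<in> sets borel"
  proof -
    have "{x \<in> E. Rb (H n \<inter> E) x = 0} \<in> sets borel" for n
    proof -
      have "{x \<in> E. Rb (H n \<inter> E) x = 0} = E \<inter> (Rb (H n \<inter> E) -` {0} \<inter> space borel)" by auto
      also have "\<dots> \<in> sets borel" by (intro sets.Int E_borel measurable_sets[OF Rb_nn(3)[OF A]]) simp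
      finally show ?thesis .
    qed
    then show ?thesis unfolding N_def by (intro sets.countable_UN) auto
  qed
  have NE: "N \<subseteq> E" by (auto simp: N_def)
  have Nm: "N \<in> sets m" using Nb NE by (simp add: m_sets_iff)
  have "AE x in m. \<forall>n. 0 < Rb (H n \<inter> E) x"
    unfolding AE_all_countable using Rb_pos_AE(2)[OF H] by blast
  then have ae: "AE x in m. x \<notin> N" 
  proof eventually_elim
    case (elim x)
    then have "Rb (H n \<inter> E) x \<noteq> 0" for n by (metis less_irrefl)
    then show ?case unfolding N_def by blast
  qed
  have null: "emeasure m N = 0"
    using ae Nm NE by (subst (asm) AE_iff_measurable[OF Nm]) (auto simp: m_space)
  \<comment> \<open>A point of \<open>N\<close> lies in one of the sets of the union, and each of
    them is absorbing by itself.\<close>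
  have full: "Pt s (indicator N) x = 1" if x: "x \<in> N" and s: "0 \<le> s" for s x
  proof -
    interpret P: prob_space "PX x" by (rule PX_prob)
    obtain n where n: "x \<in> E" "Rb (H n \<inter> E) x = 0" using x by (auto simp: N_def)
    have "AE \<omega> in PX x. indicator N (\<omega> s) = (1::real)"
      using Rb_absorb[OF A n s] AE_eval_E[OF s n(1)] by eventually_elim (unfold N_def indicator_def, force)
    then have "Pt s (indicator N) x = (\<integral>\<omega>. 1 \<partial>PX x)"
      unfolding Pt_def using measurable_comp_eval[of "indicator N :: 'a \<Rightarrow> real" s] Nb
      by (intro integral_cong_AE) auto
    then show ?thesis using P.prob_space by simp
  qed
  show "m_thin m p N"
    unfolding m_thin_def
  proof (intro conjI Nm bexI[OF _ Nm] null subsetI CollectI)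
    fix x assume x: "x \<in> N"
    then have xE: "x \<in> E" using NE by auto
    show "x \<in> space m" using xE m_space by simp
    have "ennreal (Rb N x) = (\<integral>\<^sup>+t. ennreal (exp (- t)) * indicator {0..} t \<partial>lborel)"
      unfolding Rb_nn(1)[OF Nb] using full[OF x] by (intro nn_integral_cong) (simp split: split_indicator)
    then have "Rb N x = 1" unfolding nn_integral_exp_tail using Rb_nn(2)[OF Nb, of x] by simp
    then show "0 < Rres p (indicator N) x" by (simp add: Rres_eq_Rb[OF Nb xE])
  qed
  fix Cap assume C: "capacity m Cap" "capacity_condition m p Cap"
  have "bmeas m (indicator N)"
    unfolding bmeas_def using Nm by (auto intro!: exI[of _ 1] split: split_indicator)
  moreover have "AE x in m. indicator N x = (0::real)" using ae by eventually_elim simp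
  ultimately obtain Z where Z: "Z \<in> sets m" "Cap Z = 0" "\<And>x. x \<in> space m - Z \<Longrightarrow> pf p 1 (indicator N) x = 0"
    using C(2)[unfolded capacity_condition_def, rule_format, of "indicator N" 1] by auto
  have "N \<subseteq> Z"
  proof
    fix x assume x: "x \<in> N"
    then have xE: "x \<in> E" using NE by auto
    have "pf p 1 (indicator N) x = 1"
      using full[OF x, of 1] Pt_eq_pf[OF _ xE, of 1 "indicator N"] Nb by simp
    then show "x \<in> Z" using Z(3)[of x] xE m_space by (cases "x \<in> Z") auto
  qed
  then have "Cap N \<le> Cap Z" using C(1) Nm Z(1) unfolding capacity_def by blast
  then show "Cap N = 0" using Z(2) by simp
qed

text \<open>From \<open>x\<close> the process is in \<open>H\<close> at some fixed time
  \<open>s\<close> with probability \<open>q > 0\<close>. The stretch \<open>[0,s]\<close> changes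
  the integrals by at most \<open>b * s\<close>, which half of \<open>\<epsilon> * t\<close> absorbs
  for large \<open>t\<close>; this is why \<open>lb\<close> is asked for with
  \<open>\<epsilon> / 2\<close>. The factor \<open>q * k\<close> vanishes after taking
  \<open>ln\<close> and dividing by \<open>t\<close>, at the price of the second
  \<open>c\<close>.\<close>

lemma eventually_lower_bound:
  fixes F :: "nat \<Rightarrow> 'a \<Rightarrow> real"
  assumes F: "\<And>j. F j \<in> borel_measurable borel" "\<And>j x. \<bar>F j x\<bar> \<le> b" and \<epsilon>: "0 < \<epsilon>" and c: "0 < c"
    and H: "H \<in> sets borel" and k: "0 < k"
    and lb: "\<And>T x. T0 \<le> T \<Longrightarrow> x \<in> H \<Longrightarrow>
      k * exp (- (I + c) * T) \<le> measure (PX x) {\<omega> \<in> cadlag_paths. \<forall>j<r. \<bar>Sint (F j) T \<omega>\<bar> < \<epsilon> / 2 * T}"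
    and x: "0 < Rb (H \<inter> E) x"
  shows "eventually (\<lambda>t. - (I + 2 * c) \<le> (1 / t) * ln (measure (PX x) {\<omega> \<in> cadlag_paths. \<forall>j<r. \<bar>Sint (F j) t \<omega>\<bar> < \<epsilon> * t})
      \<and> 0 < measure (PX x) {\<omega> \<in> cadlag_paths. \<forall>j<r. \<bar>Sint (F j) t \<omega>\<bar> < \<epsilon> * t}) at_top"
proof -
  interpret P: prob_space "PX x" by (rule PX_prob)
  have b: "0 \<le> b" using F(2)[of 0 undefined] by linarith
  have A: "H \<inter> E \<in> sets borel" using H E_borel by auto
  define Ev where "Ev e t = {\<omega> \<in> cadlag_paths. \<forall>j<r. \<bar>Sint (F j) t \<omega>\<bar> < e * t}" for e t
  have Evm: "Ev e t \<in> sets path_space" for e t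
  proof -
    have "Ev e t = cadlag_paths \<inter> (\<Inter>j\<in>{..<r}. {\<omega> \<in> space path_space. \<bar>Sint (F j) t \<omega>\<bar> < e * t})" by (auto simp: Ev_def)
    also have "\<dots> \<in> sets path_space"
    proof (cases "r = 0")
      case True
      then show ?thesis using sets.top[of "path_space :: (real \<Rightarrow> 'a) measure"] by simp
    next
      case False
      have "{\<omega> \<in> space path_space. \<bar>Sint (F j) t \<omega>\<bar> < e * t} \<in> sets path_space" for j
        using borel_measurable_abs[OF Sint_measurable[OF F(1), of j t]]
        by (rule borel_measurable_less[OF _ borel_measurable_const])
      then have "(\<Inter>j\<in>{..<r}. {\<omega> \<in> space path_space. \<bar>Sint (F j) t \<omega>\<bar> < e * t}) \<in> sets path_space"
        using False by (intro sets.finite_INT) auto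
      then show ?thesis using sets.Int[OF sets.top[of "path_space :: (real \<Rightarrow> 'a) measure"]] by simp
    qed
    finally show ?thesis .
  qed
  obtain s where s: "0 \<le> s" "Rb (H \<inter> E) x / 2 / 2 \<le> Pt s (indicator (H \<inter> E)) x"
    using Rb_reach[OF A, of "Rb (H \<inter> E) x / 2" x] x by auto
  define S where "S = {\<omega> \<in> cadlag_paths. \<omega> s \<in> H \<inter> E}"
  have SX: "S \<in> sets (PX x)" unfolding S_def by (rule Pt_indicator(2)[OF A])
  have S: "S \<in> sets (coord_space s)"
    using measurable_sets[OF measurable_eval_coord[OF s(1) order_refl] A] by (simp add: S_def vimage_def Int_def conj_commute)
  define q where "q = measure (PX x) S"
  have q: "0 < q" using s(2) x unfolding q_def S_def Pt_indicator(1)[OF A, symmetric] by linarith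
  have low: "q * (k * exp (- (I + c) * t)) \<le> measure (PX x) (Ev \<epsilon> t)"
    if t: "s + max T0 0 \<le> t" "2 * (b * s) / \<epsilon> \<le> t" for t
  proof -
    define T where "T = t - s"
    have T: "T0 \<le> T" "0 \<le> T" "T \<le> t" "s + T = t" using t s(1) by (auto simp: T_def)
    have bs: "b * s \<le> \<epsilon> / 2 * t" using t(2) \<epsilon> by (simp add: pos_divide_le_eq mult.commute)
    have sub: "S \<inter> (path_shift s -` Ev (\<epsilon> / 2) T \<inter> cadlag_paths) \<subseteq> Ev \<epsilon> t"
    proof
      fix \<omega> assume "\<omega> \<in> S \<inter> (path_shift s -` Ev (\<epsilon> / 2) T \<inter> cadlag_paths)"
      then have \<omega>: "\<omega> \<in> cadlag_paths" and e: "\<And>j. j < r \<Longrightarrow> \<bar>Sint (F j) T (path_shift s \<omega>)\<bar> < \<epsilon> / 2 * T"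
        by (auto simp: Ev_def)
      have "\<bar>Sint (F j) t \<omega>\<bar> < \<epsilon> * t" if j: "j < r" for j
      proof -
        have "Sint (F j) t \<omega> = Sint (F j) s \<omega> + Sint (F j) T (path_shift s \<omega>)"
          using Sint_add[OF F \<omega> s(1) T(2), of j] T(4) by simp
        moreover have "\<bar>Sint (F j) s \<omega>\<bar> \<le> b * s" by (rule Sint_bound[OF F \<omega> s(1)])
        moreover have "\<epsilon> / 2 * T \<le> \<epsilon> / 2 * t" using T(3) \<epsilon> by (intro mult_left_mono) auto
        moreover have "\<epsilon> * t = \<epsilon> / 2 * t + \<epsilon> / 2 * t" by simp
        ultimately show ?thesis using e[OF j] bs by linarith
      qed
      then show "\<omega> \<in> Ev \<epsilon> t" using \<omega> by (simp add: Ev_def)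
    qed
    have "ennreal (q * (k * exp (- (I + c) * t))) \<le> ennreal (k * exp (- (I + c) * T)) * emeasure (PX x) S"
    proof -
      have "(I + c) * T \<le> (I + c) * t" using T(3) I_nonneg c by (intro mult_left_mono) auto
      then have "exp (- (I + c) * t) \<le> exp (- (I + c) * T)"
        unfolding exp_le_cancel_iff mult_minus_left by linarith
      then have "q * (k * exp (- (I + c) * t)) \<le> (k * exp (- (I + c) * T)) * q"
        using q k by (simp add: mult.commute)
      then show ?thesis
        unfolding P.emeasure_eq_measure q_def[symmetric] using k q by (simp add: ennreal_mult[symmetric] ennreal_leI)
    qed
    also have "\<dots> = (\<integral>\<^sup>+\<omega>. ennreal (k * exp (- (I + c) * T)) * indicator S \<omega> \<partial>PX x)"
      by (rule nn_integral_cmult_indicator[OF SX, symmetric])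
    also have "\<dots> \<le> (\<integral>\<^sup>+\<omega>. indicator S \<omega> * emeasure (PX (\<omega> s)) (Ev (\<epsilon> / 2) T) \<partial>PX x)"
    proof (rule nn_integral_mono)
      fix \<omega>
      show "ennreal (k * exp (- (I + c) * T)) * indicator S \<omega> \<le> indicator S \<omega> * emeasure (PX (\<omega> s)) (Ev (\<epsilon> / 2) T)"
      proof (cases "\<omega> \<in> S")
        case True
        then have "\<omega> s \<in> H" by (simp add: S_def)
        interpret Q: prob_space "PX (\<omega> s)" by (rule PX_prob)
        have "k * exp (- (I + c) * T) \<le> measure (PX (\<omega> s)) (Ev (\<epsilon> / 2) T)"
          unfolding Ev_def by (rule lb[OF T(1) \<open>\<omega> s \<in> H\<close>])
        then show ?thesis using True by (simp add: Q.emeasure_eq_measure ennreal_leI)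
      qed simp
    qed
    also have "\<dots> = emeasure (PX x) (S \<inter> (path_shift s -` Ev (\<epsilon> / 2) T \<inter> cadlag_paths))"
      by (rule markov_sets[OF s(1) S Evm, symmetric])
    also have "\<dots> \<le> emeasure (PX x) (Ev \<epsilon> t)" by (rule emeasure_mono[OF sub]) (simp add: PX_sets Evm)
    finally show ?thesis unfolding P.emeasure_eq_measure by (simp add: ennreal_le_iff)
  qed
  have lim: "((\<lambda>t. ln (q * k) / t) \<longlongrightarrow> 0) at_top"
    by (rule tendsto_divide_0[OF tendsto_const filterlim_at_top_imp_at_infinity[OF filterlim_ident]])
  have "eventually (\<lambda>t. - c < ln (q * k) / t) at_top" using order_tendstoD(1)[OF lim, of "- c"] c by simp
  then have "eventually (\<lambda>t. - (I + 2 * c) \<le> (1 / t) * ln (measure (PX x) (Ev \<epsilon> t)) \<and> 0 < measure (PX x) (Ev \<epsilon> t)) at_top"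
    using eventually_ge_at_top[of "s + max T0 0"] eventually_ge_at_top[of "2 * (b * s) / \<epsilon>"] eventually_gt_at_top[of 0]
  proof eventually_elim
    case (elim t)
    have qk: "0 < q * (k * exp (- (I + c) * t))" using q k by simp
    have l: "q * (k * exp (- (I + c) * t)) \<le> measure (PX x) (Ev \<epsilon> t)" by (rule low[OF elim(2,3)])
    then have pos: "0 < measure (PX x) (Ev \<epsilon> t)" using qk by linarith
    have "ln (q * k) + - (I + c) * t = ln (q * k * exp (- (I + c) * t))"
      using q k by (simp add: ln_mult)
    also have "\<dots> \<le> ln (measure (PX x) (Ev \<epsilon> t))"
      using l qk pos by (intro ln_mono) (auto simp: mult.assoc)
    finally have "(1 / t) * (ln (q * k) + - (I + c) * t) \<le> (1 / t) * ln (measure (PX x) (Ev \<epsilon> t))"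
      using elim(4) by (intro mult_left_mono) auto
    moreover have "(1 / t) * (ln (q * k) + - (I + c) * t) = ln (q * k) / t - (I + c)"
      using elim(4) by (simp add: field_simps)
    ultimately show ?case using elim(1) pos by simp
  qed
  then show ?thesis unfolding Ev_def .
qed

proposition lower_bound:
  assumes \<Omega>: "\<Omega> \<in> path_sets" "\<Omega> \<subseteq> cadlag_paths" "\<forall>\<omega>\<in>\<Omega>. \<forall>t. \<omega> t \<in> E" "\<forall>x\<in>E. measure (PX x) \<Omega> = 1"
    and \<epsilon>: "0 < \<epsilon>" and fs: "\<forall>f\<in>set fs. bmeas m f"
  shows "\<exists>N. m_thin m p N \<and>
     (\<forall>x\<in>E - N. Liminf at_top (\<lambda>t. ereal (1 / t) *
         elog (measure (PX x) {\<omega> \<in> \<Omega>. occ m t \<omega> \<in> tau_nbhd m \<mu> \<epsilon> fs})) \<ge> - ereal I) \<and>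
     (\<forall>Cap. capacity m Cap \<and> capacity_condition m p Cap \<longrightarrow> Cap N = 0)"
proof -
  interpret M: prob_space \<mu> by (rule \<mu>_prob)
  define r where "r = length fs"
  define a where "a j = (\<integral>x. (fs ! j) x \<partial>\<mu>)" for j
  \<comment> \<open>Centred to have \<open>\<mu>\<close>-mean \<open>0\<close>, extended by
    \<open>0\<close> outside \<open>E\<close> to be Borel on the whole space, and \<open>0\<close>
    for \<open>j \<ge> r\<close> so that one bound serves all indices.\<close>
  define F where "F j x = (if j < r then indicator E x * ((fs ! j) x - a j) else 0)" for j x
  have fj: "fs ! j \<in> borel_measurable m" "\<exists>C. \<forall>x\<in>E. \<bar>(fs ! j) x\<bar> \<le> C" if "j < r" for j
    using fs that m_space unfolding r_def bmeas_def by auto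
  have Fm: "F j \<in> borel_measurable borel" for j
  proof (cases "j < r")
    case True
    have "(\<lambda>x. (fs ! j) x - a j) \<in> borel_measurable m" using fj(1)[OF True] by simp
    then show ?thesis using True unfolding F_def[abs_def] by (simp add: m_borel_measurable_iff)
  qed (simp add: F_def[abs_def])
  have "\<exists>B\<ge>0. \<forall>x. \<bar>F j x\<bar> \<le> B" for j
  proof (cases "j < r")
    case True
    obtain C where C: "\<forall>x\<in>E. \<bar>(fs ! j) x\<bar> \<le> C" using fj(2)[OF True] by blast
    have "\<bar>F j x\<bar> \<le> \<bar>C\<bar> + \<bar>a j\<bar>" for x
    proof (cases "x \<in> E")
      case xE: True
      have "\<bar>(fs ! j) x - a j\<bar> \<le> \<bar>(fs ! j) x\<bar> + \<bar>a j\<bar>" by (rule abs_triangle_ineq4)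
      also have "\<dots> \<le> \<bar>C\<bar> + \<bar>a j\<bar>" using C xE by (intro add_right_mono order_trans[OF _ abs_ge_self]) auto
      finally show ?thesis using True xE by (simp add: F_def)
    qed (simp add: F_def)
    then show ?thesis by (intro exI[of _ "\<bar>C\<bar> + \<bar>a j\<bar>"]) auto
  qed (auto simp: F_def)
  then obtain B where B: "\<And>j. 0 \<le> B j" "\<And>j x. \<bar>F j x\<bar> \<le> B j" by metis
  define b where "b = (\<Sum>j<r. B j)"
  have Fb: "\<bar>F j x\<bar> \<le> b" for j x
  proof (cases "j < r")
    case True
    then have "B j \<le> b" unfolding b_def using B(1) by (intro member_le_sum) auto
    then show ?thesis using B(2)[of j x] by linarith
  next
    case False
    have "0 \<le> b" unfolding b_def using B(1) by (simp add: sum_nonneg)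
    then show ?thesis using False by (simp add: F_def)
  qed
  have F0: "(\<integral>x. F j x \<partial>\<mu>b) = 0" for j
  proof (cases "j < r")
    case True
    obtain C where C: "\<forall>x\<in>E. \<bar>(fs ! j) x\<bar> \<le> C" using fj(2)[OF True] by blast
    have fm: "fs ! j \<in> borel_measurable \<mu>" using fj(1)[OF True] measurable_cong_sets[OF \<mu>_sets refl] by blast
    have int: "integrable \<mu> (fs ! j)"
      by (rule M.integrable_const_bound[OF _ fm, of C]) (use C \<mu>_space in auto)
    have "(\<integral>x. F j x \<partial>\<mu>b) = (\<integral>x. F j x \<partial>\<mu>)" by (rule \<mu>b_integral[OF Fm])
    also have "\<dots> = (\<integral>x. (fs ! j) x - a j \<partial>\<mu>)"
      using True by (intro Bochner_Integration.integral_cong refl) (simp add: F_def \<mu>_space)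
    also have "\<dots> = 0" using int M.prob_space by (simp add: a_def)
    finally show ?thesis .
  qed (simp add: F_def)
  define c where "c n = 1 / real (Suc n)" for n
  have c: "0 < c n" for n by (simp add: c_def)
  have "\<epsilon> / 2 > 0" using \<epsilon> by simp
  note ex = dv.exponential_lower_bound[where r = r, OF Fm Fb F0 this c]
  obtain H where H: "\<And>n. H n \<in> sets borel" "\<And>n. 0 < measure \<mu>b (H n)"
    and HT: "\<And>n. \<exists>k>0. \<exists>T0>0. \<forall>T\<ge>T0. \<forall>x\<in>H n. k * exp (- (I + c n) * T)
       \<le> measure (PX x) {\<omega> \<in> cadlag_paths. \<forall>j<r. \<bar>Sint (F j) T \<omega>\<bar> < \<epsilon> / 2 * T}"
  proof -
    have "\<forall>n. \<exists>H. H \<in> sets borel \<and> 0 < measure \<mu>b H \<and> (\<exists>k>0. \<exists>T0>0. \<forall>T\<ge>T0. \<forall>x\<in>H. k * exp (- (I + c n) * T)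
       \<le> measure (PX x) {\<omega> \<in> cadlag_paths. \<forall>j<r. \<bar>Sint (F j) T \<omega>\<bar> < \<epsilon> / 2 * T})" (is "\<forall>n. \<exists>H. ?Q n H")
      using ex unfolding Bex_def by (intro allI)
    from choice[OF this] obtain H where "\<forall>n. ?Q n (H n)" ..
    then show thesis by (intro that[of H]) blast+
  qed
  define N where "N = (\<Union>n. {x \<in> E. Rb (H n \<inter> E) x = 0})"
  note N = absorbing_set[where H = H, OF H, folded N_def]
  \<comment> \<open>Paths in \<open>\<Omega>\<close> stay in \<open>E\<close>, so there
    \<open>occ\<close> is a probability measure and its integrals are those of \<open>Sint\<close>
    divided by \<open>t\<close>; \<open>\<Omega>\<close> itself has full measure.\<close>
  have ev: "measure (PX x) {\<omega> \<in> \<Omega>. occ m t \<omega> \<in> tau_nbhd m \<mu> \<epsilon> fs}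
      = measure (PX x) {\<omega> \<in> cadlag_paths. \<forall>j<r. \<bar>Sint (F j) t \<omega>\<bar> < \<epsilon> * t}"
    if x: "x \<in> E" and t: "0 < t" and pos: "0 < measure (PX x) {\<omega> \<in> cadlag_paths. \<forall>j<r. \<bar>Sint (F j) t \<omega>\<bar> < \<epsilon> * t}" for x t
  proof -
    interpret P: prob_space "PX x" by (rule PX_prob)
    define W where "W = {\<omega> \<in> cadlag_paths. \<forall>j<r. \<bar>Sint (F j) t \<omega>\<bar> < \<epsilon> * t}"
    \<comment> \<open>\<open>measure\<close> is \<open>0\<close> on nonmeasurable sets, so
      positivity gives measurability.\<close>
    have Wm: "W \<in> sets (PX x)" using pos unfolding W_def[symmetric] by (metis less_irrefl measure_notin_sets)
    have \<Omega>m: "\<Omega> \<in> sets (PX x)" using \<Omega>(1) by (simp add: PX_sets sets_path_space)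
    have "{\<omega> \<in> \<Omega>. occ m t \<omega> \<in> tau_nbhd m \<mu> \<epsilon> fs} = \<Omega> \<inter> W"
    proof (intro set_eqI)
      fix \<omega>
      have "occ m t \<omega> \<in> tau_nbhd m \<mu> \<epsilon> fs \<longleftrightarrow> \<omega> \<in> W" if \<omega>: "\<omega> \<in> \<Omega>"
      proof -
        have \<omega>c: "\<omega> \<in> cadlag_paths" and \<omega>E: "\<And>t. \<omega> t \<in> E" using \<omega> \<Omega>(2,3) by auto
        note o = occ_eq_distr[OF \<omega>c \<omega>E t]
        have one: "(\<integral>x. (fs ! j) x \<partial>occ m t \<omega>) - (\<integral>x. (fs ! j) x \<partial>\<mu>) = (1 / t) * Sint (F j) t \<omega>" if j: "j < r" for j
        proof -
          obtain C where C: "\<forall>x\<in>E. \<bar>(fs ! j) x\<bar> \<le> C" using fj(2)[OF j] by blast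
          have i1: "set_integrable lborel {0..t} (\<lambda>s. F j (\<omega> s))"
            by (rule set_integrable_bounded_Icc[OF measurable_compose[OF cadlag_borel[OF \<omega>c] Fm] Fb])
          have i2: "set_integrable lborel {0..t} (\<lambda>s. a j)" by (rule set_integrable_bounded_Icc[where C = "\<bar>a j\<bar>"]) auto
          have "(LBINT s:{0..t}. (fs ! j) (\<omega> s)) = (LBINT s:{0..t}. F j (\<omega> s) + a j)"
            unfolding set_lebesgue_integral_def using j \<omega>E
            by (intro Bochner_Integration.integral_cong refl) (simp add: F_def)
          also have "\<dots> = Sint (F j) t \<omega> + a j * t"
            unfolding set_integral_add(2)[OF i1 i2] using t by (simp add: Sint_def set_lebesgue_integral_def)
          finally show ?thesis using o(4)[OF fj(1)[OF j]] t by (simp add: a_def field_simps)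
        qed
        have "\<bar>(1 / t) * Sint (F j) t \<omega>\<bar> < \<epsilon> \<longleftrightarrow> \<bar>Sint (F j) t \<omega>\<bar> < \<epsilon> * t" for j
          using t by (simp add: abs_mult pos_divide_less_eq)
        then have "(\<forall>f\<in>set fs. \<bar>(\<integral>x. f x \<partial>occ m t \<omega>) - (\<integral>x. f x \<partial>\<mu>)\<bar> < \<epsilon>) \<longleftrightarrow> (\<forall>j<r. \<bar>Sint (F j) t \<omega>\<bar> < \<epsilon> * t)"
          unfolding all_set_conv_all_nth r_def[symmetric] using one by simp
        then show ?thesis unfolding tau_nbhd_def prob_measures_def W_def using o(2,3) \<omega>c by simp
      qed
      then show "\<omega> \<in> {\<omega> \<in> \<Omega>. occ m t \<omega> \<in> tau_nbhd m \<mu> \<epsilon> fs} \<longleftrightarrow> \<omega> \<in> \<Omega> \<inter> W" by blast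
    qed
    moreover have "measure (PX x) (\<Omega> \<inter> W) = measure (PX x) W"
    proof (rule P.finite_measure_eq_AE)
      have "AE \<omega> in PX x. \<omega> \<in> \<Omega>" using P.AE_prob_1 \<Omega>(4) x by blast
      then show "AE \<omega> in PX x. (\<omega> \<in> \<Omega> \<inter> W) = (\<omega> \<in> W)" by eventually_elim simp
    qed (use Wm \<Omega>m in auto)
    ultimately show ?thesis by (simp add: W_def)
  qed
  have main: "Liminf at_top (\<lambda>t. ereal (1 / t) *
         elog (measure (PX x) {\<omega> \<in> \<Omega>. occ m t \<omega> \<in> tau_nbhd m \<mu> \<epsilon> fs})) \<ge> - ereal I" if x: "x \<in> E - N" for x
  proof (rule ereal_le_epsilon2)
    let ?X = "\<lambda>t. ereal (1 / t) * elog (measure (PX x) {\<omega> \<in> \<Omega>. occ m t \<omega> \<in> tau_nbhd m \<mu> \<epsilon> fs})"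
    fix e :: real assume e: "0 < e"
    \<comment> \<open>\<open>eventually_lower_bound\<close> loses \<open>2 * c n\<close>, hence the
      requirement with \<open>e / 2\<close>.\<close>
    obtain n where n: "inverse (real (Suc n)) < e / 2" using reals_Archimedean[of "e / 2"] e by auto
    then have cn: "2 * c n \<le> e" by (simp add: c_def inverse_eq_divide)
    have A: "H n \<inter> E \<in> sets borel" using H(1) E_borel by auto
    have "Rb (H n \<inter> E) x \<noteq> 0" using x by (auto simp: N_def)
    then have Rx: "0 < Rb (H n \<inter> E) x" using Rb_nn(2)[OF A, of x] by linarith
    obtain k T0 where k: "0 < k" and T0: "\<And>T y. T0 \<le> T \<Longrightarrow> y \<in> H n \<Longrightarrow> k * exp (- (I + c n) * T)
       \<le> measure (PX y) {\<omega> \<in> cadlag_paths. \<forall>j<r. \<bar>Sint (F j) T \<omega>\<bar> < \<epsilon> / 2 * T}"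
      using HT[of n] by blast
    have lb: "eventually (\<lambda>t. - (I + 2 * c n) \<le> (1 / t) * ln (measure (PX x) {\<omega> \<in> cadlag_paths. \<forall>j<r. \<bar>Sint (F j) t \<omega>\<bar> < \<epsilon> * t})
      \<and> 0 < measure (PX x) {\<omega> \<in> cadlag_paths. \<forall>j<r. \<bar>Sint (F j) t \<omega>\<bar> < \<epsilon> * t}) at_top"
      by (rule eventually_lower_bound[OF Fm Fb \<epsilon> c H(1) k _ Rx], rule T0)
    have "eventually (\<lambda>t. ereal (- (I + 2 * c n)) \<le> ?X t) at_top"
      using lb eventually_gt_at_top[of 0]
    proof eventually_elim
      case (elim t)
      then show ?case using x by (simp add: ev elog_def)
    qed
    from Liminf_bounded[OF this] have "ereal (- (I + 2 * c n)) \<le> Liminf at_top ?X" .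
    moreover have "- ereal I \<le> ereal (- (I + 2 * c n)) + ereal e" using cn by simp
    ultimately show "- ereal I \<le> Liminf at_top ?X + ereal e"
      by (meson add_right_mono order_trans)
  qed
  show ?thesis
    using N main by (intro exI[of _ N]) blast
qed

end

theorem theorem1p15:
  fixes T :: "'a::polish_space topology" and P :: "'p topology" and g :: "'p \<Rightarrow> 'a"
    and E :: "'a set" and m :: "'a measure" and p :: "real \<Rightarrow> 'a \<Rightarrow> 'a measure"
    and Tsg :: "real \<Rightarrow> ('a \<Rightarrow> real) \<Rightarrow> ('a \<Rightarrow> real)"
    and PX :: "'a \<Rightarrow> (real \<Rightarrow> 'a) measure" and \<Omega> :: "(real \<Rightarrow> 'a) set"
    and \<mu> :: "'a measure" and \<epsilon> :: real and fs :: "('a \<Rightarrow> real) list"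
  assumes E_top: "topspace T = E" and lusin: "lusin_space T P g"
    and E_borel: "E \<in> sets borel"
    and m_space: "space m = E" and m_sets: "sets m = borel_sets_of T"
    and m_sets_cont: "sets m = sigma_sets E
          {{x \<in> E. f x \<in> U} | f U. continuous_map T euclideanreal f \<and> open U}"
    and m_sets_trace: "sets m = sets (restrict_space borel E)"
    and m_sigma_finite: "sigma_finite_measure m" and m_pos: "emeasure m E > 0"
    and p_trans: "transition_function m p"
    and semigroup: "strongly_cont_L2_semigroup m Tsg"
    and p_repr: "\<forall>t\<ge>0. \<forall>f. bmeas m f \<and> integrable m (\<lambda>x. (f x)\<^sup>2) \<longrightarrow>
                    (AE x in m. pf p t f x = Tsg t f x)"
    and process: "markov_process E p PX"
    and \<Omega>_sets: "\<Omega> \<in> path_sets" and \<Omega>_sub: "\<Omega> \<subseteq> cadlag_paths"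
    and \<Omega>_E: "\<forall>\<omega>\<in>\<Omega>. \<forall>t. \<omega> t \<in> E"
    and \<Omega>_full: "\<forall>x\<in>E. measure (PX x) \<Omega> = 1"
    and irred: "\<forall>A\<in>sets m. emeasure m A > 0 \<longrightarrow> (AE x in m. Rres p (indicator A) x > 0)"
    and \<mu>_prob: "\<mu> \<in> prob_measures m"
    and \<epsilon>_pos: "\<epsilon> > 0" and fs_bdd: "\<forall>f\<in>set fs. bmeas m f"
  shows "\<exists>N. m_thin m p N \<and>
           (\<forall>x\<in>E - N. Liminf at_top (\<lambda>t. ereal (1 / t) *
               elog (measure (PX x) {\<omega> \<in> \<Omega>. occ m t \<omega> \<in> tau_nbhd m \<mu> \<epsilon> fs}))
              \<ge> - Irate m p \<mu>) \<and>
           (\<forall>Cap. capacity m Cap \<and> capacity_condition m p Cap \<longrightarrow> Cap N = 0)"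
proof (cases "Irate m p \<mu> = \<infinity>")
  case True
  \<comment> \<open>For an infinite rate the bound is \<open>- \<infinity>\<close> and the empty set
    serves as \<open>N\<close>.\<close>
  have "m_thin m p {}" unfolding m_thin_def by (auto intro!: bexI[of _ "{}"])
  \<comment> \<open>The definition of a capacity does not fix its value on the empty set. The
    capacity condition for \<open>f = 0\<close> supplies some set of capacity \<open>0\<close>, and
    monotonicity does the rest.\<close>
  moreover have "Cap {} = 0" if cap: "capacity m Cap" "capacity_condition m p Cap" for Cap
  proof -
    have "bmeas m (\<lambda>_. 0)" by (auto simp: bmeas_def)
    then obtain Z where "Z \<in> sets m" "Cap Z = 0"
      using cap(2)[unfolded capacity_condition_def, rule_format, of "\<lambda>_. 0" 1] by auto
    then have "Cap {} \<le> 0" using cap(1) unfolding capacity_def by (metis empty_subsetI sets.empty_sets)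
    then show ?thesis by simp
  qed
  ultimately show ?thesis using True by (intro exI[of _ "{}"]) auto
next
  case False
  then have ac: "absolutely_continuous m \<mu>" and I: "Irate m p \<mu> = Ihat m p \<mu>"
    by (auto simp: Irate_def split: if_splits)
  have le: "- ereal (\<integral>x. L x / (v x + e) \<partial>\<mu>) \<le> Ihat m p \<mu>" if "(v, L) \<in> D1 m p" "0 < e" for v L e
  proof -
    have "(INF vL\<in>D1 m p. INF \<epsilon>\<in>{0::real<..}. ereal (\<integral>x. snd vL x / (fst vL x + \<epsilon>) \<partial>\<mu>))
       \<le> ereal (\<integral>x. snd (v, L) x / (fst (v, L) x + e) \<partial>\<mu>)"
      by (rule INF_lower2[OF that(1)], rule INF_lower) (use that(2) in simp)
    then show ?thesis unfolding Ihat_def fst_conv snd_conv ereal_minus_le_minus .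
  qed
  \<comment> \<open>The function \<open>u = 0\<close> yields the value \<open>0\<close> in the
    infimum. So the rate is nonnegative, in particular not \<open>- \<infinity>\<close>, and
    \<open>J\<close> below is its real value.\<close>
  have Ihat0: "0 \<le> Ihat m p \<mu>"
  proof -
    have u: "(\<lambda>_. 0) \<in> Dset m" unfolding Dset_def by auto
    have z: "pf p s (\<lambda>_. 0) = (\<lambda>_. 0)" for s by (auto simp: pf_def)
    have "((\<lambda>x. (1 / 1) * (LBINT s=0..1. pf p s (pf p 0 (\<lambda>_. 0)) x)),
              (\<lambda>x. (1 / 1) * (pf p 1 (pf p 0 (\<lambda>_. 0)) x - pf p 0 (\<lambda>_. 0) x))) \<in> D1 m p"
      unfolding D1_def using u by (intro CollectI exI[of _ "\<lambda>_. 0"] exI[of _ 1] exI[of _ 0]) (simp add: one_ereal_def)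
    from le[OF this, of 1] show ?thesis by (simp add: z zero_ereal_def)
  qed
  define J where "J = real_of_ereal (Ihat m p \<mu>)"
  have J: "Ihat m p \<mu> = ereal J" using False Ihat0 I unfolding J_def by (cases "Ihat m p \<mu>") auto
  interpret ld_setting E m p PX Tsg \<mu> J
  proof (rule ld_setting.intro)
    show "process_setting E m p PX"
      by (rule process_setting.intro) (rule E_borel m_space m_sets_trace p_trans process)+
    show "ld_setting_axioms m p Tsg \<mu> J"
    proof (rule ld_setting_axioms.intro)
      show "prob_space \<mu>" "sets \<mu> = sets m" using \<mu>_prob by (auto simp: prob_measures_def)
      show "0 \<le> J" using Ihat0 J by simp
      fix v L \<epsilon> assume "(v, L) \<in> D1 m p" "0 < (\<epsilon> :: real)"
      from le[OF this] show "- J \<le> (\<integral>x. L x / (v x + \<epsilon>) \<partial>\<mu>)" by (simp add: J)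
    qed (rule m_sigma_finite semigroup p_repr irred ac)+
  qed
  show ?thesis
    using lower_bound[OF \<Omega>_sets \<Omega>_sub \<Omega>_E \<Omega>_full \<epsilon>_pos fs_bdd] unfolding I J by simp
qed

end
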